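(* Let $d\ge1$, $\alpha\in(0,1)$ and let $\rho_0,\rho_1$ be two Borel probability measures on $\mathbb{T}^d$. Then $$\inf_{\eta\in\Pi_{2,ac}(\rho_0,\rho_1)}K(\eta)=W_\alpha(\rho_0,\rho_1)^2 .$$ In addition, the infimum on the left-hand side is attained by some $\overline\eta\in\Pi_{2,ac}(\rho_0,\rho_1)$.
   Context: $\mathbb{T}^d=\mathbb{R}^d/\mathbb{Z}^d$ is the flat torus, $Q=[-1/2,1/2]^d$; integrals over $\mathbb{T}^d$ are identified with integrals over $Q$. Definition of $W_\alpha$. For $(\rho,w)\in\mathbb{R}\times\mathbb{R}^d$ let $H(\rho,w)=|w|^2/\rho^\alpha$ if $\rho>0$, $H(0,0)=0$, and $H=+\infty$ otherwise. Then $W_\alpha(\rho_0,\rho_1)^2\in[0,+\infty]$ is the infimum of $\int_0^1\int_Q H(\rho^{\mathrm{ac}},w)\,dx\,dt$ over pairs consisting of a finite nonnegative Borel measure $\rho$ on $[0,1]\times\mathbb{T}^d$ and an $\mathbb{R}^d$-valued finite Borel measure $w$ on $[0,1]\times\mathbb{T}^d$, absolutely continuous with respect to Lebesgue measure (identified with its density), such that $\partial_t\rho+\mathrm{div}(w)=0$, $\rho(0,\cdot)=\rho_0$, $\rho(1,\cdot)=\rho_1$ weakly, i.e. $$\int_0^1\int_Q\partial_t\psi\,d\rho+\int_0^1\int_Q\nabla\psi\cdot w\,dx\,dt=\int_Q\psi(1,\cdot)\,d\rho_1-\int_Q\psi(0,\cdot)\,d\rho_0\quad\forall\psi\in C^1([0,1]\times\mathbb{T}^d).$$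 Here $\rho^{\mathrm{ac}}$ is the density of the absolutely continuous part of $\rho$ with respect to Lebesgue measure. Measures on curves. $\Gamma=C([0,1],\mathbb{T}^d)$ with the topology of uniform convergence (equivalently, continuous curves in $\mathbb{R}^d$ modulo translations by $\mathbb{Z}^d$). $W\subset\Gamma$ is the set of absolutely continuous curves with derivative $\dot\gamma$ in $L^{2/(2-\alpha)}([0,1];\mathbb{R}^d)$. $e_t(\gamma)=\gamma(t)$. $\Pi$ is the set of Borel probability measures on $\Gamma$. $\Pi_2$ is the set of $\eta\in\Pi$ with $\int_\Gamma\int_0^1|\dot\gamma(t)|^{\frac{2}{2-\alpha}}dt\,d\eta(\gamma)<+\infty$ (the inner integral being $+\infty$ if $\gamma\notin W$). For $\eta\in\Pi_2$, $\sigma_\eta$ is the measure on $[0,1]\times\mathbb{T}^d$ defined by $$\int_0^1\int_{Q}f(s,x)\,d\sigma_\eta(s,x)=\int_\Gamma\int_0^1f(s,\gamma(s))|\dot\gamma(s)|^{\frac{2}{2-\alpha}}\,ds\,d\eta(\gamma)\qquad\forall f\in C([0,1]\times\mathbb{T}^d).$$ $\Pi_{2,ac}$ is the set of $\eta\in\Pi_2$ such that $\sigma_\eta$ is absolutely continuous with respect to Lebesgue measure; $\sigma_\eta$ is then identified with its density. $\Pi_{2,ac}(\rho_0,\rho_1)$ is the set of $\eta\in\Pi_{2,ac}$ with $e_0\sharp\eta=\rho_0$ and $e_1\sharp\eta=\rho_1$ (push-forwards). Finally $K(\eta)=\int_0^1\int_Q(\sigma_\eta(s,x))^{2-\alpha}\,dx\,ds\in[0,+\infty]$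 if $\eta\in\Pi_{2,ac}(\rho_0,\rho_1)$, and $K(\eta)=+\infty$ otherwise. *)

theory Defs
  imports "HOL-Probability.Probability"
begin

section \<open>The flat torus\<close>

definition int_equiv :: "real ^ 'n \<Rightarrow> real ^ 'n \<Rightarrow> bool" where
  "int_equiv x y \<longleftrightarrow> (\<forall>i. x $ i - y $ i \<in> \<int>)"

lemma equivp_int_equiv: "equivp (int_equiv :: real ^ 'n \<Rightarrow> real ^ 'n \<Rightarrow> bool)"
proof (rule equivpI)
  show "reflp (int_equiv :: real ^ 'n \<Rightarrow> _)" by (simp add: reflp_def int_equiv_def)
  show "symp (int_equiv :: real ^ 'n \<Rightarrow> _)"
    unfolding symp_def int_equiv_def by (metis Ints_minus minus_diff_eq)
  show "transp (int_equiv :: real ^ 'n \<Rightarrow> _)"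
    unfolding transp_def int_equiv_def
  proof (intro allI impI)
    fix x y z :: "real ^ 'n" and i
    assume "\<forall>i. x $ i - y $ i \<in> \<int>" "\<forall>i. y $ i - z $ i \<in> \<int>"
    then have "(x $ i - y $ i) + (y $ i - z $ i) \<in> \<int>" using Ints_add by blast
    then show "x $ i - z $ i \<in> \<int>" by simp
  qed
qed

quotient_type 'n torus = "real ^ 'n" / "int_equiv :: real ^ 'n::finite \<Rightarrow> real ^ 'n \<Rightarrow> bool"
  morphisms rep_torus torus_proj
  by (rule equivp_int_equiv)

lemma torus_proj_eq_iff: "torus_proj x = torus_proj y \<longleftrightarrow> int_equiv x y"
  by (simp add: torus.abs_eq_iff)

lemma torus_proj_surj: "\<exists>x. torus_proj x = a"
  by (metis Quotient3_abs_rep Quotient3_torus)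

lemma torus_proj_translate:
  "torus_proj y = torus_proj y' \<Longrightarrow> torus_proj (z + y - y') = torus_proj z"
  by (simp add: torus_proj_eq_iff int_equiv_def)

instantiation torus :: (finite) metric_space
begin

definition dist_torus :: "'a torus \<Rightarrow> 'a torus \<Rightarrow> real" where
  "dist_torus a b = Inf {dist x y |x y. torus_proj x = a \<and> torus_proj y = b}"

definition uniformity_torus :: "('a torus \<times> 'a torus) filter" where
  "uniformity_torus = (INF e\<in>{0 <..}. principal {(x, y). dist x y < e})"

definition open_torus :: "'a torus set \<Rightarrow> bool" where
  "open_torus U \<longleftrightarrow> (\<forall>x\<in>U. \<forall>\<^sub>F (x', y) in uniformity. x' = x \<longrightarrow> y \<in> U)"

lemma dist_torus_le:
  "dist (torus_proj x) (torus_proj y) \<le> dist x y"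
  unfolding dist_torus_def by (rule cInf_lower) (auto intro!: bdd_belowI[of _ 0])

lemma dist_torus_less:
  fixes a b :: "'a torus"
  assumes "dist a b < e"
  obtains x y where "torus_proj x = a" "torus_proj y = b" "dist x y < e"
proof -
  have "{dist x y |x y. torus_proj x = a \<and> torus_proj y = b} \<noteq> {}"
    using torus_proj_surj[of a] torus_proj_surj[of b] by blast
  from cInf_lessD[OF this assms[unfolded dist_torus_def]] show ?thesis using that by blast
qed

instance
proof
  fix a b c :: "'a torus"
  have nonneg: "dist u v \<ge> 0" for u v :: "'a torus"
    using dist_torus_less[of u v 0] by (metis not_less zero_le_dist)
  show "dist a b = 0 \<longleftrightarrow> a = b"
  proof
    assume 0: "dist a b = 0"
    obtain x y where xy: "torus_proj x = a" "torus_proj y = b"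
      using torus_proj_surj by metis
    have "x $ i - y $ i \<in> \<int>" for i
    proof -
      have "\<exists>k\<in>\<int>. dist k (x $ i - y $ i) < e" if "e > 0" for e
      proof -
        have "dist a b < e" using that 0 by simp
        then obtain x' y' where *: "torus_proj x' = a" "torus_proj y' = b" "dist x' y' < e"
          by (rule dist_torus_less)
        have "x $ i - x' $ i \<in> \<int>" "y $ i - y' $ i \<in> \<int>"
          using * xy torus_proj_eq_iff int_equiv_def by metis+
        then have "(x $ i - x' $ i) - (y $ i - y' $ i) \<in> \<int>" by (rule Ints_diff)
        moreover have "dist ((x $ i - x' $ i) - (y $ i - y' $ i)) (x $ i - y $ i) < e"
        proof -
          have "dist (x' $ i) (y' $ i) < e"
            using *(3) dist_vec_nth_le[of x' i y'] by linarith
          then show ?thesis by (simp add: dist_real_def)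
        qed
        ultimately show ?thesis by blast
      qed
      then show ?thesis using closed_approachable[OF closed_Ints] by blast
    qed
    then show "a = b" using xy torus_proj_eq_iff int_equiv_def by metis
  next
    assume "a = b"
    obtain x where "torus_proj x = a" using torus_proj_surj by blast
    then show "dist a b = 0" using dist_torus_le[of x x] nonneg[of a b] \<open>a = b\<close> by simp
  qed
  show "dist a b \<le> dist a c + dist b c"
  proof (rule field_le_epsilon)
    fix e :: real assume "e > 0"
    have "dist a c < dist a c + e / 2" "dist b c < dist b c + e / 2" using \<open>e > 0\<close> by auto
    obtain x z where xz: "torus_proj x = a" "torus_proj z = c" "dist x z < dist a c + e / 2"
      using dist_torus_less[OF \<open>dist a c < dist a c + e / 2\<close>] .
    obtain y z' where yz: "torus_proj y = b" "torus_proj z' = c" "dist y z' < dist b c + e / 2"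
      using dist_torus_less[OF \<open>dist b c < dist b c + e / 2\<close>] .
    have "torus_proj (y + z - z') = b" using torus_proj_translate[of z z' y] xz yz by simp
    then have "dist a b \<le> dist x (y + z - z')" using dist_torus_le[of x "y + z - z'"] xz by simp
    also have "\<dots> \<le> dist x z + dist z (y + z - z')" by (rule dist_triangle)
    also have "dist z (y + z - z') = dist y z'"
      by (simp add: dist_norm norm_minus_commute algebra_simps)
    finally show "dist a b \<le> dist a c + dist b c + e" using xz yz by simp
  qed
qed (simp_all add: uniformity_torus_def open_torus_def)

end

lemma continuous_on_torus_proj: "continuous_on S torus_proj"
  unfolding continuous_on_iff using dist_torus_le by (metis le_less_trans)

definition fund_cube :: "(real ^ 'n) set" where
  "fund_cube = cbox (\<chi> i. - 1 / 2) (\<chi> i. 1 / 2)"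


section \<open>Borel and Lebesgue measures on $[0,1] \times \mathbb{T}^d$\<close>

definition cyl :: "(real \<times> 'n::finite torus) set" where
  "cyl = {0..1} \<times> UNIV"

definition cyl_borel :: "(real \<times> 'n::finite torus) measure" where
  "cyl_borel = restrict_space borel cyl"

definition cyl_leb :: "(real \<times> 'n::finite torus) measure" where
  "cyl_leb = distr (restrict_space lborel ({0..1} \<times> fund_cube)) cyl_borel
     (\<lambda>(t, x). (t, torus_proj x))"

lemma sets_cyl_leb [simp, measurable_cong]: "sets cyl_leb = sets cyl_borel"
  by (simp add: cyl_leb_def)

lemma space_cyl_leb [simp]: "space cyl_leb = cyl"
  by (simp add: cyl_leb_def cyl_borel_def space_restrict_space)

lemma measurable_cyl_proj:
  "(\<lambda>(t, x). (t, torus_proj x)) \<in>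
     measurable (restrict_space lborel ({0..1} \<times> fund_cube)) (cyl_borel :: (real \<times> 'n::finite torus) measure)"
proof -
  have "continuous_on UNIV (\<lambda>z :: real \<times> (real ^ 'n). (fst z, torus_proj (snd z)))"
    by (intro continuous_on_Pair continuous_on_fst continuous_on_id
        continuous_on_compose2[OF continuous_on_torus_proj[of UNIV]] continuous_on_snd) auto
  then have "(\<lambda>z :: real \<times> (real ^ 'n). (fst z, torus_proj (snd z))) \<in> borel_measurable borel"
    by (rule borel_measurable_continuous_onI)
  then have "(\<lambda>z :: real \<times> (real ^ 'n). (fst z, torus_proj (snd z)))
      \<in> borel_measurable (restrict_space lborel ({0..1} \<times> fund_cube))"
    by (intro measurable_restrict_space1) simp
  then show ?thesis
    unfolding cyl_borel_def
    by (intro measurable_restrict_space2)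
      (auto simp: cyl_def case_prod_beta' space_restrict_space)
qed

lemma prob_space_cyl_leb: "prob_space (cyl_leb :: (real \<times> 'n::finite torus) measure)"
  unfolding cyl_leb_def
proof (rule prob_space.prob_space_distr[OF _ measurable_cyl_proj])
  let ?a = "(0, \<chi> i. - 1 / 2) :: real \<times> (real ^ 'n)" and ?b = "(1, \<chi> i. 1 / 2) :: real \<times> (real ^ 'n)"
  have box: "{0..1} \<times> fund_cube = cbox ?a ?b"
    by (simp add: fund_cube_def cbox_Pair_eq)
  have "emeasure lborel (cbox ?a ?b) = 1"
    by (subst emeasure_lborel_cbox)
      (auto simp: Basis_prod_def Basis_vec_def inner_axis prod.union_disjoint intro!: prod.neutral)
  then show "prob_space (restrict_space lborel ({0..1 :: real} \<times> (fund_cube :: (real ^ 'n) set)))"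
    unfolding box
    by (intro prob_spaceI) (simp add: emeasure_restrict_space space_restrict_space)
qed

definition is_finite_cyl_measure :: "(real \<times> 'n::finite torus) measure \<Rightarrow> bool" where
  "is_finite_cyl_measure \<rho> \<longleftrightarrow> finite_measure \<rho> \<and> sets \<rho> = sets cyl_borel"

text \<open>Lebesgue decomposition: \<open>r\<close> is a (finite, Borel) version of the density of the absolutely
  continuous part of \<open>\<rho>\<close>, and \<open>\<rho>s\<close> is the singular part.\<close>

definition is_ac_density ::
  "(real \<times> 'n::finite torus) measure \<Rightarrow> (real \<times> 'n torus \<Rightarrow> real) \<Rightarrow> bool" where
  "is_ac_density \<rho> r \<longleftrightarrow> r \<in> borel_measurable cyl_leb \<and> (\<forall>z. 0 \<le> r z) \<and>
     (\<exists>\<rho>s N. sets \<rho>s = sets \<rho> \<and> N \<in> null_sets cyl_leb \<and> emeasure \<rho>s (space \<rho>s - N) = 0 \<and>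
        (\<forall>A\<in>sets \<rho>. emeasure \<rho> A = emeasure (density cyl_leb r) A + emeasure \<rho>s A))"

definition ac_density ::
  "(real \<times> 'n::finite torus) measure \<Rightarrow> real \<times> 'n torus \<Rightarrow> real" where
  "ac_density \<rho> = (SOME r. is_ac_density \<rho> r)"


lemma is_ac_density_exists:
  fixes \<rho> :: "(real \<times> 'n::finite torus) measure"
  assumes "is_finite_cyl_measure \<rho>"
  shows "\<exists>r. is_ac_density \<rho> r"
proof -
  interpret finite_measure \<rho> using assms by (simp add: is_finite_cyl_measure_def)
  interpret L: prob_space "cyl_leb :: (real \<times> 'n torus) measure" by (rule prob_space_cyl_leb)
  have sets [simp, measurable_cong]: "sets \<rho> = sets (cyl_borel :: (real \<times> 'n torus) measure)"
    using assms by (simp add: is_finite_cyl_measure_def)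
  let ?L = "cyl_leb :: (real \<times> 'n torus) measure"
  define S where "S = (SUP N\<in>null_sets ?L. measure \<rho> N)"
  have ne: "null_sets ?L \<noteq> {}" by blast
  have bdd: "bdd_above (measure \<rho> ` null_sets ?L)"
    using bounded_measure by (auto intro!: bdd_aboveI2)
  have "\<exists>N\<in>null_sets ?L. S - 1 / real (Suc n) < measure \<rho> N" for n
    using less_cSUP_iff[OF ne bdd, of "S - 1 / real (Suc n)"] by (simp add: S_def)
  then obtain f where f: "\<And>n. f n \<in> null_sets ?L" "\<And>n. S - 1 / real (Suc n) < measure \<rho> (f n)"
    by metis
  define N where "N = (\<Union>n. f n)"
  have N: "N \<in> null_sets ?L" unfolding N_def using f by auto
  have Nsets [measurable]: "N \<in> sets \<rho>" using N by (simp add: null_sets_def)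
  have "S \<le> measure \<rho> N + e" if "e > 0" for e
  proof -
    obtain n where "1 / real (Suc n) < e" using nat_approx_posE[OF \<open>e > 0\<close>] by blast
    moreover have "measure \<rho> (f n) \<le> measure \<rho> N"
      using Nsets by (intro finite_measure_mono) (auto simp: N_def)
    ultimately show ?thesis using f(2)[of n] by linarith
  qed
  then have SN: "S \<le> measure \<rho> N" by (rule field_le_epsilon)
  have null: "emeasure \<rho> (A - N) = 0" if A: "A \<in> null_sets ?L" for A
  proof -
    have As: "A \<in> sets \<rho>" using A by (simp add: null_sets_def)
    have "measure \<rho> N + measure \<rho> (A - N) = measure \<rho> (N \<union> (A - N))"
      using As Nsets by (intro finite_measure_Union[symmetric]) auto
    also have "\<dots> = measure \<rho> (N \<union> A)" by simp
    also have "\<dots> \<le> S"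
      unfolding S_def using N A by (intro cSUP_upper[OF _ bdd]) auto
    finally have "measure \<rho> (A - N) = 0" using SN measure_nonneg[of \<rho> "A - N"] by linarith
    then show ?thesis by (simp add: emeasure_eq_measure)
  qed
  let ?a = "density \<rho> (indicator (- N))" and ?s = "density \<rho> (indicator N)"
  have mN [measurable]: "(indicator (- N) :: _ \<Rightarrow> ennreal) \<in> borel_measurable \<rho>"
    by (rule measurable_cong[THEN iffD1, of _ "\<lambda>x. 1 - indicator N x"])
      (auto simp: indicator_def)
  have diff [measurable]: "A - N \<in> sets \<rho>" "A \<inter> N \<in> sets \<rho>" if "A \<in> sets \<rho>" for A
    using that Nsets by auto
  have ea: "emeasure ?a A = emeasure \<rho> (A - N)" if "A \<in> sets \<rho>" for A
  proof -
    have "emeasure ?a A = (\<integral>\<^sup>+x. indicator (A - N) x \<partial>\<rho>)"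
      using that by (subst emeasure_density) (auto intro!: nn_integral_cong simp: indicator_def)
    then show ?thesis using diff[OF that] by (simp del: sets)
  qed
  have es: "emeasure ?s A = emeasure \<rho> (A \<inter> N)" if "A \<in> sets \<rho>" for A
  proof -
    have "emeasure ?s A = (\<integral>\<^sup>+x. indicator (A \<inter> N) x \<partial>\<rho>)"
      using that by (subst emeasure_density) (auto intro!: nn_integral_cong simp: indicator_def)
    then show ?thesis using diff[OF that] by (simp del: sets)
  qed
  have fin_a: "finite_measure ?a"
    using ea[OF sets.top] by (intro finite_measureI) (simp add: emeasure_eq_measure)
  have ac: "absolutely_continuous ?L ?a"
    unfolding absolutely_continuous_def
  proof
    fix A assume A: "A \<in> null_sets ?L"
    then have "A \<in> sets \<rho>" by (simp add: null_sets_def)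
    then show "A \<in> null_sets ?a" using null[OF A] by (simp add: null_sets_def ea)
  qed
  let ?g = "RN_deriv ?L ?a"
  have dg: "density ?L ?g = ?a"
    by (rule L.density_RN_deriv[OF ac]) simp
  have "AE x in ?L. ?g x \<noteq> \<infinity>"
    by (rule L.RN_deriv_finite[OF _ ac])
      (use fin_a in \<open>simp_all add: finite_measure.sigma_finite_measure finite_measure_def\<close>)
  then have dr: "density ?L (\<lambda>x. ennreal (enn2real (?g x))) = ?a"
    by (subst dg[symmetric], intro density_cong) (auto simp: top.not_eq_extremum ennreal_enn2real)
  have "is_ac_density \<rho> (\<lambda>x. enn2real (?g x))"
    unfolding is_ac_density_def
  proof (intro conjI allI exI[of _ ?s] exI[of _ N] ballI)
    show "(\<lambda>x. enn2real (?g x)) \<in> borel_measurable ?L" by measurable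
    show "N \<in> null_sets ?L" by (rule N)
    show "emeasure ?s (space ?s - N) = 0" 
      using es[OF sets.compl_sets[OF Nsets]] by (simp add: Int_commute)
    fix A assume A: "A \<in> sets \<rho>"
    have "emeasure \<rho> A = emeasure \<rho> ((A - N) \<union> (A \<inter> N))" by (rule arg_cong[of _ _ "emeasure \<rho>"]) auto
    also have "\<dots> = emeasure \<rho> (A - N) + emeasure \<rho> (A \<inter> N)"
      using diff[OF A] by (intro plus_emeasure[symmetric]) auto
    finally show "emeasure \<rho> A = emeasure (density ?L (\<lambda>x. enn2real (?g x))) A + emeasure ?s A"
      using A by (simp add: dr ea es)
  qed auto
  then show ?thesis by blast
qed


section \<open>The distance $W_\alpha$\<close>

definition H_cost :: "real \<Rightarrow> real \<Rightarrow> real ^ 'n \<Rightarrow> ennreal" where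
  "H_cost \<alpha> r w =
     (if r > 0 then ennreal ((norm w)\<^sup>2 / r powr \<alpha>) else if r = 0 \<and> w = 0 then 0 else \<infinity>)"

text \<open>\<open>\<psi>\<close> is of class \<open>C\<^sup>1\<close> with time derivative \<open>\<psi>t\<close> and spatial gradient \<open>\<psi>x\<close>; derivatives are
  those of the periodic function on \<open>[0,1] \<times> \<real>\<^sup>d\<close>, one-sided in time at \<open>t = 0, 1\<close>.\<close>

definition is_C1_test ::
  "(real \<times> 'n::finite torus \<Rightarrow> real) \<Rightarrow> (real \<times> 'n torus \<Rightarrow> real) \<Rightarrow>
   (real \<times> 'n torus \<Rightarrow> real ^ 'n) \<Rightarrow> bool" where
  "is_C1_test \<psi> \<psi>t \<psi>x \<longleftrightarrow> continuous_on cyl \<psi>t \<and> continuous_on cyl \<psi>x \<and>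
     (\<forall>t\<in>{0..1}. \<forall>x. ((\<lambda>(s, y). \<psi> (s, torus_proj y)) has_derivative
        (\<lambda>(s, y). s * \<psi>t (t, torus_proj x) + y \<bullet> \<psi>x (t, torus_proj x)))
        (at (t, x) within {0..1} \<times> UNIV))"

definition continuity_eq ::
  "(real \<times> 'n::finite torus) measure \<Rightarrow> (real \<times> 'n torus \<Rightarrow> real ^ 'n) \<Rightarrow>
   'n torus measure \<Rightarrow> 'n torus measure \<Rightarrow> bool" where
  "continuity_eq \<rho> w \<rho>0 \<rho>1 \<longleftrightarrow> (\<forall>\<psi> \<psi>t \<psi>x. is_C1_test \<psi> \<psi>t \<psi>x \<longrightarrow>
     (\<integral>z. \<psi>t z \<partial>\<rho>) + (\<integral>z. \<psi>x z \<bullet> w z \<partial>cyl_leb) = (\<integral>x. \<psi> (1, x) \<partial>\<rho>1) - (\<integral>x. \<psi> (0, x) \<partial>\<rho>0))"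

text \<open>The vector measure is represented by its density, an integrable vector field.\<close>

definition admissible ::
  "'n::finite torus measure \<Rightarrow> 'n torus measure \<Rightarrow>
   ((real \<times> 'n torus) measure \<times> (real \<times> 'n torus \<Rightarrow> real ^ 'n)) set" where
  "admissible \<rho>0 \<rho>1 =
     {(\<rho>, w). is_finite_cyl_measure \<rho> \<and> integrable cyl_leb w \<and> continuity_eq \<rho> w \<rho>0 \<rho>1}"

definition action ::
  "real \<Rightarrow> (real \<times> 'n::finite torus) measure \<Rightarrow> (real \<times> 'n torus \<Rightarrow> real ^ 'n) \<Rightarrow> ennreal" where
  "action \<alpha> \<rho> w = (\<integral>\<^sup>+z. H_cost \<alpha> (ac_density \<rho> z) (w z) \<partial>cyl_leb)"

definition ennreal_sqrt :: "ennreal \<Rightarrow> ennreal" where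
  "ennreal_sqrt a = (if a = \<infinity> then \<infinity> else ennreal (sqrt (enn2real a)))"

definition W_dist :: "real \<Rightarrow> 'n::finite torus measure \<Rightarrow> 'n torus measure \<Rightarrow> ennreal" where
  "W_dist \<alpha> \<rho>0 \<rho>1 = ennreal_sqrt (INF (\<rho>, w)\<in>admissible \<rho>0 \<rho>1. action \<alpha> \<rho> w)"

lemma ennreal_sqrt_power2: "(ennreal_sqrt a)\<^sup>2 = a"
  by (cases a) (auto simp: ennreal_sqrt_def ennreal_power)

lemma W_dist_power2: "(W_dist \<alpha> \<rho>0 \<rho>1)\<^sup>2 = (INF (\<rho>, w)\<in>admissible \<rho>0 \<rho>1. action \<alpha> \<rho> w)"
  by (simp add: W_dist_def ennreal_sqrt_power2)


section \<open>Measures on curves\<close>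

text \<open>Elements of \<open>mspace curve_metric\<close> are functions on \<open>real\<close> that are continuous on \<open>{0..1}\<close> and
  \<open>undefined\<close> outside; the metric is the supremum distance.\<close>

definition curve_metric :: "(real \<Rightarrow> 'n::finite torus) metric" where
  "curve_metric = cfunspace (top_of_set {0..1}) euclidean_metric"

abbreviation curves :: "(real \<Rightarrow> 'n::finite torus) set" where
  "curves \<equiv> mspace curve_metric"

definition curves_borel :: "(real \<Rightarrow> 'n::finite torus) measure" where
  "curves_borel = sigma curves {U. openin (mtopology_of curve_metric) U}"

definition abs_continuous_curve :: "(real \<Rightarrow> 'b::metric_space) \<Rightarrow> bool" where
  "abs_continuous_curve \<gamma> \<longleftrightarrow>
     (\<forall>\<epsilon>>0. \<exists>\<delta>>0. \<forall>(n::nat) a b.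
        (\<forall>i<n. 0 \<le> a i \<and> a i \<le> b i \<and> b i \<le> 1) \<and>
        disjoint_family_on (\<lambda>i. {a i<..<b i}) {..<n} \<and> (\<Sum>i<n. b i - a i) < \<delta> \<longrightarrow>
        (\<Sum>i<n. dist (\<gamma> (a i)) (\<gamma> (b i))) < \<epsilon>)"

text \<open>The velocity is the derivative of a continuous lift to \<open>\<real>\<^sup>d\<close>; two lifts differ by a constant.
  At times where no derivative exists, \<open>velocity\<close> is set to 0 (a null set of times for absolutely
  continuous curves).\<close>

definition has_velocity ::
  "(real \<Rightarrow> 'n::finite torus) \<Rightarrow> real ^ 'n \<Rightarrow> real \<Rightarrow> bool" where
  "has_velocity \<gamma> v t \<longleftrightarrow>
     (\<exists>g. continuous_on {0..1} g \<and> (\<forall>s\<in>{0..1}. torus_proj (g s) = \<gamma> s) \<and>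
          (g has_vector_derivative v) (at t within {0..1}))"

definition velocity :: "(real \<Rightarrow> 'n::finite torus) \<Rightarrow> real \<Rightarrow> real ^ 'n" where
  "velocity \<gamma> t = (if \<exists>v. has_velocity \<gamma> v t then THE v. has_velocity \<gamma> v t else 0)"

definition W_curves :: "real \<Rightarrow> (real \<Rightarrow> 'n::finite torus) set" where
  "W_curves \<alpha> = {\<gamma> \<in> curves. abs_continuous_curve \<gamma> \<and>
     velocity \<gamma> \<in> borel_measurable (lebesgue_on {0..1}) \<and>
     (\<integral>\<^sup>+t. ennreal (norm (velocity \<gamma> t) powr (2 / (2 - \<alpha>))) \<partial>lebesgue_on {0..1}) < \<infinity>}"

definition curve_energy :: "real \<Rightarrow> (real \<Rightarrow> 'n::finite torus) \<Rightarrow> ennreal" where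
  "curve_energy \<alpha> \<gamma> = (if \<gamma> \<in> W_curves \<alpha>
     then \<integral>\<^sup>+t. ennreal (norm (velocity \<gamma> t) powr (2 / (2 - \<alpha>))) \<partial>lebesgue_on {0..1} else \<infinity>)"

definition curve_probs :: "(real \<Rightarrow> 'n::finite torus) measure set" where
  "curve_probs = {\<eta>. prob_space \<eta> \<and> sets \<eta> = sets curves_borel}"

definition Pi2 :: "real \<Rightarrow> (real \<Rightarrow> 'n::finite torus) measure set" where
  "Pi2 \<alpha> = {\<eta> \<in> curve_probs. (\<integral>\<^sup>+\<gamma>. curve_energy \<alpha> \<gamma> \<partial>\<eta>) < \<infinity>}"

text \<open>For \<open>\<eta> \<in> Pi2 \<alpha>\<close> the curves outside \<open>W_curves \<alpha>\<close> are negligible, so the values of \<open>velocity\<close> on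
  them play no role; testing against continuous functions determines a finite Borel measure.\<close>

definition sigma_meas ::
  "real \<Rightarrow> (real \<Rightarrow> 'n::finite torus) measure \<Rightarrow> (real \<times> 'n torus) measure" where
  "sigma_meas \<alpha> \<eta> = (THE \<sigma>. is_finite_cyl_measure \<sigma> \<and>
     (\<forall>f :: real \<times> 'n torus \<Rightarrow> real. continuous_on cyl f \<longrightarrow>
        (\<integral>z. f z \<partial>\<sigma>) =
        (\<integral>\<gamma>. (\<integral>s. f (s, \<gamma> s) * norm (velocity \<gamma> s) powr (2 / (2 - \<alpha>)) \<partial>lebesgue_on {0..1}) \<partial>\<eta>)))"

definition Pi2_ac :: "real \<Rightarrow> (real \<Rightarrow> 'n::finite torus) measure set" where
  "Pi2_ac \<alpha> = {\<eta> \<in> Pi2 \<alpha>. absolutely_continuous cyl_leb (sigma_meas \<alpha> \<eta>)}"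

definition Pi2_ac_between ::
  "real \<Rightarrow> 'n::finite torus measure \<Rightarrow> 'n torus measure \<Rightarrow> (real \<Rightarrow> 'n torus) measure set" where
  "Pi2_ac_between \<alpha> \<rho>0 \<rho>1 =
     {\<eta> \<in> Pi2_ac \<alpha>. distr \<eta> borel (\<lambda>\<gamma>. \<gamma> 0) = \<rho>0 \<and> distr \<eta> borel (\<lambda>\<gamma>. \<gamma> 1) = \<rho>1}"

text \<open>\<open>sigma_meas \<alpha> \<eta>\<close> is finite, so its density is finite almost everywhere and \<open>enn2real\<close> loses
  nothing.\<close>

definition K_cost ::
  "real \<Rightarrow> 'n::finite torus measure \<Rightarrow> 'n torus measure \<Rightarrow>
   (real \<Rightarrow> 'n torus) measure \<Rightarrow> ennreal" where
  "K_cost \<alpha> \<rho>0 \<rho>1 \<eta> = (if \<eta> \<in> Pi2_ac_between \<alpha> \<rho>0 \<rho>1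
     then \<integral>\<^sup>+z. ennreal (enn2real (RN_deriv cyl_leb (sigma_meas \<alpha> \<eta>) z) powr (2 - \<alpha>)) \<partial>cyl_leb
     else \<infinity>)"

end

theory Submission
 imports Defs "HOL-Probability.Probability" "HOL-Real_Asymp.Real_Asymp"
begin

text \<open>Write \<open>p = 2/(2 - \<alpha>)\<close>. In the names below, \<open>ga\<close>, \<open>et\<close>,
\<open>sg\<close>, \<open>rh\<close>, \<open>al\<close> stand for a curve, a law on curves, a measure on the
cylinder, a marginal and the exponent.

A law on curves is at least as expensive as the distance: its occupation measure together with the associated
flux solves the continuity equation by the chain rule, the flux has a density because it vanishes where the
speed does, and Jensen's inequality bounds the action of this pair by the cost of the law
(\<open>W_dist_le_K_cost\<close>).

For the converse let \<open>(\<rho>, w)\<close> be admissible and put \<open>\<sigma> = r (|w| / r)^p\<close>,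
where \<open>r\<close> is the density of the absolutely continuous part of \<open>\<rho>\<close>; then
\<open>\<sigma>\<close> to the power \<open>2 - \<alpha>\<close> is the action density. The task is to find a
law on curves with the given marginals whose speed measure is dominated by \<open>\<sigma>\<close>. No
regularity of \<open>\<rho>\<close> or \<open>w\<close> is available, so the law is produced by duality. For a
continuous weight \<open>f\<close> the value function of the problem of minimizing the
\<open>f\<close>-weighted energy becomes, after mollification, a smooth subsolution of a Hamilton-Jacobi
equation (\<open>dual_test_function\<close>). Testing the continuity equation with it shows that
\<open>\<sigma>\<close> satisfies every linear inequality that is satisfied by all curves
(\<open>admissible_dual_ineq\<close>). A finite minimax argument (\<open>finite_minimax\<close>) then yields
finitely supported laws on curves that satisfy finitely many of the constraints up to a small error
(\<open>discrete_superposition\<close>).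

To pass to the limit, the values of a curve at all rational times are coded by one number of the unit interval
(\<open>torus_family_code\<close>), so that Helly's selection theorem applies. Dyadic energies are continuous
in the code and bounded in mean; almost every code therefore belongs to an absolutely continuous curve that
depends measurably on it (\<open>random_path\<close>), and lower semicontinuity of the dyadic energies gives
the domination by \<open>\<sigma>\<close> in the limit (\<open>limit_superposition\<close>). The same
statement applies to a minimizing sequence of pairs, whose measures \<open>\<sigma>\<close> need not be fixed,
and \<open>density_bound\<close> turns the limiting inequality into absolute continuity of the speed measure
and the bound of the cost. This gives equality and attainment if the distance is finite.

If the distance is infinite, every competitor has infinite cost, and only the existence of one is at stake. A
measure with the dual inequality is obtained by moving the mass along broken lines through intermediate points
that are spread out over a cube (\<open>spread_out_dual_feasible\<close>), and
\<open>limit_superposition\<close> converts it into a competitor.\<close>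

abbreviation (input) bm where "bm \<equiv> borel_measurable"
abbreviation (input) cont where "cont \<equiv> continuous_on UNIV"
abbreviation (input) converges (infix "~>" 60) where "X ~> L \<equiv> X \<longlonglongrightarrow> L"
text \<open>The index of the dyadic interval of generation \<open>k\<close> that contains \<open>t\<close>.\<close>
abbreviation (input) cell where "cell k (t::real) \<equiv> nat \<lfloor>2^k * t\<rfloor>"
abbreviation (input) increment where "increment g k i \<equiv> dist (g (real i/2^k)) (g (real (Suc i)/2^k))"
abbreviation (input) marg where "marg et t \<equiv> distr et borel (\<lambda>g. g t)"
abbreviation (input) pspeed where "pspeed p z \<equiv> norm (velocity (fst z) (snd z)) powr p"

section \<open>Lifts to the covering space\<close>

lemma torus_lift_near:
 assumes "dist (torus_proj x) b < e"
 obtains y where "torus_proj y = b" "dist x y < e"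
proof -
 obtain x' y' where *: "torus_proj x' = torus_proj x" "torus_proj y' = b" "dist x' y' < e"
  using dist_torus_less[OF assms] .
 have "torus_proj (y' + x - x') = b" using torus_proj_translate[of x x' y']*by simp
 moreover have "dist x (y' + x - x') < e" using *(3) by (simp add: dist_norm algebra_simps norm_minus_commute)
 ultimately show ?thesis using that by blast
qed

lemma open_torus_proj_image:
 assumes "open U"
 shows "open (torus_proj ` U)"
 unfolding open_dist
proof
 fix a assume "a : torus_proj ` U"
 then obtain x where x: "x : U" "a = torus_proj x" by blast
 obtain e where e: "e > 0" "!!y. dist y x < e ==> y : U" using assms x(1) unfolding open_dist by blast
 show "\<exists>e>0. \<forall>y. dist y a < e --> y : torus_proj ` U"
 proof (intro exI[of _ e] conjI allI impI)
  fix b assume "dist b a < e"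
  hence "dist (torus_proj x) b < e" by (simp add: x dist_commute)
  then obtain y where "torus_proj y = b" "dist x y < e" by (rule torus_lift_near)
  thus "b : torus_proj ` U" using e(2) by (auto simp: dist_commute)
 qed (rule e)
qed

instance torus :: (finite) second_countable_topology
proof
 obtain B :: "(real ^ 'a) set set" where B: "countable B" "topological_basis B"
  using ex_countable_basis by blast
 have "topological_basis ((`) torus_proj ` B)"
 proof (rule topological_basisI)
  fix V assume "V : (`) torus_proj ` B"
  thus "open V" using open_torus_proj_image topological_basis_open[OF B(2)] by blast
 next
  fix U and a :: "'a torus" assume U: "open U" "a : U"
  obtain x where x: "torus_proj x = a" using torus_proj_surj by blast
  have "open (torus_proj -` U)" using open_vimage[OF U(1) continuous_on_torus_proj] .
  moreover have "x : torus_proj -` U" using x U(2) by simp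
  ultimately obtain V where "V : B" "x : V" "V <= torus_proj -` U"
   by (rule topological_basisE[OF B(2)])
  thus "\<exists>V\<in>(`) torus_proj ` B. a : V & V <= U"
   using x by (intro bexI[of _ "torus_proj ` V"]) auto
 qed
 hence "open = generate_topology ((`) torus_proj ` B)"
  by (rule topological_basis_imp_subbasis)
 thus "\<exists>B::'a torus set set. countable B & open = generate_topology B"
  using B(1) by blast
qed

lemma fund_cube_repr: "\<exists>x\<in>fund_cube. torus_proj x = a"
proof -
 obtain x where x: "torus_proj x = a" using torus_proj_surj by blast
 let ?y = "(\<chi> i. frac (x $ i) - 1/2) :: real ^ 'a"
 let ?z = "(\<chi> i. frac (x $ i + 1/2) - 1/2) :: real ^ 'a"
 have "?z : fund_cube"
  unfolding fund_cube_def mem_box_cart by (auto simp: frac_lt_1 less_imp_le)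
 moreover have "torus_proj ?z = a"
 proof -
  have "(?z $ i) - x $ i = - of_int \<lfloor>x $ i + 1/2\<rfloor>" for i by (simp add: frac_def)
  hence "int_equiv ?z x" unfolding int_equiv_def by simp
  thus ?thesis using x torus_proj_eq_iff by blast
 qed
 ultimately show ?thesis by blast
qed

lemma compact_fund_cube: "compact fund_cube" unfolding fund_cube_def by (rule compact_cbox)

lemma compact_UNIV_torus: "compact (UNIV :: 'n::finite torus set)"
proof -
 have "UNIV = torus_proj ` (fund_cube :: (real ^ 'n) set)" using fund_cube_repr by (metis UNIV_eq_I image_eqI)
 thus ?thesis using compact_continuous_image[OF continuous_on_torus_proj compact_fund_cube] by metis
qed

instance torus :: (finite) complete_space
proof
 fix X :: "nat => 'a torus" assume "Cauchy X"
 thus "convergent X"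
  using compact_imp_complete[OF compact_UNIV_torus[where 'n = 'a]] unfolding complete_def convergent_def by blast
qed

lemma compact_cyl: "compact (cyl :: (real \<times> 'n::finite torus) set)"
 unfolding cyl_def by (intro compact_Times compact_Icc compact_UNIV_torus)

lemma torus_proj_eq_close:
 assumes "torus_proj y = torus_proj z" "dist y z < 1"
 shows "y = z"
proof -
 have "y $ i = z $ i" for i
 proof -
  have "y $ i - z $ i : \<int>" using assms(1) torus_proj_eq_iff int_equiv_def by metis
  moreover have "\<bar>y $ i - z $ i\<bar> < 1"
   using assms(2) dist_vec_nth_le[of y i z] by (simp add: dist_real_def)
  ultimately have "y $ i - z $ i = 0" using Ints_nonzero_abs_less1 by blast
  thus ?thesis by simp
 qed
 thus ?thesis by (simp add: vec_eq_iff)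
qed

lemma torus_dist_eq:
 assumes "dist x y < 1/2"
 shows "dist (torus_proj x) (torus_proj y) = dist x y"
proof (rule ccontr)
 assume "\<not> ?thesis"
 hence "dist (torus_proj x) (torus_proj y) < dist x y" using dist_torus_le[of x y] by simp
 then obtain z where z: "torus_proj z = torus_proj y" "dist x z < dist x y" by (rule torus_lift_near)
 have "dist z y < 1" using dist_triangle3[of z y x] z(2) assms by simp
 thus False using torus_proj_eq_close[OF z(1)] z(2) by simp
qed

definition is_lift :: "(real => 'n::finite torus) => (real => real ^ 'n) => bool" where
 "is_lift ga g \<longleftrightarrow> continuous_on {0..1} g & (ALL s:{0..1}. torus_proj (g s) = ga s)"

lemma lift_exists:
 fixes ga :: "real => 'n::finite torus"
 assumes "continuous_on {0..1} ga"
 obtains g where "is_lift ga g"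
proof -
 have "uniformly_continuous_on {0..1} ga" using assms by (intro compact_uniformly_continuous) auto
 then obtain d where d: "d > 0" "!!s t. s : {0..1} ==> t : {0..1} ==> dist s t < d ==> dist (ga s) (ga t) < 1/4"
  unfolding uniformly_continuous_on_def by (metis zero_less_divide_1_iff zero_less_numeral)
 obtain N where N: "1/real (Suc N) < d" using nat_approx_posE[OF d(1)] by blast
 define h where "h = 1/real (Suc N)"
 have h: "h > 0" "h < d" using N by (auto simp: h_def)
 have "\<exists>g. continuous_on {0..min 1 (real k*h)} g & (ALL s:{0..min 1 (real k*h)}. torus_proj (g s) = ga s)" for k
 proof (induction k)
  case 0
  obtain x where "torus_proj x = ga 0" using torus_proj_surj by blast
  thus ?case by (intro exI[of _ "%_. x"]) auto
 next
  case (Suc k)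
  define a where "a = min 1 (real k*h)"
  define b where "b = min 1 (real (Suc k)*h)"
  obtain g where g: "continuous_on {0..a} g" "!!s. s : {0..a} ==> torus_proj (g s) = ga s"
   using Suc unfolding a_def by blast
  have ab: "0 <= a" "a <= b" "b <= 1" "b - a <= h" using h by (auto simp: a_def b_def algebra_simps min_def)
  have "\<exists>y. torus_proj y = ga s & dist (g a) y < 1/4" if "s : {a..b}" for s
  proof -
   have "dist a s < d" using that ab h by (auto simp: dist_real_def)
   hence "dist (torus_proj (g a)) (ga s) < 1/4" using d(2)[of a s] that ab g(2)[of a] by auto
   thus ?thesis using torus_lift_near by blast
  qed
  then obtain y where y: "!!s. s : {a..b} ==> torus_proj (y s) = ga s" "!!s. s : {a..b} ==> dist (g a) (y s) < 1/4"
   by metis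
  have yd: "dist (y s) (y t) = dist (ga s) (ga t)" if "s : {a..b}" "t : {a..b}" for s t
  proof -
   have "dist (y s) (y t) < 1/2" using y(2)[OF that(1)] y(2)[OF that(2)] dist_triangle3[of "y s" "y t" "g a"] by simp
   thus ?thesis using torus_dist_eq y(1) that by metis
  qed
  have "continuous_on {a..b} ga" using assms ab by (auto intro: continuous_on_subset)
  hence yc: "continuous_on {a..b} y" unfolding continuous_on_iff using yd by metis
  have ya: "y a = g a"
  proof (rule torus_proj_eq_close)
   show "torus_proj (y a) = torus_proj (g a)" using y(1)[of a] g(2)[of a] ab by simp
   show "dist (y a) (g a) < 1" using y(2)[of a] ab by (simp add: dist_commute)
  qed
  let ?g = "%s. if s <= a then g s else y s"
  have "continuous_on ({0..a} \<union> {a..b}) ?g"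
   by (rule continuous_on_If) (use g(1) yc ya in \<open>auto intro: continuous_on_subset\<close>)
  moreover have "{0..a} \<union> {a..b} = {0..b}" using ab by auto
  moreover have "ALL s:{0..b}. torus_proj (?g s) = ga s" using g(2) y(1) by auto
  ultimately show ?case unfolding b_def by (intro exI[of _ ?g]) auto
 qed
 from this[of "Suc N"] show ?thesis using that unfolding is_lift_def h_def by auto
qed

text \<open>Lifts reduce statements on velocities of torus curves to derivatives of vector-valued functions.\<close>
lemma has_velocity_iff_lift:
 assumes "is_lift ga g" "t : {0..1}"
 shows "has_velocity ga v t \<longleftrightarrow> (g has_vector_derivative v) (at t within {0..1})"
proof
 assume "(g has_vector_derivative v) (at t within {0..1})"
 thus "has_velocity ga v t" using assms unfolding has_velocity_def is_lift_def by blast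
next
 assume "has_velocity ga v t"
 then obtain k where k: "continuous_on {0..1} k" "!!s. s : {0..1} ==> torus_proj (k s) = ga s"
  "(k has_vector_derivative v) (at t within {0..1})" unfolding has_velocity_def by blast
 have g: "continuous_on {0..1} g" "!!s. s : {0..1} ==> torus_proj (g s) = ga s"
  using assms unfolding is_lift_def by auto
 define c where "c = g t - k t"
 obtain d1 where d1: "d1 > 0" "!!s. s : {0..1} ==> dist s t < d1 ==> dist (g s) (g t) < 1/2"
  using g(1) assms(2) unfolding continuous_on_iff by (metis zero_less_divide_1_iff zero_less_numeral)
 obtain d2 where d2: "d2 > 0" "!!s. s : {0..1} ==> dist s t < d2 ==> dist (k s) (k t) < 1/2"
  using k(1) assms(2) unfolding continuous_on_iff by (metis zero_less_divide_1_iff zero_less_numeral)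
 have eq: "g s = k s + c" if s: "s : {0..1}" "dist s t < min d1 d2" for s
 proof (rule torus_proj_eq_close)
  have "torus_proj (k s + g t - k t) = torus_proj (k s)"
   by (rule torus_proj_translate) (use g(2) k(2) assms(2) in simp)
  thus "torus_proj (g s) = torus_proj (k s + c)" using g(2) k(2) s by (simp add: c_def algebra_simps)
  have "dist (g s) (k s + c) = norm ((g s - g t) - (k s - k t))" by (simp add: dist_norm c_def algebra_simps)
  also have "... <= norm (g s - g t) + norm (k s - k t)" by (rule norm_triangle_ineq4)
  also have "... < 1" using d1(2)[of s] d2(2)[of s] s by (simp add: dist_norm)
  finally show "dist (g s) (k s + c) < 1" .
 qed
 have "((%s. k s + c) has_vector_derivative v) (at t within {0..1})"
  using has_vector_derivative_add[OF k(3) has_vector_derivative_const[of c]] by simp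
 thus "(g has_vector_derivative v) (at t within {0..1})"
  using has_vector_derivative_transform_within[of "%s. k s + c" v t "{0..1}" "min d1 d2" g] eq d1(1) d2(1) assms(2)
  by auto
qed

lemma velocity_eq_lift:
 assumes "is_lift ga g" "t : {0..1}" "(g has_vector_derivative v) (at t within {0..1})"
 shows "velocity ga t = v"
proof -
 have *: "has_velocity ga u t \<longleftrightarrow> u = v" for u
  using has_velocity_iff_lift[OF assms(1,2)] assms(3)
   vector_derivative_unique_within_closed_interval[of 0 1 t g] assms(2)
  by (auto simp: cbox_interval)
 thus ?thesis unfolding velocity_def by simp
qed

text \<open>The coordinates of a representative jump; their sines and cosines are continuous on the torus and together
determine the point.\<close>
definition tsin :: "'n => 'n::finite torus => real" where "tsin c a = sin (2*pi*(rep_torus a $ c))"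
definition tcos :: "'n => 'n::finite torus => real" where "tcos c a = cos (2*pi*(rep_torus a $ c))"

lemma tsincos_proj: "tsin c (torus_proj x) = sin (2*pi*x $ c)" "tcos c (torus_proj x) = cos (2*pi*x $ c)"
proof -
 have "torus_proj (rep_torus (torus_proj x)) = torus_proj x"
  by (rule Quotient3_abs_rep[OF Quotient3_torus])
 hence "rep_torus (torus_proj x) $ c - x $ c : \<int>" using torus_proj_eq_iff int_equiv_def by metis
 then obtain k where k: "rep_torus (torus_proj x) $ c = x $ c + of_int k" by (metis Ints_cases add.commute diff_add_cancel)
 show "tsin c (torus_proj x) = sin (2*pi*x $ c)"
  using sin_add[of "2*pi*x $ c" "2*pi * of_int k"] unfolding tsin_def k
  by (simp add: sin_int_2pin cos_int_2pin distrib_left)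
 show "tcos c (torus_proj x) = cos (2*pi*x $ c)"
  using cos_add[of "2*pi*x $ c" "2*pi * of_int k"] unfolding tcos_def k
  by (simp add: sin_int_2pin cos_int_2pin distrib_left)
qed

lemma continuous_on_torus_iff:
 fixes f :: "'n::finite torus => 'b::topological_space"
 shows "cont f \<longleftrightarrow> cont (%x. f (torus_proj x))"
proof
 assume "cont f"
 thus "cont (%x. f (torus_proj x))"
  using continuous_on_compose2[OF _ continuous_on_torus_proj[of UNIV], of UNIV f] by auto
next
 assume c: "cont (%x. f (torus_proj x))"
 show "cont f"
  unfolding continuous_on_open_vimage[OF open_UNIV]
 proof (intro allI impI)
  fix B :: "'b set" assume "open B"
  hence "open ((%x. f (torus_proj x)) -` B)" using c by (simp add: open_vimage)
  hence "open (torus_proj ` ((%x. f (torus_proj x)) -` B))" by (rule open_torus_proj_image)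
  moreover have "torus_proj ` ((%x. f (torus_proj x)) -` B) = f -` B Int UNIV"
  proof (intro set_eqI iffI)
   fix a assume "a : f -` B Int UNIV"
   moreover obtain x where "torus_proj x = a" using torus_proj_surj by blast
   ultimately show "a : torus_proj ` ((%x. f (torus_proj x)) -` B)" by (intro image_eqI[of _ _ x]) auto
  qed auto
  ultimately show "open (f -` B Int UNIV)" by simp
 qed
qed

lemma continuous_tsincos: "cont (tsin c)" "cont (tcos c)"
 unfolding continuous_on_torus_iff tsincos_proj by (intro continuous_intros)+

lemma measurable_torus_section:
 obtains sec :: "'n::finite torus => real ^ 'n" where
  "sec : bm borel" "!!a. sec a : fund_cube" "!!a. torus_proj (sec a) = a"
proof -
 let ?Q = "{x :: real ^ 'n. \<forall>i. - 1/2 <= x $ i & x $ i < 1/2}"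
 have ex1: "\<exists>!x. x : ?Q & torus_proj x = a" for a :: "'n torus"
 proof -
  obtain x where x: "torus_proj x = a" using torus_proj_surj by blast
  let ?z = "(\<chi> i. frac (x $ i + 1/2) - 1/2) :: real ^ 'n"
  have "?z : ?Q" by (auto simp: frac_lt_1)
  moreover have "torus_proj ?z = a"
  proof -
   have "(?z $ i) - x $ i = - of_int \<lfloor>x $ i + 1/2\<rfloor>" for i by (simp add: frac_def)
   hence "int_equiv ?z x" unfolding int_equiv_def by simp
   thus ?thesis using x torus_proj_eq_iff by blast
  qed
  moreover have "y = z" if "y : ?Q" "torus_proj y = a" "z : ?Q" "torus_proj z = a" for y z
  proof -
   have "y $ i = z $ i" for i
   proof -
   have "y $ i - z $ i : \<int>" using that torus_proj_eq_iff int_equiv_def by metis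
   moreover have "\<bar>y $ i - z $ i\<bar> < 1" using that(1,3) by (auto simp: abs_less_iff) (smt (verit, best) field_sum_of_halves)+
   ultimately have "y $ i - z $ i = 0" using Ints_nonzero_abs_less1 by blast
   thus ?thesis by simp
   qed
   thus ?thesis by (simp add: vec_eq_iff)
  qed
  ultimately show ?thesis by blast
 qed
 define sec where "sec a = (THE x. x : ?Q & torus_proj x = a)" for a
 have sec: "sec a : ?Q" "torus_proj (sec a) = a" for a
  using theI'[OF ex1[of a]] unfolding sec_def by auto
 have sec_eq: "sec (torus_proj x) = x" if "x : ?Q" for x
  using ex1[of "torus_proj x"] sec[of "torus_proj x"] that by blast
 have "sec : bm borel"
 proof (rule borel_measurableI)
  fix U :: "(real ^ 'n) set" assume "open U"
  let ?C = "%n. cbox (\<chi> i. - 1/2) ((\<chi> i. 1/2 - 1/real (Suc n)) :: real ^ 'n)"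
  obtain F :: "nat => (real ^ 'n) set" where F': "!!n. compact (F n)" "\<Union> (range F) = U"
   by (rule open_Union_compact_subsets[OF \<open>open U\<close>], blast)
  hence F: "!!n. compact (F n)" "U = (\<Union>n. F n)" by auto
  have Q: "?Q = (\<Union>n. ?C n)"
  proof (intro set_eqI iffI)
   fix x :: "real ^ 'n" assume x: "x : ?Q"
   have "\<exists>n. \<forall>i. x $ i <= 1/2 - 1/real (Suc n)"
   proof -
   define e where "e = Min (range (%i. 1/2 - x $ i))"
   have "e > 0" unfolding e_def using x by (auto simp: Min_gr_iff)
   then obtain n where "1/real (Suc n) < e" using nat_approx_posE by blast
   moreover have "e <= 1/2 - x $ i" for i unfolding e_def by (intro Min_le) auto
   ultimately show ?thesis by (intro exI[of _ n]) (smt (verit))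
   qed
   thus "x : (\<Union>n. ?C n)" using x by (auto simp: mem_box_cart)
  next
   fix x assume "x : (\<Union>n. ?C n)"
   then obtain n where n: "x : ?C n" by blast
   have "1/real (Suc n) > 0" by simp
   have "x $ i < 1/2" for i
   proof -
   have "x $ i <= 1/2 - 1/real (Suc n)" using n by (simp add: mem_box_cart)
   thus ?thesis using \<open>1/real (Suc n) > 0\<close> by linarith
   qed
   thus "x : ?Q" using n by (simp add: mem_box_cart)
  qed
  have "sec -` U = (\<Union>n. \<Union>m. torus_proj ` (F m Int ?C n))"
  proof (intro set_eqI iffI)
   fix a assume "a : sec -` U"
   hence "sec a : U" by simp
   then obtain m where m: "sec a : F m" using F(2) by auto
   obtain n where n: "sec a : ?C n" using sec(1)[of a] unfolding Q by (elim UN_E)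
   have "a : torus_proj ` (F m Int ?C n)" using m n sec(2)[of a] by (intro image_eqI[of _ _ "sec a"] IntI) auto
   thus "a : (\<Union>n. \<Union>m. torus_proj ` (F m Int ?C n))" by (intro UN_I[of n] UN_I[of m] UNIV_I)
  next
   fix a assume "a : (\<Union>n. \<Union>m. torus_proj ` (F m Int ?C n))"
   then obtain x n m where x: "a = torus_proj x" "x : F m" "x : ?C n" by (elim UN_E imageE IntE)
   hence "x : ?Q" unfolding Q by (intro UN_I[of n] UNIV_I)
   thus "a : sec -` U" using sec_eq x F(2) by auto
  qed
  also have "... : sets borel"
  proof -
   have "torus_proj ` (F m Int ?C n) : sets borel" for m n
   by (intro borel_closed compact_imp_closed compact_continuous_image[OF continuous_on_torus_proj] compact_Int F(1) compact_cbox)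
   thus ?thesis by (intro sets.countable_nat_UN image_subsetI UNIV_I) auto
  qed
  finally show "sec -` U Int space borel : sets borel" by simp
 qed
 moreover have "sec a : fund_cube" for a
  using sec(1)[of a] by (auto simp: fund_cube_def mem_box_cart less_imp_le)
 ultimately show ?thesis using that sec(2) by blast
qed

section \<open>A finite minimax inequality\<close>

definition weights :: "'g set => 'g set => ('g => real) => bool" where
 "weights \<Gamma> S c \<longleftrightarrow> finite S & S <= \<Gamma> & (\<forall>ga. 0 <= c ga) & (\<forall>ga. ga ~: S --> c ga = 0) & sum c S = 1"

lemma weights_mix:
 assumes "weights \<Gamma> S c" "ga : \<Gamma>" "0 <= ta" "ta <= 1"
 shows "\<exists>c'. weights \<Gamma> (insert ga S) c' &
  (\<forall>\<Phi>::_ => real. (\<Sum>x\<in>insert ga S. c' x*\<Phi> x) = (1 - ta)*(\<Sum>x\<in>S. c x*\<Phi> x) + ta*\<Phi> ga)"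
proof -
 let ?c = "%x. (1 - ta)*c x + (if x = ga then ta else 0)"
 have fin: "finite S" and z: "!!x. x ~: S ==> c x = 0" using assms by (auto simp: weights_def)
 have eq: "(\<Sum>x\<in>insert ga S. ?c x*\<Phi> x) = (1 - ta)*(\<Sum>x\<in>S. c x*\<Phi> x) + ta*\<Phi> ga" for \<Phi> :: "_ => real"
 proof -
  have "(\<Sum>x\<in>insert ga S. ?c x*\<Phi> x) =
   (1 - ta)*(\<Sum>x\<in>insert ga S. c x*\<Phi> x) + (\<Sum>x\<in>insert ga S. (if x = ga then ta*\<Phi> x else 0))"
   unfolding sum_distrib_left sum.distrib[symmetric] by (intro sum.cong) (auto simp: algebra_simps)
  also have "(\<Sum>x\<in>insert ga S. (if x = ga then ta*\<Phi> x else 0)) = ta*\<Phi> ga"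
   using fin by (subst sum.delta) auto
  also have "(\<Sum>x\<in>insert ga S. c x*\<Phi> x) = (\<Sum>x\<in>S. c x*\<Phi> x)"
   using fin z by (intro sum.mono_neutral_right) auto
  finally show ?thesis .
 qed
 have "weights \<Gamma> (insert ga S) ?c"
  unfolding weights_def using assms eq[of "%_. 1"] by (auto simp: weights_def)
 thus ?thesis using eq by blast
qed

lemma pos_part_sq_le:
 fixes x y :: real
 shows "(max 0 y)\<^sup>2 <= (max 0 x)\<^sup>2 + 2*max 0 x*(y - x) + (y - x)\<^sup>2"
proof -
 have "(max 0 x)\<^sup>2 + 2*max 0 x*(y - x) + (y - x)\<^sup>2 = (max 0 x + (y - x))\<^sup>2"
  by (simp add: power2_eq_square algebra_simps)
 moreover have "max 0 y <= max 0 (max 0 x + (y - x))" by auto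
 moreover have "(max 0 y)\<^sup>2 <= (max 0 (max 0 x + (y - x)))\<^sup>2"
  using calculation(2) by (intro power_mono) auto
 moreover have "(max 0 (max 0 x + (y - x)))\<^sup>2 <= (max 0 x + (y - x))\<^sup>2" by (auto simp: max_def)
 ultimately show ?thesis by linarith
qed

text \<open>Take a finite convex combination that almost minimizes the sum of the squared positive parts of the constraint
violations. These positive parts serve as multipliers in the dual hypothesis, and mixing in a small portion of
the element that it supplies would decrease the sum if a violation of size \<open>ep\<close> remained. The
bound of all functionals by the one with index \<open>i0\<close> controls the second order term of the mixing.\<close>
lemma finite_minimax:
 fixes \<Phi> :: "'i => 'g => real" and z :: "'i => real"
 assumes I: "finite I" "i0 : I" and ne: "\<Gamma> ~= {}"
  and low: "!!i ga. i : I ==> ga : \<Gamma> ==> - B <= \<Phi> i ga"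
  and up: "!!i ga. i : I ==> ga : \<Gamma> ==> \<Phi> i ga <= B*(1 + \<Phi> i0 ga)"
  and pos0: "!!ga. ga : \<Gamma> ==> 0 <= \<Phi> i0 ga"
  and dual: "!!a e. (!!i. i : I ==> 0 <= a i) ==> 0 < e ==>
   \<exists>ga\<in>\<Gamma>. (\<Sum>i\<in>I. a i*\<Phi> i ga) <= (\<Sum>i\<in>I. a i*z i) + e"
  and eps: "0 < ep"
 obtains S c where "weights \<Gamma> S c" "!!i. i : I ==> (\<Sum>ga\<in>S. c ga*\<Phi> i ga) <= z i + ep"
proof (rule ccontr)
 assume "\<not> thesis"
 hence no: "!!S c. weights \<Gamma> S c ==> \<exists>i\<in>I. (\<Sum>ga\<in>S. c ga*\<Phi> i ga) > z i + ep"
  using that by (meson not_le)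
 define E where "E S c i = (\<Sum>ga\<in>S. c ga*\<Phi> i ga)" for S c i
 define G where "G S c = (\<Sum>i\<in>I. (max 0 (E S c i - z i))\<^sup>2)" for S c
 have Gge: "ep\<^sup>2 <= G S c" if "weights \<Gamma> S c" for S c
 proof -
  have "\<exists>i\<in>I. E S c i > z i + ep" using no[OF that] unfolding E_def .
  then obtain i where i: "i : I" "E S c i > z i + ep" by blast
  have "ep\<^sup>2 <= (max 0 (E S c i - z i))\<^sup>2" using i(2) eps by (intro power_mono) auto
  also have "... <= G S c" unfolding G_def using i(1) I(1) by (intro member_le_sum) auto
  finally show ?thesis .
 qed
 obtain g0 where g0: "g0 : \<Gamma>" using ne by blast
 have B0: "0 <= B" using low[OF I(2) g0] up[OF I(2) g0] pos0[OF g0]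
  by (smt (verit) mult_nonneg_nonneg mult_neg_pos)
 define Gs where "Gs = G {g0} (%x. if x = g0 then 1 else 0)"
 have Gs0: "0 <= Gs" unfolding Gs_def G_def by (intro sum_nonneg) auto
 define A where "A = sqrt (Gs + 1)"
 have A0: "A >= 0" "A\<^sup>2 = Gs + 1" using Gs0 by (auto simp: A_def)
 define ka where "ka = ep\<^sup>2/(4*(\<bar>z i0\<bar> + 1))"
 have kap: "ka > 0" "ka*z i0 <= ep\<^sup>2/4"
 proof -
  show "ka > 0" using eps by (simp add: ka_def)
  have "ka*z i0 <= ka*(\<bar>z i0\<bar> + 1)" using \<open>ka > 0\<close> by (intro mult_left_mono) auto
  also have "... = ep\<^sup>2/4" by (simp add: ka_def field_simps)
  finally show "ka*z i0 <= ep\<^sup>2/4" .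
 qed
 define n where "n = real (card I)"
 define Z where "Z = (\<Sum>i\<in>I. \<bar>z i\<bar>)"
 define M where "M = max (\<Phi> i0 g0) ((A*Z + A*B*n + ep\<^sup>2/2)/ka)"
 define \<Gamma>M where "\<Gamma>M = {ga\<in>\<Gamma>. \<Phi> i0 ga <= M}"
 have g0M: "g0 : \<Gamma>M" using g0 by (simp add: \<Gamma>M_def M_def)
 have wM: "weights \<Gamma> S c" if "weights \<Gamma>M S c" for S c using that by (auto simp: weights_def \<Gamma>M_def)
 have w0: "weights \<Gamma>M {g0} (%x. if x = g0 then 1 else 0)" using g0M by (auto simp: weights_def)
 define R where "R = B*(1 + M)"
 have M0: "M >= 0" using pos0[OF g0] by (simp add: M_def)
 have RB: "B <= R" using B0 M0 by (simp add: R_def algebra_simps)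
 have bnd: "\<bar>\<Phi> i ga\<bar> <= R" if "i : I" "ga : \<Gamma>M" for i ga
 proof -
  have "ga : \<Gamma>" "\<Phi> i0 ga <= M" using that by (auto simp: \<Gamma>M_def)
  have "\<Phi> i ga <= B*(1 + \<Phi> i0 ga)" using up that \<open>ga : \<Gamma>\<close> by blast
  also have "... <= R" unfolding R_def using B0 \<open>\<Phi> i0 ga <= M\<close> by (intro mult_left_mono) auto
  finally show ?thesis using low[OF that(1) \<open>ga : \<Gamma>\<close>] RB by auto
 qed
 have Ebnd: "\<bar>E S c i\<bar> <= R" if "weights \<Gamma>M S c" "i : I" for S c i
 proof -
  have "\<bar>E S c i\<bar> <= (\<Sum>ga\<in>S. c ga*R)" unfolding E_def
  proof (intro order_trans[OF sum_abs] sum_mono)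
   fix ga assume "ga : S"
   hence "ga : \<Gamma>M" "c ga >= 0" using that(1) by (auto simp: weights_def)
   thus "\<bar>c ga*\<Phi> i ga\<bar> <= c ga*R" using bnd[OF that(2)] by (simp add: abs_mult mult_left_mono)
  qed
  also have "... = R" using that(1) by (simp add: weights_def sum_distrib_right[symmetric])
  finally show ?thesis .
 qed
 define D where "D = n*(2*R)\<^sup>2 + 1"
 have D0: "D >= 1" by (simp add: D_def n_def)
 define ta where "ta = min 1 (ep\<^sup>2/(2*D))"
 have tau: "0 < ta" "ta <= 1" "ta*D <= ep\<^sup>2/2"
 proof -
  show "0 < ta" "ta <= 1" using eps D0 by (auto simp: ta_def)
  have "ta*D <= ep\<^sup>2/(2*D)*D" using D0 by (intro mult_right_mono) (auto simp: ta_def)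
  thus "ta*D <= ep\<^sup>2/2" using D0 by (simp add: field_simps)
 qed
 define gM where "gM = Inf {G S c |S c. weights \<Gamma>M S c}"
 have bdd: "bdd_below {G S c |S c. weights \<Gamma>M S c}"
  using Gge wM by (intro bdd_belowI[of _ "ep\<^sup>2"]) auto
 have gM_le: "gM <= G S c" if "weights \<Gamma>M S c" for S c
  unfolding gM_def using that by (intro cInf_lower[OF _ bdd]) blast
 define th where "th = min 1 (ta*ep\<^sup>2/2)"
 have th: "0 < th" using tau eps by (simp add: th_def)
 have "\<exists>x\<in>{G S c |S c. weights \<Gamma>M S c}. x < gM + th"
  using cInf_lessD[of "{G S c |S c. weights \<Gamma>M S c}" "gM + th"] w0 th unfolding gM_def by auto
 then obtain S c where Sc: "weights \<Gamma>M S c" "G S c < gM + th" by auto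
 define a where "a i = max 0 (E S c i - z i)" for i
 have a0: "a i >= 0" for i by (simp add: a_def)
 have aA: "a i <= A" if "i : I" for i
 proof -
  have "(a i)\<^sup>2 <= G S c" unfolding G_def a_def using that I(1) by (intro member_le_sum) auto
  also have "... <= A\<^sup>2" using Sc(2) gM_le[OF w0] A0 by (simp add: Gs_def th_def)
  finally show ?thesis by (rule power2_le_imp_le[OF _ A0(1)])
 qed
 have key: "(\<Sum>i\<in>I. a i*\<Phi> i ga) >= (\<Sum>i\<in>I. a i*z i) + ep\<^sup>2/2" if ga: "ga : \<Gamma>M" for ga
 proof -
  obtain c' where c': "weights \<Gamma>M (insert ga S) c'"
   "!!\<Psi>::_ => real. (\<Sum>x\<in>insert ga S. c' x*\<Psi> x) = (1 - ta)*(\<Sum>x\<in>S. c x*\<Psi> x) + ta*\<Psi> ga"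
   using weights_mix[OF Sc(1) ga, of ta] tau by auto
  have E': "E (insert ga S) c' i - E S c i = ta*(\<Phi> i ga - E S c i)" for i
   unfolding E_def c'(2) by (simp add: algebra_simps)
  have "gM <= G (insert ga S) c'" by (rule gM_le[OF c'(1)])
  also have "... <= (\<Sum>i\<in>I. (a i)\<^sup>2 + 2*ta*(a i*(\<Phi> i ga - E S c i)) + ta\<^sup>2*(2*R)\<^sup>2)"
   unfolding G_def
  proof (rule sum_mono)
   fix i assume i: "i : I"
   have "(max 0 (E (insert ga S) c' i - z i))\<^sup>2 <= (a i)\<^sup>2 + 2*a i*(E (insert ga S) c' i - E S c i) + (E (insert ga S) c' i - E S c i)\<^sup>2"
   using pos_part_sq_le[of "E (insert ga S) c' i - z i" "E S c i - z i"] by (simp add: a_def)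
   also have "... = (a i)\<^sup>2 + 2*ta*(a i*(\<Phi> i ga - E S c i)) + ta\<^sup>2*(\<Phi> i ga - E S c i)\<^sup>2"
   unfolding E' by (simp add: power_mult_distrib)
   also have "(\<Phi> i ga - E S c i)\<^sup>2 <= (2*R)\<^sup>2"
   using bnd[OF i ga] Ebnd[OF Sc(1) i] by (intro abs_le_square_iff[THEN iffD1]) linarith
   finally show "(max 0 (E (insert ga S) c' i - z i))\<^sup>2 <= (a i)\<^sup>2 + 2*ta*(a i*(\<Phi> i ga - E S c i)) + ta\<^sup>2*(2*R)\<^sup>2"
   by (simp add: mult_left_mono)
  qed
  also have "... = G S c + 2*ta*(\<Sum>i\<in>I. a i*(\<Phi> i ga - E S c i)) + ta\<^sup>2*(n*(2*R)\<^sup>2)"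
   by (simp add: sum.distrib sum_distrib_left G_def a_def n_def)
  also have "... <= G S c + 2*ta*(\<Sum>i\<in>I. a i*(\<Phi> i ga - E S c i)) + ta\<^sup>2*D"
   using D0 by (simp add: D_def mult_left_mono)
  finally have "- th <= 2*ta*(\<Sum>i\<in>I. a i*(\<Phi> i ga - E S c i)) + ta\<^sup>2*D" using Sc(2) by linarith
  moreover have "ta\<^sup>2*D <= ta*(ep\<^sup>2/2)"
   using mult_left_mono[OF tau(3), of ta] tau(1) by (simp add: power2_eq_square mult.assoc)
  moreover have "th <= ta*(ep\<^sup>2/2)" by (simp add: th_def)
  ultimately have "0 <= 2*ta*((\<Sum>i\<in>I. a i*(\<Phi> i ga - E S c i)) + ep\<^sup>2/2)" by (simp add: algebra_simps)
  hence 1: "(\<Sum>i\<in>I. a i*(\<Phi> i ga - E S c i)) >= - (ep\<^sup>2/2)" using tau(1) by (simp add: zero_le_mult_iff)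
  have "a i*(E S c i - z i) = (a i)\<^sup>2" for i by (auto simp: a_def max_def power2_eq_square)
  hence "(\<Sum>i\<in>I. a i*(E S c i - z i)) = G S c" by (simp add: G_def a_def)
  hence 2: "(\<Sum>i\<in>I. a i*(E S c i - z i)) >= ep\<^sup>2" using Gge[OF wM[OF Sc(1)]] by simp
  have "(\<Sum>i\<in>I. a i*\<Phi> i ga) - (\<Sum>i\<in>I. a i*z i) =
   (\<Sum>i\<in>I. a i*(\<Phi> i ga - E S c i)) + (\<Sum>i\<in>I. a i*(E S c i - z i))"
   unfolding sum_subtractf[symmetric] sum.distrib[symmetric] by (intro sum.cong) (auto simp: algebra_simps)
  thus ?thesis using 1 2 by linarith
 qed
 define a' where "a' i = a i + (if i = i0 then ka else 0)" for i
 have a'sum: "(\<Sum>i\<in>I. a' i*y i) = (\<Sum>i\<in>I. a i*y i) + ka*y i0" for y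
 proof -
  have "(\<Sum>i\<in>I. a' i*y i) = (\<Sum>i\<in>I. a i*y i) + (\<Sum>i\<in>I. if i = i0 then ka*y i else 0)"
   unfolding sum.distrib[symmetric] by (intro sum.cong) (auto simp: a'_def algebra_simps)
  thus ?thesis using I by simp
 qed
 have aZ: "(\<Sum>i\<in>I. a i*z i) <= A*Z"
  unfolding Z_def sum_distrib_left
 proof (rule sum_mono)
  fix i assume "i : I"
  have "a i*z i <= a i*\<bar>z i\<bar>" using a0 by (intro mult_left_mono) auto
  also have "... <= A*\<bar>z i\<bar>" using aA[OF \<open>i : I\<close>] by (intro mult_right_mono) auto
  finally show "a i*z i <= A*\<bar>z i\<bar>" .
 qed
 have all: "(\<Sum>i\<in>I. a' i*\<Phi> i ga) >= (\<Sum>i\<in>I. a i*z i) + ep\<^sup>2/2" if ga: "ga : \<Gamma>" for ga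
 proof (cases "\<Phi> i0 ga <= M")
  case True
  hence "ga : \<Gamma>M" using ga by (simp add: \<Gamma>M_def)
  moreover have "0 <= ka*\<Phi> i0 ga" using kap pos0[OF ga] by simp
  ultimately show ?thesis using key[of ga] unfolding a'sum by linarith
 next
  case False
  have "ka*\<Phi> i0 ga >= ka*M" using False kap by (intro mult_left_mono) auto
  also have "ka*M >= ka*((A*Z + A*B*n + ep\<^sup>2/2)/ka)"
   using kap by (intro mult_left_mono) (auto simp: M_def)
  also have "ka*((A*Z + A*B*n + ep\<^sup>2/2)/ka) = A*Z + A*B*n + ep\<^sup>2/2" using kap by simp
  finally have 1: "ka*\<Phi> i0 ga >= A*Z + A*B*n + ep\<^sup>2/2" .
  have "(\<Sum>i\<in>I. a i*\<Phi> i ga) >= (\<Sum>i\<in>I. - (A*B))"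
  proof (rule sum_mono)
   fix i assume i: "i : I"
   have "- (A*B) <= - (a i*B)" using aA[OF i] B0 by (simp add: mult_right_mono)
   also have "... = a i*(- B)" by simp
   also have "... <= a i*\<Phi> i ga" using low[OF i ga] a0 by (intro mult_left_mono) auto
   finally show "- (A*B) <= a i*\<Phi> i ga" .
  qed
  thus ?thesis using 1 aZ unfolding a'sum by (simp add: n_def algebra_simps)
 qed
 have "\<exists>ga\<in>\<Gamma>. (\<Sum>i\<in>I. a' i*\<Phi> i ga) <= (\<Sum>i\<in>I. a' i*z i) + ep\<^sup>2/8"
  using dual[of a' "ep\<^sup>2/8"] a0 kap eps by (simp add: a'_def)
 then obtain ga where ga: "ga : \<Gamma>" "(\<Sum>i\<in>I. a' i*\<Phi> i ga) <= (\<Sum>i\<in>I. a' i*z i) + ep\<^sup>2/8" by blast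
 have "0 < ep\<^sup>2" using eps by simp
 thus False using all[OF ga(1)] kap(2) ga(2) unfolding a'sum by linarith
qed

section \<open>Indefinite integrals and monotone absolutely continuous functions\<close>

definition ind_int :: "(real => 'b::euclidean_space) => (real => 'b) => bool" where
 "ind_int F v \<longleftrightarrow> v absolutely_integrable_on {0..1} &
  (\<forall>s t. 0 <= s --> s <= t --> t <= 1 --> (v has_integral (F t - F s)) {s..t})"

lemma ind_int_deriv_aux:
 fixes f :: "real => 'b::euclidean_space"
 assumes "f integrable_on UNIV"
 obtains N where "negligible N" "!!x e. x ~: N ==> 0 < e ==> \<exists>d>0. \<forall>h. 0 < h & h < d -->
  norm (integral {x..x + h} f - h *\<^sub>R f x) <= e*h & norm (integral {x - h..x} f - h *\<^sub>R f x) <= e*h"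
proof -
 have fi: "f integrable_on cbox a b" for a b using assms integrable_on_subcbox by blast
 have gi: "(%x. f (- x)) integrable_on cbox a b" for a b
  using fi[of "-b" "-a"] Henstock_Kurzweil_Integration.integrable_reflect_real[where f = f and a = "-b" and b = "-a"] by (simp add: cbox_interval)
 obtain N1 where N1: "negligible N1" "!!x e. [|x ~: N1; 0 < e|] ==>
   \<exists>d>0. \<forall>h. 0 < h & h < d --> norm(integral (cbox x (x + h *\<^sub>R One)) f /\<^sub>R h^DIM(real) - f x) < e"
  by (rule integrable_ccontinuous_explicit[of f, OF fi], blast)
 obtain N2 where N2: "negligible N2" "!!x e. [|x ~: N2; 0 < e|] ==>
   \<exists>d>0. \<forall>h. 0 < h & h < d --> norm(integral (cbox x (x + h *\<^sub>R One)) (%x. f (- x)) /\<^sub>R h^DIM(real) - f (- x)) < e"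
  by (rule integrable_ccontinuous_explicit[of "%x. f (- x)", OF gi], blast)
 have scale: "norm (I - h *\<^sub>R y) <= e*h" if "norm (I /\<^sub>R h - y) < e" "h > 0" for I y :: 'b and h e :: real
 proof -
  have "I - h *\<^sub>R y = h *\<^sub>R (I /\<^sub>R h - y)" using that(2) by (simp add: scaleR_diff_right)
  hence "norm (I - h *\<^sub>R y) = h*norm (I /\<^sub>R h - y)" using that(2) by simp
  also have "... <= h*e" using that by (intro mult_left_mono) auto
  finally show ?thesis by (simp add: mult.commute)
 qed
 show ?thesis
 proof (rule that[of "N1 \<union> uminus ` N2"])
  have "negligible (uminus ` N2)"
   using N2(1) by (intro negligible_differentiable_image_negligible) (auto simp: differentiable_on_def)
  thus "negligible (N1 \<union> uminus ` N2)" using N1 by simp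
  fix x e :: real assume x: "x ~: N1 \<union> uminus ` N2" "0 < e"
  hence "-x ~: N2" by force
  obtain d1 where d1: "d1 > 0" "!!h. 0 < h ==> h < d1 ==> norm(integral {x..x + h} f /\<^sub>R h - f x) < e"
   using N1(2)[of x e] x by (auto simp: cbox_interval)
  obtain d2 where d2: "d2 > 0" "!!h. 0 < h ==> h < d2 ==> norm(integral {-x..-x + h} (%x. f (- x)) /\<^sub>R h - f x) < e"
   using N2(2)[of "-x" e] \<open>-x ~: N2\<close> x by (auto simp: cbox_interval)
  show "\<exists>d>0. \<forall>h. 0 < h & h < d -->
  norm (integral {x..x + h} f - h *\<^sub>R f x) <= e*h & norm (integral {x - h..x} f - h *\<^sub>R f x) <= e*h"
  proof (intro exI[of _ "min d1 d2"] conjI allI impI)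
   fix h assume h: "0 < h & h < min d1 d2"
   show "norm (integral {x..x + h} f - h *\<^sub>R f x) <= e*h" using d1(2)[of h] h scale by auto
   have "integral {-x..-x + h} (%x. f (- x)) = integral {x - h..x} f"
   using Henstock_Kurzweil_Integration.integral_reflect_real[where a = "x - h" and b = x and f = f] by simp
   thus "norm (integral {x - h..x} f - h *\<^sub>R f x) <= e*h" using d2(2)[of h] h scale by auto
  qed (use d1 d2 in auto)
 qed
qed

text \<open>Lebesgue differentiation on the unit interval; it identifies the density of an absolutely continuous lift with
its velocity.\<close>
lemma ind_int_deriv:
 fixes F :: "real => 'b::euclidean_space"
 assumes "ind_int F v"
 obtains N where "negligible N" "!!t. t : {0..1} - N ==> (F has_vector_derivative v t) (at t within {0..1})"
proof -
 define f where "f t = (if t : {0..1} then v t else 0)" for t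
 have "v integrable_on {0..1}" using assms unfolding ind_int_def using set_lebesgue_integral_eq_integral(1) by blast
 hence "f integrable_on UNIV" unfolding f_def by (simp only: Henstock_Kurzweil_Integration.integrable_restrict_UNIV)
 then obtain N where N: "negligible N" "!!x e. x ~: N ==> 0 < e ==> \<exists>d>0. \<forall>h. 0 < h & h < d -->
  norm (integral {x..x + h} f - h *\<^sub>R f x) <= e*h & norm (integral {x - h..x} f - h *\<^sub>R f x) <= e*h"
  by (rule ind_int_deriv_aux, blast)
 have Fi: "F t - F s = integral {s..t} f" if "0 <= s" "s <= t" "t <= 1" for s t
 proof -
  have "F t - F s = integral {s..t} v" using assms that unfolding ind_int_def by (intro integral_unique[symmetric]) blast
  also have "... = integral {s..t} f" using that by (intro integral_cong) (auto simp: f_def)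
  finally show ?thesis .
 qed
 show ?thesis
 proof (rule that[OF N(1)])
  fix x assume x: "x : {0..1} - N"
  show "(F has_vector_derivative v x) (at x within {0..1})"
   unfolding has_vector_derivative_def has_derivative_within_alt
  proof (intro conjI allI impI)
   show "bounded_linear (%y. y *\<^sub>R v x)" by (rule bounded_linear_scaleR_left)
   fix e :: real assume "0 < e"
   then obtain d where d: "d > 0" "!!h. 0 < h ==> h < d ==> norm (integral {x..x + h} f - h *\<^sub>R f x) <= e*h"
   "!!h. 0 < h ==> h < d ==> norm (integral {x - h..x} f - h *\<^sub>R f x) <= e*h" using N(2)[of x e] x by auto
   have fx: "f x = v x" using x by (simp add: f_def)
   have "norm (F y - F x - (y - x) *\<^sub>R v x) <= e*norm (y - x)" if y: "y : {0..1}" "norm (y - x) < d" for y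
   proof (cases y x rule: linorder_cases)
   case equal thus ?thesis by simp
   next
   case greater
   have "F y - F x = integral {x..x + (y - x)} f" using Fi[of x y] x y greater by simp
   thus ?thesis using d(2)[of "y - x"] greater y fx by (simp add: abs_of_pos)
   next
   case less
   have "F x - F y = integral {x - (x - y)..x} f" using Fi[of y x] x y less by simp
   hence "norm (F x - F y - (x - y) *\<^sub>R v x) <= e*(x - y)" using d(3)[of "x - y"] less y fx by simp
   moreover have "F y - F x - (y - x) *\<^sub>R v x = - (F x - F y - (x - y) *\<^sub>R v x)" by (simp add: algebra_simps)
   ultimately show ?thesis using less by (simp only: norm_minus_cancel) (simp add: abs_of_neg)
   qed
   thus "\<exists>d>0. ALL y:{0..1}. norm (y - x) < d --> norm (F y - F x - (y - x) *\<^sub>R v x) <= e*norm (y - x)"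
   using d(1) by blast
  qed
 qed
qed

text \<open>Absolute continuity tested on families of dyadic intervals only: this is what bounds on dyadic energies
provide directly.\<close>
definition dyadic_ac :: "(real => real) => bool" where
 "dyadic_ac F \<longleftrightarrow> (\<forall>ep>0. \<exists>de>0. \<forall>k I. I <= {..<(2::nat)^k} & real (card I)/2^k < de -->
  (\<Sum>i\<in>I. F (real (Suc i)/2^k) - F (real i/2^k)) <= ep)"

lemma mono_dyadic_ac_continuous:
 assumes m: "mono_on {0..1} F" and "dyadic_ac F"
 shows "continuous_on {0..1} F"
proof -
 have *: "\<exists>d>0. \<forall>s t. 0 <= s & s <= t & t <= 1 & t - s < d --> F t - F s <= e" if "e > 0" for e
 proof -
  obtain de where de: "de > 0" "!!k I. I <= {..<(2::nat)^k} ==> real (card I)/2^k < de ==>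
  (\<Sum>i\<in>I. F (real (Suc i)/2^k) - F (real i/2^k)) <= e"
   using assms(2) \<open>e > 0\<close> unfolding dyadic_ac_def by meson
  obtain k where k: "(1/2) ^ k < de/2" using real_arch_pow_inv[of "de/2" "1/2"] de(1) by auto
  have "F t - F s <= e" if st: "0 <= s" "s <= t" "t <= 1" "t - s < (1/2)^k" for s t
  proof (cases "s < 1")
   case False
   hence "s = t" using st by simp
   thus ?thesis using \<open>e > 0\<close> by simp
  next
   case True
   define i where "i = cell k s"
   have i: "real i <= 2^k * s" "2^k * s < real i + 1" using st(1) unfolding i_def by (auto simp: of_nat_nat)
   have ik: "i < 2^k"
   proof -
   have "2^k * s < 2^k*1" using True by (intro mult_strict_left_mono) auto
   hence "real i < 2^k" using i(1) by linarith
   thus ?thesis by (metis of_nat_less_iff of_nat_numeral of_nat_power)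
   qed
   have si: "real i/2^k <= s" using i(1) by (simp add: field_simps)
   have "2^k*t < 2^k * s + 1" using st(4) by (simp add: power_divide field_simps)
   hence ti: "t <= (real i + 2)/2^k" using i(2) by (simp add: field_simps)
   let ?I = "{i, Suc i} Int {..<2^k}"
   have cI: "card ?I <= 2" using card_mono[of "{i, Suc i}" ?I] by auto
   have "real (card ?I)/2^k < de"
   proof -
   have "real (card ?I)/2^k <= 2*(1/2)^k" using cI by (simp add: power_divide divide_right_mono)
   thus ?thesis using k by simp
   qed
   hence S: "(\<Sum>i\<in>?I. F (real (Suc i)/2^k) - F (real i/2^k)) <= e" by (intro de(2)) auto
   have inI: "real j/2^k : {0..1}" if "j <= 2^k" for j
   proof -
   have "real j <= 2^k" using that by (metis of_nat_le_iff of_nat_numeral of_nat_power)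
   thus ?thesis by simp
   qed
   show ?thesis
   proof (cases "Suc i < 2^k")
   case True
   hence "?I = {i, Suc i}" by auto
   hence "F (real (Suc (Suc i))/2^k) - F (real i/2^k) <= e" using S by simp
   moreover have "F t <= F (real (Suc (Suc i))/2^k)"
   using inI[of "Suc (Suc i)"] True ti st by (intro mono_onD[OF m]) (auto simp: algebra_simps)
   moreover have "F (real i/2^k) <= F s" using inI[of i] ik si st by (intro mono_onD[OF m]) auto
   ultimately show ?thesis by linarith
   next
   case False
   hence eq: "?I = {i}" "Suc i = 2^k" using ik by auto
   hence "F (real (Suc i)/2^k) - F (real i/2^k) <= e" using S by simp
   moreover have "real (Suc i)/2^k = 1" using eq(2) by (metis divide_self_if of_nat_numeral of_nat_power power_not_zero zero_neq_numeral)
   moreover have "F t <= F 1" using st by (intro mono_onD[OF m]) auto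
   moreover have "F (real i/2^k) <= F s" using inI[of i] ik si st by (intro mono_onD[OF m]) auto
   ultimately show ?thesis by simp
   qed
  qed
  thus ?thesis by (intro exI[of _ "(1/2)^k"]) auto
 qed
 show ?thesis
  unfolding continuous_on_iff
 proof (intro ballI allI impI)
  fix x e :: real assume x: "x : {0..1}" "e > 0"
  obtain d where d: "d > 0" "!!s t. 0 <= s ==> s <= t ==> t <= 1 ==> t - s < d ==> F t - F s <= e/2"
   using *[of "e/2"] x(2) by auto
  have "dist (F y) (F x) < e" if "y : {0..1}" "dist y x < d" for y
  proof (cases "y <= x")
   case True
   hence "F y <= F x" using x that by (intro mono_onD[OF m]) auto
   thus ?thesis using d(2)[of y x] True x that by (auto simp: dist_real_def)
  next
   case False
   hence "F x <= F y" using x that by (intro mono_onD[OF m]) auto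
   thus ?thesis using d(2)[of x y] False x that by (auto simp: dist_real_def)
  qed
  thus "\<exists>d>0. ALL x':{0..1}. dist x' x < d --> dist (F x') (F x) < e" using d(1) by blast
 qed
qed

lemma mono_ac_ind_int:
 assumes m: "mono_on {0..1} F" and ac: "dyadic_ac F"
 obtains f where "ind_int F f"
proof -
 have cont: "continuous_on {0..1} F" by (rule mono_dyadic_ac_continuous[OF assms])
 define G where "G t = F (max 0 (min 1 t))" for t
 have GF: "G t = F t" if "t : {0..1}" for t using that by (simp add: G_def)
 have monoG: "G s <= G t" if "s <= t" for s t
  unfolding G_def using that by (intro mono_onD[OF m]) auto
 have "cont G" unfolding G_def
  by (rule continuous_on_compose2[OF cont, of UNIV "%t. max 0 (min 1 t)"])
   (intro continuous_on_max continuous_on_min continuous_on_const continuous_on_id, auto)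
 hence contG: "continuous (at_right a) G" for a
  by (simp add: continuous_on_eq_continuous_at continuous_at_imp_continuous_within)
 define \<mu> where "\<mu> = interval_measure G"
 have mu: "emeasure \<mu> {a<..b} = ennreal (G b - G a)" if "a <= b" for a b
  unfolding \<mu>_def using emeasure_interval_measure_Ioc[OF that monoG contG] .
 have [simp, measurable_cong]: "sets \<mu> = sets borel" by (simp add: \<mu>_def)
 define \<nu> where "\<nu> = density \<mu> (indicator {0<..1})"
 have nu: "emeasure \<nu> A = emeasure \<mu> (A Int {0<..1})" if "A : sets borel" for A
  unfolding \<nu>_def using that by (subst emeasure_density) (auto simp: indicator_inter_arith[symmetric] Int_commute)
 have [simp, measurable_cong]: "sets \<nu> = sets borel" by (simp add: \<nu>_def)
 have open_small: "\<exists>de>0. \<forall>U. open U & emeasure lborel U < ennreal de --> emeasure \<nu> U <= ennreal e" if "e > 0" for e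
 proof -
  obtain de where de: "de > 0" "!!k I. I <= {..<(2::nat)^k} ==> real (card I)/2^k < de ==>
  (\<Sum>i\<in>I. F (real (Suc i)/2^k) - F (real i/2^k)) <= e"
   using ac \<open>e > 0\<close> unfolding dyadic_ac_def by meson
  have "emeasure \<nu> U <= ennreal e" if U: "open U" "emeasure lborel U < ennreal de" for U
  proof -
   define Q where "Q k i = {real i/2^k <.. real (Suc i)/2^k}" for k i :: nat
   define J where "J k = {i. i < 2^k & Q k i <= U}" for k
   define V where "V k = (\<Union>i\<in>J k. Q k i)" for k
   have fin: "finite (J k)" "J k <= {..<2^k}" for k by (auto simp: J_def)
   have disj: "disjoint_family_on (Q k) (J k)" for k
   unfolding disjoint_family_on_def Q_def
   proof (intro ballI impI)
   fix i j :: nat assume "i ~= j"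
   have "x/2^k < y/2^k \<longleftrightarrow> x < y" "x/2^k <= y/2^k \<longleftrightarrow> x <= y" for x y :: real
   by (auto simp: divide_less_cancel divide_le_cancel)
   have "\<not> (x : {real i/2^k<..real (Suc i)/2^k} & x : {real j/2^k<..real (Suc j)/2^k})" for x
   proof
   assume a: "x : {real i/2^k<..real (Suc i)/2^k} & x : {real j/2^k<..real (Suc j)/2^k}"
   hence "real i/2^k < real (Suc j)/2^k" "real j/2^k < real (Suc i)/2^k" by auto
   hence "i < Suc j" "j < Suc i" by (simp_all add: divide_less_cancel)
   thus False using \<open>i ~= j\<close> by simp
   qed
   thus "{real i/2^k<..real (Suc i)/2^k} Int {real j/2^k<..real (Suc j)/2^k} = {}" by blast
   qed
   have meas: "Q k i : sets borel" for k i by (simp add: Q_def)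
   have inc: "V k <= V (Suc k)" for k
   proof
   fix x assume "x : V k"
   then obtain i where i: "i < 2^k" "Q k i <= U" "x : Q k i" by (auto simp: V_def J_def)
   have e1: "real (2*i)/2^Suc k = real i/2^k" "real (Suc (Suc (2*i)))/2^Suc k = real (Suc i)/2^k"
   by (simp_all add: field_simps)
   have le1: "real (2*i)/2^Suc k <= real (Suc (2*i))/2^Suc k" "real (Suc (2*i))/2^Suc k <= real (Suc (Suc (2*i)))/2^Suc k"
   by (intro divide_right_mono; simp)+
   have "Q (Suc k) (2*i) \<union> Q (Suc k) (Suc (2*i)) = Q k i"
   unfolding Q_def e1[symmetric] using le1 by auto
   hence "x : Q (Suc k) (2*i) | x : Q (Suc k) (Suc (2*i))" "Q (Suc k) (2*i) <= U" "Q (Suc k) (Suc (2*i)) <= U"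
   using i by blast+
   moreover have "2*i < 2^Suc k" "Suc (2*i) < 2^Suc k" using i(1) by auto
   ultimately show "x : V (Suc k)" unfolding V_def J_def by blast
   qed
   have un: "U Int {0<..1} = (\<Union>k. V k)"
   proof (intro set_eqI iffI)
   fix x assume x: "x : U Int {0<..1}"
   then obtain r where r: "r > 0" "!!y. dist y x < r ==> y : U" using U(1) unfolding open_dist by blast
   obtain k where k: "(1/2::real) ^ k < r" using real_arch_pow_inv[of r "1/2"] r by auto
   define i where "i = nat (\<lceil>2^k*x\<rceil> - 1)"
   have c1: "\<lceil>2^k*x\<rceil> >= 1" using x by simp
   have i: "real i < 2^k*x" "2^k*x <= real i + 1" unfolding i_def using c1 by (auto simp: of_nat_nat) linarith+
   have "real i < 2^k" using i(1) x by (smt (verit, best) IntD2 greaterThanAtMost_iff mult_left_le zero_less_power)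
   hence ik: "i < 2^k" by (metis of_nat_less_iff of_nat_numeral of_nat_power)
   have xi: "x : Q k i" using i by (auto simp: Q_def field_simps)
   have "Q k i <= U"
   proof
   fix y assume y: "y : Q k i"
   have "real (Suc i)/2^k = real i/2^k + (1/2)^k" by (simp add: field_simps power_divide)
   hence "dist y x < (1/2)^k" using xi y by (auto simp: Q_def dist_real_def)
   thus "y : U" using r(2)[of y] k by simp
   qed
   thus "x : (\<Union>k. V k)" using ik xi by (auto simp: V_def J_def)
   next
   fix x assume "x : (\<Union>k. V k)"
   then obtain k i where i: "i < 2^k" "Q k i <= U" "x : Q k i" by (auto simp: V_def J_def)
   have "real (Suc i)/2^k <= 1"
   proof -
   have "Suc i <= 2^k" using i(1) by simp
   hence "real (Suc i) <= 2^k" by (metis of_nat_le_iff of_nat_numeral of_nat_power)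
   thus ?thesis by simp
   qed
   moreover have "0 <= real i/2^k" by simp
   moreover have "real i/2^k < x" "x <= real (Suc i)/2^k" using i(3) by (auto simp: Q_def)
   ultimately have "0 < x" "x <= 1" by linarith+
   thus "x : U Int {0<..1}" using i by auto
   qed
   have mV: "emeasure \<mu> (V k) <= ennreal e" for k
   proof -
   have "emeasure lborel (V k) = (\<Sum>i\<in>J k. emeasure lborel (Q k i))"
   unfolding V_def using fin(1) disj meas by (intro sum_emeasure[symmetric]) auto
   also have "... = (\<Sum>i\<in>J k. ennreal (1/2^k))"
   by (intro sum.cong refl) (simp add: Q_def divide_right_mono diff_divide_distrib[symmetric])
   also have "... = ennreal (real (card (J k))/2^k)"
   by (subst sum_ennreal) auto
   finally have "ennreal (real (card (J k))/2^k) = emeasure lborel (V k)" by simp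
   also have "... <= emeasure lborel U"
   using U(1) by (intro emeasure_mono) (auto simp: V_def J_def)
   also note U(2)
   finally have c: "real (card (J k))/2^k < de" using de(1) by (simp add: ennreal_less_iff)
   have "emeasure \<mu> (V k) = (\<Sum>i\<in>J k. emeasure \<mu> (Q k i))"
   unfolding V_def using fin(1) disj meas by (intro sum_emeasure[symmetric]) auto
   also have "... = (\<Sum>i\<in>J k. ennreal (F (real (Suc i)/2^k) - F (real i/2^k)))"
   proof (intro sum.cong refl)
   fix i assume "i : J k"
   hence "Suc i <= 2^k" by (auto simp: J_def)
   hence 1: "real (Suc i) <= 2^k" by (metis of_nat_le_iff of_nat_numeral of_nat_power)
   have 2: "real (Suc i)/2^k : {0..1}" "real i/2^k : {0..1}" using 1 \<open>Suc i <= 2^k\<close> by (auto simp: divide_le_eq_1)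
   have "emeasure \<mu> (Q k i) = ennreal (G (real (Suc i)/2^k) - G (real i/2^k))"
   unfolding Q_def by (intro mu divide_right_mono) auto
   also have "G (real (Suc i)/2^k) = F (real (Suc i)/2^k)" using 2(1) by (rule GF)
   also have "G (real i/2^k) = F (real i/2^k)" using 2(2) by (rule GF)
   finally show "emeasure \<mu> (Q k i) = ennreal (F (real (Suc i)/2^k) - F (real i/2^k))" .
   qed
   also have "... = ennreal (\<Sum>i\<in>J k. F (real (Suc i)/2^k) - F (real i/2^k))"
   proof (intro sum_ennreal)
   fix i assume "i : J k"
   hence "Suc i <= 2^k" by (auto simp: J_def)
   hence 1: "real (Suc i) <= 2^k" by (metis of_nat_le_iff of_nat_numeral of_nat_power)
   have "F (real i/2^k) <= F (real (Suc i)/2^k)"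
   using 1 \<open>Suc i <= 2^k\<close> by (intro mono_onD[OF m]) (auto simp: divide_le_eq_1 divide_right_mono)
   thus "0 <= F (real (Suc i)/2^k) - F (real i/2^k)" by simp
   qed
   also have "... <= ennreal e" using de(2)[OF fin(2) c] by (intro ennreal_leI)
   finally show ?thesis .
   qed
   have "emeasure \<nu> U = emeasure \<mu> (\<Union>k. V k)" using U(1) by (simp add: nu un)
   also have "... = (SUP k. emeasure \<mu> (V k))"
   using inc fin(1) meas by (intro SUP_emeasure_incseq[symmetric]) (auto intro!: incseq_SucI sets.finite_UN simp: V_def image_subset_iff)
   also have "... <= ennreal e" using mV by (intro SUP_least)
   finally show ?thesis .
  qed
  thus ?thesis using de(1) by blast
 qed
 have acn: "absolutely_continuous lborel \<nu>"
  unfolding absolutely_continuous_def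
 proof
  fix N :: "real set" assume N: "N : null_sets lborel"
  hence Nb: "N : sets borel" "emeasure lborel N = 0" by (auto simp: null_sets_def)
  have "emeasure \<nu> N <= 0 + ennreal e" if "e > 0" for e
  proof -
   obtain de where de: "de > 0" "!!U. open U ==> emeasure lborel U < ennreal de ==> emeasure \<nu> U <= ennreal e"
   using open_small[OF \<open>e > 0\<close>] by blast
   obtain U where U: "open U" "N <= U" "emeasure lborel (U - N) < ennreal de"
   using outer_regular_lborel[OF Nb(1) de(1)] by blast
   have "emeasure lborel U <= emeasure lborel (U - N) + emeasure lborel N"
   using U(1,2) Nb by (subst plus_emeasure) (auto simp: Un_absorb2)
   hence "emeasure lborel U < ennreal de" using U(3) Nb(2) by simp
   hence "emeasure \<nu> U <= ennreal e" using de(2) U(1) by blast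
   moreover have "emeasure \<nu> N <= emeasure \<nu> U" using U by (intro emeasure_mono) auto
   ultimately show ?thesis by simp
  qed
  hence "emeasure \<nu> N <= 0" by (rule ennreal_le_epsilon)
  hence "emeasure \<nu> N = 0" by (rule le_zero_eq[THEN iffD1])
  thus "N : null_sets \<nu>" using Nb(1) by (intro null_setsI) simp_all
 qed
 let ?g = "RN_deriv lborel \<nu>"
 have dg: "density lborel ?g = \<nu>" by (rule sigma_finite_measure.density_RN_deriv[OF lborel.sigma_finite_measure_axioms acn]) (simp only: \<open>sets \<nu> = sets borel\<close> sets_lborel)
 have tot: "emeasure \<nu> UNIV = ennreal (F 1 - F 0)"
  unfolding nu[OF sets.top[of borel, unfolded space_borel]] using mu[of 0 1] GF[of 0] GF[of 1] by simp
 have nn: "(nn_integral lborel (%x. ?g x*indicator A x)) = emeasure \<nu> A" if "A : sets borel" for A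
  using arg_cong[OF dg, of "%M. emeasure M A"] emeasure_density[of ?g lborel A] that by simp
 have fin: "AE x in lborel. ?g x ~= \<infinity>"
 proof (rule nn_integral_PInf_AE)
  show "(nn_integral lborel (%x. ?g x)) ~= \<infinity>" using nn[of UNIV] tot by simp
 qed simp
 define f where "f x = enn2real (?g x)" for x
 have fm [measurable]: "f : bm borel" unfolding f_def by measurable
 have fg: "AE x in lborel. ennreal (f x) = ?g x" using fin by eventually_elim (auto simp: f_def top.not_eq_extremum ennreal_enn2real)
 have f0: "f x >= 0" for x by (simp add: f_def)
 have nf: "(nn_integral lborel (%x. ennreal (f x)*indicator A x)) = emeasure \<nu> A" if "A : sets borel" for A
  unfolding nn[OF that, symmetric] using fg by (intro nn_integral_cong_AE) (auto elim!: eventually_mono)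
 have "(nn_integral lborel (%x. ennreal (f x))) = ennreal (F 1 - F 0)" using nf[of UNIV] tot by simp
 hence fint: "integrable lborel f" using f0 by (intro integrableI_bounded) auto
 have hi: "(f has_integral (F t - F s)) {s..t}" if st: "0 <= s" "s <= t" "t <= 1" for s t
 proof -
  have Fle: "F s <= F t" using st by (intro mono_onD[OF m]) auto
  have "{s<..t} Int {0<..1} = {s<..t}" using st by auto
  hence "emeasure \<nu> {s<..t} = ennreal (F t - F s)" using mu[OF st(2)] GF[of s] GF[of t] st by (simp add: nu)
  hence "(nn_integral lborel (%x. ennreal (f x)*indicator {s<..t} x)) = ennreal (F t - F s)" using nf[of "{s<..t}"] by simp
  hence "(nn_integral lborel (%x. ennreal (f x*indicator {s<..t} x))) = ennreal (F t - F s)"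
   by (subst (asm) nn_integral_cong[where v = "%x. ennreal (f x*indicator {s<..t} x)"]) (auto simp: indicator_def)
  hence "((%x. f x*indicator {s<..t} x) has_integral (F t - F s)) UNIV"
  proof -
   assume nnI: "(nn_integral lborel (%x. ennreal (f x*indicator {s<..t} x))) = ennreal (F t - F s)"
   have int: "integrable lborel (%x. f x*indicator {s<..t} x)"
   using fint by (intro integrable_real_mult_indicator) auto
   have "integral\<^sup>L lborel (%x. f x*indicator {s<..t} x) = F t - F s"
   using nnI Fle f0 by (subst integral_eq_nn_integral) auto
   thus ?thesis using has_integral_integral_lborel[OF int] by simp
  qed
  hence "((%x. if x : {s<..t} then f x else 0) has_integral (F t - F s)) UNIV"
   by (rule has_integral_eq[rotated]) (auto simp: indicator_def)
  hence "(f has_integral (F t - F s)) {s<..t}" by (simp only: has_integral_restrict_UNIV)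
  moreover have "negligible {x : {s<..t} - {s..t}. f x ~= 0}" "negligible {x : {s..t} - {s<..t}. f x ~= 0}"
   by (rule negligible_subset[of "{s}"]; auto)+
  ultimately show ?thesis using has_integral_spike_set_eq by blast
 qed
 have "f absolutely_integrable_on {0..1}"
  using hi[of 0 1] f0 by (intro nonnegative_absolutely_integrable_1) (auto simp: integrable_on_def)
 thus ?thesis using that hi unfolding ind_int_def by blast
qed

section \<open>Absolutely continuous curves in the torus\<close>

lemma ind_int_unique_spike:
 assumes "ind_int F v" "negligible N" "!!t. t : {0..1} - N ==> w t = v t"
 shows "ind_int F w"
 unfolding ind_int_def
proof (intro conjI allI impI)
 show "w absolutely_integrable_on {0..1}"
  by (rule absolutely_integrable_spike[OF _ assms(2)]) (use assms(1,3) in \<open>auto simp: ind_int_def\<close>)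
 fix s t :: real assume "0 <= s" "s <= t" "t <= 1"
 moreover have "(v has_integral (F t - F s)) {s..t}" using assms(1) calculation unfolding ind_int_def by blast
 ultimately show "(w has_integral (F t - F s)) {s..t}"
  by (intro has_integral_spike[OF assms(2), of "{s..t}" w v]) (use assms(3) in auto)
qed

lemma dominated_ind_int_real:
 fixes G V :: "real => real"
 assumes m: "mono_on {0..1} V" and ac: "dyadic_ac V"
  and dom: "!!s t. 0 <= s ==> s <= t ==> t <= 1 ==> \<bar>G t - G s\<bar> <= V t - V s"
 obtains v where "ind_int G v"
proof -
 let ?F = "%t. G t + V t"
 have 1: "mono_on {0..1} ?F"
 proof (intro mono_onI)
  fix s t :: real assume "s : {0..1}" "t : {0..1}" "s <= t"
  thus "?F s <= ?F t" using dom[of s t] by auto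
 qed
 have 2: "dyadic_ac ?F"
  unfolding dyadic_ac_def
 proof (intro allI impI)
  fix ep :: real assume "ep > 0"
  then obtain de where de: "de > 0" "!!k I. I <= {..<(2::nat)^k} ==> real (card I)/2^k < de ==>
  (\<Sum>i\<in>I. V (real (Suc i)/2^k) - V (real i/2^k)) <= ep/2"
   using ac half_gt_zero unfolding dyadic_ac_def by meson
  have "(\<Sum>i\<in>I. ?F (real (Suc i)/2^k) - ?F (real i/2^k)) <= ep"
   if I: "I <= {..<(2::nat)^k}" "real (card I)/2^k < de" for k I
  proof -
   have "(\<Sum>i\<in>I. ?F (real (Suc i)/2^k) - ?F (real i/2^k)) <= (\<Sum>i\<in>I. 2*(V (real (Suc i)/2^k) - V (real i/2^k)))"
   proof (intro sum_mono)
   fix i assume "i : I"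
   hence "Suc i <= 2^k" using I(1) by auto
   hence "real (Suc i) <= real (2^k)" by (simp only: of_nat_le_iff)
   hence "real (Suc i)/2^k <= 1" by (simp add: divide_le_eq_1)
   thus "?F (real (Suc i)/2^k) - ?F (real i/2^k) <= 2*(V (real (Suc i)/2^k) - V (real i/2^k))"
   using dom[of "real i/2^k" "real (Suc i)/2^k"] by (simp add: divide_right_mono)
   qed
   also have "... <= ep" using de(2)[OF I] unfolding sum_distrib_left[symmetric] by linarith
   finally show ?thesis .
  qed
  thus "\<exists>de>0. \<forall>k I. I <= {..<(2::nat)^k} & real (card I)/2^k < de -->
  (\<Sum>i\<in>I. ?F (real (Suc i)/2^k) - ?F (real i/2^k)) <= ep" using de(1) by blast
 qed
 obtain f where f: "ind_int ?F f" using mono_ac_ind_int[OF 1 2] .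
 obtain h where h: "ind_int V h" using mono_ac_ind_int[OF m ac] .
 have "ind_int G (%t. f t - h t)"
  unfolding ind_int_def
 proof (intro conjI allI impI)
  show "(%t. f t - h t) absolutely_integrable_on {0..1}"
   using f h unfolding ind_int_def by (intro set_integral_diff(1)) auto
  fix s t :: real assume st: "0 <= s" "s <= t" "t <= 1"
  have "(f has_integral (?F t - ?F s)) {s..t}" "(h has_integral (V t - V s)) {s..t}"
   using f h st unfolding ind_int_def by blast+
  from has_integral_diff[OF this] show "((%t. f t - h t) has_integral (G t - G s)) {s..t}" by (simp add: algebra_simps)
 qed
 thus ?thesis by (rule that)
qed

lemma dominated_ind_int:
 fixes G :: "real => real ^ 'n::finite"
 assumes m: "mono_on {0..1} V" and ac: "dyadic_ac V"
  and dom: "!!s t. 0 <= s ==> s <= t ==> t <= 1 ==> dist (G s) (G t) <= V t - V s"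
 obtains v where "ind_int G v"
proof -
 have "\<exists>v. ind_int (%t. G t $ i) v" for i
 proof -
  have "\<bar>G t $ i - G s $ i\<bar> <= V t - V s" if "0 <= s" "s <= t" "t <= 1" for s t
   using dom[OF that] dist_vec_nth_le[of "G s" i "G t"] by (simp add: dist_real_def abs_minus_commute)
  from dominated_ind_int_real[OF m ac this] show ?thesis by blast
 qed
 then obtain v where v: "!!i. ind_int (%t. G t $ i) (v i)" by metis
 have "ind_int G (%t. \<chi> i. v i t)"
  unfolding ind_int_def
 proof (intro conjI allI impI)
  show "(%t. \<chi> i. v i t) absolutely_integrable_on {0..1}"
  proof (rule absolutely_integrable_componentwise)
   fix b :: "real ^ 'n" assume "b : Basis"
   then obtain i where b: "b = axis i 1" by (auto simp: Basis_vec_def)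
   show "(%t. (\<chi> i. v i t) \<bullet> b) absolutely_integrable_on {0..1}"
   using v[of i] unfolding ind_int_def b by (simp add: inner_axis)
  qed
  fix s t :: real assume st: "0 <= s" "s <= t" "t <= 1"
  show "((%t. \<chi> i. v i t) has_integral (G t - G s)) {s..t}"
   unfolding has_integral_componentwise_iff[of "%t. \<chi> i. v i t"]
  proof
   fix b :: "real ^ 'n" assume "b : Basis"
   then obtain i where b: "b = axis i 1" by (auto simp: Basis_vec_def)
   have "(v i has_integral G t $ i - G s $ i) {s..t}" using v[of i] st unfolding ind_int_def by blast
   thus "((%t. (\<chi> i. v i t) \<bullet> b) has_integral (G t - G s) \<bullet> b) {s..t}"
   unfolding b by (simp add: inner_axis inner_diff_left)
  qed
 qed
 thus ?thesis by (rule that)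
qed

lemma abs_continuous_finite:
 fixes ga :: "real => 'b::metric_space"
 assumes "abs_continuous_curve ga" "ep > 0"
 obtains de where "de > 0" "!!k I. I <= {..<(2::nat)^k} ==> real (card I)/2^k < de ==>
  (\<Sum>i\<in>I. increment ga k i) < ep"
proof -
 obtain de where de: "de > 0" "!!(n::nat) a b. (\<forall>i<n. 0 <= a i & a i <= b i & b i <= 1) ==>
   disjoint_family_on (%i. {a i<..<b i}) {..<n} ==> (\<Sum>i<n. b i - a i) < de ==>
   (\<Sum>i<n. dist (ga (a i)) (ga (b i))) < ep"
  using assms unfolding abs_continuous_curve_def by meson
 show ?thesis
 proof (rule that[OF de(1)])
  fix k I assume I: "I <= {..<(2::nat)^k}" "real (card I)/2^k < de"
  have "finite I" using I(1) finite_subset by blast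
  then obtain e where e: "bij_betw e {..<card I} I" using ex_bij_betw_nat_finite[of I] by (auto simp: atLeast0LessThan)
  let ?a = "%j. real (e j)/2^k" and ?b = "%j. real (Suc (e j))/2^k"
  have "\<forall>j<card I. 0 <= ?a j & ?a j <= ?b j & ?b j <= 1"
  proof (intro allI impI)
   fix j assume "j < card I"
   hence "e j < 2^k" using e I(1) by (auto simp: bij_betw_def)
   hence "real (Suc (e j)) <= real (2^k)" by (simp only: of_nat_le_iff Suc_le_eq)
   thus "0 <= ?a j & ?a j <= ?b j & ?b j <= 1" by (simp add: divide_le_eq_1 divide_right_mono)
  qed
  moreover have "disjoint_family_on (%j. {?a j<..<?b j}) {..<card I}"
   unfolding disjoint_family_on_def
  proof (intro ballI impI)
   fix j l assume jl: "j : {..<card I}" "l : {..<card I}" "j ~= l"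
   hence "e j ~= e l" using e by (auto simp: bij_betw_def inj_on_def)
   have "\<not> (x : {?a j<..<?b j} & x : {?a l<..<?b l})" for x
   proof
   assume a: "x : {?a j<..<?b j} & x : {?a l<..<?b l}"
   hence "?a j < ?b l" "?a l < ?b j" by auto
   hence "e j < Suc (e l)" "e l < Suc (e j)" by (simp_all add: divide_less_cancel)
   thus False using \<open>e j ~= e l\<close> by simp
   qed
   thus "{?a j<..<?b j} Int {?a l<..<?b l} = {}" by blast
  qed
  moreover have "(\<Sum>j<card I. ?b j - ?a j) < de"
   using I(2) by (simp add: diff_divide_distrib[symmetric])
  ultimately have "(\<Sum>j<card I. dist (ga (?a j)) (ga (?b j))) < ep" by (rule de(2))
  thus "(\<Sum>i\<in>I. increment ga k i) < ep"
   using sum.reindex_bij_betw[OF e, of "%i. increment ga k i"] by simp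
 qed
qed

lemma dist_le_sum_steps:
 fixes ga :: "nat => 'b::metric_space"
 assumes "a <= b"
 shows "dist (ga a) (ga b) <= (\<Sum>i\<in>{a..<b}. dist (ga i) (ga (Suc i)))"
 using assms
proof (induction b rule: dec_induct)
 case (step b)
 have "dist (ga a) (ga (Suc b)) <= dist (ga a) (ga b) + dist (ga b) (ga (Suc b))" by (rule dist_triangle)
 thus ?case using step by simp
qed simp

lemma dyadic_floor_tendsto: "(%k. real (cell k t)/2^k) ~> t" if "0 <= t" for t :: real
proof (rule real_tendsto_sandwich)
 have "t - (1/2)^k <= real (cell k t)/2^k & real (cell k t)/2^k <= t" for k
 proof -
  have "2^k*t - 1 <= real (cell k t)" "real (cell k t) <= 2^k*t" using \<open>0 <= t\<close> by (auto simp: of_nat_nat)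
  hence "(2^k*t - 1)/2^k <= real (cell k t)/2^k" "real (cell k t)/2^k <= (2^k*t)/2^k"
   by (intro divide_right_mono; simp)+
  thus ?thesis by (simp add: diff_divide_distrib power_divide)
 qed
 thus "\<forall>\<^sub>F k in sequentially. t - (1/2)^k <= real (cell k t)/2^k"
  "\<forall>\<^sub>F k in sequentially. real (cell k t)/2^k <= t" by auto
 have "(%k. (1/2::real)^k) ~> 0" by (rule LIMSEQ_realpow_zero) auto
 thus "(%k. t - (1/2)^k) ~> t" using tendsto_diff[OF tendsto_const[of t]] by fastforce
qed simp

lemma abs_continuous_variation:
 fixes ga :: "real => 'b::metric_space"
 assumes ac: "abs_continuous_curve ga" and cont: "continuous_on {0..1} ga"
 obtains V where "mono_on {0..1} V" "dyadic_ac V"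
  "!!s t. 0 <= s ==> s <= t ==> t <= 1 ==> dist (ga s) (ga t) <= V t - V s"
proof -
 define d where "d k i = increment ga k i" for k i
 define n where "n k t = cell k t" for k and t :: real
 define S where "S k t = (\<Sum>i<n k t. d k i)" for k t
 have d0: "d k i >= 0" for k i by (simp add: d_def)
 have n2: "2*n k t <= n (Suc k) t" if "0 <= t" for k t
 proof -
  have "2*\<lfloor>2^k*t\<rfloor> <= \<lfloor>2*(2^k*t)\<rfloor>" by linarith
  thus ?thesis using that unfolding n_def by (simp add: mult.assoc nat_mult_distrib[symmetric] le_nat_iff)
 qed
 have nn: "n k s <= n k t" if "s <= t" for k s t unfolding n_def using that by (intro nat_mono floor_mono) auto
 have ndy: "n (k + m) (real i/2^k) = i*2^m" for k m i
 proof -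
  have "2^(k+m)*(real i/2^k) = real (i*2^m)" by (simp add: power_add)
  thus ?thesis unfolding n_def by (metis floor_of_nat nat_int)
 qed
 have sub2: "(\<Sum>i<2*m. d (Suc k) i) >= (\<Sum>i<m. d k i)" for k m
 proof (induction m)
  case (Suc m)
  have e: "real (2*m)/2^Suc k = real m/2^k" "real (Suc (Suc (2*m)))/2^Suc k = real (Suc m)/2^k"
   by (simp_all add: field_simps)
  have "d k m <= d (Suc k) (2*m) + d (Suc k) (Suc (2*m))"
   unfolding d_def e[symmetric] by (rule dist_triangle)
  thus ?case using Suc by simp
 qed simp
 have Sinc: "S k t <= S (Suc k) t" if "0 <= t" for k t
 proof -
  have "S k t <= (\<Sum>i<2*n k t. d (Suc k) i)" unfolding S_def by (rule sub2)
  also have "... <= S (Suc k) t" unfolding S_def using n2[OF that] d0 by (intro sum_mono2) auto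
  finally show ?thesis .
 qed
 hence inc: "incseq (%k. S k t)" if "0 <= t" for t using that by (intro incseq_SucI)
 have "\<exists>C. \<forall>k. S k 1 <= C"
 proof -
  obtain de where de: "de > 0" "!!k I. I <= {..<(2::nat)^k} ==> real (card I)/2^k < de ==> (\<Sum>i\<in>I. d k i) < 1"
   unfolding d_def using abs_continuous_finite[OF ac zero_less_one] by blast
  obtain m where m: "(1/2::real) ^ m < de" using real_arch_pow_inv[of de "1/2"] de(1) by auto
  have b: "S (m + j) 1 <= 2^m" for j
  proof -
   have n1: "n (m + j) 1 = 2^m*2^j" using ndy[of 0 "m + j" 1] by (simp add: power_add)
   have "(\<Sum>i<r*2^j. d (m + j) i) <= real r" if "r <= 2^m" for r using that
   proof (induction r)
   case (Suc r)
   have sub: "{r*2^j..<Suc r*2^j} <= {..<2^(m + j)}"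
   proof -
   have "Suc r*2^j <= 2^m*2^j" using Suc.prems by (rule mult_right_mono) simp
   thus ?thesis by (auto simp: power_add)
   qed
   have "real (card {r*2^j..<Suc r*2^j})/2^(m + j) = (1/2)^m" by (simp add: power_add power_divide)
   hence "(\<Sum>i\<in>{r*2^j..<Suc r*2^j}. d (m + j) i) < 1" using de(2)[OF sub] m by simp
   moreover have "(\<Sum>i<Suc r*2^j. d (m + j) i) = (\<Sum>i<r*2^j. d (m + j) i) + (\<Sum>i\<in>{r*2^j..<Suc r*2^j}. d (m + j) i)"
   by (subst sum.union_disjoint[symmetric]) (auto intro!: sum.cong simp: ivl_disj_un)
   ultimately show ?case using Suc by simp
   qed simp
   from this[of "2^m"] show ?thesis by (simp add: S_def n1)
  qed
  have "S k 1 <= 2^m" for k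
   using incseqD[OF inc[of 1], of k "m + k"] b[of k] by simp
  thus ?thesis by blast
 qed
 then obtain C where C: "!!k. S k 1 <= C" by blast
 have SC: "S k t <= C" if "t <= 1" for k t
 proof -
  have "S k t <= S k 1" unfolding S_def using nn[OF that] d0 by (intro sum_mono2) auto
  thus ?thesis using C[of k] by simp
 qed
 define V where "V t = lim (%k. S k t)" for t
 have lim: "(%k. S k t) ~> V t" if t: "0 <= t" "t <= 1" for t
 proof -
  obtain L where "(%k. S k t) ~> L" using incseq_convergent[OF inc[OF t(1)], of C] SC[OF t(2)] by blast
  thus ?thesis unfolding V_def by (simp add: limI)
 qed
 have Sdiff: "S k t - S k s = (\<Sum>i\<in>{n k s..<n k t}. d k i)" if "s <= t" for k s t
  unfolding S_def using nn[OF that, of k]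
  by (subst sum_diff[symmetric]) (auto intro!: sum.cong simp: lessThan_minus_lessThan)
 have dom: "dist (ga s) (ga t) <= V t - V s" if st: "0 <= s" "s <= t" "t <= 1" for s t
 proof (rule LIMSEQ_le)
  have seq: "(%k. ga (real (n k u)/2^k)) ~> ga u" if u: "0 <= u" "u <= 1" for u
  proof (rule continuous_on_tendsto_compose[OF cont])
   show "(%k. real (n k u)/2^k) ~> u" unfolding n_def by (rule dyadic_floor_tendsto[OF u(1)])
   have "real (n k u)/2^k <= 1" for k
   proof -
   have "real (n k u) <= 2^k*u" using u unfolding n_def by (auto simp: of_nat_nat)
   also have "... <= 2^k" using u by simp
   finally show ?thesis by simp
   qed
   thus "\<forall>\<^sub>F k in sequentially. real (n k u)/2^k : {0..1}" by auto
  qed (use u in auto)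
  show "(%k. dist (ga (real (n k s)/2^k)) (ga (real (n k t)/2^k))) ~> dist (ga s) (ga t)"
   using st by (intro tendsto_dist seq) auto
  show "(%k. S k t - S k s) ~> V t - V s" using st by (intro tendsto_diff lim) auto
  show "\<exists>N. \<forall>k\<ge>N. dist (ga (real (n k s)/2^k)) (ga (real (n k t)/2^k)) <= S k t - S k s"
   unfolding Sdiff[OF st(2)] d_def using dist_le_sum_steps[OF nn[OF st(2)], of "%i. ga (real i/2^_)"] by blast
 qed
 have mono: "mono_on {0..1} V"
 proof (intro mono_onI)
  fix s t :: real assume "s : {0..1}" "t : {0..1}" "s <= t"
  hence "0 <= V t - V s" using order_trans[OF zero_le_dist dom[of s t]] by auto
  thus "V s <= V t" by simp
 qed
 have "dyadic_ac V"
  unfolding dyadic_ac_def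
 proof (intro allI impI)
  fix ep :: real assume "ep > 0"
  then obtain de where de: "de > 0" "!!k I. I <= {..<(2::nat)^k} ==> real (card I)/2^k < de ==> (\<Sum>i\<in>I. d k i) < ep"
   unfolding d_def using abs_continuous_finite[OF ac] by blast
  have "(\<Sum>i\<in>I. V (real (Suc i)/2^k) - V (real i/2^k)) <= ep"
   if I: "I <= {..<(2::nat)^k}" "real (card I)/2^k < de" for k I
  proof (rule LIMSEQ_le_const2)
   have fin: "finite I" using I(1) finite_subset by blast
   have in01: "real i/2^k <= 1" if "i <= 2^k" for i
   proof -
   have "real i <= real (2^k)" using that by (simp only: of_nat_le_iff)
   thus ?thesis by (simp add: divide_le_eq_1)
   qed
   have lim': "(%m. S (k + m) t) ~> V t" if "0 <= t" "t <= 1" for t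
   using LIMSEQ_ignore_initial_segment[OF lim[OF that], of k] by (simp add: add.commute)
   show "(%m. \<Sum>i\<in>I. S (k + m) (real (Suc i)/2^k) - S (k + m) (real i/2^k)) ~> (\<Sum>i\<in>I. V (real (Suc i)/2^k) - V (real i/2^k))"
   using I(1) by (intro tendsto_sum tendsto_diff lim' in01) auto
   have "(\<Sum>i\<in>I. S (k + m) (real (Suc i)/2^k) - S (k + m) (real i/2^k)) <= ep" for m
   proof -
   let ?J = "\<Union>i\<in>I. {i*2^m..<Suc i*2^m}"
   have disj: "{i*2^m..<Suc i*2^m} Int {j*2^m..<Suc j*2^m} = {}" if "i ~= j" for i j :: nat
   proof -
   have "False" if x: "i*2^m <= x" "x < Suc i*2^m" "j*2^m <= x" "x < Suc j*2^m" for x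
   proof -
   have "i*2^m < Suc j*2^m" "j*2^m < Suc i*2^m" using x by linarith+
   hence "i < Suc j" "j < Suc i" by (simp_all only: mult_less_cancel2)
   thus False using \<open>i ~= j\<close> by simp
   qed
   thus ?thesis by fastforce
   qed
   have "(\<Sum>i\<in>I. S (k + m) (real (Suc i)/2^k) - S (k + m) (real i/2^k)) = (\<Sum>i\<in>I. \<Sum>j\<in>{i*2^m..<Suc i*2^m}. d (k + m) j)"
   by (intro sum.cong refl, subst Sdiff) (simp_all only: ndy, simp add: divide_right_mono)
   also have "... = (\<Sum>j\<in>?J. d (k + m) j)"
   using fin disj by (intro sum.UNION_disjoint[symmetric]) auto
   also have "... < ep"
   proof (rule de(2))
   show "?J <= {..<2^(k + m)}"
   proof (intro UN_least subsetI)
   fix i x assume "i : I" "x : {i*2^m..<Suc i*2^m}"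
   moreover have "Suc i*2^m <= 2^k*2^m" using I(1) \<open>i : I\<close> by (intro mult_right_mono) auto
   ultimately show "x : {..<2^(k + m)}" by (auto simp: power_add)
   qed
   have "card ?J = (\<Sum>i\<in>I. card {i*2^m..<Suc i*2^m})"
   using fin disj by (intro card_UN_disjoint) auto
   also have "... = card I*2^m" by simp
   finally have "real (card ?J)/2^(k + m) = real (card I)/2^k" by (simp add: power_add)
   thus "real (card ?J)/2^(k + m) < de" using I(2) by simp
   qed
   finally show ?thesis by simp
   qed
   thus "\<exists>N. \<forall>m\<ge>N. (\<Sum>i\<in>I. S (k + m) (real (Suc i)/2^k) - S (k + m) (real i/2^k)) <= ep" by blast
  qed
  thus "\<exists>de>0. \<forall>k I. I <= {..<(2::nat)^k} & real (card I)/2^k < de -->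
  (\<Sum>i\<in>I. V (real (Suc i)/2^k) - V (real i/2^k)) <= ep" using de(1) by blast
 qed
 thus ?thesis using that mono dom by blast
qed

lemma local_to_global_dominated:
 fixes g :: "real => 'b::metric_space"
 assumes "et > 0" and loc: "!!s t. 0 <= s ==> s <= t ==> t <= 1 ==> t - s <= et ==> dist (g s) (g t) <= V t - V s"
  and "0 <= s" "s <= t" "t <= (1::real)"
 shows "dist (g s) (g t) <= V t - V s"
proof -
 have "dist (g s) (g t) <= V t - V s" if "0 <= s" "s <= t" "t <= 1" "t - s <= real n*et" for n s t
  using that
 proof (induction n arbitrary: s)
  case 0
  hence "s = t" by simp
  thus ?case by simp
 next
  case (Suc n)
  let ?u = "min t (s + et)"
  have u: "s <= ?u" "?u <= t" "?u - s <= et" "t - ?u <= real n*et" using Suc.prems assms(1) by (auto simp: algebra_simps min_def)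
  have "dist (g s) (g ?u) <= V ?u - V s" using Suc.prems u by (intro loc) auto
  moreover have "dist (g ?u) (g t) <= V t - V ?u" using Suc.prems u by (intro Suc.IH) auto
  ultimately show ?case using dist_triangle[of "g s" "g t" "g ?u"] by linarith
 qed
 moreover obtain n :: nat where "(t - s)/et <= real n" using real_arch_simple by blast
 ultimately show ?thesis using assms by (simp add: field_simps)
qed

lemma lift_dominated:
 assumes l: "is_lift ga g" and dom: "!!s t. 0 <= s ==> s <= t ==> t <= 1 ==> dist (ga s) (ga t) <= V t - V s"
  and "0 <= s" "s <= t" "t <= (1::real)"
 shows "dist (g s) (g t) <= V t - V s"
proof -
 have "uniformly_continuous_on {0..1} g" using l unfolding is_lift_def by (intro compact_uniformly_continuous) auto
 then obtain d where d: "d > 0" "!!s t. s : {0..1} ==> t : {0..1} ==> dist s t < d ==> dist (g s) (g t) < 1/2"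
  unfolding uniformly_continuous_on_def by (metis zero_less_divide_1_iff zero_less_numeral)
 show ?thesis
 proof (rule local_to_global_dominated[of "d/2" g V, OF _ _ assms(3-5)])
  fix s t assume st: "0 <= s" "s <= t" "t <= 1" "t - s <= d/2"
  hence "dist (g s) (g t) < 1/2" using d by (intro d(2)) (auto simp: dist_real_def)
  hence "dist (g s) (g t) = dist (ga s) (ga t)" using torus_dist_eq[of "g s" "g t"] l st unfolding is_lift_def by simp
  thus "dist (g s) (g t) <= V t - V s" using dom st by simp
 qed (use d in auto)
qed

text \<open>The increments of the curve are dominated by those of its variation, a monotone absolutely continuous
function. The domination is local and passes to the lift, because both metrics agree at short distances; a
function dominated in this way is an indefinite integral, and its density is the velocity almost everywhere.\<close>
theorem abs_continuous_velocity:
 fixes ga :: "real => 'n::finite torus"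
 assumes ac: "abs_continuous_curve ga" and l: "is_lift ga g"
 obtains N where "ind_int g (velocity ga)" "negligible N"
  "!!t. t : {0..1} - N ==> (g has_vector_derivative velocity ga t) (at t within {0..1})"
proof -
 have "continuous_on {0..1} (%s. torus_proj (g s))"
  using l unfolding is_lift_def by (intro continuous_on_compose2[OF continuous_on_torus_proj[of UNIV]]) auto
 hence cont: "continuous_on {0..1} ga" using continuous_on_cong[of "{0..1}" "{0..1}" "%s. torus_proj (g s)" ga] l unfolding is_lift_def by blast
 obtain V where V: "mono_on {0..1} V" "dyadic_ac V"
  "!!s t. 0 <= s ==> s <= t ==> t <= 1 ==> dist (ga s) (ga t) <= V t - V s"
  using abs_continuous_variation[OF ac cont] by blast
 obtain v where v: "ind_int g v"
  using dominated_ind_int[OF V(1,2), of g] lift_dominated[OF l V(3)] by blast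
 obtain N where N: "negligible N" "!!t. t : {0..1} - N ==> (g has_vector_derivative v t) (at t within {0..1})"
  using ind_int_deriv[OF v] by blast
 have eq: "velocity ga t = v t" if "t : {0..1} - N" for t
  using velocity_eq_lift[OF l _ N(2)[OF that]] that by simp
 show ?thesis
  using that[of N] ind_int_unique_spike[OF v N(1) eq] N eq by simp
qed

section \<open>Dyadic energies of curves\<close>

lemma curves_iff:
 "ga : (curves :: (real => 'n::finite torus) set) \<longleftrightarrow> ga : extensional {0..1} & continuous_on {0..1} ga"
proof -
 have "Met_TC.mbounded (ga ` {0..1})" if c: "continuous_on {0..1} ga"
 proof -
  obtain x e where "!!y. y : ga ` {0..1} ==> dist x y <= e"
   using compact_imp_bounded[OF compact_continuous_image[OF c compact_Icc]] unfolding bounded_def by blast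
  thus ?thesis unfolding Met_TC.mbounded_def Met_TC.mcball_def by (intro exI[of _ x] exI[of _ e]) auto
 qed
 thus ?thesis
  by (auto simp: curve_metric_def continuous_map_iff_continuous)
qed

lemma powr_tangent:
 fixes v c :: "'b::real_inner"
 assumes p: "1 < p"
 shows "norm c powr p + p*norm c powr (p - 2)*(c \<bullet> (v - c)) <= norm v powr p"
proof (cases "c = 0")
 case False
 define a b where "a = norm c" and "b = norm v"
 have a: "a > 0" and b: "b >= 0" using False by (auto simp: a_def b_def)
 define q where "q = p/(p - 1)"
 have q: "q > 1" "1/p + 1/q = 1" "(p - 1)*q = p" using p by (auto simp: q_def field_simps)
 have "b*a powr (p - 1) <= b powr p/p + (a powr (p - 1)) powr q/q"
  using p q b by (intro Youngs_inequality) auto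
 also have "(a powr (p - 1)) powr q = a powr p" using q(3) by (simp add: powr_powr)
 finally have "p*(b*a powr (p - 1)) <= p*(b powr p/p + a powr p/q)" using p by (intro mult_left_mono) auto
 also have "... = b powr p + (p - 1)*a powr p" using p by (simp add: q_def field_simps)
 finally have Y: "p*a powr (p - 1)*b <= b powr p + (p - 1)*a powr p" by (simp add: mult_ac)
 have ap: "a powr (p - 2)*a = a powr (p - 1)" "a powr (p - 2)*a\<^sup>2 = a powr p"
 proof -
  show "a powr (p - 2)*a = a powr (p - 1)" using a powr_add[of a "p - 2" 1] by simp
  show "a powr (p - 2)*a\<^sup>2 = a powr p" using a powr_add[of a "p - 2" 2] by simp
 qed
 have "c \<bullet> (v - c) <= a*b - a\<^sup>2"
  using norm_cauchy_schwarz[of c v] by (simp add: a_def b_def inner_diff_right power2_norm_eq_inner)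
 hence "p*a powr (p - 2)*(c \<bullet> (v - c)) <= p*a powr (p - 2)*(a*b - a\<^sup>2)"
  using p by (intro mult_left_mono) auto
 also have "... = p*(a powr (p - 2)*a)*b - p*(a powr (p - 2)*a\<^sup>2)" by (simp add: algebra_simps)
 finally show ?thesis unfolding ap using Y by (simp add: a_def b_def algebra_simps)
qed simp

lemma jensen_interval:
 fixes g v :: "real => 'b::euclidean_space"
 assumes gv: "(v has_integral (g t - g s)) {s..t}" and p: "1 < p" and st: "s < t"
  and vi: "(%r. norm (v r) powr p) integrable_on {s..t}"
 shows "(norm (g t - g s)/(t - s)) powr p*(t - s) <= integral {s..t} (%r. norm (v r) powr p)"
proof -
 define c where "c = (g t - g s) /\<^sub>R (t - s)"
 have nc: "norm c = norm (g t - g s)/(t - s)" using st by (simp add: c_def divide_inverse mult.commute)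
 have "((%r. v r - c) has_integral (g t - g s) - (t - s) *\<^sub>R c) {s..t}"
  using has_integral_const_real[of c s t] st by (intro has_integral_diff gv) simp
 hence "((%r. v r - c) has_integral 0) {s..t}" using st by (simp add: c_def)
 hence "((%r. c \<bullet> (v r - c)) has_integral 0) {s..t}"
  using has_integral_linear[OF _ bounded_linear_inner_right[of c], of "%r. v r - c" 0 "{s..t}"] by (simp add: o_def)
 hence "((%r. norm c powr p + p*norm c powr (p - 2)*(c \<bullet> (v r - c))) has_integral (t - s) *\<^sub>R norm c powr p + p*norm c powr (p - 2)*0) {s..t}"
  using has_integral_const_real[of "norm c powr p" s t] st by (intro has_integral_add has_integral_mult_right) simp_all
 hence "(t - s) *\<^sub>R norm c powr p + p*norm c powr (p - 2)*0 <= integral {s..t} (%r. norm (v r) powr p)"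
  by (rule has_integral_le[OF _ integrable_integral[OF vi]]) (use powr_tangent[OF p] in auto)
 thus ?thesis by (simp add: nc mult.commute)
qed

text \<open>The energy seen at the dyadic times of one generation. In contrast to the energy itself it is a continuous
function of finitely many values of the curve.\<close>
definition E_dy :: "real => nat => (real => 'b::metric_space) => real" where
 "E_dy p k ga = (\<Sum>i<2^k. (2^k*increment ga k i) powr p/2^k)"

definition dq :: "nat => (real => 'b::metric_space) => real => real" where
 "dq k ga s = 2^k*dist (ga (real (cell k s)/2^k)) (ga (real (Suc (cell k s))/2^k))"

lemma E_dy_nonneg: "0 <= E_dy p k ga"
 unfolding E_dy_def by (intro sum_nonneg) auto

lemma dyadic_le_1: "i <= 2^k ==> real i/2^k <= 1"
proof -
 assume "i <= 2^k"
 hence "real i <= real (2^k)" by (simp only: of_nat_le_iff)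
 thus ?thesis by (simp add: divide_le_eq_1)
qed

lemma floor_dyadic_iff:
 assumes "0 <= s"
 shows "cell k s = i \<longleftrightarrow> s : {real i/2^k ..< real (Suc i)/2^k}"
proof -
 have "cell k s = i \<longleftrightarrow> \<lfloor>2^k * s\<rfloor> = int i" using assms by (auto simp: nat_eq_iff)
 also have "... \<longleftrightarrow> real i <= 2^k * s & 2^k * s < real i + 1" by (simp add: floor_eq_iff)
 also have "... \<longleftrightarrow> s : {real i/2^k ..< real (Suc i)/2^k}"
  by (simp add: divide_le_eq less_divide_eq mult.commute add.commute)
 finally show ?thesis .
qed

lemma floor_dyadic_less: "0 <= s ==> s < 1 ==> cell k s < 2^k" for s :: real
proof -
 assume s: "0 <= s" "s < 1"
 have "2^k * s < 2^k*1" using s by (intro mult_strict_left_mono) auto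
 moreover have "real (cell k s) <= 2^k * s" using s by (simp add: of_nat_nat)
 moreover have "real (2^k) = (2::real)^k" by simp
 ultimately have "real (cell k s) < real (2^k)" by linarith
 thus ?thesis by (simp only: of_nat_less_iff)
qed

lemma nn_integral_dyadic_step:
 fixes F :: "nat => ennreal"
 shows "(nn_integral (lebesgue_on {0..1::real}) (%s. F (cell k s))) = (\<Sum>i<2^k. F i*ennreal (1/2^k))"
proof -
 let ?I = "%i. {real i/2^k ..< real (Suc i)/2^k :: real}"
 have "(nn_integral (lebesgue_on {0..1::real}) (%s. F (cell k s))) = (nn_integral lebesgue (%s. F (cell k s)*indicator {0..1::real} s))"
  by (subst nn_integral_restrict_space) auto
 also have "... = (nn_integral lebesgue (%s. (\<Sum>i<2^k. F i*indicator (?I i) s)))"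
 proof (rule nn_integral_cong_AE)
  have "AE s in lebesgue. s ~= (1::real)"
   by (rule AE_completion[OF AE_lborel_singleton])
  thus "AE s in lebesgue. F (cell k s)*indicator {0..1} s = (\<Sum>i<2^k. F i*indicator (?I i) s)"
  proof eventually_elim
   case (elim s)
   show ?case
   proof (cases "0 <= s & s < 1")
   case True
   have *: "s : ?I i \<longleftrightarrow> i = cell k s" for i using True floor_dyadic_iff[of s k i] by blast
   have "(\<Sum>i<2^k. F i*indicator (?I i) s) = (\<Sum>i<2^k. if i = cell k s then F i else 0)"
   unfolding indicator_def*by (intro sum.cong refl) simp
   also have "... = F (cell k s)" using floor_dyadic_less[of s k] True by (subst sum.delta) auto
   finally show ?thesis using True by simp
   next
   case False
   have "s ~: ?I i" if "i < 2^k" for i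
   proof -
   have "real (Suc i)/2^k <= 1" using that by (intro dyadic_le_1) simp
   moreover have "0 <= real i/2^k" by simp
   ultimately show ?thesis using False unfolding atLeastLessThan_iff by linarith
   qed
   thus ?thesis using False elim by (auto intro!: sum.neutral[symmetric])
   qed
  qed
 qed
 also have "... = (\<Sum>i<2^k. \<integral>\<^sup>+s. F i*indicator (?I i) s \<partial>lebesgue)"
  by (intro nn_integral_sum borel_measurable_times_ennreal borel_measurable_const borel_measurable_indicator) auto
 also have "... = (\<Sum>i<2^k. F i*ennreal (1/2^k))"
 proof (intro sum.cong refl)
  fix i
  have "real (Suc i)/2^k - real i/2^k = 1/2^k" by (simp add: diff_divide_distrib[symmetric])
  moreover have "real i/2^k <= real (Suc i)/2^k" by (intro divide_right_mono) auto
  ultimately show "(nn_integral lebesgue (%s. F i*indicator (?I i) s)) = F i*ennreal (1/2^k)"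
   by (simp add: nn_integral_cmult_indicator emeasure_lborel_Ico)
 qed
 finally show ?thesis .
qed

lemma measurable_dyadic_step [measurable]:
 "(%s. F (cell k s)) : bm (lebesgue_on {0..1::real})" for F :: "nat => 'b::topological_space"
proof -
 have "(%s. F (cell k s)) : bm (lborel :: real measure)" by measurable
 hence "(%s. F (cell k s)) : bm (lebesgue :: real measure)" by (rule measurable_completion)
 thus ?thesis by (rule measurable_restrict_space1)
qed

lemma E_dy_eq_nn_integral:
 "ennreal (E_dy p k ga) = (nn_integral (lebesgue_on {0..1}) (%s. ennreal (dq k ga s powr p)))"
proof -
 let ?F = "%i. ennreal ((2^k*increment ga k i) powr p)"
 have "(nn_integral (lebesgue_on {0..1}) (%s. ennreal (dq k ga s powr p))) = (\<Sum>i<2^k. ?F i*ennreal (1/2^k))"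
  unfolding dq_def by (rule nn_integral_dyadic_step[of ?F])
 also have "... = ennreal (E_dy p k ga)"
  unfolding E_dy_def by (subst sum_ennreal[symmetric]) (auto simp: ennreal_mult[symmetric])
 finally show ?thesis by simp
qed

lemma quotient_tendsto:
 fixes g :: "real => 'b::real_normed_vector"
 assumes d: "(g has_vector_derivative v) (at t within {0..1})" and t: "0 <= t" "t < 1"
 shows "(%k. 2^k *\<^sub>R (g (real (Suc (cell k t))/2^k) - g (real (cell k t)/2^k))) ~> v"
proof (rule LIMSEQ_I)
 fix r :: real assume "0 < r"
 have "\<exists>d>0. ALL y:{0..1}. norm (y - t) < d --> norm (g y - g t - (y - t) *\<^sub>R v) <= (r/2)*norm (y - t)"
  using d \<open>0 < r\<close> unfolding has_vector_derivative_def has_derivative_within_alt by (meson half_gt_zero)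
 then obtain d where d: "d > 0" "!!y. y : {0..1} ==> norm (y - t) < d ==> norm (g y - g t - (y - t) *\<^sub>R v) <= (r/2)*norm (y - t)"
  by blast
 obtain K where K: "(1/2::real) ^ K < d" using real_arch_pow_inv[of d "1/2"] d(1) by auto
 show "\<exists>no. \<forall>k\<ge>no. norm (2^k *\<^sub>R (g (real (Suc (cell k t))/2^k) - g (real (cell k t)/2^k)) - v) < r"
 proof (intro exI[of _ K] allI impI)
  fix k assume "K <= k"
  define a b where "a = real (cell k t)/2^k" and "b = real (Suc (cell k t))/2^k"
  have ab: "a <= t" "t < b" using floor_dyadic_iff[OF t(1), of k "cell k t"] by (auto simp: a_def b_def)
  have bma: "b - a = 1/2^k" by (simp add: a_def b_def diff_divide_distrib[symmetric])
  have "(1/2::real)^k <= (1/2)^K" using \<open>K <= k\<close> by (intro power_decreasing) auto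
  hence small: "b - a < d" using K bma by (simp add: power_divide)
  have "b <= 1" unfolding b_def by (intro dyadic_le_1 Suc_leI floor_dyadic_less t)
  moreover have "0 <= a" by (simp add: a_def)
  ultimately have in01: "a : {0..1}" "b : {0..1}" using ab t by auto
  have 1: "norm (g b - g t - (b - t) *\<^sub>R v) <= (r/2)*(b - t)" using d(2)[OF in01(2)] ab small by auto
  have 2: "norm (g a - g t - (a - t) *\<^sub>R v) <= (r/2)*(t - a)" using d(2)[OF in01(1)] ab small by auto
  have eq: "2^k *\<^sub>R (g b - g a) - v = 2^k *\<^sub>R ((g b - g t - (b - t) *\<^sub>R v) - (g a - g t - (a - t) *\<^sub>R v))"
  proof -
   have "(g b - g t - (b - t) *\<^sub>R v) - (g a - g t - (a - t) *\<^sub>R v) = (g b - g a) - (b - a) *\<^sub>R v" by (simp add: algebra_simps)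
   thus ?thesis by (subst \<open>_ = (g b - g a) - (b - a) *\<^sub>R v\<close>, subst scaleR_diff_right) (simp add: bma)
  qed
  have "norm (2^k *\<^sub>R (g b - g a) - v) <= 2^k*((r/2)*(b - t) + (r/2)*(t - a))"
   unfolding eq using norm_triangle_ineq4[of "g b - g t - (b - t) *\<^sub>R v" "g a - g t - (a - t) *\<^sub>R v"] 1 2 by simp
  also have "... = 2^k*((r/2)*(b - a))" unfolding distrib_left[symmetric] by simp
  also have "... = r/2" by (simp add: bma)
  finally show "norm (2^k *\<^sub>R (g (real (Suc (cell k t))/2^k) - g (real (cell k t)/2^k)) - v) < r"
   using \<open>0 < r\<close> by (simp add: a_def b_def)
 qed
qed

lemma dq_lift_eventually:
 assumes l: "is_lift ga g" and t: "0 <= t" "t < 1"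
 shows "\<forall>\<^sub>F k in sequentially. dq k ga t = norm (2^k *\<^sub>R (g (real (Suc (cell k t))/2^k) - g (real (cell k t)/2^k)))"
proof -
 have "uniformly_continuous_on {0..1} g" using l unfolding is_lift_def by (intro compact_uniformly_continuous) auto
 then obtain d where d: "d > 0" "!!s t. s : {0..1} ==> t : {0..1} ==> dist s t < d ==> dist (g s) (g t) < 1/2"
  unfolding uniformly_continuous_on_def by (metis zero_less_divide_1_iff zero_less_numeral)
 obtain K where K: "(1/2::real) ^ K < d" using real_arch_pow_inv[of d "1/2"] d(1) by auto
 show ?thesis
  unfolding eventually_sequentially
 proof (intro exI[of _ K] allI impI)
  fix k assume "K <= k"
  define a b where "a = real (cell k t)/2^k" and "b = real (Suc (cell k t))/2^k"
  have ab: "a <= b" by (simp add: a_def b_def divide_right_mono)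
  have bma: "b - a = 1/2^k" by (simp add: a_def b_def diff_divide_distrib[symmetric])
  have "(1/2::real)^k <= (1/2)^K" using \<open>K <= k\<close> by (intro power_decreasing) auto
  hence small: "dist a b < d" using K bma ab by (simp add: power_divide dist_real_def)
  have "b <= 1" unfolding b_def by (intro dyadic_le_1 Suc_leI floor_dyadic_less t)
  moreover have "0 <= a" by (simp add: a_def)
  ultimately have in01: "a : {0..1}" "b : {0..1}" using ab t by auto
  have "dist (g a) (g b) < 1/2" using d(2)[OF in01 small] .
  hence "dist (ga a) (ga b) = dist (g a) (g b)" using torus_dist_eq[of "g a" "g b"] l in01 unfolding is_lift_def by simp
  thus "dq k ga t = norm (2^k *\<^sub>R (g (real (Suc (cell k t))/2^k) - g (real (cell k t)/2^k)))"
   by (simp add: dq_def a_def b_def dist_norm norm_minus_commute)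
 qed
qed

lemma AE_lebesgue_on_negligible:
 assumes "negligible N" "!!t. t : {0..1} - N ==> P t"
 shows "AE t in lebesgue_on {0..1::real}. P t"
proof -
 have "N : null_sets lebesgue" using assms(1) by (simp add: negligible_iff_null_sets)
 hence "AE t in lebesgue. t ~: N" by (rule AE_not_in)
 hence "AE t in lebesgue. t : {0..1} --> P t" by eventually_elim (use assms(2) in blast)
 thus ?thesis by (subst AE_restrict_space_iff) auto
qed

lemma dq_tendsto_velocity:
 fixes ga :: "real => 'n::finite torus"
 assumes ac: "abs_continuous_curve ga" and l: "is_lift ga g"
 shows "AE t in lebesgue_on {0..1}. (%k. dq k ga t) ~> norm (velocity ga t)"
proof -
 obtain N where "ind_int g (velocity ga)" and N: "negligible N"
  "!!t. t : {0..1} - N ==> (g has_vector_derivative velocity ga t) (at t within {0..1})"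
  by (rule abs_continuous_velocity[OF ac l], rule that)
 have "negligible (insert 1 N)" using N(1) by simp
 thus ?thesis
 proof (rule AE_lebesgue_on_negligible)
  fix t :: real assume t: "t : {0..1} - insert 1 N"
  hence t': "0 <= t" "t < 1" by auto
  have "(%k. norm (2^k *\<^sub>R (g (real (Suc (cell k t))/2^k) - g (real (cell k t)/2^k)))) ~> norm (velocity ga t)"
   using t N(2) t' by (intro tendsto_norm quotient_tendsto) auto
  thus "(%k. dq k ga t) ~> norm (velocity ga t)"
   using dq_lift_eventually[OF l t'] by (subst tendsto_cong) auto
 qed
qed

lemma velocity_measurable:
 fixes ga :: "real => 'n::finite torus"
 assumes ac: "abs_continuous_curve ga" and l: "is_lift ga g"
 shows "velocity ga : bm (lebesgue_on {0..1})"
proof -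
 obtain N where "ind_int g (velocity ga)" using abs_continuous_velocity[OF ac l] by blast
 thus ?thesis unfolding ind_int_def by (intro absolutely_integrable_measurable_real[THEN iffD1, THEN conjunct1] absolutely_integrable_measurable[THEN iffD1, THEN conjunct1]) auto
qed

text \<open>Split the steps at the speed \<open>L\<close>: slow ones move at most \<open>L\<close> times the elapsed time,
and for fast ones the speed is at most its power \<open>p\<close> divided by \<open>L\<close> to the power
\<open>p - 1\<close>, which the energy controls.\<close>
lemma dyadic_ac_continuity_aux:
 fixes ga :: "real => 'b::metric_space"
 assumes p: "1 < p" and M: "!!k. E_dy p k ga <= M" and L: "L > 0" and J: "J <= {..<(2::nat)^k}"
 shows "(\<Sum>i\<in>J. increment ga k i) <= L*(real (card J)/2^k) + M/L powr (p - 1)"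
proof -
 define x where "x i = 2^k*increment ga k i" for i
 have x0: "x i >= 0" for i by (simp add: x_def)
 have one: "x i <= L + x i powr p/L powr (p - 1)" for i
 proof (cases "x i <= L")
  case True thus ?thesis using x0[of i] by (smt (verit) divide_nonneg_nonneg powr_ge_zero)
 next
  case False
  hence "L powr (p - 1) <= x i powr (p - 1)" using L p by (intro powr_mono2) auto
  hence "x i*L powr (p - 1) <= x i*x i powr (p - 1)" using x0 by (intro mult_left_mono)
  also have "... = x i powr p" using False L powr_add[of "x i" 1 "p - 1"] by simp
  finally have "x i <= x i powr p/L powr (p - 1)" using L by (simp add: pos_le_divide_eq)
  thus ?thesis using L by linarith
 qed
 have fin: "finite J" using J finite_subset by blast
 have "(\<Sum>i\<in>J. increment ga k i) = (\<Sum>i\<in>J. x i/2^k)" by (simp add: x_def)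
 also have "... <= (\<Sum>i\<in>J. L/2^k + (x i powr p/2^k)/L powr (p - 1))"
 proof (rule sum_mono)
  fix i
  have "x i/2^k <= (L + x i powr p/L powr (p - 1))/2^k" using one by (intro divide_right_mono) auto
  thus "x i/2^k <= L/2^k + (x i powr p/2^k)/L powr (p - 1)" by (simp add: add_divide_distrib mult.commute)
 qed
 also have "... = L*(real (card J)/2^k) + (\<Sum>i\<in>J. x i powr p/2^k)/L powr (p - 1)"
  by (simp add: sum.distrib sum_divide_distrib)
 also have "(\<Sum>i\<in>J. x i powr p/2^k) <= E_dy p k ga"
  unfolding E_dy_def x_def using J by (intro sum_mono2) auto
 finally show ?thesis using M[of k] L by (smt (verit) divide_right_mono powr_ge_zero)
qed

lemma E_dy_bounded_abs_continuous:
 fixes ga :: "real => 'b::metric_space"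
 assumes p: "1 < p" and cont: "continuous_on {0..1} ga" and M: "!!k. E_dy p k ga <= M"
 shows "abs_continuous_curve ga"
 unfolding abs_continuous_curve_def
proof (intro allI impI)
 fix ep :: real assume "0 < ep"
 have M0: "M >= 0" using M[of 0] E_dy_nonneg[of p 0 ga] by linarith
 define L where "L = (3*M/ep + 1) powr (1/(p - 1))"
 have base: "3*M/ep + 1 > 0" using M0 \<open>0 < ep\<close> by (simp add: add_nonneg_pos)
 have L: "L > 0" using base by (simp add: L_def)
 have Lp: "L powr (p - 1) = 3*M/ep + 1" using p base by (simp add: L_def powr_powr)
 have MdL: "M/L powr (p - 1) <= ep/3"
 proof -
  have "M <= ep/3*(3*M/ep + 1)" using \<open>0 < ep\<close> M0 by (simp add: algebra_simps)
  thus ?thesis unfolding Lp using base by (simp add: pos_divide_le_eq)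
 qed
 define de where "de = ep/(3*L)"
 have main: "(\<Sum>i<n. dist (ga (a i)) (ga (b i))) < ep"
  if ab: "\<forall>i<n. 0 <= a i & a i <= b i & b i <= 1" and disj: "disjoint_family_on (%i. {a i<..<b i}) {..<n}"
   and small: "(\<Sum>i<n. b i - a i) < de" for n and a b :: "nat => real"
 proof -
  define m where "m k t = cell k t" for k and t :: real
  have mm: "m k s <= m k t" if "s <= t" for k s t unfolding m_def using that by (intro nat_mono floor_mono) auto
  have m1: "m k t <= 2^k" if "0 <= t" "t <= 1" for k t
  proof -
   have "2^k*t <= 2^k*1" using that by (intro mult_left_mono) auto
   hence "\<lfloor>2^k*t\<rfloor> <= \<lfloor>2^k :: real\<rfloor>" by (intro floor_mono) simp
   thus ?thesis unfolding m_def by (simp add: nat_le_iff)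
  qed
  have dj: "{m k (a i)..<m k (b i)} Int {m k (a j)..<m k (b j)} = {}" if ij: "i < n" "j < n" "i ~= j" for i j k
  proof (rule ccontr)
   assume "\<not> ?thesis"
   then obtain x where "x : {m k (a i)..<m k (b i)} Int {m k (a j)..<m k (b j)}" by blast
   hence x: "m k (a i) <= x" "x < m k (b i)" "m k (a j) <= x" "x < m k (b j)" by auto
   have up: "a l < real (Suc x)/2^k" if "m k (a l) <= x" "l < n" for l
   proof -
   have "0 <= a l" using ab that by auto
   hence "2^k*a l < real (m k (a l)) + 1" unfolding m_def by (simp add: of_nat_nat)
   also have "... <= real (Suc x)" using that by simp
   finally show ?thesis by (simp add: less_divide_eq mult.commute)
   qed
   have lo: "real (Suc x)/2^k <= b l" if "x < m k (b l)" "l < n" for l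
   proof -
   have "0 <= b l" using ab that by force
   have "real (Suc x) <= real (m k (b l))" using that by simp
   also have "... <= 2^k*b l" unfolding m_def using \<open>0 <= b l\<close> by (simp add: of_nat_nat)
   finally show ?thesis by (simp add: divide_le_eq mult.commute)
   qed
   have "max (a i) (a j) < real (Suc x)/2^k" using up x ij by simp
   then obtain y where y: "max (a i) (a j) < y" "y < real (Suc x)/2^k" using dense by blast
   hence "y : {a i<..<b i} Int {a j<..<b j}" using lo[OF x(2) ij(1)] lo[OF x(4) ij(2)] by auto
   thus False using disj ij unfolding disjoint_family_on_def by blast
  qed
  have le: "(\<Sum>i<n. dist (ga (real (m k (a i))/2^k)) (ga (real (m k (b i))/2^k))) <=
   L*(\<Sum>i<n. real (m k (b i))/2^k - real (m k (a i))/2^k) + M/L powr (p - 1)" for k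
  proof -
   let ?J = "\<Union>i\<in>{..<n}. {m k (a i)..<m k (b i)}"
   have "(\<Sum>i<n. dist (ga (real (m k (a i))/2^k)) (ga (real (m k (b i))/2^k))) <=
   (\<Sum>i<n. \<Sum>j\<in>{m k (a i)..<m k (b i)}. dist (ga (real j/2^k)) (ga (real (Suc j)/2^k)))"
   using ab mm by (intro sum_mono dist_le_sum_steps[where ga = "%j. ga (real j/2^k)"]) auto
   also have "... = (\<Sum>j\<in>?J. dist (ga (real j/2^k)) (ga (real (Suc j)/2^k)))"
   using dj by (intro sum.UNION_disjoint[symmetric]) auto
   also have "... <= L*(real (card ?J)/2^k) + M/L powr (p - 1)"
   proof (rule dyadic_ac_continuity_aux[OF p M L])
   show "?J <= {..<2^k}"
   proof (intro UN_least subsetI)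
   fix i x assume "i : {..<n}" "x : {m k (a i)..<m k (b i)}"
   moreover have "m k (b i) <= 2^k" using ab \<open>i : {..<n}\<close> by (intro m1) force+
   ultimately show "x : {..<2^k}" by auto
   qed
   qed
   also have "real (card ?J)/2^k = (\<Sum>i<n. real (m k (b i))/2^k - real (m k (a i))/2^k)"
   proof -
   have "card ?J = (\<Sum>i<n. card {m k (a i)..<m k (b i)})" using dj by (intro card_UN_disjoint) auto
   also have "... = (\<Sum>i<n. m k (b i) - m k (a i))" by simp
   finally have "real (card ?J) = (\<Sum>i<n. real (m k (b i)) - real (m k (a i)))"
   using ab mm by (simp add: of_nat_diff)
   thus ?thesis by (simp add: sum_divide_distrib diff_divide_distrib)
   qed
   finally show ?thesis .
  qed
  have fl: "(%k. real (m k t)/2^k) ~> t" if "0 <= t" for t unfolding m_def by (rule dyadic_floor_tendsto[OF that])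
  have seq: "(%k. ga (real (m k u)/2^k)) ~> ga u" if u: "0 <= u" "u <= 1" for u
   by (rule continuous_on_tendsto_compose[OF cont fl[OF u(1)]]) (use u dyadic_le_1[OF m1[OF u]] in auto)
  have "(\<Sum>i<n. dist (ga (a i)) (ga (b i))) <= L*(\<Sum>i<n. b i - a i) + M/L powr (p - 1)"
  proof (rule LIMSEQ_le)
   show "(%k. \<Sum>i<n. dist (ga (real (m k (a i))/2^k)) (ga (real (m k (b i))/2^k))) ~> (\<Sum>i<n. dist (ga (a i)) (ga (b i)))"
   using ab by (intro tendsto_sum tendsto_dist seq) force+
   show "(%k. L*(\<Sum>i<n. real (m k (b i))/2^k - real (m k (a i))/2^k) + M/L powr (p - 1)) ~> L*(\<Sum>i<n. b i - a i) + M/L powr (p - 1)"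
   using ab by (intro tendsto_intros fl) force+
   show "\<exists>N. \<forall>k\<ge>N. (\<Sum>i<n. dist (ga (real (m k (a i))/2^k)) (ga (real (m k (b i))/2^k))) <=
   L*(\<Sum>i<n. real (m k (b i))/2^k - real (m k (a i))/2^k) + M/L powr (p - 1)" using le by blast
  qed
  also have "... < ep"
  proof -
   have "L*(\<Sum>i<n. b i - a i) <= L*de" using small L by (intro mult_left_mono) auto
   also have "... = ep/3" using L by (simp add: de_def)
   finally show ?thesis using MdL \<open>0 < ep\<close> by linarith
  qed
  finally show ?thesis .
 qed
 show "\<exists>de>0. \<forall>(n::nat) a b. (\<forall>i<n. 0 <= a i & a i <= b i & b i <= 1) &
   disjoint_family_on (%i. {a i<..<b i}) {..<n} & (\<Sum>i<n. b i - a i) < de -->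
   (\<Sum>i<n. dist (ga (a i)) (ga (b i))) < ep"
 proof (intro exI[of _ de] conjI allI impI)
  show "0 < de" using L \<open>0 < ep\<close> by (simp add: de_def)
  fix n :: nat and a b :: "nat => real"
  assume A: "(\<forall>i<n. 0 <= a i & a i <= b i & b i <= 1) & disjoint_family_on (%i. {a i<..<b i}) {..<n} & (\<Sum>i<n. b i - a i) < de"
  show "(\<Sum>i<n. dist (ga (a i)) (ga (b i))) < ep"
   by (rule main[of n a b]) (use A in auto)
 qed
qed

lemma E_dy_le_integral:
 fixes g v :: "real => real ^ 'n::finite"
 assumes gv: "ind_int g v" and p: "1 < p" and vi: "(%r. norm (v r) powr p) integrable_on {0..1}"
  and l: "!!s. s : {0..1} ==> torus_proj (g s) = ga s"
 shows "E_dy p k ga <= integral {0..1} (%r. norm (v r) powr p)"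
proof -
 have "(\<Sum>i<m. (2^k*increment ga k i) powr p/2^k) <= integral {0..real m/2^k} (%r. norm (v r) powr p)"
  if "m <= 2^k" for m using that
 proof (induction m)
  case (Suc m)
  define s t where "s = real m/2^k" and "t = real (Suc m)/2^k"
  have st: "0 <= s" "s < t" "t <= 1" using dyadic_le_1[OF Suc.prems] by (auto simp: s_def t_def divide_strict_right_mono)
  have ts: "t - s = 1/2^k" by (simp add: s_def t_def diff_divide_distrib[symmetric])
  have vi': "(%r. norm (v r) powr p) integrable_on {a..b}" if "0 <= a" "b <= 1" for a b
   using integrable_on_subinterval[OF vi, of a b] that by auto
  have "dist (ga s) (ga t) <= norm (g t - g s)"
   using dist_torus_le[of "g s" "g t"] l[of s] l[of t] st by (simp add: dist_norm norm_minus_commute)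
  hence "(2^k*dist (ga s) (ga t)) powr p <= (2^k*norm (g t - g s)) powr p"
   using p by (intro powr_mono2) auto
  hence "(2^k*dist (ga s) (ga t)) powr p/2^k <= (norm (g t - g s)/(t - s)) powr p*(t - s)"
   by (simp add: ts divide_right_mono mult.commute)
  also have "... <= integral {s..t} (%r. norm (v r) powr p)"
   using gv st unfolding ind_int_def by (intro jensen_interval p vi') auto
  finally have "(2^k*dist (ga s) (ga t)) powr p/2^k <= integral {s..t} (%r. norm (v r) powr p)" .
  moreover have "integral {0..s} (%r. norm (v r) powr p) + integral {s..t} (%r. norm (v r) powr p) = integral {0..t} (%r. norm (v r) powr p)"
   using st by (intro Henstock_Kurzweil_Integration.integral_combine vi') auto
  ultimately show ?case using Suc by (simp add: s_def t_def)
 qed simp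
 from this[of "2^k"] show ?thesis by (simp add: E_dy_def)
qed

text \<open>Jensen's inequality on every dyadic interval bounds dyadic energies by the energy. Conversely, bounded dyadic
energies force absolute continuity; the difference quotients then converge to the velocity almost everywhere
and Fatou's lemma applies.\<close>
theorem curve_energy_eq:
 fixes ga :: "real => 'n::finite torus"
 assumes a: "0 < al" "al < 1" and ga: "ga : curves"
 defines "p \<equiv> 2/(2 - al)"
 shows "curve_energy al ga = (SUP k. ennreal (E_dy p k ga))"
proof (rule antisym)
 have p: "1 < p" using a by (simp add: p_def field_simps)
 have cont: "continuous_on {0..1} ga" using ga by (simp add: curves_iff)
 obtain g where l: "is_lift ga g" using lift_exists[OF cont] .
 show "curve_energy al ga <= (SUP k. ennreal (E_dy p k ga))"
 proof (cases "(SUP k. ennreal (E_dy p k ga)) = \<infinity>")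
  case False
  then obtain M where M: "M >= 0" "(SUP k. ennreal (E_dy p k ga)) = ennreal M"
   by (metis ennreal_cases infinity_ennreal_def)
  have "ennreal (E_dy p k ga) <= ennreal M" for k unfolding M(2)[symmetric] by (rule SUP_upper) simp
  hence EM: "E_dy p k ga <= M" for k using M(1) by simp
  have ac: "abs_continuous_curve ga" by (rule E_dy_bounded_abs_continuous[OF p cont EM])
  have vm [measurable]: "velocity ga : bm (lebesgue_on {0..1})" by (rule velocity_measurable[OF ac l])
  have "(nn_integral (lebesgue_on {0..1}) (%t. ennreal (norm (velocity ga t) powr p))) = (nn_integral (lebesgue_on {0..1}) (%t. liminf (%k. ennreal (dq k ga t powr p))))"
  proof (rule nn_integral_cong_AE, use dq_tendsto_velocity[OF ac l] in eventually_elim)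
   fix t assume t: "(%k. dq k ga t) ~> norm (velocity ga t)"
   have "(%k. ennreal (dq k ga t powr p)) ~> ennreal (norm (velocity ga t) powr p)"
   using p by (intro tendsto_ennrealI tendsto_powr' t tendsto_const) (auto simp: dq_def)
   thus "ennreal (norm (velocity ga t) powr p) = liminf (%k. ennreal (dq k ga t powr p))"
   by (intro lim_imp_Liminf[symmetric]) auto
  qed
  also have "... <= liminf (%k. \<integral>\<^sup>+t. ennreal (dq k ga t powr p) \<partial>lebesgue_on {0..1})"
   unfolding dq_def by (intro nn_integral_liminf) measurable
  also have "... <= ennreal M"
   unfolding E_dy_eq_nn_integral[symmetric] using EM
   by (intro Liminf_le) (auto intro!: always_eventually ennreal_leI)
  finally have le: "(nn_integral (lebesgue_on {0..1}) (%t. ennreal (norm (velocity ga t) powr p))) <= ennreal M" .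
  hence "ga : W_curves al" unfolding W_curves_def p_def[symmetric] using ga ac vm by (auto simp: less_top[symmetric] top_unique)
  thus ?thesis using le unfolding curve_energy_def p_def[symmetric] M(2) by simp
 next
  case True
  thus ?thesis by (simp only: infinity_ennreal_def top_greatest)
 qed
 show "(SUP k. ennreal (E_dy p k ga)) <= curve_energy al ga"
 proof (cases "ga : W_curves al")
  case True
  hence ac: "abs_continuous_curve ga" and [measurable]: "velocity ga : bm (lebesgue_on {0..1})"
   and fin: "(nn_integral (lebesgue_on {0..1}) (%t. ennreal (norm (velocity ga t) powr p))) < \<infinity>"
   unfolding W_curves_def p_def by auto
  have gi: "ind_int g (velocity ga)" using abs_continuous_velocity[OF ac l] by blast
  have int: "integrable (lebesgue_on {0..1}) (%t. norm (velocity ga t) powr p)"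
   using fin by (intro integrableI_bounded) auto
  hence hk: "(%t. norm (velocity ga t) powr p) integrable_on {0..1}"
   by (simp add: integrable_on_lebesgue_on)
  have "ennreal (E_dy p k ga) <= curve_energy al ga" for k
  proof -
   have "E_dy p k ga <= integral {0..1} (%r. norm (velocity ga r) powr p)"
   using l unfolding is_lift_def by (intro E_dy_le_integral[OF gi p hk]) auto
   also have "... = integral\<^sup>L (lebesgue_on {0..1}) (%t. norm (velocity ga t) powr p)"
   using int by (intro lebesgue_integral_eq_integral[symmetric]) auto
   finally have "ennreal (E_dy p k ga) <= ennreal (integral\<^sup>L (lebesgue_on {0..1}) (%t. norm (velocity ga t) powr p))"
   by (rule ennreal_leI)
   also have "... = (nn_integral (lebesgue_on {0..1}) (%t. ennreal (norm (velocity ga t) powr p)))"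
   by (intro nn_integral_eq_integral[symmetric] int) auto
   finally show ?thesis using True by (simp add: curve_energy_def p_def)
  qed
  thus ?thesis by (intro SUP_least)
 qed (simp add: curve_energy_def)
qed

section \<open>Measures bounded through continuous functions\<close>

text \<open>These functions decrease to the indicator of the closed set \<open>F\<close>. The distance to the empty set is
zero by convention, so that case is separate.\<close>
definition hat :: "'a::metric_space set => nat => 'a => real" where
 "hat F m x = (if F = {} then 0 else max 0 (1 - real m*infdist x F))"

lemma hat_props:
 "cont (hat F m)" "0 <= hat F m x" "hat F m x <= 1"
 unfolding hat_def[abs_def] by (cases "F = {}"; auto intro!: continuous_intros infdist_nonneg mult_nonneg_nonneg)+

lemma hat_tendsto:
 assumes "closed F"
 shows "(%m. hat F m x) ~> indicator F x"
proof (cases "F = {}")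
 case ne: False
 show ?thesis
proof (cases "x : F")
 case True thus ?thesis using ne by (simp add: hat_def)
next
 case False
 hence d: "infdist x F > 0" using assms in_closed_iff_infdist_zero[OF assms ne, of x] infdist_nonneg[of x F] by linarith
 obtain N :: nat where N: "1/infdist x F <= real N" using real_arch_simple by blast
 have "hat F m x = 0" if "N <= m" for m
 proof -
  have "1/infdist x F <= real m" using N that by linarith
  hence "1 <= real m*infdist x F" using d by (simp add: pos_divide_le_eq)
  thus ?thesis by (simp add: hat_def)
 qed
 hence "\<forall>\<^sub>F m in sequentially. hat F m x = 0" unfolding eventually_sequentially by blast
 thus ?thesis using False by (simp add: tendsto_eventually)
qed
qed (simp add: hat_def)

lemma Int_stable_closed: "Int_stable {S. closed S}"
 by (auto simp: Int_stable_def)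

lemma continuous_measurable_restrict:
 assumes "sets M = sets (restrict_space borel C)" "cont f"
 shows "f : bm M"
proof -
 have "f : bm borel" using assms(2) by (rule borel_measurable_continuous_onI)
 hence "f : bm (restrict_space borel C)" by (rule measurable_restrict_space1)
 thus ?thesis by (simp add: measurable_cong_sets[OF assms(1) refl])
qed

lemma indicator_measurable_restrict:
 assumes "sets M = sets (restrict_space borel C)" "A : sets borel"
 shows "(indicator A :: _ => real) : bm M"
proof -
 have "(indicator A :: _ => real) : bm borel" using assms(2) by (rule borel_measurable_indicator)
 hence "(indicator A :: _ => real) : bm (restrict_space borel C)" by (rule measurable_restrict_space1)
 thus ?thesis by (simp add: measurable_cong_sets[OF assms(1) refl])
qed

lemma finite_measure_eqI_continuous:
 fixes M N :: "'a::metric_space measure"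
 assumes M: "finite_measure M" "sets M = sets (restrict_space borel C)"
  and N: "finite_measure N" "sets N = sets (restrict_space borel C)"
  and eq: "!!f. cont f ==> (!!x. 0 <= f x) ==> (!!x. f x <= 1) ==> integral\<^sup>L M f = (integral\<^sup>L N f :: real)"
 shows "M = N"
proof -
 have id: "id : measurable L borel" if "sets L = sets (restrict_space borel C)" for L :: "'a measure"
 proof -
  have "id : measurable (restrict_space borel C) borel" by (intro measurable_restrict_space1) simp
  thus ?thesis using measurable_cong_sets[OF that refl] by blast
 qed
 have sp: "space L = C" if "sets L = sets (restrict_space borel C)" for L :: "'a measure"
  using sets_eq_imp_space_eq[OF that] by (simp add: space_restrict_space)
 have closed_eq: "emeasure M (F Int C) = emeasure N (F Int C)" if F: "closed F" for F
 proof (cases "F = {}")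
  case False
  have *: "(%m. integral\<^sup>L L (hat F m)) ~> measure L (F Int C)"
   if L: "finite_measure L" "sets L = sets (restrict_space borel C)" for L :: "'a measure"
  proof -
   interpret finite_measure L by (rule L)
   have "(%m. integral\<^sup>L L (hat F m)) ~> integral\<^sup>L L (indicator F)"
   proof (rule integral_dominated_convergence[where w = "%_. 1"])
   show "(indicator F :: _ => real) : bm L" using F by (intro indicator_measurable_restrict[OF L(2)]) auto
   show "hat F m : bm L" for m by (rule continuous_measurable_restrict[OF L(2) hat_props(1)])
   show "AE x in L. (%m. hat F m x) ~> indicator F x" using hat_tendsto[OF F] by simp
   show "AE x in L. norm (hat F m x) <= 1" for m using hat_props(2,3)[of F m] by simp
   qed simp
   moreover have "integral\<^sup>L L (indicator F) = measure L (F Int C)"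
   by (simp add: sp[OF L(2)])
   ultimately show ?thesis by simp
  qed
  have "measure M (F Int C) = measure N (F Int C)"
   using LIMSEQ_unique[OF *[OF M]] *[OF N] eq[OF hat_props(1) hat_props(2,3)] by simp
  thus ?thesis using M(1) N(1) by (simp add: finite_measure.emeasure_eq_measure)
 qed simp
 have d: "distr M borel id = distr N borel id"
 proof (rule measure_eqI_generator_eq[OF Int_stable_closed, where \<Omega> = UNIV and A = "%_. UNIV"])
  fix X :: "'a set" assume "X : {S. closed S}"
  thus "emeasure (distr M borel id) X = emeasure (distr N borel id) X"
   using closed_eq[of X] by (simp add: emeasure_distr id[OF M(2)] id[OF N(2)] sp[OF M(2)] sp[OF N(2)])
 next
  show "emeasure (distr M borel id) UNIV ~= \<infinity>"
   using M(1) by (simp add: emeasure_distr id[OF M(2)] finite_measure.emeasure_eq_measure)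
 qed (auto simp: borel_eq_closed)
 show ?thesis
 proof (rule measure_eqI)
  fix A assume A: "A : sets M"
  then obtain B where B: "B : sets borel" "A = C Int B" using M(2) by (auto simp: sets_restrict_space)
  have "emeasure L A = emeasure (distr L borel id) B" if "sets L = sets (restrict_space borel C)" for L
   using B by (simp add: emeasure_distr id[OF that] sp[OF that] Int_commute)
  thus "emeasure M A = emeasure N A" using M(2) N(2) d by simp
 qed (simp add: M N)
qed

lemma closed_inner_approx:
 fixes M :: "'a::{second_countable_topology, complete_space} measure"
 assumes M: "finite_measure M" "sets M = sets (restrict_space borel C)" and A: "A : sets M" and e: "0 < e"
 obtains K where "closed K" "K Int C <= A" "measure M A <= measure M (K Int C) + e"
proof -
 interpret finite_measure M by fact
 have sp: "space M = C" using sets_eq_imp_space_eq[OF M(2)] by (simp add: space_restrict_space)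
 have id: "id : measurable M borel"
  using measurable_restrict_space1[of id borel borel C] by (simp add: measurable_cong_sets[OF M(2) refl])
 obtain B where B: "B : sets borel" "A = C Int B" using A unfolding M(2) sets_restrict_space by auto
 define N where "N = distr M borel id"
 have N: "emeasure N X = ennreal (measure M (X Int C))" if "X : sets borel" for X
  unfolding N_def using that id sp by (simp add: emeasure_distr emeasure_eq_measure)
 have "emeasure N B = (SUP K\<in>{K. K <= B & compact K}. emeasure N K)"
  by (rule inner_regular) (use B N[of UNIV] in \<open>auto simp: N_def\<close>)
 moreover have "ennreal (measure M A - e) < emeasure N B | measure M A <= e"
  using N[OF B(1)] e B(2) by (auto simp: Int_commute ennreal_less_iff)
 ultimately consider "measure M A <= e" | K where "K <= B" "compact K" "ennreal (measure M A - e) < emeasure N K"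
  by (auto simp: less_SUP_iff)
 thus ?thesis
 proof cases
  case 1 thus ?thesis using that[of "{}"] by simp
 next
  case 2
  hence "measure M A - e < measure M (K Int C)" using N[of K] borel_compact[of K] by (simp add: ennreal_less_iff ennreal_lessI linorder_not_le[symmetric])
   (metis ennreal_leI linorder_not_le)
  thus ?thesis using 2 B by (intro that[of K]) (auto simp: compact_imp_closed)
 qed
qed

text \<open>Large multiples of continuous approximations to the indicator of a null set show absolute continuity. The
second part comes from testing with approximations to powers of truncations of the density itself, which is
the case of equality in Young's inequality.\<close>
theorem density_bound:
 fixes sg \<mu> :: "'a::{second_countable_topology, complete_space} measure"
 assumes sg: "finite_measure sg" "sets sg = sets (restrict_space borel C)"
  and \<mu>: "finite_measure \<mu>" "sets \<mu> = sets (restrict_space borel C)"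
  and q: "1 < q" and A: "0 <= A"
  and bound: "!!f B. cont f ==> (!!x. 0 <= f x) ==> (!!x. f x <= B) ==>
   (LINT x|sg. f x) <= A/q + (LINT x|\<mu>. f x powr (q/(q - 1)))/(q/(q - 1))"
 shows "absolutely_continuous \<mu> sg"
  and "(nn_integral \<mu> (%z. ennreal (enn2real (RN_deriv \<mu> sg z) powr q))) <= ennreal A"
proof -
 interpret S: finite_measure sg by (rule sg)
 interpret L: finite_measure \<mu> by (rule \<mu>)
 define q' where "q' = q/(q - 1)"
 have q': "1 < q'" "1/q + 1/q' = 1" "(q - 1)*q' = q" using q by (auto simp: q'_def field_simps)
 have sets_eq: "sets sg = sets \<mu>" using sg \<mu> by simp
 have mc: "f : bm sg \<longleftrightarrow> f : bm \<mu>" for f :: "'a => real"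
  by (simp add: measurable_cong_sets[OF sets_eq refl])
 have sp: "space sg = C" "space \<mu> = C"
  using sets_eq_imp_space_eq[OF sg(2)] sets_eq_imp_space_eq[OF \<mu>(2)] by (simp_all add: space_restrict_space)
 have simple_closed: "(\<Sum>j\<in>J. h*measure sg (K j Int C)) <= A/q + (LINT x|\<mu>. (\<Sum>j\<in>J. h*indicator (K j) x) powr q')/q'"
  if J: "finite J" and h: "0 <= h" and K: "!!j. closed (K j)" for J :: "nat set" and h K
 proof -
  let ?f = "%m x. \<Sum>j\<in>J. h*hat (K j) m x" and ?g = "%x. \<Sum>j\<in>J. h*indicator (K j) x"
  have fc: "cont (?f m)" for m by (intro continuous_intros hat_props)
  have f0: "0 <= ?f m x" for m x by (intro sum_nonneg mult_nonneg_nonneg h hat_props(2))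
  have fT: "?f m x <= h*real (card J)" for m x
  proof -
   have "h*hat (K i) m x <= h" for i using h hat_props(3)[of "K i" m x] by (simp add: mult_left_le)
   thus ?thesis using sum_bounded_above[of J "%j. h*hat (K j) m x" h] by (simp add: mult.commute)
  qed
  have lim: "(%m. ?f m x) ~> ?g x" for x by (intro tendsto_sum tendsto_mult tendsto_const hat_tendsto K)
  have gm: "(indicator (K j) :: 'a => real) : bm M" if "sets M = sets (restrict_space borel C)" for j and M :: "'a measure"
   by (rule borel_measurable_LIMSEQ_real[OF hat_tendsto[OF K]]) (rule continuous_measurable_restrict[OF that hat_props(1)])
  have gs: "?g : bm M" if "sets M = sets (restrict_space borel C)" for M :: "'a measure"
   by (intro borel_measurable_sum borel_measurable_times borel_measurable_const gm that)
  have fs: "?f m : bm M" if "sets M = sets (restrict_space borel C)" for m and M :: "'a measure"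
   by (rule continuous_measurable_restrict[OF that fc])
  have "(%m. \<integral>x. ?f m x \<partial>sg) ~> (LINT x|sg. ?g x)"
  proof (rule integral_dominated_convergence[where w = "%_. h*real (card J)"])
   show "AE x in sg. (%m. ?f m x) ~> ?g x" by (intro AE_I2 lim)
   show "AE x in sg. norm (?f m x) <= h*real (card J)" for m
   using fT[of m] f0[of m] by (intro AE_I2) (simp only: real_norm_def abs_of_nonneg)
  qed (simp_all add: gs[OF sg(2)] fs[OF sg(2)])
  moreover have "(%m. \<integral>x. ?f m x powr q' \<partial>\<mu>) ~> (LINT x|\<mu>. ?g x powr q')"
  proof (rule integral_dominated_convergence[where w = "%_. (h*real (card J)) powr q'"])
   show "AE x in \<mu>. (%m. ?f m x powr q') ~> ?g x powr q'"
   using q' by (intro AE_I2 tendsto_powr2 lim tendsto_const always_eventually allI f0) auto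
   show "AE x in \<mu>. norm (?f m x powr q') <= (h*real (card J)) powr q'" for m
   proof (rule AE_I2)
   fix x have "?f m x powr q' <= (h*real (card J)) powr q'" by (intro powr_mono2 fT f0) (use q' in auto)
   thus "norm (?f m x powr q') <= (h*real (card J)) powr q'" by (simp only: real_norm_def abs_of_nonneg powr_ge_zero)
   qed
   show "(%x. ?g x powr q') : bm \<mu>" using gs[OF \<mu>(2)] by measurable
   show "(%x. ?f m x powr q') : bm \<mu>" for m using fs[OF \<mu>(2), of m] by measurable
  qed simp
  hence "(%m. A/q + (LINT x|\<mu>. ?f m x powr q')/q') ~> A/q + (LINT x|\<mu>. ?g x powr q')/q'" using q' by (intro tendsto_intros) auto
  ultimately have "(LINT x|sg. ?g x) <= A/q + (LINT x|\<mu>. ?g x powr q')/q'"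
   using bound[OF fc f0 fT] by (intro LIMSEQ_le) (auto simp: q'_def)
  moreover have "(LINT x|sg. ?g x) = (\<Sum>j\<in>J. h*measure sg (K j Int C))"
  proof -
   have "integrable sg (indicator (K j) :: 'a => real)" for j by (intro S.integrable_const_bound[where B = 1] gm[OF sg(2)]) auto
   moreover have "K j Int C : sets sg" for j unfolding sg(2) sets_restrict_space using borel_closed[OF K] by auto
   ultimately show ?thesis by (simp add: sp)
  qed
  ultimately show ?thesis by simp
 qed
 have ext: "(LINT x|sg. f x) <= A/q + (LINT x|\<mu>. f x powr q')/q'"
  if fm [measurable]: "f : bm \<mu>" and f0: "!!x. 0 <= f x" and fT: "!!x. f x <= T" and T: "0 < T" for f T
 proof (rule field_le_epsilon)
  fix e :: real assume e: "0 < e"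
  have fmsg [measurable]: "f : bm sg" using fm by (simp add: mc)
  define m where "m = measure sg C"
  define n where "n = nat \<lceil>2*T*(m + 1)/e\<rceil> + 1"
  define h where "h = T/real n"
  have m0: "0 <= m" by (simp add: m_def)
  have h: "0 < h" "h*real n = T" using T by (auto simp: h_def n_def)
  have hm: "h*m <= e/2"
  proof -
   have "2*T*(m + 1)/e <= real n" unfolding n_def by linarith
   hence "2*T*(m + 1) <= real n*e" using e by (simp add: pos_divide_le_eq)
   hence "2*T*m <= real n*e" using T by (simp add: distrib_left)
   thus ?thesis unfolding h_def using h by (simp add: field_simps n_def)
  qed
  define L where "L j = {x : C. real j*h <= f x}" for j
  have Ls: "L j : sets sg" for j unfolding L_def sp(1)[symmetric] by measurable
  have e': "0 < e/(2*T)" using e T by simp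
  have "\<exists>K. closed K & K Int C <= L j & measure sg (L j) <= measure sg (K Int C) + e/(2*T)" for j
   using closed_inner_approx[OF sg Ls e'] by metis
  then obtain K where K: "!!j. closed (K j)" "!!j. K j Int C <= L j" "!!j. measure sg (L j) <= measure sg (K j Int C) + e/(2*T)" by metis
  let ?J = "{1..n}"
  have cnt: "(\<Sum>j\<in>?J. h*indicator (L j) x) = h*real_of_int \<lfloor>f x/h\<rfloor>" if x: "x : C" for x
  proof -
   have 1: "f x/h <= real n" using fT[of x] h by (simp add: pos_divide_le_eq mult.commute)
   have 0: "0 <= f x/h" using f0 h by simp
   have "?J Int {j. x : L j} = {1..nat \<lfloor>f x/h\<rfloor>}"
   using 0 1 x h by (auto simp: L_def pos_le_divide_eq[symmetric] le_nat_floor le_floor_iff nat_le_iff floor_le_iff) linarith+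
   thus ?thesis using 0 by (simp add: indicator_def sum_distrib_left[symmetric] sum.If_cases)
  qed
  have iL: "integrable sg (%x. h*indicator (L j) x)" for j
   by (intro integrable_mult_right S.integrable_const_bound[where B = 1]) (use Ls in auto)
  have sI: "integrable sg (%x. \<Sum>j\<in>?J. h*indicator (L j) x)" by (rule Bochner_Integration.integrable_sum) (rule iL)
  have "(LINT x|sg. f x) <= (LINT x|sg. (\<Sum>j\<in>?J. h*indicator (L j) x) + h)"
  proof (rule integral_mono_AE)
   show "integrable sg f" using f0 fT by (intro S.integrable_const_bound[where B = T]) auto
   show "integrable sg (%x. (\<Sum>j\<in>?J. h*indicator (L j) x) + h)" by (intro Bochner_Integration.integrable_add sI) simp
   show "AE x in sg. f x <= (\<Sum>j\<in>?J. h*indicator (L j) x) + h"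
   proof (rule AE_I2)
   fix x assume "x : space sg"
   hence "x : C" by (simp add: sp)
   have "f x/h <= \<lfloor>f x/h\<rfloor> + 1" by linarith
   from this[unfolded pos_divide_le_eq[OF h(1)]] have "f x <= (\<lfloor>f x/h\<rfloor> + 1)*h" .
   thus "f x <= (\<Sum>j\<in>?J. h*indicator (L j) x) + h" unfolding cnt[OF \<open>x : C\<close>] by (simp add: algebra_simps)
   qed
  qed
  also have "... = (\<Sum>j\<in>?J. h*measure sg (L j)) + h*m"
  proof -
   have "L j Int C = L j" for j by (auto simp: L_def)
   hence "(LINT x|sg. (\<Sum>j\<in>?J. h*indicator (L j) x)) = (\<Sum>j\<in>?J. h*measure sg (L j))"
   by (subst Bochner_Integration.integral_sum[OF iL]) (simp add: sp)
   moreover have "(LINT x|sg. h) = h*m" by (simp add: m_def sp)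
   ultimately show ?thesis using Bochner_Integration.integral_add[OF sI, of "%_. h"] by simp
  qed
  also have "(\<Sum>j\<in>?J. h*measure sg (L j)) <= (\<Sum>j\<in>?J. h*measure sg (K j Int C) + h*(e/(2*T)))"
   unfolding distrib_left[symmetric] using h by (intro sum_mono mult_left_mono K(3)) simp
  also have "... = (\<Sum>j\<in>?J. h*measure sg (K j Int C)) + e/2"
   using h T by (simp add: sum.distrib mult.assoc[symmetric] mult.commute[of "real n"])
  also have "(\<Sum>j\<in>?J. h*measure sg (K j Int C)) <= A/q + (LINT x|\<mu>. (\<Sum>j\<in>?J. h*indicator (K j) x) powr q')/q'"
   using h K by (intro simple_closed) auto
  also have "(LINT x|\<mu>. (\<Sum>j\<in>?J. h*indicator (K j) x) powr q') <= (LINT x|\<mu>. f x powr q')"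
  proof (rule integral_mono')
   show "integrable \<mu> (%x. f x powr q')"
   using f0 fT q' by (intro L.integrable_const_bound[where B = "T powr q'"]) (auto intro!: powr_mono2)
   fix x assume "x : space \<mu>"
   hence x: "x : C" by (simp add: sp)
   have "(\<Sum>j\<in>?J. h*indicator (K j) x) <= (\<Sum>j\<in>?J. h*indicator (L j) x)"
   using K(2) x h by (intro sum_mono mult_left_mono) (auto simp: indicator_def)
   also have "... <= h*(f x/h)" unfolding cnt[OF x] using h by (intro mult_left_mono) auto
   finally show "(\<Sum>j\<in>?J. h*indicator (K j) x) powr q' <= f x powr q'"
   using h q' by (intro powr_mono2) (auto intro!: sum_nonneg)
  qed simp
  finally show "(LINT x|sg. f x) <= A/q + (LINT x|\<mu>. f x powr q')/q' + e"
   using q' hm by (simp add: divide_right_mono)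
 qed
 show ac: "absolutely_continuous \<mu> sg"
  unfolding absolutely_continuous_def
 proof
  fix N assume N: "N : null_sets \<mu>"
  hence Ns: "N : sets \<mu>" by auto
  have "real n*measure sg N <= A/q" if "0 < n" for n :: nat
  proof -
   have "(LINT x|sg. real n*indicator N x) <= A/q + (LINT x|\<mu>. (real n*indicator N x) powr q')/q'"
   using Ns that by (intro ext[of _ "real n"]) (auto simp: indicator_def)
   also have "(LINT x|\<mu>. (real n*indicator N x) powr q') = 0"
   using AE_not_in[OF N] by (intro integral_eq_zero_AE) (auto elim!: eventually_mono simp: indicator_def)
   finally show ?thesis using Ns sets_eq by (simp add: sets.Int_space_eq2)
  qed
  hence nA: "!!n::nat. 0 < n ==> real n*measure sg N <= A/q" .
  have "measure sg N = 0"
  proof (rule ccontr)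
   assume "measure sg N ~= 0"
   hence pos: "measure sg N > 0" using measure_nonneg[of sg N] by linarith
   define c where "c = A/q"
   obtain n :: nat where n: "c/measure sg N < real n" using reals_Archimedean2 by blast
   hence "c < real n*measure sg N" unfolding pos_divide_less_eq[OF pos] .
   hence "A/q < real n*measure sg N" unfolding c_def .
   moreover have "0 <= c/measure sg N" using A q pos by (simp add: c_def)
   hence "0 < n" using n by linarith
   ultimately show False using nA[of n] by linarith
  qed
  thus "N : null_sets sg" using Ns sets_eq by (intro null_setsI) (auto simp: S.emeasure_eq_measure)
 qed
 define s where "s z = enn2real (RN_deriv \<mu> sg z)" for z
 have sm [measurable]: "s : bm \<mu>" unfolding s_def by measurable
 have s0: "s z >= 0" for z by (simp add: s_def)
 have "AE x in \<mu>. RN_deriv \<mu> sg x ~= \<infinity>"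
  by (rule L.RN_deriv_finite[OF S.sigma_finite_measure_axioms ac sets_eq])
 hence dens: "density \<mu> (%x. ennreal (s x)) = sg"
  by (subst L.density_RN_deriv[OF ac sets_eq, symmetric], intro density_cong)
   (auto simp: s_def top.not_eq_extremum ennreal_enn2real)
 have trunc: "(nn_integral \<mu> (%z. ennreal (min (s z) T powr q))) <= ennreal A" if T: "0 < T" for T
 proof -
  define m where "m z = min (s z) T" for z
  have m0: "0 <= m z" "m z <= T" "m z <= s z" for z using s0[of z] T by (auto simp: m_def)
  have mm [measurable]: "m : bm \<mu>" unfolding m_def by measurable
  let ?f = "%z. m z powr (q - 1)"
  have fT: "?f z <= T powr (q - 1)" for z using m0[of z] q by (intro powr_mono2) auto
  have mT: "m z powr q <= T powr q" for z using m0[of z] q by (intro powr_mono2) auto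
  have mi: "integrable \<mu> (%z. m z powr q)" using mT by (intro L.integrable_const_bound[of _ "T powr q"]) auto
  have fs: "integrable sg ?f" using fT by (intro S.integrable_const_bound[of _ "T powr (q - 1)"]) (auto simp: mc)
  hence "integrable (density \<mu> (%x. ennreal (s x))) ?f" unfolding dens .
  hence fs': "integrable \<mu> (%z. s z*?f z)" using s0 by (subst (asm) integrable_density) auto
  have "(LINT z|\<mu>. m z powr q) <= (LINT z|\<mu>. s z*?f z)"
  proof (rule integral_mono[OF mi fs'])
   fix z
   have "m z powr q = m z*m z powr (q - 1)"
   using m0(1)[of z] powr_add[of "m z" 1 "q - 1"] by (cases "m z = 0") auto
   also have "... <= s z*?f z" using m0[of z] by (intro mult_right_mono) auto
   finally show "m z powr q <= s z*?f z" .
  qed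
  also have "... = (LINT z|density \<mu> (%x. ennreal (s x)). ?f z)" using s0 by (subst integral_density) auto
  also have "... = (LINT z|sg. ?f z)" by (simp only: dens)
  also have "... <= A/q + (LINT z|\<mu>. ?f z powr q')/q'"
   using fT T by (intro ext[of _ "T powr (q - 1)"]) auto
  also have "(%z. ?f z powr q') = (%z. m z powr q)" using q'(3) by (simp add: powr_powr)
  finally have "(LINT z|\<mu>. m z powr q)*(1 - 1/q') <= A/q" by (simp add: algebra_simps)
  also have "1 - 1/q' = 1/q" using q'(2) by simp
  finally have "(LINT z|\<mu>. m z powr q) <= A" using q by (simp add: divide_le_cancel)
  thus ?thesis using nn_integral_eq_integral[OF mi] by (simp add: m_def ennreal_leI)
 qed
 have "(nn_integral \<mu> (%z. ennreal (s z powr q))) = (nn_integral \<mu> (%z. liminf (%n. ennreal (min (s z) (real (Suc n)) powr q))))"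
 proof (rule nn_integral_cong)
  fix z
  obtain N :: nat where N: "s z <= real N" using real_arch_simple by blast
  have "\<forall>\<^sub>F n in sequentially. ennreal (min (s z) (real (Suc n)) powr q) = ennreal (s z powr q)"
   unfolding eventually_sequentially using N by (intro exI[of _ N]) (auto simp: min_def)
  thus "ennreal (s z powr q) = liminf (%n. ennreal (min (s z) (real (Suc n)) powr q))"
   by (intro lim_imp_Liminf[symmetric] tendsto_eventually) auto
 qed
 also have "... <= liminf (%n. \<integral>\<^sup>+z. ennreal (min (s z) (real (Suc n)) powr q) \<partial>\<mu>)"
  by (intro nn_integral_liminf) measurable
 also have "... <= ennreal A" using trunc by (intro Liminf_le) (auto intro!: always_eventually)
 finally show "(nn_integral \<mu> (%z. ennreal (enn2real (RN_deriv \<mu> sg z) powr q))) <= ennreal A" by (simp add: s_def)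
qed

section \<open>Joint measurability of the velocity\<close>

lemma curve_mdist_le:
 assumes "ga : (curves :: (real => 'n::finite torus) set)" "de : curves"
 shows "mdist curve_metric ga de <= a \<longleftrightarrow> (ALL t:{0..1}. dist (ga t) (de t) <= a)"
 using cfunspace_mdist_le[of ga "top_of_set {0..1}" euclidean_metric de a] assms
 by (simp add: curve_metric_def)

lemma openin_curves_iff:
 "openin (mtopology_of (curve_metric :: (real => 'n::finite torus) metric)) U \<longleftrightarrow>
  U <= curves & (ALL ga:U. \<exists>r>0. ALL de:curves. mdist curve_metric ga de < r --> de : U)"
 unfolding mtopology_of_def
 by (subst Metric_space.openin_mtopology[OF Metric_space_mspace_mdist])
  (unfold Metric_space.mball_def[OF Metric_space_mspace_mdist], blast)

lemma space_curves_borel: "space curves_borel = (curves :: (real => 'n::finite torus) set)"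
 unfolding curves_borel_def using openin_curves_iff by (intro space_measure_of) blast

lemma sets_curves_borel: "sets curves_borel = sigma_sets (curves :: (real => 'n::finite torus) set) {U. openin (mtopology_of curve_metric) U}"
 unfolding curves_borel_def using openin_curves_iff by (intro sets_measure_of) blast

lemma eval_measurable [measurable]:
 "(%ga. ga r) : bm (curves_borel :: (real => 'n::finite torus) measure)"
proof (cases "r : {0..1}")
 case True
 show ?thesis
 proof (rule borel_measurableI)
  fix S :: "'n torus set" assume "open S"
  have "openin (mtopology_of curve_metric) {ga : curves. ga r : S}"
   unfolding openin_curves_iff
  proof (intro conjI ballI)
   fix ga :: "real => 'n torus" assume ga: "ga : {ga : curves. ga r : S}"
   then obtain e where e: "e > 0" "!!y. dist y (ga r) < e ==> y : S" using \<open>open S\<close> unfolding open_dist by blast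
   have "de r : S" if de: "de : curves" "mdist curve_metric ga de < e" for de
   proof -
   have "dist (ga r) (de r) <= mdist curve_metric ga de" using curve_mdist_le[of ga de "mdist curve_metric ga de"] ga de True by blast
   thus ?thesis using e(2) de(2) by (simp add: dist_commute)
   qed
   thus "\<exists>r'>0. ALL de:curves. mdist curve_metric ga de < r' --> de : {ga : curves. ga r : S}" using e(1) by blast
  qed auto
  thus "(%ga. ga r) -` S Int space curves_borel : sets curves_borel"
   unfolding sets_curves_borel space_curves_borel by (intro sigma_sets.Basic) (auto simp: vimage_def Int_def conj_commute)
 qed
next
 case False
 have "(%ga. undefined) : bm (curves_borel :: (real => 'n::finite torus) measure)" by simp
 moreover have "ga r = undefined" if "ga : space (curves_borel :: (real => 'n::finite torus) measure)" for ga
  using that False unfolding space_curves_borel curves_iff extensional_def by auto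
 ultimately show ?thesis by (subst measurable_cong[where g = "%_. undefined"]) auto
qed

abbreviation I01 :: "real measure" where "I01 \<equiv> restrict_space lborel {0..1}"

lemma nn_integral_I01:
 assumes "h : bm I01"
 shows "(nn_integral (lebesgue_on {0..1}) (%s. h s)) = (nn_integral I01 (%s. h s))"
proof -
 have m: "(%s. h s*indicator {0..1} s) : bm lborel"
  using assms by (subst (asm) borel_measurable_restrict_space_iff_ennreal) auto
 have "(nn_integral (lebesgue_on {0..1}) (%s. h s)) = (nn_integral lebesgue (%s. h s*indicator {0..1} s))"
  by (subst nn_integral_restrict_space) auto
 also have "... = (nn_integral lborel (%s. h s*indicator {0..1} s))" by (rule nn_integral_completion)
 also have "... = (nn_integral I01 (%s. h s))" by (subst nn_integral_restrict_space) auto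
 finally show ?thesis .
qed

lemma integral_I01:
 fixes h :: "real => real"
 assumes "h : bm I01"
 shows "(LINT s|lebesgue_on {0..1}. h s) = (LINT s|I01. h s)"
proof -
 have m: "(%s. indicator {0..1} s *\<^sub>R h s) : bm lborel"
  using assms by (subst (asm) borel_measurable_restrict_space_iff) auto
 have "(LINT s|lebesgue_on {0..1}. h s) = (LINT s|lebesgue. indicator {0..1} s *\<^sub>R h s)"
  by (subst integral_restrict_space) auto
 also have "... = (LINT s|lborel. indicator {0..1} s *\<^sub>R h s)" using m by (rule integral_completion)
 also have "... = (LINT s|I01. h s)" by (subst integral_restrict_space) auto
 finally show ?thesis .
qed

lemma finite_I01: "prob_space I01"
 by (intro prob_spaceI) (simp add: emeasure_restrict_space space_restrict_space)

lemma space_I01: "space I01 = {0..1}" by (simp add: space_restrict_space)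

abbreviation CI :: "((real => 'n::finite torus) \<times> real) measure" where "CI \<equiv> curves_borel \<Otimes>\<^sub>M I01"

lemma space_CI: "z : space (CI :: ((real => 'n::finite torus) \<times> real) measure) \<longleftrightarrow> fst z : curves & snd z : {0..1}"
 by (cases z) (auto simp: space_pair_measure space_curves_borel space_restrict_space)

lemma snd_CI [measurable]: "snd : bm CI"
proof -
 have "snd : measurable CI I01" by measurable
 moreover have "(%s. s) : measurable I01 borel" by (intro measurable_restrict_space1) simp
 ultimately show ?thesis using measurable_compose by fastforce
qed

lemma eval_fixed_CI [measurable]:
 "(%z. fst z r) : bm (CI :: ((real => 'n::finite torus) \<times> real) measure)"
 by (rule measurable_compose[OF measurable_fst eval_measurable])

lemma eval_index_CI:
 assumes "(%z. i z) : measurable (CI :: ((real => 'n::finite torus) \<times> real) measure) (count_space UNIV)"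
 shows "(%z. fst z (real (i z)/2^k)) : bm (CI :: ((real => 'n::finite torus) \<times> real) measure)"
 by (rule measurable_compose_countable[OF eval_fixed_CI assms])

lemma eval_joint_CI [measurable]:
 "(%z. fst z (snd z)) : bm (CI :: ((real => 'n::finite torus) \<times> real) measure)"
proof (rule borel_measurable_LIMSEQ_metric)
 show "(%z. fst z (real (nat \<lfloor>2^k * snd z\<rfloor>)/2^k)) : bm (CI :: ((real => 'n::finite torus) \<times> real) measure)" for k
  by (rule eval_index_CI) measurable
 fix z assume "z : space (CI :: ((real => 'n::finite torus) \<times> real) measure)"
 hence z: "continuous_on {0..1} (fst z)" "0 <= snd z" "snd z <= 1" by (auto simp: space_CI curves_iff)
 show "(%k. fst z (real (nat \<lfloor>2^k * snd z\<rfloor>)/2^k)) ~> fst z (snd z)"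
 proof (rule continuous_on_tendsto_compose[OF z(1) dyadic_floor_tendsto[OF z(2)]])
  have "real (nat \<lfloor>2^k * snd z\<rfloor>)/2^k <= 1" for k
  proof -
   have "real (nat \<lfloor>2^k * snd z\<rfloor>) <= 2^k * snd z" using z by (simp add: of_nat_nat)
   also have "... <= 2^k*1" using z by (intro mult_left_mono) auto
   finally show ?thesis by simp
  qed
  thus "\<forall>\<^sub>F k in sequentially. real (nat \<lfloor>2^k * snd z\<rfloor>)/2^k : {0..1}" by auto
 qed (use z in auto)
qed

definition sdiff :: "'n => 'n::finite torus => 'n torus => real" where
 "sdiff c a b = (tsin c b*tcos c a - tcos c b*tsin c a)/(2*pi)"

lemma sdiff_proj: "sdiff c (torus_proj x) (torus_proj y) = sin (2*pi*(y $ c - x $ c))/(2*pi)"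
 unfolding sdiff_def tsincos_proj by (simp add: right_diff_distrib sin_diff)

lemma sdiff_measurable [measurable]:
 assumes [measurable]: "f : bm M" "g : bm M"
 shows "(%z. sdiff c (f z) (g z)) : bm M"
proof -
 have [measurable]: "tsin c : bm borel" "tcos c : bm borel"
  by (intro borel_measurable_continuous_onI continuous_tsincos)+
 show ?thesis unfolding sdiff_def by measurable
qed

lemma continuous_sdiff:
 assumes "continuous_on S ga" shows "continuous_on S (%t. sdiff c a (ga t))"
proof -
 have "continuous_on S (%t. tsin c (ga t))" "continuous_on S (%t. tcos c (ga t))"
  using continuous_on_compose2[OF continuous_tsincos(1) assms] continuous_on_compose2[OF continuous_tsincos(2) assms] by auto
 thus ?thesis unfolding sdiff_def by (intro continuous_intros) auto
qed

text \<open>Differentiability at \<open>s\<close> with derivative \<open>l\<close>, tested at rational times and with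
countably many moduli, hence a countable combination of measurable conditions.\<close>
definition deriv_crit :: "(real => real) => real => real => bool" where
 "deriv_crit u s l \<longleftrightarrow> (\<forall>n::nat. \<exists>m::nat. \<forall>q::rat. real_of_rat q : {0..1} & \<bar>real_of_rat q - s\<bar> < 1/real (Suc m) -->
  \<bar>u (real_of_rat q) - l*(real_of_rat q - s)\<bar> <= \<bar>real_of_rat q - s\<bar>/real (Suc n))"

lemma real_deriv_within_alt:
 assumes "u s = (0::real)"
 shows "(u has_real_derivative l) (at s within {0..1}) \<longleftrightarrow>
  (\<forall>e>0. \<exists>d>0. ALL y:{0..1}. \<bar>y - s\<bar> < d --> \<bar>u y - l*(y - s)\<bar> <= e*\<bar>y - s\<bar>)"
 unfolding has_field_derivative_def has_derivative_within_alt
 by (auto simp: assms bounded_linear_mult_right)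

lemma deriv_crit_iff:
 assumes u: "continuous_on {0..1} u" "u s = 0"
 shows "deriv_crit u s l \<longleftrightarrow> (u has_real_derivative l) (at s within {0..1})"
 unfolding real_deriv_within_alt[of u s, OF u(2)]
proof (intro iffI allI impI)
 assume l: "\<forall>e>0. \<exists>d>0. ALL y:{0..1}. \<bar>y - s\<bar> < d --> \<bar>u y - l*(y - s)\<bar> <= e*\<bar>y - s\<bar>"
 show "deriv_crit u s l"
  unfolding deriv_crit_def
 proof
  fix n :: nat
  have "0 < 1/real (Suc n)" by simp
  then obtain d where d: "d > 0" "!!y. y : {0..1} ==> \<bar>y - s\<bar> < d ==> \<bar>u y - l*(y - s)\<bar> <= 1/real (Suc n)*\<bar>y - s\<bar>" using l by blast
  obtain m where m: "1/real (Suc m) < d" using nat_approx_posE[OF d(1)] by blast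
  show "\<exists>m::nat. \<forall>q::rat. real_of_rat q : {0..1} & \<bar>real_of_rat q - s\<bar> < 1/real (Suc m) -->
  \<bar>u (real_of_rat q) - l*(real_of_rat q - s)\<bar> <= \<bar>real_of_rat q - s\<bar>/real (Suc n)"
  proof (intro exI[of _ m] allI impI)
   fix q :: rat
   assume "real_of_rat q : {0..1} & \<bar>real_of_rat q - s\<bar> < 1/real (Suc m)"
   thus "\<bar>u (real_of_rat q) - l*(real_of_rat q - s)\<bar> <= \<bar>real_of_rat q - s\<bar>/real (Suc n)"
   using d(2)[of "real_of_rat q"] m by (simp del: of_nat_Suc)
  qed
 qed
next
 fix e :: real assume crit: "deriv_crit u s l" and "0 < e"
 obtain n where n: "1/real (Suc n) < e" using nat_approx_posE[OF \<open>0 < e\<close>] by blast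
 obtain m :: nat where m: "!!q::rat. real_of_rat q : {0..1} ==> \<bar>real_of_rat q - s\<bar> < 1/real (Suc m) ==>
  \<bar>u (real_of_rat q) - l*(real_of_rat q - s)\<bar> <= \<bar>real_of_rat q - s\<bar>/real (Suc n)"
  using crit unfolding deriv_crit_def by meson
 have "\<bar>u y - l*(y - s)\<bar> <= e*\<bar>y - s\<bar>" if y: "y : {0..1}" "\<bar>y - s\<bar> < 1/real (Suc m)" for y
 proof -
  let ?q = "%k. of_nat (cell k y)/2^k :: rat"
  have e: "real_of_rat (?q k) = real (cell k y)/2^k" for k by (simp add: of_rat_divide of_rat_power)
  have q: "(%k. real_of_rat (?q k)) ~> y" unfolding e using dyadic_floor_tendsto[of y] y by simp
  have q01: "real_of_rat (?q k) : {0..1}" for k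
  proof -
   have "real (cell k y) <= 2^k*y" using y by (simp add: of_nat_nat)
   also have "... <= 2^k*1" using y by (intro mult_left_mono) auto
   finally show ?thesis unfolding e by simp
  qed
  have uq: "(%k. u (real_of_rat (?q k))) ~> u y" using q01 by (intro continuous_on_tendsto_compose[OF u(1) q y(1)]) auto
  have "\<forall>\<^sub>F k in sequentially. \<bar>real_of_rat (?q k) - s\<bar> < 1/real (Suc m)"
   by (rule order_tendstoD(2)[OF _ y(2)]) (intro tendsto_intros q)
  hence "\<forall>\<^sub>F k in sequentially. \<bar>u (real_of_rat (?q k)) - l*(real_of_rat (?q k) - s)\<bar> <= \<bar>real_of_rat (?q k) - s\<bar>/real (Suc n)"
   by eventually_elim (intro m q01)
  moreover have "(%k. \<bar>real_of_rat (?q k) - s\<bar>/real (Suc n)) ~> \<bar>y - s\<bar>/real (Suc n)"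
   by (intro tendsto_intros q) simp
  moreover have "(%k. \<bar>u (real_of_rat (?q k)) - l*(real_of_rat (?q k) - s)\<bar>) ~> \<bar>u y - l*(y - s)\<bar>"
   by (intro tendsto_intros q uq)
  ultimately have "\<bar>u y - l*(y - s)\<bar> <= \<bar>y - s\<bar>/real (Suc n)" by (intro tendsto_le[OF sequentially_bot])
  also have "... = (1/real (Suc n))*\<bar>y - s\<bar>" by simp
  also have "... <= e*\<bar>y - s\<bar>" using n by (intro mult_right_mono) auto
  finally show ?thesis .
 qed
 thus "\<exists>d>0. ALL y:{0..1}. \<bar>y - s\<bar> < d --> \<bar>u y - l*(y - s)\<bar> <= e*\<bar>y - s\<bar>" by (intro exI[of _ "1/real (Suc m)"]) auto
qed

lemma vec_derivative_componentwise:
 fixes g :: "real => real ^ 'n::finite"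
 shows "(g has_vector_derivative v) (at s within S) \<longleftrightarrow> (\<forall>c. ((%t. g t $ c) has_real_derivative v $ c) (at s within S))"
proof -
 have "(g has_vector_derivative v) (at s within S) \<longleftrightarrow> (ALL b:Basis. ((%t. g t \<bullet> b) has_derivative (%x. (x *\<^sub>R v) \<bullet> b)) (at s within S))"
  unfolding has_vector_derivative_def by (rule has_derivative_componentwise_within)
 also have "... \<longleftrightarrow> (\<forall>c. ((%t. g t $ c) has_real_derivative v $ c) (at s within S))"
 proof -
  have e: "(%x. (x *\<^sub>R v) \<bullet> axis c 1) = (*) (v $ c)" for c by (auto simp: inner_axis)
  have "(ALL b:Basis. P b) \<longleftrightarrow> (\<forall>c. P (axis c 1))" for P :: "real ^ 'n => bool" by (auto simp: Basis_vec_def)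
  thus ?thesis unfolding has_field_derivative_def by (simp only: e cart_eq_inner_axis)
 qed
 finally show ?thesis .
qed

lemma sin_derivative_iff:
 fixes w :: "real => real"
 assumes w: "continuous_on {0..1} w" "w s = 0" and s: "s : {0..1}"
 shows "((%t. sin (2*pi*w t)/(2*pi)) has_real_derivative l) (at s within {0..1}) \<longleftrightarrow> (w has_real_derivative l) (at s within {0..1})"
proof
 assume "(w has_real_derivative l) (at s within {0..1})"
 thus "((%t. sin (2*pi*w t)/(2*pi)) has_real_derivative l) (at s within {0..1})"
  by (auto intro!: derivative_eq_intros simp: w)
next
 assume d: "((%t. sin (2*pi*w t)/(2*pi)) has_real_derivative l) (at s within {0..1})"
 let ?S = "%t. sin (2*pi*w t)/(2*pi)"
 have a0: "(arcsin has_real_derivative 1) (at (2*pi*?S s))" using DERIV_arcsin[of 0] w(2) by simp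
 have "((%t. arcsin (2*pi*?S t)) has_real_derivative 1*(2*pi*l)) (at s within {0..1})"
  by (rule DERIV_chain2[OF a0 DERIV_cmult[OF d]])
 hence D: "((%t. arcsin (2*pi*?S t)/(2*pi)) has_real_derivative (1*(2*pi*l))/(2*pi)) (at s within {0..1})"
  by (rule DERIV_cdivide)
 obtain d where d: "d > 0" "!!t. t : {0..1} ==> dist t s < d ==> dist (w t) (w s) < 1/4"
  using w(1) s unfolding continuous_on_iff by (metis zero_less_divide_1_iff zero_less_numeral)
 have "(w has_field_derivative (1*(2*pi*l))/(2*pi)) (at s within {0..1})"
 proof (rule has_field_derivative_transform_within[OF D d(1) s])
  fix t assume t: "t : {0..1}" "dist t s < d"
  have "\<bar>w t\<bar> < 1/4" using d(2)[OF t] w(2) by (simp add: dist_real_def)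
  hence "\<bar>2*pi*w t\<bar> <= pi/2" by (simp add: abs_mult)
  hence "arcsin (sin (2*pi*w t)) = 2*pi*w t" by (intro arcsin_sin) linarith+
  thus "arcsin (2*pi*?S t)/(2*pi) = w t" by simp
 qed
 thus "(w has_real_derivative l) (at s within {0..1})" by simp
qed

text \<open>The index of a dyadic time in the unit interval that is close to \<open>s\<close> and different from it, so
that difference quotients along these times compute the derivative.\<close>
definition vidx :: "nat => real => nat" where
 "vidx k s = (if s < 1 then Suc (cell k s) else 2^k - 1)"

lemma vidx_props:
 assumes "s : {0..1}"
 shows "real (vidx k s)/2^k : {0..1}" "real (vidx k s)/2^k ~= s" "(%k. real (vidx k s)/2^k) ~> s"
proof -
 have "real (vidx k s)/2^k : {0..1} & real (vidx k s)/2^k ~= s & \<bar>real (vidx k s)/2^k - s\<bar> <= (1/2)^k" for k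
 proof (cases "s < 1")
  case True
  have "s : {real (cell k s)/2^k ..< real (Suc (cell k s))/2^k}"
   using floor_dyadic_iff[of s k "cell k s"] assms by simp
  moreover have "real (Suc (cell k s))/2^k = real (cell k s)/2^k + (1/2)^k"
   by (simp add: add_divide_distrib power_divide)
  moreover have "real (Suc (cell k s))/2^k <= 1" using assms True by (intro dyadic_le_1 Suc_leI floor_dyadic_less) auto
  ultimately show ?thesis using True unfolding vidx_def by (auto simp del: of_nat_Suc)
 next
  case False
  hence s1: "s = 1" using assms by simp
  have "real (2^k - 1)/2^k = 1 - (1/2)^k" by (simp add: of_nat_diff diff_divide_distrib power_divide)
  moreover have "(1/2::real)^k <= 1" "(1/2::real)^k > 0" by (auto simp: power_le_one)
  ultimately show ?thesis unfolding vidx_def s1 by auto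
 qed
 hence a: "real (vidx k s)/2^k : {0..1}" "real (vidx k s)/2^k ~= s" "\<bar>real (vidx k s)/2^k - s\<bar> <= (1/2)^k" for k by blast+
 show "real (vidx k s)/2^k : {0..1}" "real (vidx k s)/2^k ~= s" by (rule a)+
 have "(%k. real (vidx k s)/2^k - s) ~> 0"
  by (rule Lim_null_comparison[of _ "%k. (1/2)^k"]) (use a(3) in \<open>auto intro!: LIMSEQ_realpow_zero\<close>)
 thus "(%k. real (vidx k s)/2^k) ~> s" by (simp add: LIM_zero_iff)
qed

definition vlim :: "'n => (real => 'n::finite torus) => real => real" where
 "vlim c ga s = lim (%k. sdiff c (ga s) (ga (real (vidx k s)/2^k))/(real (vidx k s)/2^k - s))"

lemma velocity_formula:
 fixes ga :: "real => 'n::finite torus"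
 assumes ga: "ga : curves" and s: "s : {0..1}"
 shows "velocity ga s = (if \<forall>c. deriv_crit (%t. sdiff c (ga s) (ga t)) s (vlim c ga s) then \<chi> c. vlim c ga s else 0)"
proof -
 have cont: "continuous_on {0..1} ga" using ga by (simp add: curves_iff)
 obtain g where l: "is_lift ga g" using lift_exists[OF cont] .
 let ?u = "%c t. sdiff c (ga s) (ga t)"
 have u: "?u c t = sin (2*pi*(g t $ c - g s $ c))/(2*pi)" if "t : {0..1}" for c t
  using l s that sdiff_proj[of c "g s" "g t"] unfolding is_lift_def by simp
 have gc: "continuous_on {0..1} (%t. g t $ c - g s $ c)" for c
  using l unfolding is_lift_def by (intro continuous_intros) auto
 have iff: "(?u c has_real_derivative d) (at s within {0..1}) \<longleftrightarrow> ((%t. g t $ c) has_real_derivative d) (at s within {0..1})" for c d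
 proof -
  have "(?u c has_real_derivative d) (at s within {0..1}) \<longleftrightarrow> ((%t. sin (2*pi*(g t $ c - g s $ c))/(2*pi)) has_real_derivative d) (at s within {0..1})"
   using u s by (intro has_field_derivative_cong_eventually) (auto simp: eventually_at_filter)
  also have "... \<longleftrightarrow> ((%t. g t $ c - g s $ c) has_real_derivative d) (at s within {0..1})"
   by (rule sin_derivative_iff[OF gc _ s]) simp
  also have "... \<longleftrightarrow> ((%t. g t $ c) has_real_derivative d) (at s within {0..1})"
   using DERIV_add[OF _ DERIV_const[of "g s $ c"], of "%t. g t $ c - g s $ c" d s "{0..1}"]
   DERIV_diff[OF _ DERIV_const[of "g s $ c"], of "%t. g t $ c" d s "{0..1}"] by auto
  finally show ?thesis .
 qed
 have uc: "continuous_on {0..1} (?u c)" for c by (rule continuous_sdiff[OF cont])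
 have us: "?u c s = 0" for c using u[OF s] by simp
 have crit: "deriv_crit (?u c) s d \<longleftrightarrow> ((%t. g t $ c) has_real_derivative d) (at s within {0..1})" for c d
  unfolding deriv_crit_iff[OF uc us] iff ..
 have lim: "vlim c ga s = d" if "((%t. g t $ c) has_real_derivative d) (at s within {0..1})" for c d
  unfolding vlim_def
 proof (rule limI)
  have "(?u c has_real_derivative d) (at s within {0..1})" using that iff by blast
  hence lim: "((%y. (?u c y - ?u c s)/(y - s)) \<longlongrightarrow> d) (at s within {0..1})" by (simp add: has_field_derivative_iff)
  have "filterlim (%k. real (vidx k s)/2^k) (at s within {0..1}) sequentially"
   unfolding filterlim_at using vidx_props[OF s] by auto
  from filterlim_compose[OF lim this]
  show "(%k. ?u c (real (vidx k s)/2^k)/(real (vidx k s)/2^k - s)) ~> d" by (simp add: us)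
 qed
 show ?thesis
 proof (cases "\<forall>c. deriv_crit (?u c) s (vlim c ga s)")
  case True
  hence "(g has_vector_derivative (\<chi> c. vlim c ga s)) (at s within {0..1})" unfolding crit by (simp add: vec_derivative_componentwise)
  thus ?thesis using velocity_eq_lift[OF l s] True by simp
 next
  case False
  have "\<not> has_velocity ga v s" for v
  proof
   assume "has_velocity ga v s"
   hence "(g has_vector_derivative v) (at s within {0..1})" using has_velocity_iff_lift[OF l s] by blast
   hence "((%t. g t $ c) has_real_derivative v $ c) (at s within {0..1})" for c by (simp add: vec_derivative_componentwise)
   thus False using False lim unfolding crit by metis
  qed
  hence "velocity ga s = 0" by (simp add: velocity_def)
  thus ?thesis using False by (simp only: if_False)
 qed
qed

lemma pred_deriv_crit_step:
 fixes f l h :: "'a => real" and N :: real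
 assumes f: "f : bm M" and l: "l : bm M" and h: "h : bm M"
 shows "Measurable.pred M (%z. r : {0..1} & \<bar>r - h z\<bar> < d --> \<bar>f z - l z*(r - h z)\<bar> <= \<bar>r - h z\<bar>/N)"
proof -
 have lt: "Measurable.pred M (%z. \<bar>r - h z\<bar> < d)"
  by (intro borel_measurable_pred_less borel_measurable_abs borel_measurable_diff borel_measurable_const h)
 have "Measurable.pred M (%z. \<bar>r - h z\<bar>/N < \<bar>f z - l z*(r - h z)\<bar>)"
  by (intro borel_measurable_pred_less borel_measurable_abs borel_measurable_diff borel_measurable_const
   borel_measurable_times borel_measurable_divide f l h)
 hence le: "Measurable.pred M (%z. \<bar>f z - l z*(r - h z)\<bar> <= \<bar>r - h z\<bar>/N)"
  unfolding not_less[symmetric] by (rule pred_intros_logic)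
 show ?thesis by (intro pred_intros_logic lt le) auto
qed

text \<open>Differentiability is a measurable condition by the rational criterion, and the derivative is a limit of
difference quotients along dyadic times.\<close>
theorem velocity_joint_measurable [measurable]:
 "(%z. velocity (fst z) (snd z)) : bm (CI :: ((real => 'n::finite torus) \<times> real) measure)"
proof -
 let ?M = "CI :: ((real => 'n torus) \<times> real) measure"
 have vi: "(%z. vidx k (snd z)) : measurable ?M (count_space UNIV)" for k
 proof -
  have "(%s. vidx k s) : measurable borel (count_space UNIV)" unfolding vidx_def by measurable
  from measurable_compose[OF snd_CI this] show ?thesis .
 qed
 have L: "(%z. vlim c (fst z) (snd z)) : bm ?M" for c
  unfolding vlim_def
 proof (rule borel_measurable_lim_metric)
  fix k
  have [measurable]: "(%z. fst z (real (vidx k (snd z))/2^k)) : bm ?M" by (rule eval_index_CI[OF vi])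
  have [measurable]: "(%z. real (vidx k (snd z))) : bm ?M"
   by (rule measurable_compose[OF vi]) simp
  show "(%z. sdiff c (fst z (snd z)) (fst z (real (vidx k (snd z))/2^k))/(real (vidx k (snd z))/2^k - snd z)) : bm ?M"
   by measurable
 qed
 let ?D = "%z c. deriv_crit (%t. sdiff c (fst z (snd z)) (fst z t)) (snd z) (vlim c (fst z) (snd z))"
 have P: "Measurable.pred ?M (%z. \<forall>c. ?D z c)"
  unfolding deriv_crit_def
  by (intro pred_intros_countable pred_deriv_crit_step[where f = "%z. sdiff _ (fst z (snd z)) (fst z (real_of_rat _))"]
   sdiff_measurable eval_joint_CI eval_fixed_CI snd_CI L)
 let ?V = "%z. if \<forall>c. ?D z c then \<chi> c. vlim c (fst z) (snd z) else 0"
 have "(%z. \<chi> c. vlim c (fst z) (snd z)) : bm ?M"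
 proof (rule borel_measurable_euclidean_space[THEN iffD2], rule ballI)
  fix b :: "real ^ 'n" assume "b : Basis"
  then obtain c where b: "b = axis c 1" by (auto simp: Basis_vec_def)
  show "(%z. (\<chi> c. vlim c (fst z) (snd z)) \<bullet> b) : bm ?M"
   using L[of c] unfolding b by (simp add: inner_axis)
 qed
 hence "?V : bm ?M" using P by (intro measurable_If) auto
 thus ?thesis
  by (subst measurable_cong[where g = ?V]) (simp_all only: space_CI velocity_formula)
qed

section \<open>The speed measure of a law on curves\<close>

lemma dyadic_ac_add_id:
 assumes V: "dyadic_ac V" and L: "0 < L"
 shows "dyadic_ac (%t. L*(t + V t))"
 unfolding dyadic_ac_def
proof (intro allI impI)
 fix ep :: real assume "ep > 0"
 hence e: "ep/(2*L) > 0" using L by simp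
 then obtain de where de: "de > 0" "!!k I. I <= {..<(2::nat)^k} ==> real (card I)/2^k < de ==>
  (\<Sum>i\<in>I. V (real (Suc i)/2^k) - V (real i/2^k)) <= ep/(2*L)"
  using V unfolding dyadic_ac_def by meson
 show "\<exists>de>0. \<forall>k I. I <= {..<(2::nat)^k} & real (card I)/2^k < de -->
  (\<Sum>i\<in>I. L*(real (Suc i)/2^k + V (real (Suc i)/2^k)) - L*(real i/2^k + V (real i/2^k))) <= ep"
 proof (intro exI[of _ "min de (ep/(2*L))"] conjI allI impI)
  fix k and I :: "nat set" assume I: "I <= {..<2^k} & real (card I)/2^k < min de (ep/(2*L))"
  have st: "real (Suc i)/2^k - real i/2^k = 1/2^k" for i by (simp add: diff_divide_distrib[symmetric])
  have "(\<Sum>i\<in>I. L*(real (Suc i)/2^k + V (real (Suc i)/2^k)) - L*(real i/2^k + V (real i/2^k)))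
   = (\<Sum>i\<in>I. L*((real (Suc i)/2^k - real i/2^k) + (V (real (Suc i)/2^k) - V (real i/2^k))))"
   by (intro sum.cong refl) (simp only: right_diff_distrib[symmetric] add_diff_add)
  also have "... = L*(real (card I)/2^k + (\<Sum>i\<in>I. V (real (Suc i)/2^k) - V (real i/2^k)))"
   unfolding st sum_distrib_left[symmetric] sum.distrib by simp
  also have "... <= L*(ep/(2*L) + ep/(2*L))"
   using I de(2)[of I k] L by (intro mult_left_mono add_mono) auto
  also have "... = ep" using L by (simp add: field_simps)
  finally show "(\<Sum>i\<in>I. L*(real (Suc i)/2^k + V (real (Suc i)/2^k)) - L*(real i/2^k + V (real i/2^k))) <= ep" .
 qed (use de e in auto)
qed

lemma C1_test_lipschitz:
 fixes ps :: "real \<times> 'n::finite torus => real"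
 assumes C1: "is_C1_test ps pst psx"
 obtains L where "0 < L" "!!s t x y. s : {0..1} ==> t : {0..1} ==>
  \<bar>ps (t, torus_proj y) - ps (s, torus_proj x)\<bar> <= L*(\<bar>t - s\<bar> + norm (y - x))"
proof -
 have "bounded (pst ` cyl)" "bounded (psx ` cyl)"
  using C1 unfolding is_C1_test_def by (auto intro!: compact_imp_bounded compact_continuous_image compact_cyl)
 then obtain A B where A: "!!z. z : cyl ==> \<bar>pst z\<bar> <= A" and B: "!!z. z : cyl ==> norm (psx z) <= B"
  unfolding bounded_iff by (auto simp: image_iff)
 define L where "L = \<bar>A\<bar> + \<bar>B\<bar> + 1"
 show ?thesis
 proof (rule that)
  show "0 < L" by (simp add: L_def)
  fix s t :: real and x y :: "real ^ 'n" assume st: "s : {0..1}" "t : {0..1}"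
  let ?S = "{0..1::real} \<times> (UNIV :: (real ^ 'n) set)"
  let ?f = "%z. ps (fst z, torus_proj (snd z))"
  let ?f' = "%z h. fst h*pst (fst z, torus_proj (snd z)) + snd h \<bullet> psx (fst z, torus_proj (snd z))"
  have "norm (?f (t, y) - ?f (s, x)) <= L*norm ((t, y) - (s, x))"
  proof (rule differentiable_bound[where S = ?S and f' = ?f'])
   show "convex ?S" by (intro convex_Times) auto
   fix z assume z: "z : ?S"
   thus "(?f has_derivative ?f' z) (at z within ?S)"
   using C1 unfolding is_C1_test_def by (cases z) (auto simp: case_prod_beta')
   show "onorm (?f' z) <= L"
   proof (rule onorm_le)
   fix h :: "real \<times> (real ^ 'n)"
   have c: "(fst z, torus_proj (snd z)) : cyl" using z by (auto simp: cyl_def)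
   have "norm (?f' z h) <= \<bar>fst h\<bar>*\<bar>A\<bar> + norm (snd h)*\<bar>B\<bar>"
   unfolding real_norm_def
   proof (intro order_trans[OF abs_triangle_ineq] add_mono)
   show "\<bar>fst h*pst (fst z, torus_proj (snd z))\<bar> <= \<bar>fst h\<bar>*\<bar>A\<bar>"
   using A[OF c] by (simp add: abs_mult mult_left_mono)
   have "\<bar>snd h \<bullet> psx (fst z, torus_proj (snd z))\<bar> <= norm (snd h)*norm (psx (fst z, torus_proj (snd z)))"
   by (rule Cauchy_Schwarz_ineq2)
   also have "... <= norm (snd h)*\<bar>B\<bar>" using B[OF c] by (intro mult_left_mono) auto
   finally show "\<bar>snd h \<bullet> psx (fst z, torus_proj (snd z))\<bar> <= norm (snd h)*\<bar>B\<bar>" .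
   qed
   also have "... <= norm h*\<bar>A\<bar> + norm h*\<bar>B\<bar>"
   using norm_fst_le[of "fst h" "snd h"] norm_snd_le[of "snd h" "fst h"] by (intro add_mono mult_right_mono) auto
   also have "... <= L*norm h" by (simp add: L_def algebra_simps)
   finally show "norm (?f' z h) <= L*norm h" .
   qed
  qed (use st in auto)
  also have "... <= L*(\<bar>t - s\<bar> + norm (y - x))"
   using norm_Pair_le[of "t - s" "y - x"] \<open>0 < L\<close> by (intro mult_left_mono) auto
  finally show "\<bar>ps (t, torus_proj y) - ps (s, torus_proj x)\<bar> <= L*(\<bar>t - s\<bar> + norm (y - x))" by simp
 qed
qed

text \<open>A test function is Lipschitz, so its values along the curve have increments dominated by those of a monotone
absolutely continuous function. They are therefore the integral of their derivative, which the ordinary chain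
rule provides almost everywhere.\<close>
lemma chain_rule_abs_continuous:
 fixes ga :: "real => 'n::finite torus"
 assumes ga: "abs_continuous_curve ga" "ga : curves" and C1: "is_C1_test ps pst psx"
 shows "(%s. pst (s, ga s) + psx (s, ga s) \<bullet> velocity ga s) absolutely_integrable_on {0..1}"
  and "((%s. pst (s, ga s) + psx (s, ga s) \<bullet> velocity ga s) has_integral ps (1, ga 1) - ps (0, ga 0)) {0..1}"
proof -
 have cont: "continuous_on {0..1} ga" using ga by (simp add: curves_iff)
 obtain g where l: "is_lift ga g" using lift_exists[OF cont] .
 obtain V where V: "mono_on {0..1} V" "dyadic_ac V"
  "!!s t. 0 <= s ==> s <= t ==> t <= 1 ==> dist (ga s) (ga t) <= V t - V s"
  by (rule abs_continuous_variation[OF ga(1) cont], rule that)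
 obtain L where L: "0 < L" "!!s t x y. s : {0..1} ==> t : {0..1} ==>
  \<bar>ps (t, torus_proj y) - ps (s, torus_proj x)\<bar> <= L*(\<bar>t - s\<bar> + norm (y - x))"
  by (rule C1_test_lipschitz[OF C1], rule that)
 have lg: "torus_proj (g s) = ga s" if "s : {0..1}" for s using l that by (simp add: is_lift_def)
 let ?\<Psi> = "%t. ps (t, ga t)"
 let ?V = "%t. L*(t + V t)"
 have mV: "mono_on {0..1} ?V"
 proof (intro mono_onI)
  fix s t :: real assume "s : {0..1}" "t : {0..1}" "s <= t"
  hence "V s <= V t" using mono_onD[OF V(1)] by blast
  thus "?V s <= ?V t" using L(1) \<open>s <= t\<close> by (intro mult_left_mono) auto
 qed
 have dom: "\<bar>?\<Psi> t - ?\<Psi> s\<bar> <= ?V t - ?V s" if st: "0 <= s" "s <= t" "t <= 1" for s t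
 proof -
  have "\<bar>?\<Psi> t - ?\<Psi> s\<bar> <= L*(\<bar>t - s\<bar> + norm (g t - g s))"
   using L(2)[of s t "g t" "g s"] lg[of s] lg[of t] st by simp
  also have "norm (g t - g s) <= V t - V s"
   using lift_dominated[OF l V(3) st] by (simp add: dist_norm norm_minus_commute)
  finally show ?thesis using st L(1) by (simp add: algebra_simps)
 qed
 obtain u where u: "ind_int ?\<Psi> u" by (rule dominated_ind_int_real[OF mV dyadic_ac_add_id[OF V(2) L(1)] dom])
 obtain N1 where N1: "negligible N1" "!!t. t : {0..1} - N1 ==> (?\<Psi> has_vector_derivative u t) (at t within {0..1})"
  by (rule ind_int_deriv[OF u], rule that)
 obtain N2 where "ind_int g (velocity ga)" and N2: "negligible N2"
  "!!t. t : {0..1} - N2 ==> (g has_vector_derivative velocity ga t) (at t within {0..1})"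
  by (rule abs_continuous_velocity[OF ga(1) l], rule that)
 have eq: "pst (t, ga t) + psx (t, ga t) \<bullet> velocity ga t = u t" if t: "t : {0..1} - (N1 \<union> N2)" for t
 proof -
  let ?h = "%s. (s, g s)" and ?F = "%(s, y). ps (s, torus_proj y)"
  have gd: "(?h has_derivative (%x. (x, x *\<^sub>R velocity ga t))) (at t within {0..1})"
   using N2(2)[of t] t unfolding has_vector_derivative_def by (auto intro!: derivative_eq_intros)
  have "(?F has_derivative (%(s, y). s*pst (t, torus_proj (g t)) + y \<bullet> psx (t, torus_proj (g t)))) (at (t, g t) within {0..1} \<times> UNIV)"
   using C1 t unfolding is_C1_test_def by blast
  hence "(?F has_derivative (%(s, y). s*pst (t, torus_proj (g t)) + y \<bullet> psx (t, torus_proj (g t)))) (at (?h t) within ?h ` {0..1})"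
   by (rule has_derivative_subset) auto
  from has_derivative_in_compose[OF gd this]
  have "((%s. ps (s, torus_proj (g s))) has_derivative (%x. x *\<^sub>R (pst (t, ga t) + psx (t, ga t) \<bullet> velocity ga t))) (at t within {0..1})"
   using lg[of t] t by (simp add: algebra_simps inner_commute)
  hence "((%s. ps (s, torus_proj (g s))) has_vector_derivative pst (t, ga t) + psx (t, ga t) \<bullet> velocity ga t) (at t within {0..1})"
   unfolding has_vector_derivative_def .
  hence "(?\<Psi> has_vector_derivative pst (t, ga t) + psx (t, ga t) \<bullet> velocity ga t) (at t within {0..1})"
   by (rule has_vector_derivative_transform[rotated 2]) (use t lg in auto)
  thus ?thesis
   using vector_derivative_unique_within_closed_interval[of 0 1 t ?\<Psi>] N1(2)[of t] t by (auto simp: cbox_interval)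
 qed
 have "ind_int ?\<Psi> (%s. pst (s, ga s) + psx (s, ga s) \<bullet> velocity ga s)"
  by (rule ind_int_unique_spike[OF u negligible_Un[OF N1(1) N2(1)] eq])
 thus "(%s. pst (s, ga s) + psx (s, ga s) \<bullet> velocity ga s) absolutely_integrable_on {0..1}"
  "((%s. pst (s, ga s) + psx (s, ga s) \<bullet> velocity ga s) has_integral ps (1, ga 1) - ps (0, ga 0)) {0..1}"
  unfolding ind_int_def by auto
qed

text \<open>The speed measure of a law, written as an image of the joint law of curve and time with the density given by
the power of the speed.\<close>
definition sig :: "real => (real => 'n::finite torus) measure => (real \<times> 'n torus) measure" where
 "sig p et = distr (density (et \<Otimes>\<^sub>M I01) (%z. ennreal (pspeed p z))) cyl_borel
  (%z. (snd z, fst z (snd z)))"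

locale curve_law = prob_space et for et :: "(real => 'n::finite torus) measure" +
 assumes sets_eta [simp, measurable_cong]: "sets et = sets curves_borel"
begin

abbreviation M :: "((real => 'n torus) \<times> real) measure" where "M \<equiv> et \<Otimes>\<^sub>M I01"
abbreviation Phi :: "(real => 'n torus) \<times> real => real \<times> 'n torus" where "Phi \<equiv> %z. (snd z, fst z (snd z))"

lemma sets_M: "sets M = sets CI" by (intro sets_pair_measure_cong) auto

lemma space_eta: "space et = curves" using sets_eq_imp_space_eq[OF sets_eta] by (simp add: space_curves_borel)

lemma space_M: "z : space M \<longleftrightarrow> fst z : curves & snd z : {0..1}"
 using sets_eq_imp_space_eq[OF sets_M] space_CI[of z] by simp

lemma meas_M: "f : measurable CI N ==> f : measurable M N"
 by (simp add: measurable_cong_sets[OF sets_M refl])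

lemma vel_M [measurable]: "(%z. velocity (fst z) (snd z)) : bm M"
 by (rule meas_M[OF velocity_joint_measurable])

lemma Phi_M [measurable]: "Phi : measurable M cyl_borel"
proof -
 have "Phi : measurable CI (borel \<Otimes>\<^sub>M borel)" by (intro measurable_Pair snd_CI eval_joint_CI)
 hence "Phi : measurable M borel" unfolding borel_prod by (rule meas_M)
 thus ?thesis unfolding cyl_borel_def by (rule measurable_restrict_space2[rotated]) (auto simp: space_M cyl_def)
qed

sublocale I: prob_space I01 by (rule finite_I01)
sublocale MI: pair_prob_space et I01 ..

lemma vel_section: "(ga :: real => 'n torus) : curves ==> (%s. velocity ga s) : bm I01"
 using measurable_Pair2[OF vel_M, of ga] by (simp add: space_eta)

lemma Phi_section: "(ga :: real => 'n torus) : curves ==> (%s. (s, ga s)) : measurable I01 cyl_borel"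
 using measurable_Pair2[OF Phi_M, of ga] by (simp add: space_eta)

end

lemma cont_cyl_measurable:
 fixes f :: "real \<times> 'n::finite torus => 'b::topological_space"
 assumes "continuous_on cyl f" shows "f : bm cyl_borel"
 unfolding cyl_borel_def using assms by (rule borel_measurable_continuous_on_restrict)

lemma cont_cyl_bounded:
 fixes f :: "real \<times> 'n::finite torus => 'b::real_normed_vector"
 assumes "continuous_on cyl f" obtains B where "!!z. z : cyl ==> norm (f z) <= B"
 using compact_imp_bounded[OF compact_continuous_image[OF assms compact_cyl]] unfolding bounded_iff by auto

lemma space_cyl_borel: "space cyl_borel = cyl" by (simp add: cyl_borel_def space_restrict_space)

lemma curve_energy_measurable:
 assumes a: "0 < al" "al < 1"
 shows "curve_energy al : bm (curves_borel :: (real => 'n::finite torus) measure)"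
proof -
 have "(%ga. SUP k. ennreal (E_dy (2/(2 - al)) k ga)) : bm (curves_borel :: (real => 'n torus) measure)"
  unfolding E_dy_def by measurable
 thus ?thesis
  by (subst measurable_cong[OF curve_energy_eq[OF a]]) (simp_all add: space_curves_borel)
qed

locale Pi2_law = curve_law et for et :: "(real => 'n::finite torus) measure" +
 fixes al p :: real
 assumes alpha: "0 < al" "al < 1" and p_def: "p = 2/(2 - al)"
  and finite_energy: "(nn_integral et (%ga. curve_energy al ga)) < \<infinity>"
begin

lemma p1: "1 < p" using alpha by (simp add: p_def field_simps)

lemma energy_meas [measurable]: "curve_energy al : bm et"
 using curve_energy_measurable[OF alpha] by (simp add: measurable_cong_sets[OF sets_eta refl])

lemma AE_W: "AE ga in et. ga : W_curves al"
proof -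
 have "AE ga in et. curve_energy al ga ~= \<infinity>" using finite_energy by (intro nn_integral_PInf_AE) auto
 thus ?thesis by eventually_elim (auto simp: curve_energy_def split: if_splits)
qed

lemma speed_section:
 assumes "(ga :: real => 'n torus) : W_curves al"
 shows "(nn_integral I01 (%s. ennreal (norm (velocity ga s) powr p))) = curve_energy al ga"
proof -
 have "ga : curves" using assms by (simp add: W_curves_def)
 hence [measurable]: "(%s. velocity ga s) : bm I01" by (rule vel_section)
 have "(nn_integral I01 (%s. ennreal (norm (velocity ga s) powr p))) = (nn_integral (lebesgue_on {0..1}) (%s. ennreal (norm (velocity ga s) powr p)))"
  by (rule nn_integral_I01[symmetric]) measurable
 thus ?thesis using assms by (simp add: curve_energy_def p_def)
qed

lemma total_speed: "(nn_integral M (%z. ennreal (pspeed p z))) = (nn_integral et (%ga. curve_energy al ga))"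
proof -
 have "(nn_integral M (%z. ennreal (pspeed p z))) = (\<integral>\<^sup>+ga. \<integral>\<^sup>+s. ennreal (norm (velocity ga s) powr p) \<partial>I01 \<partial>et)"
  by (subst I.nn_integral_fst[symmetric]) auto
 also have "... = (nn_integral et (%ga. curve_energy al ga))"
  using AE_W by (intro nn_integral_cong_AE) (auto elim!: eventually_mono simp: speed_section)
 finally show ?thesis .
qed

lemma speed_integrable: "integrable M (%z. pspeed p z)"
 using finite_energy total_speed by (intro integrableI_bounded) auto

lemma sets_sig [simp]: "sets (sig p et) = sets cyl_borel" by (simp add: sig_def)

lemma nn_integral_sig:
 assumes f: "f : bm cyl_borel"
 shows "(nn_integral (sig p et) (%z. f z)) = (nn_integral M (%z. ennreal (pspeed p z)*f (Phi z)))"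
proof -
 have [measurable]: "(%z. f (Phi z)) : bm M" by (rule measurable_compose[OF Phi_M f])
 have "(nn_integral (sig p et) (%z. f z)) = (nn_integral (density M (%z. ennreal (pspeed p z))) (%z. f (Phi z)))"
  unfolding sig_def using f by (intro nn_integral_distr) auto
 also have "... = (nn_integral M (%z. ennreal (pspeed p z)*f (Phi z)))"
  by (intro nn_integral_density) auto
 finally show ?thesis .
qed

lemma emeasure_sig:
 assumes "A : sets cyl_borel"
 shows "emeasure (sig p et) A = (nn_integral M (%z. ennreal (pspeed p z)*indicator A (Phi z)))"
 using nn_integral_sig[of "indicator A"] nn_integral_indicator[of A "sig p et"] assms by simp

lemma finite_sig: "finite_measure (sig p et)"
proof (rule finite_measureI)
 have "emeasure (sig p et) (space (sig p et)) <= (nn_integral M (%z. ennreal (pspeed p z)))"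
  by (subst emeasure_sig) (auto simp: sets_eq_imp_space_eq[OF sets_sig] intro!: nn_integral_mono split: split_indicator)
 thus "emeasure (sig p et) (space (sig p et)) ~= \<infinity>"
  using total_speed finite_energy by (auto simp: top_unique)
qed

lemma integral_sig:
 fixes f :: "real \<times> 'n torus => real"
 assumes "f : bm cyl_borel"
 shows "(LINT z|sig p et. f z) = (LINT z|M. pspeed p z*f (Phi z))"
proof -
 have [measurable]: "(%z. f (Phi z)) : bm M" by (rule measurable_compose[OF Phi_M assms])
 have "(LINT z|sig p et. f z) = (LINT z|density M (%z. ennreal (pspeed p z)). f (Phi z))"
  unfolding sig_def using assms by (intro integral_distr) auto
 also have "... = (LINT z|M. pspeed p z *\<^sub>R f (Phi z))" by (intro integral_density) auto
 finally show ?thesis by simp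
qed

lemma integral_sig_iterated:
 fixes f :: "real \<times> 'n torus => real"
 assumes f: "continuous_on cyl f"
 shows "(LINT z|sig p et. f z) =
  (\<integral>ga. (LINT s|lebesgue_on {0..1}. f (s, ga s)*norm (velocity ga s) powr p) \<partial>et)"
proof -
 have fm: "f : bm cyl_borel" by (rule cont_cyl_measurable[OF f])
 have [measurable]: "(%z. f (Phi z)) : bm M" by (rule measurable_compose[OF Phi_M fm])
 obtain B where B: "!!z. z : cyl ==> norm (f z) <= B" by (rule cont_cyl_bounded[OF f], rule that)
 have int: "integrable M (%z. pspeed p z*f (Phi z))"
 proof (rule Bochner_Integration.integrable_bound[OF integrable_mult_left[OF speed_integrable, of B]])
  show "AE z in M. norm (pspeed p z*f (Phi z)) <= norm (pspeed p z*B)"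
  proof (rule AE_I2)
   fix z assume "z : space M"
   hence "Phi z : cyl" by (auto simp: space_M cyl_def)
   hence "\<bar>f (Phi z)\<bar> <= \<bar>B\<bar>" using B[of "Phi z"] by simp
   thus "norm (pspeed p z*f (Phi z)) <= norm (pspeed p z*B)"
   by (simp add: abs_mult mult_left_mono)
  qed
 qed measurable
 have "(LINT z|sig p et. f z) = (LINT z|M. pspeed p z*f (Phi z))" by (rule integral_sig[OF fm])
 also have "... = (\<integral>ga. (LINT s|I01. norm (velocity ga s) powr p*f (s, ga s)) \<partial>et)"
  using MI.integral_fst'[OF int] by simp
 also have "... = (\<integral>ga. (LINT s|lebesgue_on {0..1}. f (s, ga s)*norm (velocity ga s) powr p) \<partial>et)"
 proof (rule Bochner_Integration.integral_cong[OF refl])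
  fix ga assume "ga : space et"
  hence g: "ga : curves" by (simp add: space_eta)
  have [measurable]: "(%s. velocity ga s) : bm I01" by (rule vel_section[OF g])
  have [measurable]: "(%s. f (s, ga s)) : bm I01" by (rule measurable_compose[OF Phi_section[OF g] fm])
  show "(LINT s|I01. norm (velocity ga s) powr p*f (s, ga s)) = (LINT s|lebesgue_on {0..1}. f (s, ga s)*norm (velocity ga s) powr p)"
   by (subst integral_I01) (auto simp: mult.commute)
 qed
 finally show ?thesis .
qed

lemma sigma_meas_eq_sig: "sigma_meas al et = sig p et"
 unfolding sigma_meas_def p_def[symmetric]
proof (rule the_equality)
 show "is_finite_cyl_measure (sig p et) & (\<forall>f :: real \<times> 'n torus => real. continuous_on cyl f --> (LINT z|sig p et. f z) =
   (\<integral>ga. (LINT s|lebesgue_on {0..1}. f (s, ga s)*norm (velocity ga s) powr p) \<partial>et))"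
  using finite_sig integral_sig_iterated by (simp add: is_finite_cyl_measure_def)
 fix sg assume s: "is_finite_cyl_measure sg & (\<forall>f :: real \<times> 'n torus => real. continuous_on cyl f --> (LINT z|sg. f z) =
   (\<integral>ga. (LINT s|lebesgue_on {0..1}. f (s, ga s)*norm (velocity ga s) powr p) \<partial>et))"
 show "sg = sig p et"
 proof (rule finite_measure_eqI_continuous[where C = cyl])
  fix f :: "real \<times> 'n torus => real" assume "cont f"
  hence "continuous_on cyl f" by (rule continuous_on_subset) simp
  thus "integral\<^sup>L sg f = integral\<^sup>L (sig p et) f" using s integral_sig_iterated by simp
 qed (use s finite_sig in \<open>auto simp: is_finite_cyl_measure_def cyl_borel_def\<close>)
qed

end

lemma Pi2_law_iff:
 assumes "0 < al" "al < 1"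
 shows "Pi2_law et al (2/(2 - al)) \<longleftrightarrow> et : Pi2 al"
 using assms unfolding Pi2_law_def Pi2_law_axioms_def curve_law_def curve_law_axioms_def Pi2_def curve_probs_def by auto

section \<open>The continuity equation solved by a law on curves\<close>

lemma AE_le_if_set_integral_le:
 fixes f g :: "'a => real"
 assumes f: "integrable M f" and g: "integrable M g"
  and le: "!!A. A : sets M ==> (LINT x|M. f x*indicator A x) <= (LINT x|M. g x*indicator A x)"
 shows "AE x in M. f x <= g x"
proof -
 define A where "A = {x : space M. g x < f x}"
 have A [measurable]: "A : sets M" unfolding A_def using f g by measurable
 have i: "integrable M (%x. f x*indicator A x)" "integrable M (%x. g x*indicator A x)"
  using f g A by (auto intro: integrable_real_mult_indicator)
 have i3: "integrable M (%x. (f x - g x)*indicator A x)"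
  using Bochner_Integration.integrable_diff[OF i] by (simp add: left_diff_distrib)
 have nn: "0 <= (f x - g x)*indicator A x" for x by (auto simp: A_def indicator_def)
 have "(LINT x|M. (f x - g x)*indicator A x) = (LINT x|M. f x*indicator A x) - (LINT x|M. g x*indicator A x)"
  using Bochner_Integration.integral_diff[OF i] by (simp add: left_diff_distrib)
 also have "... <= 0" using le[OF A] by simp
 finally have "(LINT x|M. (f x - g x)*indicator A x) = 0"
  using Bochner_Integration.integral_nonneg[of M "%x. (f x - g x)*indicator A x"] nn by fastforce
 hence "AE x in M. (f x - g x)*indicator A x = 0"
  using integral_nonneg_eq_0_iff_AE[OF i3] nn by simp
 thus ?thesis using AE_space by eventually_elim (auto simp: A_def indicator_def split: if_splits)
qed

text \<open>A convex function is the supremum of its tangents, and slopes from a dense set suffice. Each tangent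
inequality is linear in \<open>r\<close>, \<open>w\<close> and \<open>s\<close>, hence survives integration
over laws on curves; a countable choice of slopes then gives Jensen's inequality almost everywhere.\<close>
lemma tangent_bounds_imp_cost_le:
 fixes w :: "'b::euclidean_space"
 assumes p: "1 < p" and r: "0 <= r" and s: "0 <= s"
  and D: "!!X. open X ==> X ~= {} ==> \<exists>d\<in>D. d : X"
  and tan: "!!c. c : D ==> (1 - p)*norm c powr p*r + p*norm c powr (p - 2)*(c \<bullet> w) <= s"
 shows "r = 0 ==> w = 0" and "0 < r ==> r*(norm w/r) powr p <= s"
proof -
 have all: "(1 - p)*norm c powr p*r + p*norm c powr (p - 2)*(c \<bullet> w) <= s" if c: "c ~= 0" for c
 proof -
  have "\<exists>d. d : D & dist d c < 1/real (Suc n)" for n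
   using D[of "ball c (1/real (Suc n))"] by (auto simp: dist_commute)
  then obtain d where d: "!!n. d n : D" "!!n. dist (d n) c < 1/real (Suc n)" by metis
  have "(%n. dist (d n) c) ~> 0"
  proof (rule Lim_null_comparison)
   show "(%n. inverse (real (Suc n))) ~> 0" by (rule LIMSEQ_inverse_real_of_nat)
   show "\<forall>\<^sub>F n in sequentially. norm (dist (d n) c) <= inverse (real (Suc n))"
   using d(2) by (intro always_eventually allI) (simp add: inverse_eq_divide less_imp_le)
  qed
  hence lim: "d ~> c" using tendsto_dist_iff by blast
  have "(%n. (1 - p)*norm (d n) powr p*r + p*norm (d n) powr (p - 2)*(d n \<bullet> w)) ~>
   (1 - p)*norm c powr p*r + p*norm c powr (p - 2)*(c \<bullet> w)"
   using c by (intro tendsto_intros tendsto_powr lim) auto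
  thus ?thesis by (rule LIMSEQ_le_const2) (use tan d(1) in auto)
 qed
 show "w = 0" if "r = 0"
 proof (rule ccontr)
  assume w: "w ~= 0"
  define b where "b = (s + 1)/(p*norm w powr p)"
  define t where "t = b powr (1/(p - 1))"
  have base: "b > 0" using p s w by (simp add: b_def)
  have pb: "p*b*norm w powr p = s + 1" using p w by (simp add: b_def)
  have t: "t > 0" using base by (simp add: t_def)
  have tp: "t powr (p - 1) = b" using p base by (simp add: t_def powr_powr)
  have ww: "norm w powr (p - 2)*(norm w)\<^sup>2 = norm w powr p" using w powr_add[of "norm w" "p - 2" 2] by simp
  have tt: "t powr (p - 2)*t = t powr (p - 1)" using t powr_add[of t "p - 2" 1] by simp
  have "p*norm (t *\<^sub>R w) powr (p - 2)*((t *\<^sub>R w) \<bullet> w) = p*(t powr (p - 2)*t)*(norm w powr (p - 2)*(norm w)\<^sup>2)"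
   using t by (simp add: powr_mult power2_norm_eq_inner)
  also have "... = s + 1" unfolding ww tt tp by (rule pb)
  finally show False using all[of "t *\<^sub>R w"] t w that by simp
 qed
 show "r*(norm w/r) powr p <= s" if r0: "0 < r"
 proof (cases "w = 0")
  case True thus ?thesis using s p by simp
 next
  case False
  define v where "v = w /\<^sub>R r"
  have v: "v ~= 0" "w = r *\<^sub>R v" "norm v = norm w/r" using False r0 by (auto simp: v_def divide_inverse mult.commute)
  have vv: "norm v powr (p - 2)*(norm v)\<^sup>2 = norm v powr p" using v(1) powr_add[of "norm v" "p - 2" 2] by simp
  have "(1 - p)*norm v powr p*r + p*norm v powr (p - 2)*(v \<bullet> w) = (1 - p)*norm v powr p*r + p*r*(norm v powr (p - 2)*(norm v)\<^sup>2)"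
   unfolding v(2) by (simp add: power2_norm_eq_inner)
  also have "... = r*norm v powr p" unfolding vv by (simp add: algebra_simps)
  finally show ?thesis using all[OF v(1)] v(3) by simp
 qed
qed

lemma H_cost_le_powr:
 fixes w :: "real ^ 'n::finite"
 assumes a: "0 < al" "al < 1" and p: "p = 2/(2 - al)" and r: "0 <= r" and s: "0 <= s"
  and z: "r = 0 ==> w = 0" and le: "0 < r ==> r*(norm w/r) powr p <= s"
 shows "H_cost al r w <= ennreal (s powr (2 - al))"
proof (cases "r = 0")
 case True thus ?thesis using z by (simp add: H_cost_def)
next
 case False
 hence r0: "r > 0" using r by simp
 have pq: "p*(2 - al) = 2" using nonzero_eq_divide_eq[of "2 - al" p 2] p a by simp
 have "(norm w)\<^sup>2/r powr al = (r*(norm w/r) powr p) powr (2 - al)"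
 proof (cases "w = 0")
  case False
  have "(r*(norm w/r) powr p) powr (2 - al) = r powr (2 - al)*(norm w/r) powr 2"
   using r0 pq by (simp add: powr_mult powr_powr)
  also have "(norm w/r) powr 2 = (norm w)\<^sup>2/r powr 2" using r0 False by (simp add: powr_divide)
  also have "r powr (2 - al)*((norm w)\<^sup>2/r powr 2) = (norm w)\<^sup>2/r powr al"
   using r0 by (simp add: powr_diff)
  finally show ?thesis by simp
 qed (use pq in simp)
 also have "... <= s powr (2 - al)" using le[OF r0] r0 a by (intro powr_mono2) auto
 finally show ?thesis using r0 by (simp add: H_cost_def ennreal_leI)
qed

definition bmeas :: "(real \<times> 'n::finite torus => real) => bool" where
 "bmeas h \<longleftrightarrow> h : bm cyl_borel & (\<exists>B. ALL z:cyl. \<bar>h z\<bar> <= B)"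

lemma is_ac_density_ac_density:
 "is_finite_cyl_measure rh ==> is_ac_density rh (ac_density rh)"
 unfolding ac_density_def using is_ac_density_exists by (rule someI_ex)

lemma C1_test_slice_continuous:
 assumes "is_C1_test ps pst psx" "t : {0..1}"
 shows "cont (%x :: 'n::finite torus. ps (t, x))"
 unfolding continuous_on_torus_iff
proof (subst continuous_on_iff, intro ballI allI impI)
 fix x :: "real ^ 'n" and e :: real assume "0 < e"
 obtain L where L: "0 < L" "!!s t x y. s : {0..1} ==> t : {0..1} ==>
  \<bar>ps (t, torus_proj y) - ps (s, torus_proj x)\<bar> <= L*(\<bar>t - s\<bar> + norm (y - x))"
  by (rule C1_test_lipschitz[OF assms(1)], rule that)
 show "\<exists>d>0. ALL x':UNIV. dist x' x < d --> dist (ps (t, torus_proj x')) (ps (t, torus_proj x)) < e"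
 proof (intro exI[of _ "e/L"] conjI ballI impI)
  fix x' assume "dist x' x < e/L"
  hence "L*norm (x' - x) < e" using L(1) by (simp add: dist_norm field_simps)
  thus "dist (ps (t, torus_proj x')) (ps (t, torus_proj x)) < e"
   using L(2)[of t t x' x] assms(2) by (simp add: dist_real_def)
 qed (use L \<open>0 < e\<close> in auto)
qed

context Pi2_law
begin

text \<open>The occupation measure, that is, the law of the space-time position at a uniformly distributed time.\<close>
definition occ :: "(real \<times> 'n torus) measure" where "occ = distr M cyl_borel Phi"

lemma occ_finite: "is_finite_cyl_measure occ"
 unfolding is_finite_cyl_measure_def occ_def
 using MI.finite_measure_distr[OF Phi_M] by simp

lemma vel_integrable: "integrable M (%z. velocity (fst z) (snd z))"
proof (rule Bochner_Integration.integrable_bound[of M "%z. 1 + pspeed p z"])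
 show "integrable M (%z. 1 + pspeed p z)" using speed_integrable by simp
 show "AE z in M. norm (velocity (fst z) (snd z)) <= norm (1 + pspeed p z)"
 proof (rule AE_I2)
  fix z
  let ?x = "norm (velocity (fst z) (snd z))"
  have "?x <= 1 + ?x powr p"
  proof (cases "?x <= 1")
   case False
   hence "?x powr 1 <= ?x powr p" using p1 by (intro powr_mono) auto
   thus ?thesis by simp
  qed (auto intro: add_increasing2)
  thus "?x <= norm (1 + ?x powr p)" by simp
 qed
qed measurable

lemma vel_nth_integrable: "integrable M (%z. velocity (fst z) (snd z) $ c)"
 using integrable_inner_left[OF vel_integrable, of "axis c 1"] by (simp add: inner_axis)

text \<open>The function \<open>u\<close> vanishes wherever the speed does, so its image measure does not charge the null
sets of the speed measure.\<close>
lemma occ_density: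
 assumes ac: "absolutely_continuous cyl_leb (sig p et)"
  and u: "integrable M u" "!!z. 0 <= u z" "!!z. velocity (fst z) (snd z) = 0 ==> u z = 0"
 obtains f where "f : bm cyl_borel"
  "!!h. bmeas h ==>
   integrable cyl_leb (%z. h z*f z) & (LINT z|cyl_leb. h z*f z) = (LINT z|M. h (Phi z)*(u z :: real))"
proof -
 interpret L: prob_space "cyl_leb :: (real \<times> 'n torus) measure" by (rule prob_space_cyl_leb)
 have um [measurable]: "u : bm M" using u(1) by simp
 define \<mu> where "\<mu> = distr (density M (%z. ennreal (u z))) cyl_borel Phi"
 have PhiD: "Phi : measurable (density M (%z. ennreal (u z))) cyl_borel" by simp
 have smu: "sets \<mu> = sets cyl_leb" by (simp add: \<mu>_def)
 have emu: "emeasure \<mu> A = (nn_integral M (%z. ennreal (u z)*indicator A (Phi z)))" if A: "A : sets cyl_borel" for A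
 proof -
  have m: "(indicator A :: _ => ennreal) : bm cyl_borel" using A by simp
  have [measurable]: "(%z. indicator A (Phi z) :: ennreal) : bm M" by (rule measurable_compose[OF Phi_M m])
  have "emeasure \<mu> A = (nn_integral \<mu> (%z. indicator A z))" using A by (simp add: \<mu>_def)
  also have "... = (nn_integral (density M (%z. ennreal (u z))) (%z. indicator A (Phi z)))"
   unfolding \<mu>_def using m by (intro nn_integral_distr[OF PhiD]) simp
  also have "... = (nn_integral M (%z. ennreal (u z)*indicator A (Phi z)))" by (intro nn_integral_density) auto
  finally show ?thesis .
 qed
 have fin: "finite_measure \<mu>"
 proof (rule finite_measureI)
  have "space \<mu> : sets cyl_borel" using sets.top[of \<mu>] smu by simp
  hence "emeasure \<mu> (space \<mu>) <= (nn_integral M (%z. ennreal (u z)))"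
   by (subst emu) (auto intro!: nn_integral_mono split: split_indicator)
  also have "... < \<infinity>" using u by (simp add: nn_integral_eq_integral)
  finally show "emeasure \<mu> (space \<mu>) ~= \<infinity>" by simp
 qed
 have acm: "absolutely_continuous cyl_leb \<mu>"
  unfolding absolutely_continuous_def
 proof
  fix A assume "A : null_sets (cyl_leb :: (real \<times> 'n torus) measure)"
  hence A: "A : sets cyl_borel" "A : null_sets (sig p et)" using ac by (auto simp: absolutely_continuous_def null_sets_def)
  have m: "(indicator A :: _ => ennreal) : bm cyl_borel" using A by simp
  have [measurable]: "(%z. indicator A (Phi z) :: ennreal) : bm M" by (rule measurable_compose[OF Phi_M m])
  have "(nn_integral M (%z. ennreal (pspeed p z)*indicator A (Phi z))) = 0"
   using A emeasure_sig[OF A(1)] by auto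
  hence "AE z in M. ennreal (pspeed p z)*indicator A (Phi z) = 0"
   by (subst (asm) nn_integral_0_iff_AE) auto
  hence "AE z in M. ennreal (u z)*indicator A (Phi z) = 0"
  proof eventually_elim
   case (elim z)
   hence "velocity (fst z) (snd z) = 0 | indicator A (Phi z) = (0 :: ennreal)" by (auto simp: ennreal_eq_0_iff)
   thus ?case using u(3)[of z] by auto
  qed
  hence "(nn_integral M (%z. ennreal (u z)*indicator A (Phi z))) = 0" by (subst nn_integral_0_iff_AE) auto
  thus "A : null_sets \<mu>" using A(1) emu[OF A(1)] smu by (intro null_setsI) auto
 qed
 define f where "f z = enn2real (RN_deriv cyl_leb \<mu> z)" for z
 have fm: "f : bm cyl_leb" unfolding f_def by measurable
 have f0: "f z >= 0" for z by (simp add: f_def)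
 have "AE x in cyl_leb. RN_deriv cyl_leb \<mu> x ~= \<infinity>"
  by (rule L.RN_deriv_finite[OF finite_measure.sigma_finite_measure[OF fin] acm smu])
 hence dens: "density cyl_leb (%x. ennreal (f x)) = \<mu>"
  by (subst L.density_RN_deriv[OF acm smu, symmetric], intro density_cong)
   (auto simp: f_def top.not_eq_extremum ennreal_enn2real)
 show ?thesis
 proof (rule that)
  show "f : bm cyl_borel" using fm by (simp add: measurable_cong_sets[OF sets_cyl_leb refl])
  fix h :: "real \<times> 'n torus => real" assume "bmeas h"
  then obtain B where h: "h : bm cyl_borel" "!!z. z : cyl ==> \<bar>h z\<bar> <= B" unfolding bmeas_def by blast
  have hm [measurable]: "h : bm cyl_leb" using h(1) by (simp add: measurable_cong_sets[OF sets_cyl_leb refl])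
  have hmu: "h : bm \<mu>" using hm by (simp add: measurable_cong_sets[OF smu refl])
  have "space \<mu> = cyl" using sets_eq_imp_space_eq[OF smu] by simp
  hence "integrable \<mu> h" using h(2) hmu by (intro finite_measure.integrable_const_bound[OF fin, of _ B]) auto
  hence "integrable (density cyl_leb (%x. ennreal (f x))) h" unfolding dens .
  hence "integrable cyl_leb (%z. f z*h z)" using fm f0 by (subst (asm) integrable_density) auto
  moreover have "(LINT z|cyl_leb. f z*h z) = (LINT z|density cyl_leb (%x. ennreal (f x)). h z)"
   using fm f0 by (subst integral_density) auto
  moreover have "(LINT z|density cyl_leb (%x. ennreal (f x)). h z) = (LINT z|\<mu>. h z)" unfolding dens ..
  moreover have "(LINT z|\<mu>. h z) = (LINT z|density M (%z. ennreal (u z)). h (Phi z))"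
   unfolding \<mu>_def by (rule integral_distr[OF PhiD h(1)])
  moreover have "(LINT z|density M (%z. ennreal (u z)). h (Phi z)) = (LINT z|M. u z*h (Phi z))"
   using u(2) measurable_compose[OF Phi_M h(1)] by (subst integral_density) auto
  ultimately show "integrable cyl_leb (%z. h z*f z) & (LINT z|cyl_leb. h z*f z) = (LINT z|M. h (Phi z)*u z)"
   by (simp add: mult.commute)
 qed
qed

lemma flux_exists:
 assumes ac: "absolutely_continuous cyl_leb (sig p et)"
 obtains w :: "real \<times> 'n torus => real ^ 'n" where
  "!!c. (%z. w z $ c) : bm cyl_borel"
  "!!h c. bmeas h ==>
   integrable cyl_leb (%z. h z*w z $ c) &
   (LINT z|cyl_leb. h z*w z $ c) = (LINT z|M. h (Phi z) * velocity (fst z) (snd z) $ c)"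
proof -
 let ?v = "%c z. velocity (fst z) (snd z) $ c"
 define P where "P u f \<longleftrightarrow> f : bm cyl_borel &
  (\<forall>h. bmeas h -->
   integrable cyl_leb (%z. h z*f z) & (LINT z|cyl_leb. h z*f z) = (LINT z|M. h (Phi z)*(u z :: real)))"
  for u f
 have ex: "\<exists>f. P u f" if "integrable M u" "!!z. 0 <= u z" "!!z. velocity (fst z) (snd z) = 0 ==> u z = 0" for u
  by (rule occ_density[OF ac that]) (auto simp: P_def)
 have ip: "integrable M (%z. max 0 (?v c z))" "integrable M (%z. max 0 (- ?v c z))" for c
  using vel_nth_integrable[of c] by (auto intro!: integrable_max)
 have "\<forall>c. \<exists>f. P (%z. max 0 (?v c z)) f" "\<forall>c. \<exists>f. P (%z. max 0 (- ?v c z)) f"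
  using ip by (auto intro!: ex)
 from choice[OF this(1)] choice[OF this(2)] obtain f g
  where f: "!!c. P (%z. max 0 (?v c z)) (f c)" and g: "!!c. P (%z. max 0 (- ?v c z)) (g c)" by blast
 let ?w = "%z. \<chi> c. f c z - g c z"
 show ?thesis
 proof (rule that[of ?w])
  show "(%z. ?w z $ c) : bm cyl_borel" for c
  proof -
   have "f c : bm cyl_borel" "g c : bm cyl_borel" using f[of c] g[of c] unfolding P_def by blast+
   thus ?thesis by simp
  qed
  fix h :: "real \<times> 'n torus => real" and c assume bh: "bmeas h"
  then obtain B where h: "h : bm cyl_borel" "!!z. z : cyl ==> \<bar>h z\<bar> <= B" unfolding bmeas_def by blast
  have 1: "integrable cyl_leb (%z. h z*f c z)" "(LINT z|cyl_leb. h z*f c z) = (LINT z|M. h (Phi z)*max 0 (?v c z))"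
   using f[of c] bh unfolding P_def by blast+
  have 2: "integrable cyl_leb (%z. h z*g c z)" "(LINT z|cyl_leb. h z*g c z) = (LINT z|M. h (Phi z)*max 0 (- ?v c z))"
   using g[of c] bh unfolding P_def by blast+
  have hb: "AE z in M. norm (h (Phi z)) <= \<bar>B\<bar>"
  proof (rule AE_I2)
   fix z assume "z : space M"
   hence "Phi z : cyl" by (auto simp: space_M cyl_def)
   thus "norm (h (Phi z)) <= \<bar>B\<bar>" using h(2)[of "Phi z"] by simp
  qed
  have hi: "integrable M (%z. h (Phi z)*u z)" if "integrable M u" for u
  proof (rule Bochner_Integration.integrable_bound[OF integrable_mult_right[OF that, of "\<bar>B\<bar>"]])
   show "(%z. h (Phi z)*u z) : bm M" using that measurable_compose[OF Phi_M h(1)] by measurable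
   show "AE z in M. norm (h (Phi z)*u z) <= norm (\<bar>B\<bar>*u z)" using hb by eventually_elim (simp add: abs_mult mult_right_mono)
  qed
  have "(LINT z|M. h (Phi z)*max 0 (?v c z)) - (LINT z|M. h (Phi z)*max 0 (- ?v c z)) = (LINT z|M. h (Phi z)*max 0 (?v c z) - h (Phi z)*max 0 (- ?v c z))"
   by (intro Bochner_Integration.integral_diff[symmetric] hi ip)
  also have "... = (LINT z|M. h (Phi z)*?v c z)"
   by (intro Bochner_Integration.integral_cong refl) (auto simp: max_def algebra_simps)
  finally show "integrable cyl_leb (%z. h z*?w z $ c) &
   (LINT z|cyl_leb. h z*?w z $ c) = (LINT z|M. h (Phi z) * velocity (fst z) (snd z) $ c)"
   using 1 2 by (simp add: right_diff_distrib)
 qed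
qed

lemma eval_eta: "(%ga. ga r) : bm et"
 using eval_measurable[of r] by (simp add: measurable_cong_sets[OF sets_eta refl])

lemma law_continuity_eq:
 assumes w: "!!c. (%z. w z $ c) : bm cyl_borel"
  "!!h c. bmeas h ==>
   integrable cyl_leb (%z. h z*w z $ c) &
   (LINT z|cyl_leb. h z*w z $ c) = (LINT z|M. h (Phi z) * velocity (fst z) (snd z) $ c)"
 shows "continuity_eq occ w (marg et 0) (marg et 1)"
 unfolding continuity_eq_def
proof (intro allI impI)
 fix ps pst :: "real \<times> 'n torus => real" and psx :: "real \<times> 'n torus => real ^ 'n"
 assume C1: "is_C1_test ps pst psx"
 hence ct: "continuous_on cyl pst" and cx: "continuous_on cyl psx" by (auto simp: is_C1_test_def)
 have tm: "pst : bm cyl_borel" and xm: "psx : bm cyl_borel"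
  using ct cx by (auto intro: cont_cyl_measurable)
 have xcm: "(%z. psx z $ c) : bm cyl_borel" for c using cx by (intro cont_cyl_measurable continuous_intros)
 obtain A where A: "!!z. z : cyl ==> norm (pst z) <= A" by (rule cont_cyl_bounded[OF ct], rule that)
 obtain B where B: "!!z. z : cyl ==> norm (psx z) <= B" by (rule cont_cyl_bounded[OF cx], rule that)
 have Bc: "\<bar>psx z $ c\<bar> <= B" if "z : cyl" for z c using B[OF that] component_le_norm_cart[of "psx z" c] by linarith
 let ?v = "%z. velocity (fst z) (snd z)"
 have PM: "Phi z : cyl" if "z : space M" for z using that by (auto simp: space_M cyl_def)
 have [measurable]: "(%z. pst (Phi z)) : bm M" "(%z. psx (Phi z)) : bm M" "!!c. (%z. psx (Phi z) $ c) : bm M"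
  by (rule measurable_compose[OF Phi_M tm] measurable_compose[OF Phi_M xm] measurable_compose[OF Phi_M xcm])+
 have bx: "bmeas (%z. psx z $ c)" for c unfolding bmeas_def using xcm Bc by blast
 have i1: "integrable M (%z. pst (Phi z))" using A PM by (intro MI.P.integrable_const_bound[of _ A]) auto
 have i2: "integrable M (%z. psx (Phi z) $ c*?v z $ c)" for c
 proof (rule Bochner_Integration.integrable_bound[OF integrable_mult_right[OF vel_nth_integrable, of "\<bar>B\<bar>"]])
  show "AE z in M. norm (psx (Phi z) $ c*?v z $ c) <= norm (\<bar>B\<bar>*?v z $ c)"
  proof (rule AE_I2)
   fix z assume "z : space M"
   hence "\<bar>psx (Phi z) $ c\<bar> <= \<bar>B\<bar>" using Bc[OF PM, of z c] by simp
   thus "norm (psx (Phi z) $ c*?v z $ c) <= norm (\<bar>B\<bar>*?v z $ c)" by (simp add: abs_mult mult_right_mono)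
  qed
  show "(%z. psx (Phi z) $ c*?v z $ c) : bm M" using vel_nth_integrable[of c] by measurable
 qed
 have "(LINT z|cyl_leb. psx z \<bullet> w z) = (LINT z|cyl_leb. (\<Sum>c\<in>UNIV. psx z $ c*w z $ c))" by (simp add: inner_vec_def)
 also have "... = (\<Sum>c\<in>UNIV. \<integral>z. psx z $ c*w z $ c \<partial>cyl_leb)"
  using w(2)[OF bx] by (intro Bochner_Integration.integral_sum) blast
 also have "... = (\<Sum>c\<in>UNIV. \<integral>z. psx (Phi z) $ c*?v z $ c \<partial>M)"
  using w(2)[OF bx] by (intro sum.cong refl) blast
 also have "... = (LINT z|M. psx (Phi z) \<bullet> ?v z)"
  unfolding inner_vec_def using i2 by (subst Bochner_Integration.integral_sum) auto
 finally have X: "(LINT z|cyl_leb. psx z \<bullet> w z) = (LINT z|M. psx (Phi z) \<bullet> ?v z)" .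
 have i3: "integrable M (%z. psx (Phi z) \<bullet> ?v z)" unfolding inner_vec_def using i2 by auto
 have T: "(LINT z|occ. pst z) = (LINT z|M. pst (Phi z))" unfolding occ_def by (rule integral_distr[OF Phi_M tm])
 have i4: "integrable M (%z. pst (Phi z) + psx (Phi z) \<bullet> ?v z)" using i1 i3 by simp
 have "(LINT z|occ. pst z) + (LINT z|cyl_leb. psx z \<bullet> w z) = (LINT z|M. pst (Phi z) + psx (Phi z) \<bullet> ?v z)"
  unfolding X T using i1 i3 by simp
 also have "... = (\<integral>ga. (LINT s|I01. pst (s, ga s) + psx (s, ga s) \<bullet> velocity ga s) \<partial>et)"
  using MI.integral_fst'[OF i4] by simp
 also have "... = (LINT ga|et. ps (1, ga 1) - ps (0, ga 0))"
 proof (rule integral_cong_AE)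
  show "(%ga. \<integral>s. pst (s, ga s) + psx (s, ga s) \<bullet> velocity ga s \<partial>I01) : bm et"
   using i4 MI.integrable_fst'[OF i4] by (auto dest: borel_measurable_integrable)
  have "(%ga. ps (1, ga 1)) : bm et" "(%ga. ps (0, ga 0)) : bm et"
   by (rule measurable_compose[OF eval_eta borel_measurable_continuous_onI[OF C1_test_slice_continuous[OF C1]]]; simp)+
  thus "(%ga. ps (1, ga 1) - ps (0, ga 0)) : bm et" by measurable
  show "AE ga in et. (LINT s|I01. pst (s, ga s) + psx (s, ga s) \<bullet> velocity ga s) = ps (1, ga 1) - ps (0, ga 0)"
   using AE_W
  proof eventually_elim
   case (elim ga)
   hence g: "abs_continuous_curve ga" "ga : curves" by (auto simp: W_curves_def)
   let ?F = "%s. pst (s, ga s) + psx (s, ga s) \<bullet> velocity ga s"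
   have [measurable]: "(%s. velocity ga s) : bm I01" by (rule vel_section[OF g(2)])
   have [measurable]: "(%s. pst (s, ga s)) : bm I01" "(%s. psx (s, ga s)) : bm I01"
   by (rule measurable_compose[OF Phi_section[OF g(2)] tm] measurable_compose[OF Phi_section[OF g(2)] xm])+
   have "(LINT s|I01. ?F s) = (LINT s|lebesgue_on {0..1}. ?F s)" by (rule integral_I01[symmetric]) measurable
   also have "... = (LINT s:{0..1}|lebesgue. ?F s)" unfolding set_lebesgue_integral_def by (rule integral_restrict_space) simp
   also have "... = integral {0..1} ?F" by (rule set_lebesgue_integral_eq_integral(2)[OF chain_rule_abs_continuous(1)[OF g C1]])
   also have "... = ps (1, ga 1) - ps (0, ga 0)" by (rule integral_unique[OF chain_rule_abs_continuous(2)[OF g C1]])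
   finally show ?case .
  qed
 qed
 also have "... = (LINT ga|et. ps (1, ga 1)) - (LINT ga|et. ps (0, ga 0))"
 proof (rule Bochner_Integration.integral_diff)
  have "integrable et (%ga. ps (t, ga t))" if t: "t : {0..1}" for t
  proof -
   have c: "cont (%x. ps (t, x))" by (rule C1_test_slice_continuous[OF C1 t])
   obtain K where K: "!!x. norm (ps (t, x)) <= K"
   using compact_imp_bounded[OF compact_continuous_image[OF c compact_UNIV_torus]] unfolding bounded_iff by auto
   show ?thesis
   using K measurable_compose[OF eval_eta borel_measurable_continuous_onI[OF c]] by (intro integrable_const_bound[of _ K]) auto
  qed
  thus "integrable et (%ga. ps (1, ga 1))" "integrable et (%ga. ps (0, ga 0))" by auto
 qed
 also have "(LINT ga|et. ps (1, ga 1)) = (LINT x|marg et 1. ps (1, x))"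
  by (rule integral_distr[symmetric, OF eval_eta borel_measurable_continuous_onI[OF C1_test_slice_continuous[OF C1]]]) simp
 also have "(LINT ga|et. ps (0, ga 0)) = (LINT x|marg et 0. ps (0, x))"
  by (rule integral_distr[symmetric, OF eval_eta borel_measurable_continuous_onI[OF C1_test_slice_continuous[OF C1]]]) simp
 finally show "(LINT z|occ. pst z) + (LINT z|cyl_leb. psx z \<bullet> w z) =
  (LINT x|marg et 1. ps (1, x)) - (LINT x|marg et 0. ps (0, x))" .
qed

theorem admissible_of_law:
 assumes ac: "absolutely_continuous cyl_leb (sig p et)"
 obtains w where "(occ, w) : admissible (marg et 0) (marg et 1)"
  "action al occ w <= (nn_integral cyl_leb (%z. ennreal (enn2real (RN_deriv cyl_leb (sig p et) z) powr (2 - al))))"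
proof -
 interpret L: prob_space "cyl_leb :: (real \<times> 'n torus) measure" by (rule prob_space_cyl_leb)
 interpret S: finite_measure "sig p et" by (rule finite_sig)
 interpret O: finite_measure occ using occ_finite by (simp add: is_finite_cyl_measure_def)
 have mcl: "f : bm cyl_leb \<longleftrightarrow> f : bm cyl_borel" for f :: "real \<times> 'n torus => real"
  by (simp add: measurable_cong_sets[OF sets_cyl_leb refl])
 obtain w :: "real \<times> 'n torus => real ^ 'n" where w: "!!c. (%z. w z $ c) : bm cyl_borel"
  "!!h c. bmeas h ==>
   integrable cyl_leb (%z. h z*w z $ c) &
   (LINT z|cyl_leb. h z*w z $ c) = (LINT z|M. h (Phi z) * velocity (fst z) (snd z) $ c)"
  by (rule flux_exists[OF ac], rule that)
 have wci: "integrable cyl_leb (%z. w z $ c)" for c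
 proof -
  have "bmeas (%_ :: real \<times> 'n torus. 1)" unfolding bmeas_def by (auto intro: exI[of _ 1])
  from w(2)[OF this, of c] show ?thesis by simp
 qed
 have wi: "integrable cyl_leb w"
 proof (rule Bochner_Integration.integrable_bound[of _ "%z. \<Sum>c\<in>UNIV. \<bar>w z $ c\<bar>"])
  show "integrable cyl_leb (%z. \<Sum>c\<in>UNIV. \<bar>w z $ c\<bar>)" using wci by auto
  show "w : bm cyl_leb"
  proof (rule borel_measurable_euclidean_space[THEN iffD2], rule ballI)
   fix b :: "real ^ 'n" assume "b : Basis"
   then obtain c where b: "b = axis c 1" by (auto simp: Basis_vec_def)
   show "(%z. w z \<bullet> b) : bm cyl_leb" using wci[of c] unfolding b by (simp add: inner_axis)
  qed
  show "AE z in cyl_leb. norm (w z) <= norm (\<Sum>c\<in>UNIV. \<bar>w z $ c\<bar>)"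
   using norm_le_l1_cart by (intro AE_I2) (simp add: sum_nonneg)
 qed
 define s where "s z = enn2real (RN_deriv cyl_leb (sig p et) z)" for z
 have sm [measurable]: "s : bm cyl_leb" unfolding s_def by measurable
 have s0: "s z >= 0" for z by (simp add: s_def)
 have ssig: "sets (sig p et) = sets cyl_leb" by simp
 have "AE x in cyl_leb. RN_deriv cyl_leb (sig p et) x ~= \<infinity>"
  by (rule L.RN_deriv_finite[OF S.sigma_finite_measure_axioms ac ssig])
 hence dens: "density cyl_leb (%x. ennreal (s x)) = sig p et"
  by (subst L.density_RN_deriv[OF ac ssig, symmetric], intro density_cong)
   (auto simp: s_def top.not_eq_extremum ennreal_enn2real)
 define r where "r = ac_density occ"
 have "is_ac_density occ r" unfolding r_def by (rule is_ac_density_ac_density[OF occ_finite])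
 then obtain rhs N where r: "r : bm cyl_leb" "!!z. 0 <= r z" and
  N: "sets rhs = sets occ" "N : null_sets cyl_leb" "emeasure rhs (space rhs - N) = 0"
  "!!A. A : sets occ ==> emeasure occ A = emeasure (density cyl_leb r) A + emeasure rhs A"
  unfolding is_ac_density_def by blast
 have socc: "sets occ = sets cyl_borel" by (simp add: occ_def)
 note rm [measurable] = r(1)
 have rnn: "(nn_integral cyl_leb (%z. ennreal (r z)*indicator A z)) <= emeasure occ A" if "A : sets cyl_borel" for A
  using N(4)[of A] that socc by (simp add: emeasure_density)
 have ri: "integrable cyl_leb r"
 proof (rule integrableI_bounded)
  have "(nn_integral cyl_leb (%z. ennreal (norm (r z)))) = (nn_integral cyl_leb (%z. ennreal (r z)*indicator cyl z))"
   using r(2) by (intro nn_integral_cong) (auto simp: indicator_def)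
  also have "... <= emeasure occ cyl" using sets.top[of cyl_borel] by (intro rnn) (simp add: space_cyl_borel)
  also have "... < \<infinity>" by (simp add: O.emeasure_eq_measure)
  finally show "(nn_integral cyl_leb (%z. ennreal (norm (r z)))) < \<infinity>" .
 qed simp
 have "integrable (sig p et) (%_. 1 :: real)" by simp
 hence "integrable (density cyl_leb (%x. ennreal (s x))) (%_. 1 :: real)" unfolding dens .
 hence si: "integrable cyl_leb s" using s0 by (subst (asm) integrable_density) auto
 let ?v = "%z. velocity (fst z) (snd z)"
 have tangent_AE: "AE z in cyl_leb. (1 - p)*norm c powr p*r z + p*norm c powr (p - 2)*(c \<bullet> w z) <= s z" for c
 proof (rule AE_le_if_set_integral_le[OF _ si])
  let ?k = "p*norm c powr (p - 2)" and ?a = "(1 - p)*norm c powr p"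
  have wc: "integrable cyl_leb (%z. c \<bullet> w z)" using wi by auto
  show Fi: "integrable cyl_leb (%z. ?a*r z + ?k*(c \<bullet> w z))" using ri wc by auto
  fix A assume "A : sets (cyl_leb :: (real \<times> 'n torus) measure)"
  hence A: "A : sets cyl_borel" by simp
  define B where "B = A - N"
  have B: "B : sets cyl_borel" using A N(2) by (auto simp: B_def null_sets_def)
  have AE: "AE z in cyl_leb. indicator A z = (indicator B z :: real)"
   using AE_not_in[OF N(2)] by eventually_elim (auto simp: B_def indicator_def)
  have iBm: "(indicator B :: _ => real) : bm cyl_borel" using B by simp
  have [measurable]: "(%z. indicator B (Phi z) :: real) : bm M" by (rule measurable_compose[OF Phi_M iBm])
  have bB: "bmeas (indicator B)" unfolding bmeas_def using iBm by (auto intro!: exI[of _ 1] simp: indicator_def)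
  have iB: "integrable M (%z. indicator B (Phi z)*u z)" if u: "integrable M u" for u :: "_ => real"
  proof (rule Bochner_Integration.integrable_bound[OF u])
   show "(%z. indicator B (Phi z)*u z) : bm M" using u by measurable
   show "AE z in M. norm (indicator B (Phi z)*u z) <= norm (u z)" by (intro AE_I2) (auto simp: indicator_def)
  qed
  have i1: "integrable M (%z. indicator B (Phi z)*1 :: real)" by (rule iB) simp
  have i2: "integrable M (%z. c \<bullet> ?v z)" using vel_integrable by auto
  have R: "(LINT z|cyl_leb. r z*indicator B z) = (LINT z|M. indicator B (Phi z)*1)"
  proof -
   have "emeasure rhs B <= emeasure rhs (space rhs - N)"
   proof (rule emeasure_mono)
   have "B <= space rhs" using B N(1) socc sets.sets_into_space[of B rhs] by simp
   thus "B <= space rhs - N" by (auto simp: B_def)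
   show "space rhs - N : sets rhs" using N(1,2) socc by (intro sets.compl_sets) (auto simp: null_sets_def)
   qed
   hence "emeasure occ B = (nn_integral cyl_leb (%z. ennreal (r z)*indicator B z))"
   using N(3) N(4)[of B] B socc by (simp add: emeasure_density)
   also have "... = (nn_integral cyl_leb (%z. ennreal (r z*indicator B z)))" by (intro nn_integral_cong) (auto simp: indicator_def)
   also have "... = ennreal (LINT z|cyl_leb. r z*indicator B z)"
   using ri B r(2) by (intro nn_integral_eq_integral integrable_real_mult_indicator) auto
   finally have "measure occ B = (LINT z|cyl_leb. r z*indicator B z)"
   using r(2) by (simp add: measure_def Bochner_Integration.integral_nonneg)
   moreover have "measure occ B = (LINT z|occ. indicator B z)" using B socc sets.sets_into_space[of B occ] by (simp add: Int_absorb2)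
   moreover have "... = (LINT z|M. indicator B (Phi z))" unfolding occ_def by (rule integral_distr[OF Phi_M iBm])
   ultimately show ?thesis by simp
  qed
  have W: "(LINT z|cyl_leb. (c \<bullet> w z)*indicator B z) = (LINT z|M. indicator B (Phi z)*(c \<bullet> ?v z))"
  proof -
   have "(LINT z|cyl_leb. (c \<bullet> w z)*indicator B z) = (LINT z|cyl_leb. (\<Sum>j\<in>UNIV. c $ j*(indicator B z*w z $ j)))"
   by (intro Bochner_Integration.integral_cong refl) (simp add: inner_vec_def sum_distrib_left sum_distrib_right mult_ac)
   also have "... = (\<Sum>j\<in>UNIV. c $ j*(LINT z|cyl_leb. indicator B z*w z $ j))"
   using w(2)[OF bB] by (subst Bochner_Integration.integral_sum) auto
   also have "... = (\<Sum>j\<in>UNIV. c $ j*(LINT z|M. indicator B (Phi z)*?v z $ j))"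
   using w(2)[OF bB] by simp
   also have "... = (LINT z|M. (\<Sum>j\<in>UNIV. c $ j*(indicator B (Phi z)*?v z $ j)))"
   using iB[OF vel_nth_integrable] by (subst Bochner_Integration.integral_sum) auto
   also have "... = (LINT z|M. indicator B (Phi z)*(c \<bullet> ?v z))"
   by (intro Bochner_Integration.integral_cong refl) (simp add: inner_vec_def sum_distrib_left mult_ac)
   finally show ?thesis .
  qed
  have Sg: "(LINT z|cyl_leb. s z*indicator B z) = (LINT z|M. indicator B (Phi z)*(norm (?v z) powr p))"
  proof -
   have "(LINT z|cyl_leb. s z*indicator B z) = (LINT z|density cyl_leb (%x. ennreal (s x)). indicator B z)"
   using s0 B by (subst integral_density) auto
   also have "... = (LINT z|sig p et. indicator B z)" unfolding dens ..
   also have "... = (LINT z|M. indicator B (Phi z)*(norm (?v z) powr p))"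
   unfolding integral_sig[OF iBm] by (simp add: mult.commute)
   finally show ?thesis .
  qed
  have cm: "(LINT z|cyl_leb. F z*indicator A z) = (LINT z|cyl_leb. F z*indicator B z)" if "integrable cyl_leb F" for F :: "real \<times> 'n torus => real"
   using AE that A B by (intro integral_cong_AE) (auto elim!: eventually_mono)
  have "(LINT z|cyl_leb. (?a*r z + ?k*(c \<bullet> w z))*indicator A z) = (LINT z|cyl_leb. ?a*(r z*indicator B z) + ?k*((c \<bullet> w z)*indicator B z))"
   unfolding cm[OF Fi] by (intro Bochner_Integration.integral_cong refl) (simp add: algebra_simps)
  also have "... = ?a*(LINT z|cyl_leb. r z*indicator B z) + ?k*(LINT z|cyl_leb. (c \<bullet> w z)*indicator B z)"
   using ri wc B by (subst Bochner_Integration.integral_add) (auto intro!: integrable_real_mult_indicator)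
  also have "... = (LINT z|M. ?a*(indicator B (Phi z)*1) + ?k*(indicator B (Phi z)*(c \<bullet> ?v z)))"
   unfolding R W using i1 iB[OF i2] by (subst Bochner_Integration.integral_add) auto
  also have "... <= (LINT z|M. indicator B (Phi z)*(norm (?v z) powr p))"
  proof (rule integral_mono)
   show "integrable M (%z. ?a*(indicator B (Phi z)*1) + ?k*(indicator B (Phi z)*(c \<bullet> ?v z)))" using i1 iB[OF i2] by auto
   show "integrable M (%z. indicator B (Phi z)*norm (?v z) powr p)" by (rule iB[OF speed_integrable])
   fix z
   have cc: "norm c powr (p - 2)*(c \<bullet> c) = norm c powr p"
   using powr_add[of "norm c" "p - 2" 2] by (cases "c = 0") (simp_all add: power2_norm_eq_inner[symmetric])
   have "?a + ?k*(c \<bullet> ?v z) = norm c powr p + ?k*(c \<bullet> (?v z - c))"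
   unfolding inner_diff_right right_diff_distrib mult.assoc cc by (simp add: algebra_simps)
   also have "... <= norm (?v z) powr p" by (rule powr_tangent[OF p1])
   finally have "indicator B (Phi z)*(?a + ?k*(c \<bullet> ?v z)) <= indicator B (Phi z)*norm (?v z) powr p"
   by (intro mult_left_mono) auto
   thus "?a*(indicator B (Phi z)*1) + ?k*(indicator B (Phi z)*(c \<bullet> ?v z)) <= indicator B (Phi z)*norm (?v z) powr p"
   by (simp add: algebra_simps)
  qed
  also have "... = (LINT z|cyl_leb. s z*indicator A z)" unfolding cm[OF si] Sg ..
  finally show "(LINT z|cyl_leb. (?a*r z + ?k*(c \<bullet> w z))*indicator A z) <= (LINT z|cyl_leb. s z*indicator A z)" .
 qed
 obtain D :: "(real ^ 'n) set" where D: "countable D" "!!X. open X ==> X ~= {} ==> \<exists>d\<in>D. d : X"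
  by (rule countable_dense_setE, rule that)
 have "AE z in cyl_leb. ALL c:D. (1 - p)*norm c powr p*r z + p*norm c powr (p - 2)*(c \<bullet> w z) <= s z"
  using tangent_AE D(1) by (simp add: AE_ball_countable)
 hence "AE z in cyl_leb. H_cost al (r z) (w z) <= ennreal (s z powr (2 - al))"
 proof eventually_elim
  case (elim z)
  note * = tangent_bounds_imp_cost_le[where w = "w z" and D = D, OF p1 r(2)[of z] s0[of z] D(2)]
  show ?case
   by (rule H_cost_le_powr[OF alpha p_def r(2) s0]) (use*elim in blast)+
 qed
 hence "action al occ w <= (nn_integral cyl_leb (%z. ennreal (s z powr (2 - al))))"
  unfolding action_def r_def by (rule nn_integral_mono_AE)
 moreover have "(occ, w) : admissible (marg et 0) (marg et 1)"
  unfolding admissible_def using occ_finite wi law_continuity_eq[OF w] by simp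
 ultimately show ?thesis using that by (simp add: s_def)
qed

end

text \<open>The occupation measure and the flux of the law form an admissible pair whose action is at most the cost.\<close>
theorem W_dist_le_K_cost:
 fixes rh0 rh1 :: "'n::finite torus measure"
 assumes a: "0 < al" "al < 1"
 shows "(W_dist al rh0 rh1)\<^sup>2 <= K_cost al rh0 rh1 et"
proof (cases "et : Pi2_ac_between al rh0 rh1")
 case True
 hence et: "et : Pi2 al" "absolutely_continuous cyl_leb (sigma_meas al et)"
  "marg et 0 = rh0" "marg et 1 = rh1"
  by (auto simp: Pi2_ac_between_def Pi2_ac_def)
 interpret Pi2_law et al "2/(2 - al)" using et(1) Pi2_law_iff[OF a] by blast
 obtain w where w: "(occ, w) : admissible rh0 rh1"
  "action al occ w <= (nn_integral cyl_leb (%z. ennreal (enn2real (RN_deriv cyl_leb (sig (2/(2 - al)) et) z) powr (2 - al))))"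
  using admissible_of_law et unfolding sigma_meas_eq_sig by metis
 have "(W_dist al rh0 rh1)\<^sup>2 <= action al occ w"
  unfolding W_dist_power2 using INF_lower[OF w(1), of "%(rh, w). action al rh w"] by simp
 also note w(2)
 finally show ?thesis using True by (simp add: K_cost_def sigma_meas_eq_sig)
qed (simp add: K_cost_def)

section \<open>Mollification and the value function\<close>

lemma integrable_bounded_support:
 fixes g :: "'e::euclidean_space => 'b::{banach, second_countable_topology}"
 assumes "g : bm borel" "!!y. norm (g y) <= C" "!!y. y ~: cball z R ==> g y = 0"
 shows "integrable lborel g"
proof (rule Bochner_Integration.integrable_bound)
 have "emeasure lborel (cball z R) < \<infinity>" using emeasure_bounded_finite[OF bounded_cball] by simp
 thus "integrable lborel (%y. indicator (cball z R) y *\<^sub>R C)" by (intro integrable_scaleR_left) (simp add: integrable_indicator_iff)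
 show "g : bm lborel" using assms(1) by simp
 have "0 <= C" using assms(2)[of z] norm_ge_zero order_trans by blast
 thus "AE y in lborel. norm (g y) <= norm (indicator (cball z R) y *\<^sub>R C)"
  using assms(2,3) by (intro AE_I2) (auto simp: indicator_def)
qed

text \<open>An unnormalized kernel with compact support whose second order Taylor remainder is explicitly bounded; this is
all the smoothness that mollification uses here.\<close>
definition bump :: "real => 'e::euclidean_space => real" where
 "bump e x = (max 0 (e\<^sup>2 - (norm x)\<^sup>2))\<^sup>2"

lemma bump_zero_aux: "0 < e ==> e <= norm x ==> max 0 (e\<^sup>2 - (norm x)\<^sup>2) = 0"
proof -
 assume "0 < e" "e <= norm x"
 hence "e\<^sup>2 <= (norm x)\<^sup>2" by (intro power_mono) auto
 thus ?thesis by simp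
qed

lemma bump_support: "0 < e ==> e <= norm x ==> bump e x = 0"
 unfolding bump_def by (simp only: bump_zero_aux) simp

lemma bump_bound: "0 <= bump e x" "bump e x <= e^4"
proof -
 show "0 <= bump e x" by (simp add: bump_def)
 have "(max 0 (e\<^sup>2 - (norm x)\<^sup>2))\<^sup>2 <= (e\<^sup>2)\<^sup>2" by (intro power_mono) auto
 thus "bump e x <= e^4" by (simp add: bump_def power_mult[symmetric])
qed

lemma continuous_bump: "continuous_on S (bump e)"
 unfolding bump_def[abs_def] by (intro continuous_intros)

lemma bump_taylor:
 fixes x k :: "'e::euclidean_space"
 assumes e: "0 < e" and k: "norm k <= 1"
 shows "\<bar>bump e (x + k) - bump e x + 4*max 0 (e\<^sup>2 - (norm x)\<^sup>2)*(x \<bullet> k)\<bar>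
  <= ((2*(e + 1) + 1)\<^sup>2 + 2*e\<^sup>2)*(norm k)\<^sup>2*indicator (cball 0 (e + 1)) x"
proof (cases "norm x <= e + 1")
 case False
 have "norm x <= norm (x + k) + norm k" using norm_triangle_ineq4[of "x + k" k] by simp
 hence "e <= norm (x + k)" "e <= norm x" using False k by auto
 hence "bump e (x + k) = 0" "bump e x = 0" "max 0 (e\<^sup>2 - (norm x)\<^sup>2) = 0"
  using e bump_support bump_zero_aux by blast+
 thus ?thesis by simp
next
 case True
 define a b m where "a = (norm x)\<^sup>2" and "b = (norm (x + k))\<^sup>2" and "m = max 0 (e\<^sup>2 - a)"
 have m: "0 <= m" "m <= e\<^sup>2" by (auto simp: m_def a_def)
 have ba: "b - a = 2*(x \<bullet> k) + (norm k)\<^sup>2" by (simp add: a_def b_def power2_norm_eq_inner inner_add inner_commute)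
 have sq: "\<bar>(max 0 v)\<^sup>2 - (max 0 u)\<^sup>2 - 2*max 0 u*(v - u)\<bar> <= (v - u)\<^sup>2" for u v :: real
 proof (cases "0 <= u")
  case u: True
  show ?thesis
  proof (cases "0 <= v")
   case True
   hence "(max 0 v)\<^sup>2 - (max 0 u)\<^sup>2 - 2*max 0 u*(v - u) = (v - u)\<^sup>2"
   using u by (simp add: power2_eq_square algebra_simps)
   thus ?thesis by simp
  next
   case False
   hence "(max 0 v)\<^sup>2 - (max 0 u)\<^sup>2 - 2*max 0 u*(v - u) = u\<^sup>2 - 2*(u * v)"
   using u by (simp add: power2_eq_square algebra_simps)
   moreover have "u * v <= 0" using u False by (intro mult_nonneg_nonpos) auto
   moreover have "(v - u)\<^sup>2 = u\<^sup>2 - 2*(u * v) + v\<^sup>2" by (simp add: power2_diff)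
   ultimately show ?thesis using zero_le_power2[of u] zero_le_power2[of v] by linarith
  qed
 next
  case u: False
  show ?thesis
  proof (cases "0 <= v")
   case True
   hence "v\<^sup>2 <= (v - u)\<^sup>2" using u by (intro power_mono) auto
   thus ?thesis using u True by simp
  qed (use u in simp)
 qed
 have "bump e (x + k) - bump e x + 4*max 0 (e\<^sup>2 - (norm x)\<^sup>2)*(x \<bullet> k)
  = ((max 0 (e\<^sup>2 - b))\<^sup>2 - m\<^sup>2 - 2*m*((e\<^sup>2 - b) - (e\<^sup>2 - a))) - 2*m*(norm k)\<^sup>2"
  unfolding bump_def a_def[symmetric] b_def[symmetric] m_def[symmetric] using ba by (simp add: algebra_simps)
 hence F1: "\<bar>bump e (x + k) - bump e x + 4*max 0 (e\<^sup>2 - (norm x)\<^sup>2)*(x \<bullet> k)\<bar> <= ((e\<^sup>2 - b) - (e\<^sup>2 - a))\<^sup>2 + 2*m*(norm k)\<^sup>2"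
  using sq[of "e\<^sup>2 - b" "e\<^sup>2 - a"] m unfolding m_def[symmetric]
  by (smt (verit) mult_nonneg_nonneg zero_le_power2)
 have F2: "((e\<^sup>2 - b) - (e\<^sup>2 - a))\<^sup>2 = (b - a)\<^sup>2" by (simp add: power2_commute)
 have F3: "(b - a)\<^sup>2 <= ((2*(e + 1) + 1)*norm k)\<^sup>2"
 proof (rule power2_le_iff_abs_le[THEN iffD2])
  show "0 <= (2*(e + 1) + 1)*norm k" using e by simp
  have "\<bar>b - a\<bar> <= 2*\<bar>x \<bullet> k\<bar> + (norm k)\<^sup>2" unfolding ba
   using abs_triangle_ineq[of "2*(x \<bullet> k)" "(norm k)\<^sup>2"] by simp
  also have "... <= 2*(norm x*norm k) + norm k*norm k"
   using Cauchy_Schwarz_ineq2[of x k] by (simp add: power2_eq_square)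
  also have "... <= 2*((e + 1)*norm k) + 1*norm k"
   using True k by (intro add_mono mult_left_mono mult_right_mono) auto
  finally show "\<bar>b - a\<bar> <= (2*(e + 1) + 1)*norm k" by (simp add: algebra_simps)
 qed
 have F4: "2*m*(norm k)\<^sup>2 <= 2*e\<^sup>2*(norm k)\<^sup>2" using m by (intro mult_right_mono) auto
 have "\<bar>bump e (x + k) - bump e x + 4*max 0 (e\<^sup>2 - (norm x)\<^sup>2)*(x \<bullet> k)\<bar>
   <= ((2*(e + 1) + 1)\<^sup>2 + 2*e\<^sup>2)*(norm k)\<^sup>2"
  using F1 F2 F3 F4 unfolding power_mult_distrib distrib_right[of "(2*(e + 1) + 1)\<^sup>2"] by linarith
 thus ?thesis using True by simp
qed

lemma bump_integral_pos:
 assumes e: "0 < e"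
 shows "integrable lborel (bump e :: 'e::euclidean_space => real)" "0 < (LINT y|(lborel :: 'e measure). bump e y)"
proof -
 have m: "(bump e :: 'e => real) : bm borel" by (rule borel_measurable_continuous_onI[OF continuous_bump])
 show i: "integrable lborel (bump e :: 'e => real)"
 proof (rule integrable_bounded_support[OF m])
  show "norm (bump e y) <= e^4" for y :: 'e using bump_bound[of e y] by simp
  show "bump e y = 0" if "y ~: cball 0 e" for y :: 'e using that bump_support[OF e, of y] by simp
 qed
 have "ball (0::'e) (e/2) ~= {}" using e by simp
 hence "0 < measure lborel (ball (0::'e) (e/2))" using e by (simp add: content_ball_pos)
 moreover have "(LINT y|(lborel :: 'e measure). (e\<^sup>2 - (e/2)\<^sup>2)\<^sup>2*indicator (ball 0 (e/2)) y) <= (LINT y|(lborel :: 'e measure). bump e y)"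
 proof (rule integral_mono[OF _ i])
  have "emeasure lborel (ball (0::'e) (e/2)) < \<infinity>" using emeasure_bounded_finite[OF bounded_ball] by simp
  thus "integrable lborel (%y. (e\<^sup>2 - (e/2)\<^sup>2)\<^sup>2*indicator (ball (0::'e) (e/2)) y)" by (simp add: integrable_indicator_iff)
  fix y :: 'e
  show "(e\<^sup>2 - (e/2)\<^sup>2)\<^sup>2*indicator (ball 0 (e/2)) y <= bump e y"
  proof (cases "y : ball 0 (e/2)")
   case True
   hence "(norm y)\<^sup>2 <= (e/2)\<^sup>2" by (intro power_mono) auto
   moreover have "(e/2)\<^sup>2 <= e\<^sup>2" using e by (intro power_mono) auto
   ultimately have "(e\<^sup>2 - (e/2)\<^sup>2)\<^sup>2 <= (max 0 (e\<^sup>2 - (norm y)\<^sup>2))\<^sup>2" by (intro power_mono) auto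
   thus ?thesis using True by (simp add: bump_def)
  qed (simp add: bump_bound)
 qed
 moreover have "(LINT y|(lborel :: 'e measure). (e\<^sup>2 - (e/2)\<^sup>2)\<^sup>2*indicator (ball 0 (e/2)) y) = (e\<^sup>2 - (e/2)\<^sup>2)\<^sup>2*measure lborel (ball (0::'e) (e/2))"
  by simp
 moreover have "0 < (e\<^sup>2 - (e/2)\<^sup>2)\<^sup>2" using e by (simp add: power_divide)
 ultimately show "0 < (LINT y|(lborel :: 'e measure). bump e y)" by (smt (verit) mult_pos_pos)
qed

text \<open>The Taylor bound of the kernel is integrated; the mollified function needs no regularity beyond boundedness
and measurability.\<close>
lemma mollify:
 fixes U :: "'e::euclidean_space => real"
 assumes U: "U : bm borel" "!!y. \<bar>U y\<bar> <= B" and e: "0 < e"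
 obtains ps G and ka :: "'e => real" where
  "ka : bm borel" "!!y. 0 <= ka y" "!!y. e <= norm y ==> ka y = 0" "integrable lborel ka" "(LINT y|lborel. ka y) = 1"
  "!!z. integrable lborel (%y. U (z - y)*ka y)" "!!z. ps z = (LINT y|lborel. U (z - y)*ka y)"
  "!!z. (ps has_derivative (%h. h \<bullet> G z)) (at z)" "cont G"
proof -
 define I where "I = (LINT y|(lborel :: 'e measure). bump e y)"
 have I: "0 < I" unfolding I_def by (rule bump_integral_pos[OF e])
 define ka :: "'e => real" where "ka y = bump e y/I" for y
 have bm [measurable]: "(bump e :: 'e => real) : bm borel" by (rule borel_measurable_continuous_onI[OF continuous_bump])
 have km: "ka : bm borel" unfolding ka_def[abs_def] by measurable
 note Um [measurable] = U(1)
 have B0: "0 <= B" using U(2) abs_ge_zero order_trans by blast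
 have Uk: "integrable lborel (%y. U (z - y)*bump e y)" for z
 proof (rule integrable_bounded_support[where z = 0 and R = e and C = "B*e^4"])
  show "(%y. U (z - y)*bump e y) : bm borel" by measurable
  show "norm (U (z - y)*bump e y) <= B*e^4" for y
   using U(2)[of "z - y"] bump_bound[of e y] B0 by (simp add: abs_mult mult_mono)
  show "U (z - y)*bump e y = 0" if "y ~: cball 0 e" for y using that bump_support[OF e, of y] by simp
 qed
 have Uk2: "integrable lborel (%y. U y*bump e (z - y))" for z
 proof (rule integrable_bounded_support[where z = z and R = e and C = "B*e^4"])
  show "(%y. U y*bump e (z - y)) : bm borel" by measurable
  show "norm (U y*bump e (z - y)) <= B*e^4" for y
   using U(2)[of y] bump_bound[of e "z - y"] B0 by (simp add: abs_mult mult_mono)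
  show "U y*bump e (z - y) = 0" if "y ~: cball z e" for y using that bump_support[OF e, of "z - y"] by (simp add: dist_norm)
 qed
 define \<Psi> where "\<Psi> z = (LINT y|lborel. U y*bump e (z - y))" for z
 have swap: "\<Psi> z = (LINT y|lborel. U (z - y)*bump e y)" for z
 proof -
  have "(lborel :: 'e measure) = distr lborel borel (%x. z + (- 1) *\<^sub>R x)"
   using lborel_affine[of "- 1" z] by (simp add: density_1)
  hence "\<Psi> z = (LINT y|distr lborel borel (%x. z + (- 1) *\<^sub>R x). U y*bump e (z - y))"
   unfolding \<Psi>_def by simp
  also have "... = (LINT y|lborel. U (z - y)*bump e y)"
   by (subst integral_distr) auto
  finally show ?thesis .
 qed
 define m where "m x = max 0 (e\<^sup>2 - (norm x)\<^sup>2)" for x :: 'e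
 have m: "0 <= m x" "m x <= e\<^sup>2" for x by (auto simp: m_def)
 have mc: "cont m" unfolding m_def[abs_def] by (intro continuous_intros)
 have mm [measurable]: "m : bm borel" by (rule borel_measurable_continuous_onI[OF mc])
 have m0: "m x = 0" if "e <= norm x" for x unfolding m_def using bump_zero_aux[OF e that] .
 have mnx: "norm (m x *\<^sub>R x) <= e\<^sup>2*e" for x
 proof (cases "e <= norm x")
  case False thus ?thesis using m[of x] by (simp add: mult_mono)
 qed (use m0 e in simp)
 define D where "D z = (LINT y|lborel. (- 4*U y*m (z - y)) *\<^sub>R (z - y))" for z
 have Db: "norm ((- 4*U y*m (z - y)) *\<^sub>R (z - y)) <= 4*B*(e\<^sup>2*e)" for y z
 proof -
  have "norm ((- 4*U y*m (z - y)) *\<^sub>R (z - y)) = 4*\<bar>U y\<bar>*norm (m (z - y) *\<^sub>R (z - y))"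
   by (simp add: abs_mult)
  also have "... <= 4*B*(e\<^sup>2*e)" using U(2)[of y] mnx[of "z - y"] B0 by (intro mult_mono) auto
  finally show ?thesis .
 qed
 have Di: "integrable lborel (%y. (- 4*U y*m (z - y)) *\<^sub>R (z - y))" for z
 proof (rule integrable_bounded_support[where z = z and R = e, OF _ Db])
  show "(%y. (- 4*U y*m (z - y)) *\<^sub>R (z - y)) : bm borel" by measurable
  show "(- 4*U y*m (z - y)) *\<^sub>R (z - y) = 0" if "y ~: cball z e" for y using that m0[of "z - y"] by (simp add: dist_norm)
 qed
 have Dc: "cont D"
  unfolding continuous_on_sequentially o_def
 proof (intro ballI allI impI)
  fix z :: 'e and zn assume "(\<forall>n. zn n : UNIV) & zn ~> z"
  hence zn: "zn ~> z" by blast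
  then obtain N where N: "!!n. n >= N ==> dist (zn n) z < 1" using metric_LIMSEQ_D[OF zn zero_less_one] by blast
  have "(%n. D (zn (n + N))) ~> D z"
   unfolding D_def
  proof (rule integral_dominated_convergence[where w = "%y. indicator (cball z (e + 1)) y *\<^sub>R (4*B*(e\<^sup>2*e))"])
   have "emeasure lborel (cball z (e + 1)) < \<infinity>" using emeasure_bounded_finite[OF bounded_cball] by simp
   thus "integrable lborel (%y. indicator (cball z (e + 1)) y *\<^sub>R (4*B*(e\<^sup>2*e)))"
   by (intro integrable_scaleR_left) (simp add: integrable_indicator_iff)
   show "AE y in lborel. (%n. (- 4*U y*m (zn (n + N) - y)) *\<^sub>R (zn (n + N) - y)) ~> (- 4*U y*m (z - y)) *\<^sub>R (z - y)"
   proof (rule AE_I2)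
   fix y
   have l: "(%n. zn (n + N) - y) ~> z - y" by (intro tendsto_intros LIMSEQ_ignore_initial_segment zn)
   have "(%n. m (zn (n + N) - y)) ~> m (z - y)" by (rule continuous_on_tendsto_compose[OF mc l]) auto
   thus "(%n. (- 4*U y*m (zn (n + N) - y)) *\<^sub>R (zn (n + N) - y)) ~> (- 4*U y*m (z - y)) *\<^sub>R (z - y)"
   by (intro tendsto_scaleR tendsto_mult tendsto_const l)
   qed
   show "AE y in lborel. norm ((- 4*U y*m (zn (n + N) - y)) *\<^sub>R (zn (n + N) - y)) <= indicator (cball z (e + 1)) y *\<^sub>R (4*B*(e\<^sup>2*e))" for n
   proof (rule AE_I2)
   fix y
   show "norm ((- 4*U y*m (zn (n + N) - y)) *\<^sub>R (zn (n + N) - y)) <= indicator (cball z (e + 1)) y *\<^sub>R (4*B*(e\<^sup>2*e))"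
   proof (cases "y : cball z (e + 1)")
   case True thus ?thesis using Db[of y "zn (n + N)"] by simp
   next
   case False
   hence "e <= norm (zn (n + N) - y)"
   using N[of "n + N"] dist_triangle[of z y "zn (n + N)"] by (simp add: dist_norm norm_minus_commute)
   thus ?thesis using m0 False by simp
   qed
   qed
  qed measurable
  thus "(%n. D (zn n)) ~> D z" by (rule LIMSEQ_offset)
 qed
 have der: "(\<Psi> has_derivative (%h. h \<bullet> D z)) (at z)" for z
  unfolding has_derivative_within_alt
 proof (intro conjI allI impI)
  show "bounded_linear (%h. h \<bullet> D z)" by (rule bounded_linear_inner_left)
  fix r :: real assume r: "0 < r"
  define C where "C = B*((2*(e + 1) + 1)\<^sup>2 + 2*e\<^sup>2)"
  define vol where "vol = measure lborel (cball z (e + 1))"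
  have C0: "0 <= C" "0 <= vol" using B0 by (auto simp: C_def vol_def)
  define d where "d = min 1 (r/(C * vol + 1))"
  have d: "d > 0" "d <= 1" "C * vol*d <= r"
  proof -
   have p: "C * vol + 1 > 0" using C0 by (simp add: add_nonneg_pos)
   thus "d > 0" "d <= 1" using r by (auto simp: d_def)
   have "C * vol*d <= (C * vol + 1)*(r/(C * vol + 1))"
   using C0 r p by (intro mult_mono) (auto simp: d_def)
   thus "C * vol*d <= r" using p by simp
  qed
  have "norm (\<Psi> y - \<Psi> z - (y - z) \<bullet> D z) <= r*norm (y - z)" if y: "norm (y - z) < d" for y
  proof -
   define k where "k = y - z"
   have k: "norm k <= 1" "norm k < d" using y d by (auto simp: k_def)
   let ?T = "%x. bump e (x + k) - bump e x + 4*m x*(x \<bullet> k)"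
   have i1: "integrable lborel (%x. k \<bullet> ((- 4*U x*m (z - x)) *\<^sub>R (z - x)))" by (intro integrable_inner_right Di)
   have "k \<bullet> D z = (LINT x|lborel. k \<bullet> ((- 4*U x*m (z - x)) *\<^sub>R (z - x)))"
   unfolding D_def by (rule integral_inner_right[symmetric]) (rule Di)
   hence "\<Psi> y - \<Psi> z - k \<bullet> D z = (LINT x|lborel. U x*bump e (y - x) - U x*bump e (z - x) - k \<bullet> ((- 4*U x*m (z - x)) *\<^sub>R (z - x)))"
   unfolding \<Psi>_def using Uk2 i1 by simp
   also have "... = (LINT x|lborel. U x*?T (z - x))"
   by (intro Bochner_Integration.integral_cong refl) (simp add: k_def algebra_simps inner_commute)
   finally have eq: "\<Psi> y - \<Psi> z - k \<bullet> D z = (LINT x|lborel. U x*?T (z - x))" .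
   have "\<bar>\<integral>x. U x*?T (z - x) \<partial>lborel\<bar> <= (LINT x|lborel. C*(norm k)\<^sup>2*indicator (cball z (e + 1)) x)"
   proof (rule integral_abs_bound_integral)
   have "integrable lborel (%x. U x*bump e (y - x) - U x*bump e (z - x) - k \<bullet> ((- 4*U x*m (z - x)) *\<^sub>R (z - x)))"
   using Uk2 i1 by simp
   thus "integrable lborel (%x. U x*?T (z - x))"
   by (rule Bochner_Integration.integrable_cong[THEN iffD1, rotated 2]) (simp_all add: k_def algebra_simps inner_commute)
   have "emeasure lborel (cball z (e + 1)) < \<infinity>" using emeasure_bounded_finite[OF bounded_cball] by simp
   thus "integrable lborel (%x. C*(norm k)\<^sup>2*indicator (cball z (e + 1)) x)" by (simp add: integrable_indicator_iff)
   fix x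
   have "\<bar>?T (z - x)\<bar> <= ((2*(e + 1) + 1)\<^sup>2 + 2*e\<^sup>2)*(norm k)\<^sup>2*indicator (cball 0 (e + 1)) (z - x)"
   unfolding m_def by (rule bump_taylor[OF e k(1)])
   hence "\<bar>U x\<bar>*\<bar>?T (z - x)\<bar> <= B*(((2*(e + 1) + 1)\<^sup>2 + 2*e\<^sup>2)*(norm k)\<^sup>2*indicator (cball 0 (e + 1)) (z - x))"
   using U(2)[of x] B0 by (intro mult_mono) auto
   also have "... = C*(norm k)\<^sup>2*indicator (cball z (e + 1)) x" by (simp add: C_def indicator_def dist_norm norm_minus_commute)
   finally show "\<bar>U x*?T (z - x)\<bar> <= C*(norm k)\<^sup>2*indicator (cball z (e + 1)) x" by (simp add: abs_mult)
   qed
   also have "... = C * vol*norm k*norm k" by (simp add: vol_def power2_eq_square)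
   also have "... <= r*norm k"
   proof (rule mult_right_mono)
   have "C * vol*norm k <= C * vol*d" using k C0 by (intro mult_left_mono) auto
   thus "C * vol*norm k <= r" using d by linarith
   qed simp
   finally show ?thesis using eq by (simp add: k_def)
  qed
  thus "\<exists>d>0. ALL y:UNIV. norm (y - z) < d --> norm (\<Psi> y - \<Psi> z - (y - z) \<bullet> D z) <= r*norm (y - z)" using d(1) by blast
 qed
 show ?thesis
 proof (rule that[of ka "%z. \<Psi> z/I" "%z. D z /\<^sub>R I"])
  show "ka : bm borel" by (rule km)
  show "0 <= ka y" for y using bump_bound[of e y] I by (simp add: ka_def)
  show "ka y = 0" if "e <= norm y" for y using bump_support[OF e that] by (simp add: ka_def)
  show "integrable lborel ka" unfolding ka_def[abs_def]
   using integrable_mult_left[OF bump_integral_pos(1)[OF e, where 'e = 'e], of "1/I"] by simp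
  show "(LINT y|lborel. ka y) = 1" unfolding ka_def using I by (simp add: I_def)
  show "integrable lborel (%y. U (z - y)*ka y)" for z unfolding ka_def using Uk[of z] by simp
  show "\<Psi> z/I = (LINT y|lborel. U (z - y)*ka y)" for z unfolding ka_def swap by simp
  show "((%z. \<Psi> z/I) has_derivative (%h. h \<bullet> (D z /\<^sub>R I))) (at z)" for z
   using has_derivative_mult_right[OF der[of z], of "inverse I"] by (simp add: divide_inverse mult.commute)
  show "cont (%z. D z /\<^sub>R I)" using Dc by (intro continuous_intros)
 qed
qed

text \<open>A control consists of a starting point and a velocity field along the trajectory, so that trajectories are
defined without solving differential equations.\<close>
definition controls :: "((real ^ 'n) \<times> (real => real ^ 'n)) set" where
 "controls = {(x, v). v : bm borel & bounded (range v)}"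

definition pos :: "(real ^ 'n) \<times> (real => real ^ 'n) => real => real ^ 'n" where
 "pos c s = fst c + integral {0..s} (snd c)"

definition cost :: "real => (real \<times> 'n::finite torus => real) => (real ^ 'n) \<times> (real => real ^ 'n) => real => real" where
 "cost p f c t = integral {0..t} (%s. f (s, torus_proj (pos c s))*norm (snd c s) powr p)"

lemma bounded_measurable_integrable_on:
 fixes h :: "real => 'b::euclidean_space"
 assumes h: "h : bm (lebesgue_on {a..b})" and B: "!!s. s : {a..b} ==> norm (h s) <= B"
 shows "h absolutely_integrable_on {a..b}" "h integrable_on {a..b}"
proof -
 have "integrable (lebesgue_on {a..b}) h"
 proof (rule finite_measure.integrable_const_bound[where B = B])
  show "finite_measure (lebesgue_on {a..b})" by (rule finite_measure_lebesgue_on) simp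
  show "AE x in lebesgue_on {a..b}. norm (h x) <= B" using B by (intro AE_I2) (simp add: space_restrict_space)
 qed (rule h)
 thus "h absolutely_integrable_on {a..b}"
  unfolding set_integrable_def by (subst (asm) integrable_restrict_space) auto
 thus "h integrable_on {a..b}" using set_lebesgue_integral_eq_integral(1) by blast
qed

lemma borel_measurable_lebesgue_on: "h : bm borel ==> h : bm (lebesgue_on S)"
 for h :: "real => 'b::topological_space"
 by (intro measurable_restrict_space1 measurable_completion) simp

lemma controls_integrable:
 assumes "c : controls" shows "snd c absolutely_integrable_on {a..b}" "snd c integrable_on {a..b}"
proof -
 obtain B where B: "!!s. norm (snd c s) <= B" and m: "snd c : bm borel"
  using assms by (cases c) (auto simp: controls_def bounded_iff)
 show "snd c absolutely_integrable_on {a..b}" "snd c integrable_on {a..b}"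
  by (rule bounded_measurable_integrable_on[OF borel_measurable_lebesgue_on[OF m] B])+
qed

lemma pos_diff:
 assumes "c : controls" "0 <= s" "s <= t"
 shows "(snd c has_integral (pos c t - pos c s)) {s..t}"
proof -
 have "integral {0..s} (snd c) + integral {s..t} (snd c) = integral {0..t} (snd c)"
  using assms by (intro Henstock_Kurzweil_Integration.integral_combine controls_integrable) auto
 hence "pos c t - pos c s = integral {s..t} (snd c)" unfolding pos_def by (metis add_diff_cancel_left add_diff_cancel_left')
 thus ?thesis using integrable_integral[OF controls_integrable(2)[OF assms(1)]] by simp
qed

lemma pos_ind_int: "c : controls ==> ind_int (pos c) (snd c)"
 unfolding ind_int_def using controls_integrable(1) pos_diff by blast

lemma continuous_pos: "c : controls ==> continuous_on {0..T} (pos c)"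
 unfolding pos_def using indefinite_integral_continuous_1[OF controls_integrable(2), of c 0 T] by (intro continuous_intros)

lemma cost_integrand:
 fixes f :: "real \<times> 'n::finite torus => real"
 assumes c: "c : controls" and f: "continuous_on cyl f" and ab: "0 <= a" "b <= 1" and p: "0 <= p"
 shows "(%s. f (s, torus_proj (pos c s))*norm (snd c s) powr p) integrable_on {a..b}"
proof -
 obtain B where B: "!!s. norm (snd c s) <= B" and m: "snd c : bm borel"
  using c by (cases c) (auto simp: controls_def bounded_iff)
 obtain A where A: "!!z. z : cyl ==> norm (f z) <= A" by (rule cont_cyl_bounded[OF f], rule that)
 have "continuous_on {a..b} (%s. f (s, torus_proj (pos c s)))"
 proof (rule continuous_on_compose2[OF f])
  have "continuous_on {a..b} (pos c)" using continuous_pos[OF c, of 1] ab by (rule_tac continuous_on_subset) auto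
  thus "continuous_on {a..b} (%s. (s, torus_proj (pos c s)))"
   by (intro continuous_intros continuous_on_compose2[OF continuous_on_torus_proj[of UNIV]]) auto
  show "(%s. (s, torus_proj (pos c s))) ` {a..b} <= cyl" using ab by (auto simp: cyl_def)
 qed
 hence 1: "(%s. f (s, torus_proj (pos c s))) : bm (lebesgue_on {a..b})"
  by (intro continuous_imp_measurable_on_sets_lebesgue) auto
 have 2: "(%s. norm (snd c s) powr p) : bm (lebesgue_on {a..b})"
  using m by (intro borel_measurable_lebesgue_on) measurable
 show ?thesis
 proof (rule bounded_measurable_integrable_on(2)[where B = "\<bar>A\<bar>*\<bar>B\<bar> powr p"])
  show "(%s. f (s, torus_proj (pos c s))*norm (snd c s) powr p) : bm (lebesgue_on {a..b})"
   using 1 2 by measurable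
  fix s assume "s : {a..b}"
  hence "\<bar>f (s, torus_proj (pos c s))\<bar> <= \<bar>A\<bar>" using A[of "(s, torus_proj (pos c s))"] ab by (auto simp: cyl_def)
  moreover have "norm (snd c s) powr p <= \<bar>B\<bar> powr p" using B[of s] p by (intro powr_mono2) auto
  ultimately show "norm (f (s, torus_proj (pos c s))*norm (snd c s) powr p) <= \<bar>A\<bar>*\<bar>B\<bar> powr p"
   by (simp add: abs_mult mult_mono)
 qed
qed

lemma cost_nonneg:
 fixes f :: "real \<times> 'n::finite torus => real"
 assumes "c : controls" "continuous_on cyl f" "!!z. z : cyl ==> 0 <= f z" "t <= 1" "0 <= p"
 shows "0 <= cost p f c t"
 unfolding cost_def
 using assms by (intro Henstock_Kurzweil_Integration.integral_nonneg cost_integrand) (auto simp: cyl_def)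

locale value_fn =
 fixes p :: real and f :: "real \<times> 'n::finite torus => real" and ph0 :: "'n torus => real" and B :: real
 assumes p: "1 < p" and f: "continuous_on cyl f" "!!z. z : cyl ==> 0 <= f z"
  and ph0: "!!a. \<bar>ph0 a\<bar> <= B"
begin

definition vals :: "real => 'n torus => real set" where
 "vals t a = {ph0 (torus_proj (fst c)) + cost p f c t |c. c : controls & torus_proj (pos c t) = a}"

text \<open>The least cost of arriving at \<open>a\<close> at time \<open>t\<close>, where the starting point is charged
by the initial potential. Prolonging a trajectory by a straight segment gives the dynamic programming
inequality, which is a Hamilton-Jacobi inequality in integrated form.\<close>
definition val :: "real => 'n torus => real" where "val t a = Inf (vals t a)"

lemma vals_lower: "t <= 1 ==> y : vals t a ==> - B <= y"
proof -
 assume "t <= 1" "y : vals t a"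
 then obtain c where "y = ph0 (torus_proj (fst c)) + cost p f c t" "c : controls" unfolding vals_def by blast
 thus ?thesis using cost_nonneg[OF _ f \<open>t <= 1\<close>, of c p] p ph0[of "torus_proj (fst c)"] by auto
qed

lemma vals_bdd: "t <= 1 ==> bdd_below (vals t a)"
 using vals_lower by (intro bdd_belowI) blast

lemma const_in_vals: "ph0 a : vals t a"
proof -
 obtain x where x: "torus_proj x = a" using torus_proj_surj by blast
 have "(x, %_. 0) : controls" by (simp add: controls_def)
 moreover have "cost p f (x, %_. 0) t = 0" using p by (simp add: cost_def)
 ultimately show ?thesis unfolding vals_def using x by (intro CollectI exI[of _ "(x, %_. 0)"]) (simp add: pos_def)
qed

lemma val_le: "t <= 1 ==> val t a <= ph0 a"
 unfolding val_def by (intro cInf_lower const_in_vals vals_bdd)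

lemma val_step:
 assumes t: "0 <= t" "0 <= h" "t + h <= 1"
  and m: "!!s. t <= s ==> s <= t + h ==> f (s, torus_proj (x + (s - t) *\<^sub>R w)) <= m"
 shows "val (t + h) (torus_proj (x + h *\<^sub>R w)) <= val t (torus_proj x) + h*m*norm w powr p"
proof -
 have "val (t + h) (torus_proj (x + h *\<^sub>R w)) - h*m*norm w powr p <= y" if y: "y : vals t (torus_proj x)" for y
 proof -
  obtain c where c: "y = ph0 (torus_proj (fst c)) + cost p f c t" "c : controls" "torus_proj (pos c t) = torus_proj x"
   using y unfolding vals_def by blast
  define c' where "c' = (fst c, %s. if s <= t then snd c s else w)"
  have vm: "snd c : bm borel" "bounded (range (snd c))" using c(2) by (cases c; auto simp: controls_def)+
  have c'C: "c' : controls"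
  proof -
   have "(%s. if s <= t then snd c s else w) : bm borel" using vm(1) by measurable
   moreover have "range (%s. if s <= t then snd c s else w) <= insert w (range (snd c))" by auto
   hence "bounded (range (%s. if s <= t then snd c s else w))" using vm(2) bounded_insert bounded_subset by blast
   ultimately show ?thesis by (simp add: controls_def c'_def)
  qed
  have pos1: "pos c' s = pos c s" if "0 <= s" "s <= t" for s
   unfolding pos_def c'_def using that by (auto intro!: integral_cong)
  have pos2: "pos c' s = pos c t + (s - t) *\<^sub>R w" if "t <= s" for s
  proof -
   have "((%_. w) has_integral (s - t) *\<^sub>R w) {t..s}" using has_integral_const_real[of w t s] that by simp
   hence "(snd c' has_integral (s - t) *\<^sub>R w) {t..s}"
   by (rule has_integral_spike[OF negligible_sing[of t], rotated]) (auto simp: c'_def)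
   moreover have "(snd c' has_integral (pos c' s - pos c' t)) {t..s}" using pos_diff[OF c'C t(1) that] .
   ultimately have "pos c' s - pos c' t = (s - t) *\<^sub>R w" by (rule has_integral_unique[rotated])
   thus ?thesis using pos1[of t] t by (simp add: algebra_simps)
  qed
  have pr: "torus_proj (pos c t + (s - t) *\<^sub>R w) = torus_proj (x + (s - t) *\<^sub>R w)" for s
   using torus_proj_translate[OF c(3), of "x + (s - t) *\<^sub>R w"] by (simp add: algebra_simps)
  let ?F = "%s. f (s, torus_proj (pos c' s))*norm (snd c' s) powr p"
  have "cost p f c' (t + h) = integral {0..t} ?F + integral {t..t + h} ?F"
   unfolding cost_def using t p by (intro Henstock_Kurzweil_Integration.integral_combine[symmetric] cost_integrand[OF c'C f(1)]) auto
  also have "integral {0..t} ?F = cost p f c t"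
   unfolding cost_def by (intro integral_cong) (simp add: pos1, simp add: c'_def)
  also have "integral {t..t + h} ?F <= h*(m*norm w powr p)"
  proof -
   have i: "?F integrable_on {t..t + h}" using t p by (intro cost_integrand[OF c'C f(1)]) auto
   have "((%_. m*norm w powr p) has_integral h*(m*norm w powr p)) {t..t + h}"
   using has_integral_const_real[of "m*norm w powr p" t "t + h"] t by simp
   note j2 = this
   have "(?F has_integral integral {t..t + h} ?F) {t..t + h}" using i by (rule integrable_integral)
   hence "((%s. if s = t then 0 else ?F s) has_integral integral {t..t + h} ?F) {t..t + h}"
   by (rule has_integral_spike[OF negligible_sing[of t], rotated]) auto
   thus ?thesis
   proof (rule has_integral_le[OF _ j2])
   fix s assume s: "s : {t..t + h}"
   have "0 <= f (t, torus_proj (x + (t - t) *\<^sub>R w))" using f(2)[of "(t, torus_proj x)"] t by (auto simp: cyl_def)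
   hence m0: "0 <= m" using m[of t] t by simp
   show "(if s = t then 0 else ?F s) <= m*norm w powr p"
   proof (cases "s = t")
   case False
   hence "snd c' s = w" using s by (simp add: c'_def)
   moreover have "f (s, torus_proj (pos c' s)) <= m" using pos2[of s] s m[of s] pr[of s] by simp
   ultimately show ?thesis using False by (simp add: mult_right_mono)
   qed (use m0 in simp)
   qed
  qed
  finally have J: "cost p f c' (t + h) <= cost p f c t + h*(m*norm w powr p)" by simp
  have "ph0 (torus_proj (fst c')) + cost p f c' (t + h) : vals (t + h) (torus_proj (x + h *\<^sub>R w))"
   unfolding vals_def using c'C pos2[of "t + h"] t pr[of "t + h"] by (intro CollectI exI[of _ c']) simp
  hence "val (t + h) (torus_proj (x + h *\<^sub>R w)) <= ph0 (torus_proj (fst c')) + cost p f c' (t + h)"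
   unfolding val_def using t by (intro cInf_lower vals_bdd) auto
  thus ?thesis using J c(1) by (simp add: c'_def mult.assoc)
 qed
 hence "val (t + h) (torus_proj (x + h *\<^sub>R w)) - h*m*norm w powr p <= val t (torus_proj x)"
  unfolding val_def[of t] using const_in_vals by (intro cInf_greatest) blast+
 thus ?thesis by simp
qed

lemma val_antimono: "0 <= s ==> s <= t ==> t <= 1 ==> val t a <= val s a"
proof -
 assume st: "0 <= s" "s <= t" "t <= 1"
 obtain x where x: "torus_proj x = a" using torus_proj_surj by blast
 obtain A where A: "!!z. z : cyl ==> norm (f z) <= A" by (rule cont_cyl_bounded[OF f(1)], rule that)
 have "f (r, torus_proj (x + (r - s) *\<^sub>R 0)) <= A" if "s <= r" "r <= s + (t - s)" for r
  using A[of "(r, torus_proj x)"] st that by (auto simp: cyl_def)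
 from val_step[of s "t - s" x 0 A, OF _ _ _ this] show ?thesis using st x p by simp
qed

end

section \<open>Smooth Hamilton-Jacobi subsolutions\<close>

lemma rep_torus_proj: "torus_proj (rep_torus a) = a"
 by (metis Quotient3_abs_rep Quotient3_torus)

lemma continuous_periodic_descends:
 fixes F :: "real \<times> (real ^ 'n::finite) => 'b::metric_space"
 assumes F: "cont F" and per: "!!t x y. torus_proj x = torus_proj y ==> F (t, x) = F (t, y)"
  and T: "cont (T :: real => real)"
 shows "continuous_on S (%z. F (T (fst z), rep_torus (snd z)))"
 unfolding continuous_on_iff
proof (intro ballI allI impI)
 fix z :: "real \<times> 'n torus" and e :: real assume e: "0 < e"
 obtain t a where z: "z = (t, a)" by (cases z)
 have "cont (%u::real \<times> (real ^ 'n). F (T (fst u), snd u))"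
  by (rule continuous_on_compose2[OF F]) (auto intro!: continuous_intros continuous_on_compose2[OF T])
 then obtain d where d: "0 < d" "!!u. dist u (t, rep_torus a) < d ==> dist (F (T (fst u), snd u)) (F (T t, rep_torus a)) < e"
  using e unfolding continuous_on_iff by (metis UNIV_I fst_conv snd_conv)
 show "\<exists>d>0. ALL z':S. dist z' z < d --> dist (F (T (fst z'), rep_torus (snd z'))) (F (T (fst z), rep_torus (snd z))) < e"
 proof (intro exI[of _ "d/2"] conjI ballI impI)
  fix z' assume d2: "dist z' z < d/2"
  have "dist (torus_proj (rep_torus a)) (snd z') < d/2"
   using dist_snd_le[of z' z] d2 by (simp add: rep_torus_proj z dist_commute)
  then obtain y where y: "torus_proj y = snd z'" "dist (rep_torus a) y < d/2" by (rule torus_lift_near)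
  have "dist (fst z') t < d/2" using dist_fst_le[of z' z] d2 by (simp add: z)
  hence "dist (fst z', y) (t, rep_torus a) < d"
   using y(2) sqrt_sum_squares_le_sum_abs[of "dist (fst z') t" "dist y (rep_torus a)"] by (simp add: dist_Pair_Pair dist_commute)
  from d(2)[OF this] show "dist (F (T (fst z'), rep_torus (snd z'))) (F (T (fst z), rep_torus (snd z))) < e"
   using per[of y "rep_torus (snd z')" "T (fst z')"] y(1) by (simp add: z rep_torus_proj)
 qed (use d in auto)
qed

lemma continuous_on_cyl_uniform:
 fixes f :: "real \<times> 'n::finite torus => real"
 assumes "continuous_on cyl f" "0 < w"
 obtains d where "0 < d" "!!z z'. z : cyl ==> z' : cyl ==> dist z z' < d ==> \<bar>f z - f z'\<bar> < w"
proof -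
 have "uniformly_continuous_on cyl f" by (rule compact_uniformly_continuous[OF assms(1) compact_cyl])
 thus ?thesis using that assms(2) unfolding uniformly_continuous_on_def dist_real_def by (metis dist_commute)
qed

lemma continuous_torus_uniform:
 fixes f :: "'n::finite torus => real"
 assumes "cont f" "0 < w"
 obtains d where "0 < d" "!!x y. dist x y < d ==> \<bar>f x - f y\<bar> < w"
proof -
 have "uniformly_continuous_on UNIV f" by (rule compact_uniformly_continuous[OF assms(1) compact_UNIV_torus])
 thus ?thesis using that assms(2) unfolding uniformly_continuous_on_def dist_real_def by (metis UNIV_I dist_commute)
qed

context value_fn
begin

text \<open>The value function need not be measurable. Its supremum over nearby points is, and it still satisfies the
dynamic programming inequality, with the weight replaced by its supremum over a slightly larger ball.\<close>
definition upper_env :: "real => real \<times> (real ^ 'n) => real" where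
 "upper_env e z = Sup (insert (- B) {val t (torus_proj x) |t x. t : {0..1} & dist z (t, x) < e})"

lemma val_upper: "t <= 1 ==> val t a <= B"
 using val_le[of t a] ph0[of a] by linarith

lemma upper_env_bdd: "bdd_above (insert (- B) {val t (torus_proj x) |t x. t : {0..1} & dist z (t, x) < e})"
proof (rule bdd_aboveI[of _ "\<bar>B\<bar>"])
 fix y assume "y : insert (- B) {val t (torus_proj x) |t x. t : {0..1} & dist z (t, x) < e}"
 hence "y = - B | (\<exists>t x. t <= 1 & y = val t (torus_proj x))" by auto
 thus "y <= \<bar>B\<bar>"
 proof (elim disjE exE)
  fix t x assume "t <= 1 & y = val t (torus_proj x)"
  thus ?thesis using val_upper[of t "torus_proj x"] by linarith
 qed simp
qed

lemma upper_env_ge: "t : {0..1} ==> dist z (t, x) < e ==> val t (torus_proj x) <= upper_env e z"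
 unfolding upper_env_def by (intro cSup_upper upper_env_bdd) blast

lemma upper_env_ge_lb: "- B <= upper_env e z"
 unfolding upper_env_def by (intro cSup_upper upper_env_bdd) blast

lemma upper_env_least:
 assumes "- B <= m" "!!t x. t : {0..1} ==> dist z (t, x) < e ==> val t (torus_proj x) <= m"
 shows "upper_env e z <= m"
 unfolding upper_env_def using assms by (intro cSup_least) auto

lemma upper_env_abs: "\<bar>upper_env e z\<bar> <= B"
proof -
 have "0 <= B" using ph0[of undefined] by linarith
 hence "upper_env e z <= B" using val_upper by (intro upper_env_least) auto
 thus ?thesis using upper_env_ge_lb[of e z] by linarith
qed

lemma upper_env_measurable: "upper_env e : bm borel"
proof (rule borel_measurableI_greater)
 fix c
 have iff: "c < upper_env e z \<longleftrightarrow> c < - B | (\<exists>t x. (t : {0..1} & c < val t (torus_proj x)) & dist z (t, x) < e)" for z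
  unfolding upper_env_def by (subst less_cSup_iff[OF _ upper_env_bdd]) blast+
 have "open {z. c < upper_env e z}"
  unfolding iff by (intro open_Collect_disj open_Collect_ex open_Collect_conj open_Collect_const open_Collect_less continuous_intros)
 from borel_open[OF this] show "{x : space borel. c < upper_env e x} : sets borel" by (simp only: space_borel UNIV_I simp_thms)
qed

lemma upper_env_periodic:
 assumes xy: "torus_proj x = torus_proj y" shows "upper_env e (t, x) = upper_env e (t, y)"
proof -
 have "upper_env e (t, x) <= upper_env e (t, y)" if xy: "torus_proj x = torus_proj y" for x y
 proof (rule upper_env_least[OF upper_env_ge_lb])
  fix s u assume s: "s : {0..1::real}" "dist (t, x) (s, u) < e"
  have "dist (t, y) (s, u + y - x) < e" using s(2) by (simp add: dist_Pair_Pair dist_norm algebra_simps)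
  from upper_env_ge[OF s(1) this] show "val s (torus_proj u) <= upper_env e (t, y)"
   using torus_proj_translate[OF xy[symmetric], of u] by simp
 qed
 thus ?thesis using xy by (intro antisym) auto
qed

lemma upper_env_step:
 assumes h: "0 <= h" "e <= ta"
  and m: "!!s y. s : {0..1} ==> dist (ta, x) (s, y) < e + h*(1 + norm w) ==> f (s, torus_proj y) <= m"
  and m0: "0 <= m"
 shows "upper_env e (ta + h, x + h *\<^sub>R w) <= upper_env e (ta, x) + h*m*norm w powr p"
proof (rule upper_env_least)
 show "- B <= upper_env e (ta, x) + h*m*norm w powr p" using upper_env_ge_lb[of e "(ta, x)"] h m0 by (simp add: add_increasing2)
 fix t y assume t: "t : {0..1::real}" "dist (ta + h, x + h *\<^sub>R w) (t, y) < e"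
 have d: "dist (ta, x) (t - h, y - h *\<^sub>R w) < e"
  using t(2) by (simp add: dist_Pair_Pair dist_norm algebra_simps)
 have "\<bar>ta - (t - h)\<bar> < e" using dist_fst_le[of "(ta, x)" "(t - h, y - h *\<^sub>R w)"] d by (simp add: dist_real_def)
 hence t0: "0 <= t - h" using h by linarith
 have "val (t - h + h) (torus_proj (y - h *\<^sub>R w + h *\<^sub>R w)) <= val (t - h) (torus_proj (y - h *\<^sub>R w)) + h*m*norm w powr p"
 proof (rule val_step)
  fix s assume s: "t - h <= s" "s <= t - h + h"
  have "dist (t - h, y - h *\<^sub>R w) (s, y - h *\<^sub>R w + (s - (t - h)) *\<^sub>R w) <= \<bar>s - (t - h)\<bar> + norm ((s - (t - h)) *\<^sub>R w)"
  proof -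
   have eq: "(t - h, y - h *\<^sub>R w) - (s, y - h *\<^sub>R w + (s - (t - h)) *\<^sub>R w) = (- (s - (t - h)), - ((s - (t - h)) *\<^sub>R w))" by simp
   show ?thesis unfolding dist_norm eq
   using norm_Pair_le[of "- (s - (t - h))" "- ((s - (t - h)) *\<^sub>R w)"] by (simp only: norm_minus_cancel real_norm_def)
  qed
  also have "... = (s - (t - h))*(1 + norm w)" using s by (simp only: norm_scaleR) (simp add: algebra_simps)
  also have "... <= h*(1 + norm w)" using s by (intro mult_right_mono) auto
  finally have "dist (ta, x) (s, y - h *\<^sub>R w + (s - (t - h)) *\<^sub>R w) < e + h*(1 + norm w)"
   using d dist_triangle[of "(ta, x)" "(s, y - h *\<^sub>R w + (s - (t - h)) *\<^sub>R w)" "(t - h, y - h *\<^sub>R w)"] by linarith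
  thus "f (s, torus_proj (y - h *\<^sub>R w + (s - (t - h)) *\<^sub>R w)) <= m"
   using s t0 t(1) by (intro m) auto
 qed (use t0 t h in auto)
 also have "val (t - h) (torus_proj (y - h *\<^sub>R w)) <= upper_env e (ta, x)"
  using t0 t(1) h d by (intro upper_env_ge) auto
 finally show "val t (torus_proj y) <= upper_env e (ta, x) + h*m*norm w powr p" by simp
qed

end

text \<open>Mollification of the upper envelope gives a continuously differentiable function; letting the duration of the
straight segments in the dynamic programming inequality tend to zero makes it a subsolution, with an error
that is absorbed by the uniform continuity of the weight.\<close>
lemma dual_test_function:
 fixes f :: "real \<times> 'n::finite torus => real"
 assumes p: "1 < p" and f: "continuous_on cyl f" "!!z. z : cyl ==> 0 <= f z"
  and ph: "cont ph0" "cont ph1"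
  and dual: "!!c. c : controls ==> ph1 (torus_proj (pos c 1)) <= ph0 (torus_proj (fst c)) + cost p f c 1"
  and w: "0 < w"
 obtains ps pst psx where "is_C1_test ps pst psx" "!!t a. t : {0..1} ==> pst (t, a) <= 0"
  "!!t a v. t : {0..1} ==> pst (t, a) + psx (t, a) \<bullet> v <= (1 + w)*(f (t, a) + w)*norm v powr p"
  "!!a. ph1 a - w <= ps (1, a)" "!!a. ps (0, a) <= ph0 a + w"
proof -
 obtain B where B: "!!a. \<bar>ph0 a\<bar> <= B"
  using compact_imp_bounded[OF compact_continuous_image[OF ph(1) compact_UNIV_torus]] unfolding bounded_iff by auto
 interpret value_fn p f ph0 B by unfold_locales (use p f B in auto)
 have val1: "ph1 a <= val 1 a" for a
  unfolding val_def
 proof (rule cInf_greatest)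
  fix y assume "y : vals 1 a"
  then obtain c where "y = ph0 (torus_proj (fst c)) + cost p f c 1" "c : controls" "torus_proj (pos c 1) = a"
   unfolding vals_def by blast
  thus "ph1 a <= y" using dual[of c] by simp
 qed (use const_in_vals in blast)
 have w2: "0 < w/2" using w by simp
 obtain d1 where d1: "0 < d1" "!!z z'. z : cyl ==> z' : cyl ==> dist z z' < d1 ==> \<bar>f z - f z'\<bar> < w/2"
  by (rule continuous_on_cyl_uniform[OF f(1) w2], rule that)
 obtain d2 where d2: "0 < d2" "!!x y. dist x y < d2 ==> \<bar>ph0 x - ph0 y\<bar> < w"
  by (rule continuous_torus_uniform[OF ph(1) w], rule that)
 obtain d3 where d3: "0 < d3" "!!x y. dist x y < d3 ==> \<bar>ph1 x - ph1 y\<bar> < w"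
  by (rule continuous_torus_uniform[OF ph(2) w], rule that)
 have "((%e. (1 - 3*e) powr (1 - p)) \<longlongrightarrow> (1 - 3*0) powr (1 - p)) (at_right 0)"
  by (intro tendsto_intros) auto
 hence "\<forall>\<^sub>F e in at_right 0. (1 - 3*e) powr (1 - p) < 1 + w" using w by (intro order_tendstoD) auto
 moreover have "\<forall>\<^sub>F e in at_right 0. e : {0<..<min (1/4) (min (d1/6) (min (d2/2) (d3/2)))}"
  using d1(1) d2(1) d3(1) by (intro eventually_at_right_real) auto
 ultimately have "\<forall>\<^sub>F e in at_right 0. (1 - 3*e) powr (1 - p) < 1 + w & e : {0<..<min (1/4) (min (d1/6) (min (d2/2) (d3/2)))}"
  by (rule eventually_conj)
 then obtain e where e': "(1 - 3*e) powr (1 - p) < 1 + w & e : {0<..<min (1/4) (min (d1/6) (min (d2/2) (d3/2)))}"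
  using eventually_happens'[OF trivial_limit_at_right_real] by blast
 hence e: "(1 - 3*e) powr (1 - p) < 1 + w" "e < 1/4" "6*e < d1" "2*e < d2" "2*e < d3" "0 < e" by auto
 obtain ps1 G ka where M: "ka : bm borel" "!!y. 0 <= ka y" "!!y. e <= norm y ==> ka y = 0" "integrable lborel ka" "(LINT y|lborel. ka y) = 1"
  "!!z. integrable lborel (%y. upper_env e (z - y)*ka y)" "!!z. ps1 z = (LINT y|lborel. upper_env e (z - y)*ka y)"
  "!!z. (ps1 has_derivative (%h. h \<bullet> G z)) (at z)" "cont G"
  by (rule mollify[OF upper_env_measurable[of e] upper_env_abs e(6)], rule that)
 have avg_le: "(LINT y|lborel. g y*ka y) <= m" if "integrable lborel (%y. g y*ka y)" "!!y. norm y < e ==> g y <= m" for g m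
 proof -
  have "(LINT y|lborel. g y*ka y) <= (LINT y|lborel. m*ka y)"
  proof (rule integral_mono[OF that(1)])
   show "g y*ka y <= m*ka y" for y
   using that(2)[of y] M(2)[of y] M(3)[of y] by (cases "norm y < e") (auto intro: mult_right_mono)
  qed (use M(4) in simp)
  thus ?thesis using M(5) by simp
 qed
 have avg_ge: "m <= (LINT y|lborel. g y*ka y)" if "integrable lborel (%y. g y*ka y)" "!!y. norm y < e ==> m <= g y" for g m
  using avg_le[of "%y. - g y" "- m"] that by simp
 have per: "ps1 (t, x) = ps1 (t, y)" if "torus_proj x = torus_proj y" for t x y
 proof -
  have "upper_env e ((t, x) - z) = upper_env e ((t, y) - z)" for z
  proof (cases z)
   case (Pair s u)
   have "torus_proj (x - u) = torus_proj (y - u)" using torus_proj_translate[OF that, of "y - u"] by (simp add: algebra_simps)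
   from upper_env_periodic[OF this] show ?thesis by (simp only: Pair diff_Pair)
  qed
  thus ?thesis unfolding M(7) by simp
 qed
 have perG: "G (t, x) = G (t, y)" if "torus_proj x = torus_proj y" for t x y
 proof -
  have tr: "torus_proj (z + x - y) = torus_proj z" for z using torus_proj_translate[OF that] .
  have "((%z. z + (0, x - y)) has_derivative (%h. h)) (at (t, y))" by (auto intro!: derivative_eq_intros)
  moreover have "(ps1 has_derivative (%h. h \<bullet> G (t, x))) (at ((t, y) + (0, x - y)))" using M(8)[of "(t, x)"] by simp
  ultimately have "(ps1 \<circ> (%z. z + (0, x - y)) has_derivative (%h. h \<bullet> G (t, x)) \<circ> (%h. h)) (at (t, y))" by (rule diff_chain_at)
  moreover have "ps1 \<circ> (%z. z + (0, x - y)) = ps1"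
  proof
   fix z show "(ps1 \<circ> (%z. z + (0, x - y))) z = ps1 z"
   proof (cases z)
   case (Pair s u)
   have "torus_proj (u + (x - y)) = torus_proj u" using tr[of u] by (simp only: add_diff_eq)
   from per[OF this, of s] show ?thesis by (simp add: Pair)
   qed
  qed
  ultimately have "(ps1 has_derivative (%h. h \<bullet> G (t, x))) (at (t, y))" by (simp add: o_def)
  hence "(%h. h \<bullet> G (t, x)) = (%h. h \<bullet> G (t, y))" using M(8) by (rule has_derivative_unique)
  from fun_cong[OF this, of "G (t, x) - G (t, y)"] have "(G (t, x) - G (t, y)) \<bullet> (G (t, x) - G (t, y)) = 0" by (simp add: inner_diff_right)
  thus ?thesis by simp
 qed
 have slope: "s*fst (G (ta, x)) + v \<bullet> snd (G (ta, x)) = (s, v) \<bullet> G (ta, x)" for s v ta x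
  by (cases "G (ta, x)") simp
 have subsol: "fst (G (ta, x)) + v \<bullet> snd (G (ta, x)) <= m*norm v powr p"
  if ta: "2*e <= ta" and m: "0 <= m" "!!s y. s : {0..1} ==> dist (ta, x) (s, y) < 3*e ==> f (s, torus_proj y) <= m" for ta x v m
 proof -
  have "((%h. (ta + h, x + h *\<^sub>R v)) has_derivative (%h. (h, h *\<^sub>R v))) (at 0)" by (auto intro!: derivative_eq_intros)
  moreover have "(ps1 has_derivative (%h. h \<bullet> G (ta, x))) (at (ta + 0, x + 0 *\<^sub>R v))" using M(8)[of "(ta, x)"] by simp
  ultimately have "((%h. ps1 (ta + h, x + h *\<^sub>R v)) has_derivative (%h. (h, h *\<^sub>R v) \<bullet> G (ta, x))) (at 0)"
   by (rule has_derivative_compose)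
  moreover have "(%h. (h, h *\<^sub>R v) \<bullet> G (ta, x)) = (*) ((1, v) \<bullet> G (ta, x))"
   by (cases "G (ta, x)") (auto simp: fun_eq_iff algebra_simps)
  ultimately have D: "((%h. ps1 (ta + h, x + h *\<^sub>R v)) has_real_derivative ((1, v) \<bullet> G (ta, x))) (at 0)"
   by (simp add: has_field_derivative_def)
  have "((%h. (ps1 (ta + h, x + h *\<^sub>R v) - ps1 (ta, x))/h) \<longlongrightarrow> (1, v) \<bullet> G (ta, x)) (at_right 0)"
   using D[unfolded DERIV_def] by (simp add: filterlim_at_split)
  moreover have "\<forall>\<^sub>F h in at_right 0. (ps1 (ta + h, x + h *\<^sub>R v) - ps1 (ta, x))/h <= m*norm v powr p"
  proof -
   have "0 < e/(1 + norm v)" using e by (simp add: add_pos_nonneg)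
   hence "\<forall>\<^sub>F h in at_right 0. h : {0<..<e/(1 + norm v)}" by (rule eventually_at_right_real)
   thus ?thesis
   proof eventually_elim
   case (elim h)
   have "h*(1 + norm v) < e" using elim by (simp add: pos_less_divide_eq add_pos_nonneg)
   have "ps1 (ta + h, x + h *\<^sub>R v) - ps1 (ta, x) = (LINT y|lborel. (upper_env e ((ta + h, x + h *\<^sub>R v) - y) - upper_env e ((ta, x) - y))*ka y)"
   unfolding M(7) left_diff_distrib using M(6) by simp
   also have "... <= h*m*norm v powr p"
   proof (rule avg_le)
   show "integrable lborel (%y. (upper_env e ((ta + h, x + h *\<^sub>R v) - y) - upper_env e ((ta, x) - y))*ka y)"
   unfolding left_diff_distrib using M(6) by simp
   fix y :: "real \<times> (real ^ 'n)" assume y: "norm y < e"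
   obtain s u where su: "y = (s, u)" by (cases y)
   have "\<bar>s\<bar> < e" using y norm_fst_le[of s u] su by simp
   have "upper_env e (ta - s + h, x - u + h *\<^sub>R v) <= upper_env e (ta - s, x - u) + h*m*norm v powr p"
   proof (rule upper_env_step)
   fix s' y' assume s': "s' : {0..1::real}" "dist (ta - s, x - u) (s', y') < e + h*(1 + norm v)"
   have "dist (ta, x) (ta - s, x - u) < e" using y su by (simp add: dist_Pair_Pair norm_Pair dist_norm)
   hence "dist (ta, x) (s', y') < 3*e"
   using s'(2) \<open>h*(1 + norm v) < e\<close> dist_triangle[of "(ta, x)" "(s', y')" "(ta - s, x - u)"] by linarith
   thus "f (s', torus_proj y') <= m" by (rule m(2)[OF s'(1)])
   qed (use elim ta \<open>\<bar>s\<bar> < e\<close> m in auto)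
   thus "upper_env e ((ta + h, x + h *\<^sub>R v) - y) - upper_env e ((ta, x) - y) <= h*m*norm v powr p"
   by (simp add: su algebra_simps)
   qed
   finally show ?case using elim by (simp add: pos_divide_le_eq mult_ac)
   qed
  qed
  ultimately have "(1, v) \<bullet> G (ta, x) <= m*norm v powr p"
   by (rule tendsto_upperbound) simp
  thus ?thesis using slope[of 1 ta x v] by simp
 qed
 define b where "b = 1 - 3*e"
 have b: "0 < b" "b <= 1" using e by (auto simp: b_def)
 define ta where "ta t = 2*e + b*t" for t :: real
 have tac: "cont ta" unfolding ta_def by (intro continuous_intros)
 have ta: "2*e <= ta t" "ta t <= 1 - e" "\<bar>ta t - t\<bar> <= 3*e" if "t : {0..1}" for t
 proof -
  have "0 <= b*t" "b*t <= b*1" using that b by (auto intro: mult_left_mono)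
  thus "2*e <= ta t" "ta t <= 1 - e" by (auto simp: ta_def b_def)
  have "0 <= e*t" "e*t <= e*1" using that e by (auto intro: mult_left_mono)
  thus "\<bar>ta t - t\<bar> <= 3*e" using e by (auto simp: ta_def b_def algebra_simps abs_le_iff)
 qed
 define ps where "ps z = ps1 (ta (fst z), rep_torus (snd z))" for z
 define pst where "pst z = b*fst (G (ta (fst z), rep_torus (snd z)))" for z
 define psx where "psx z = snd (G (ta (fst z), rep_torus (snd z)))" for z
 have ps_proj: "ps (t, torus_proj x) = ps1 (ta t, x)" for t x unfolding ps_def by (auto intro: per simp: rep_torus_proj)
 have G_proj: "G (ta t, rep_torus (torus_proj x)) = G (ta t, x)" for t x by (intro perG rep_torus_proj)
 have Gc: "continuous_on cyl (%z. G (ta (fst z), rep_torus (snd z)))"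
  by (rule continuous_periodic_descends[OF M(9) _ tac]) (rule perG)
 show ?thesis
 proof (rule that[of ps pst psx])
  show "is_C1_test ps pst psx"
   unfolding is_C1_test_def
  proof (intro conjI ballI allI)
   show "continuous_on cyl pst" "continuous_on cyl psx"
   unfolding pst_def[abs_def] psx_def[abs_def] by (intro continuous_intros Gc)+
   fix t :: real and x :: "real ^ 'n"
   have "((%z. ps1 (ta (fst z), snd z)) has_derivative (%h. (b*fst h, snd h) \<bullet> G (ta t, x))) (at (t, x))"
   unfolding ta_def using M(8)[of "(2*e + b*t, x)"]
   by (rule_tac has_derivative_compose[where f = "%z. (2*e + b*fst z, snd z)" and g = ps1, simplified]) (auto intro!: derivative_eq_intros)
   hence "((%(s, y). ps (s, torus_proj y)) has_derivative (%(s, y). s*pst (t, torus_proj x) + y \<bullet> psx (t, torus_proj x))) (at (t, x))"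
   by (simp add: ps_proj case_prod_beta' pst_def psx_def G_proj inner_prod_def mult_ac)
   thus "((%(s, y). ps (s, torus_proj y)) has_derivative (%(s, y). s*pst (t, torus_proj x) + y \<bullet> psx (t, torus_proj x))) (at (t, x) within {0..1} \<times> UNIV)"
   by (rule has_derivative_at_withinI)
  qed
  fix t :: real and a :: "'n torus" assume t: "t : {0..1}"
  have f_close: "f (s, torus_proj y) <= f (t, a) + w/2" if "s : {0..1}" "dist (ta t, rep_torus a) (s, y) < 3*e" for s y
  proof -
   have "dist (t, a) (s, torus_proj y) <= dist (t, a) (ta t, a) + dist (ta t, a) (s, torus_proj y)" by (rule dist_triangle)
   also have "dist (t, a) (ta t, a) <= 3*e" using ta(3)[OF t] by (simp add: dist_Pair_Pair dist_real_def abs_minus_commute)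
   also have "dist (ta t, a) (s, torus_proj y) <= dist (ta t, rep_torus a) (s, y)"
   using dist_torus_le[of "rep_torus a" y] by (auto simp: dist_Pair_Pair rep_torus_proj intro!: power_mono add_mono)
   finally have "dist (t, a) (s, torus_proj y) < d1" using that(2) e(3) by linarith
   hence "\<bar>f (t, a) - f (s, torus_proj y)\<bar> < w/2" using that(1) t by (intro d1(2)) (auto simp: cyl_def)
   thus ?thesis by linarith
  qed
  have m0: "0 <= f (t, a) + w/2" using f(2)[of "(t, a)"] t w by (auto simp: cyl_def)
  have main: "pst (t, a) + psx (t, a) \<bullet> v <= b powr (1 - p)*(f (t, a) + w/2)*norm v powr p" for v
  proof -
   have "fst (G (ta t, rep_torus a)) + (v /\<^sub>R b) \<bullet> snd (G (ta t, rep_torus a)) <= (f (t, a) + w/2)*norm (v /\<^sub>R b) powr p"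
   by (rule subsol[OF ta(1)[OF t] m0 f_close])
   hence "b*(fst (G (ta t, rep_torus a)) + (v /\<^sub>R b) \<bullet> snd (G (ta t, rep_torus a))) <= b*((f (t, a) + w/2)*norm (v /\<^sub>R b) powr p)"
   using b by (intro mult_left_mono) auto
   also have "norm (v /\<^sub>R b) powr p = norm v powr p/b powr p" using b by (simp add: divide_inverse_commute powr_mult inverse_powr)
   also have "b*((f (t, a) + w/2)*(norm v powr p/b powr p)) = b powr (1 - p)*(f (t, a) + w/2)*norm v powr p"
   using b by (simp add: powr_diff)
   finally show ?thesis using b by (simp add: pst_def psx_def distrib_left inner_commute mult.assoc[symmetric])
  qed
  show "pst (t, a) <= 0" using main[of 0] p by simp
  have "b powr (1 - p)*(f (t, a) + w/2) <= (1 + w)*(f (t, a) + w)"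
   using e(1) m0 w by (intro mult_mono) (auto simp: b_def)
  thus "pst (t, a) + psx (t, a) \<bullet> v <= (1 + w)*(f (t, a) + w)*norm v powr p" for v
   using main[of v] mult_right_mono[of _ _ "norm v powr p"] by (meson order_trans powr_ge_zero)
 next
  fix a :: "'n torus"
  let ?x = "rep_torus a"
  have "ph1 a - w <= upper_env e ((ta 1, ?x) - y)" if y: "norm y < e" for y
  proof -
   obtain s u where su: "y = (s, u)" by (cases y)
   have s: "\<bar>s\<bar> < e" "norm u < e" using y norm_fst_le[of s u] norm_snd_le[of u s] su by auto
   have t1: "ta 1 - s : {0..1}" using s e by (auto simp: ta_def b_def)
   have "dist a (torus_proj (?x - u)) <= norm u" using dist_torus_le[of ?x "?x - u"] by (simp add: rep_torus_proj dist_norm)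
   hence "\<bar>ph1 a - ph1 (torus_proj (?x - u))\<bar> < w" using s e by (intro d3(2)) auto
   hence "ph1 a - w <= val 1 (torus_proj (?x - u))" using val1[of "torus_proj (?x - u)"] by linarith
   also have "... <= val (ta 1 - s) (torus_proj (?x - u))" using t1 by (intro val_antimono) auto
   also have "... <= upper_env e (ta 1 - s, ?x - u)" using t1 e by (intro upper_env_ge) auto
   finally show ?thesis by (simp add: su)
  qed
  from avg_ge[OF M(6) this] show "ph1 a - w <= ps (1, a)" by (simp add: ps_def M(7))
  have "upper_env e ((ta 0, ?x) - y) <= ph0 a + w" if y: "norm y < e" for y
  proof (rule upper_env_least)
   show "- B <= ph0 a + w" using B[of a] w by linarith
   fix t' x' assume t': "t' : {0..1::real}" "dist ((ta 0, ?x) - y) (t', x') < e"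
   obtain s u where su: "y = (s, u)" by (cases y)
   have "norm u < e" using y norm_snd_le[of u s] su by auto
   moreover have "dist (?x - u) x' < e" using t'(2) dist_snd_le[of "(ta 0 - s, ?x - u)" "(t', x')"] by (simp add: su)
   ultimately have "dist ?x x' < 2*e" using dist_triangle[of ?x x' "?x - u"] by (simp add: dist_norm)
   hence "dist a (torus_proj x') < d2" using dist_torus_le[of ?x x'] e by (simp add: rep_torus_proj)
   hence "\<bar>ph0 a - ph0 (torus_proj x')\<bar> < w" by (rule d2(2))
   thus "val t' (torus_proj x') <= ph0 a + w" using val_le[of t' "torus_proj x'"] t' by auto
  qed
  from avg_le[OF M(6) this] show "ps (0, a) <= ph0 a + w" by (simp add: ps_def M(7))
 qed
qed

section \<open>Dual inequality for admissible pairs\<close>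

text \<open>Linear inequalities between weighted energy and boundary potentials that hold along all trajectories. They
hold for the speed measure of every law on trajectories with these marginals, and by duality they characterize
the measures that dominate such a speed measure approximately.\<close>
definition dual_ineq :: "real => 'n::finite torus measure => 'n torus measure => (real \<times> 'n torus) measure => bool" where
 "dual_ineq p rh0 rh1 sg \<longleftrightarrow> (\<forall>f ph0 ph1. continuous_on cyl f & (ALL z:cyl. 0 <= f z) &
  cont ph0 & cont ph1 &
  (ALL c:controls. ph1 (torus_proj (pos c 1)) <= ph0 (torus_proj (fst c)) + cost p f c 1) -->
  (LINT a|rh1. ph1 a) - (LINT a|rh0. ph0 a) <= (LINT z|sg. f z))"

lemma continuous_torus_integrable:
 fixes ph :: "'n::finite torus => real"
 assumes "finite_measure M" "sets M = sets borel" "cont ph"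
 shows "integrable M ph"
proof -
 interpret finite_measure M by fact
 obtain B where "!!a. norm (ph a) <= B"
  using compact_imp_bounded[OF compact_continuous_image[OF assms(3) compact_UNIV_torus]] unfolding bounded_iff by auto
 thus ?thesis using borel_measurable_continuous_onI[OF assms(3)]
  by (intro integrable_const_bound[where B = B]) (simp_all add: measurable_cong_sets[OF assms(2) refl])
qed

lemma finite_cyl_integrable:
 fixes f :: "real \<times> 'n::finite torus => real"
 assumes "is_finite_cyl_measure M" "continuous_on cyl f"
 shows "integrable M f"
proof -
 interpret finite_measure M using assms(1) by (simp add: is_finite_cyl_measure_def)
 have s: "sets M = sets cyl_borel" using assms(1) by (simp add: is_finite_cyl_measure_def)
 obtain B where B: "!!z. z : cyl ==> norm (f z) <= B" by (rule cont_cyl_bounded[OF assms(2)], rule that)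
 have "space M = cyl" using sets_eq_imp_space_eq[OF s] by (simp add: space_cyl_borel)
 thus ?thesis using cont_cyl_measurable[OF assms(2)] B
  by (intro integrable_const_bound[where B = B]) (auto simp: measurable_cong_sets[OF s refl])
qed

text \<open>The continuity equation is tested with the smooth subsolution. Young's inequality bounds the product of
gradient and flux by the time derivative times the density plus the weight times the measure in question.\<close>
lemma admissible_dual_ineq:
 fixes rh0 rh1 :: "'n::finite torus measure"
 assumes a: "0 < al" "al < 1" and p: "p = 2/(2 - al)"
  and P: "prob_space rh0" "sets rh0 = sets borel" "prob_space rh1" "sets rh1 = sets borel"
  and adm: "(rh, w) : admissible rh0 rh1" and fin: "action al rh w < \<infinity>"
 obtains s where "s : bm cyl_leb" "!!z. 0 <= s z" "integrable cyl_leb s"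
  "(nn_integral cyl_leb (%z. ennreal (s z powr (2 - al)))) = action al rh w"
  "dual_ineq p rh0 rh1 (density cyl_leb (%z. ennreal (s z)))"
proof -
 let ?L = "cyl_leb :: (real \<times> 'n torus) measure"
 interpret L: prob_space ?L by (rule prob_space_cyl_leb)
 interpret P0: prob_space rh0 by fact
 interpret P1: prob_space rh1 by fact
 define r where "r = ac_density rh"
 have rh: "is_finite_cyl_measure rh" and w: "integrable ?L w" and ce: "continuity_eq rh w rh0 rh1"
  using adm by (auto simp: admissible_def)
 interpret R: finite_measure rh using rh by (simp add: is_finite_cyl_measure_def)
 have sr: "sets rh = sets ?L" using rh by (simp add: is_finite_cyl_measure_def)
 have spr: "space rh = cyl" using sets_eq_imp_space_eq[OF sr] by simp
 have dec: "r : bm ?L" "!!z. 0 <= r z" "!!A. A : sets ?L ==> emeasure (density ?L r) A <= emeasure rh A"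
  using is_ac_density_ac_density[OF rh] sr unfolding is_ac_density_def r_def by fastforce+
 note [measurable] = dec(1) borel_measurable_integrable[OF w]
 define s where "s z = (if 0 < r z then r z*(norm (w z)/r z) powr p else 0)" for z
 have s0: "0 <= s z" for z by (simp add: s_def)
 have sm [measurable]: "s : bm ?L" unfolding s_def[abs_def] by measurable
 have p1: "1 < p" "p*(2 - al) = 2" using a by (auto simp: p field_simps)
 have Hm: "(%z. H_cost al (r z) (w z)) : bm ?L" unfolding H_cost_def by measurable
 have "AE z in ?L. H_cost al (r z) (w z) ~= \<infinity>"
  using fin Hm unfolding action_def r_def[symmetric] by (intro nn_integral_PInf_AE) auto
 hence rw: "AE z in ?L. 0 < r z | (r z = 0 & w z = 0)"
  by eventually_elim (use dec(2) in \<open>auto simp: H_cost_def order_less_le split: if_splits\<close>)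
 have sq: "ennreal (s z powr (2 - al)) = H_cost al (r z) (w z)" if "0 < r z | (r z = 0 & w z = 0)" for z
 proof (cases "0 < r z")
  case True
  have "s z powr (2 - al) = r z powr (2 - al)*(norm (w z)/r z) powr 2"
   using True dec(2)[of z] by (simp add: s_def powr_mult powr_powr p1)
  also have "... = (norm (w z))\<^sup>2/r z powr al" using True by (simp add: powr_diff power_divide)
  finally show ?thesis using True by (simp add: H_cost_def)
 qed (use that in \<open>auto simp: s_def H_cost_def\<close>)
 have act: "(nn_integral ?L (%z. ennreal (s z powr (2 - al)))) = action al rh w"
  unfolding action_def r_def[symmetric] using rw by (intro nn_integral_cong_AE) (auto simp: sq)
 have iq: "integrable ?L (%z. s z powr (2 - al))"
  using fin by (intro integrableI_nonneg) (auto simp: act)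
 have sI: "integrable ?L s"
 proof (rule Bochner_Integration.integrable_bound)
  show "integrable ?L (%z. 1 + s z powr (2 - al))" using iq by simp
  show "AE z in ?L. norm (s z) <= norm (1 + s z powr (2 - al))"
  proof (rule AE_I2)
   fix z show "norm (s z) <= norm (1 + s z powr (2 - al))"
   proof (cases "s z <= 1")
   case True
   thus ?thesis using s0[of z] powr_ge_zero[of "s z" "2 - al"] unfolding real_norm_def by linarith
   next
   case False
   hence "s z powr 1 <= s z powr (2 - al)" using a by (intro powr_mono) auto
   thus ?thesis using False by simp
   qed
  qed
 qed simp
 have "dual_ineq p rh0 rh1 (density ?L (%z. ennreal (s z)))"
  unfolding dual_ineq_def
 proof (intro allI impI, elim conjE)
  fix f :: "real \<times> 'n torus => real" and ph0 ph1 :: "'n torus => real"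
  assume f: "continuous_on cyl f" "ALL z:cyl. 0 <= f z" and ph: "cont ph0" "cont ph1"
   and D: "ALL c:controls. ph1 (torus_proj (pos c 1)) <= ph0 (torus_proj (fst c)) + cost p f c 1"
  note fm [measurable] = cont_cyl_measurable[OF f(1)]
  obtain Bf where Bf: "!!z. z : cyl ==> norm (f z) <= Bf" by (rule cont_cyl_bounded[OF f(1)], rule that)
  have ifs: "integrable ?L (%z. f z * s z)"
  proof (rule Bochner_Integration.integrable_bound[OF integrable_mult_right[OF sI, of Bf]])
   show "(%z. f z * s z) : bm ?L" by measurable
   show "AE z in ?L. norm (f z * s z) <= norm (Bf * s z)"
   using Bf s0 by (intro AE_I2) (force simp: abs_mult intro: mult_right_mono)
  qed
  have Fe: "(LINT z|density ?L (%z. ennreal (s z)). f z) = (LINT z|?L. f z * s z)"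
   using s0 by (subst integral_density) (auto simp: mult.commute)
  let ?J = "(LINT a|rh1. ph1 a) - (LINT a|rh0. ph0 a)"
  have J: "?J <= (1 + e)*((LINT z|?L. f z * s z) + e*(LINT z|?L. s z)) + 2*e" if e: "0 < e" for e
  proof -
   obtain ps pst psx where T: "is_C1_test ps pst psx" "!!t a. t : {0..1} ==> pst (t, a) <= 0"
   "!!t a v. t : {0..1} ==> pst (t, a) + psx (t, a) \<bullet> v <= (1 + e)*(f (t, a) + e)*norm v powr p"
   "!!a. ph1 a - e <= ps (1, a)" "!!a. ps (0, a) <= ph0 a + e"
   proof (rule dual_test_function[OF p1(1) f(1) _ ph _ e])
   show "0 <= f z" if "z : cyl" for z using f(2) that by blast
   show "ph1 (torus_proj (pos c 1)) <= ph0 (torus_proj (fst c)) + cost p f c 1" if "c : controls" for c using D that by blast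
   qed (rule that)
   have ct: "continuous_on cyl pst" "continuous_on cyl psx" using T(1) by (auto simp: is_C1_test_def)
   note [measurable] = cont_cyl_measurable[OF ct(1)] cont_cyl_measurable[OF ct(2)]
   obtain Bt where Bt: "!!z. z : cyl ==> norm (pst z) <= Bt" by (rule cont_cyl_bounded[OF ct(1)], rule that)
   obtain Bx where Bx: "!!z. z : cyl ==> norm (psx z) <= Bx" by (rule cont_cyl_bounded[OF ct(2)], rule that)
   have t0: "pst z <= 0" if "z : cyl" for z using T(2)[of "fst z" "snd z"] that by (cases z) (auto simp: cyl_def)
   have it: "integrable rh pst" using finite_cyl_integrable[OF rh ct(1)] .
   have nn: "(nn_integral ?L (%z. ennreal (r z*- pst z))) <= (nn_integral rh (%z. ennreal (- pst z)))"
   proof -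
   have "(nn_integral ?L (%z. ennreal (r z*- pst z))) = (nn_integral (density ?L r) (%z. ennreal (- pst z)))"
   using dec(2) by (subst nn_integral_density) (measurable, simp add: ennreal_mult'[symmetric])
   also have "... <= (nn_integral rh (%z. ennreal (- pst z)))"
   using dec(3) sr by (intro nn_integral_mono_measure) (auto simp: le_measure)
   finally show ?thesis .
   qed
   have "(nn_integral rh (%z. ennreal (- pst z))) = ennreal (LINT z|rh. - pst z)"
   using it t0 spr by (intro nn_integral_eq_integral) auto
   with nn have nn2: "(nn_integral ?L (%z. ennreal (r z*- pst z))) <= ennreal (LINT z|rh. - pst z)" by simp
   have rt0: "0 <= r z*- pst z" if "z : cyl" for z using t0[OF that] dec(2)[of z] by (simp add: mult_nonneg_nonpos)
   have irt: "integrable ?L (%z. r z*- pst z)"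
   using nn2 rt0 by (intro integrableI_nonneg) (auto intro: le_less_trans)
   have "ennreal (LINT z|?L. r z*- pst z) <= ennreal (LINT z|rh. - pst z)"
   proof -
   have "AE z in ?L. 0 <= r z*- pst z" by (intro AE_I2 rt0) simp
   from nn_integral_eq_integral[OF irt this] nn2 show ?thesis by (simp only:)
   qed
   moreover have "0 <= (LINT z|rh. - pst z)" using t0 spr by (intro Bochner_Integration.integral_nonneg_AE AE_I2) simp
   ultimately have le1: "(LINT z|rh. pst z) <= (LINT z|?L. r z*pst z)" by simp
   have ix: "integrable ?L (%z. psx z \<bullet> w z)"
   proof (rule Bochner_Integration.integrable_bound[OF integrable_mult_right[OF integrable_norm[OF w], of Bx]])
   show "AE z in ?L. norm (psx z \<bullet> w z) <= norm (Bx*norm (w z))"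
   proof (rule AE_I2)
   fix z :: "real \<times> 'n torus" assume "z : space ?L"
   hence "norm (psx z)*norm (w z) <= Bx*norm (w z)" using Bx by (intro mult_right_mono) auto
   thus "norm (psx z \<bullet> w z) <= norm (Bx*norm (w z))" using Cauchy_Schwarz_ineq2[of "psx z" "w z"] by simp
   qed
   qed measurable
   have irt': "integrable ?L (%z. r z*pst z)" using irt by simp
   have "(LINT z|?L. r z*pst z) + (LINT z|?L. psx z \<bullet> w z) = (LINT z|?L. r z*pst z + psx z \<bullet> w z)"
   using irt' ix by simp
   also have "... <= (LINT z|?L. (1 + e)*(f z * s z + e * s z))"
   proof (rule integral_mono_AE)
   show "AE z in ?L. r z*pst z + psx z \<bullet> w z <= (1 + e)*(f z * s z + e * s z)"
   using rw AE_space
   proof eventually_elim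
   case (elim z)
   show ?case
   proof (cases "0 < r z")
   case True
   have "pst z + psx z \<bullet> (w z /\<^sub>R r z) <= (1 + e)*(f z + e)*norm (w z /\<^sub>R r z) powr p"
   using T(3)[of "fst z" "snd z" "w z /\<^sub>R r z"] elim(2) by (simp add: cyl_def mem_Times_iff)
   hence le: "r z*(pst z + psx z \<bullet> (w z /\<^sub>R r z)) <= r z*((1 + e)*(f z + e)*norm (w z /\<^sub>R r z) powr p)"
   using True by (intro mult_left_mono) auto
   have n: "norm (w z /\<^sub>R r z) = norm (w z)/r z" using True by (simp add: divide_inverse_commute)
   have "r z*(pst z + psx z \<bullet> (w z /\<^sub>R r z)) = r z*pst z + psx z \<bullet> w z" using True by (simp add: distrib_left)
   thus ?thesis using le True unfolding n by (simp add: s_def) (simp add: algebra_simps)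
   qed (use elim in \<open>auto simp: s_def\<close>)
   qed
   qed (use irt' ix ifs sI in auto)
   also have "... = (1 + e)*((LINT z|?L. f z * s z) + e*(LINT z|?L. s z))" using ifs sI by simp
   finally have le2: "(LINT z|rh. pst z) + (LINT z|?L. psx z \<bullet> w z) <= (1 + e)*((LINT z|?L. f z * s z) + e*(LINT z|?L. s z))"
   using le1 by linarith
   have i: "integrable rh1 ph1" "integrable rh0 ph0" "integrable rh1 (%a. ps (1, a))" "integrable rh0 (%a. ps (0, a))"
   using ph P C1_test_slice_continuous[OF T(1)] P0.finite_measure_axioms P1.finite_measure_axioms
   by (auto intro!: continuous_torus_integrable)
   have "(LINT a|rh1. ph1 a) - e = (LINT a|rh1. ph1 a - e)" using i P1.prob_space by simp
   also have "... <= (LINT a|rh1. ps (1, a))" using i T(4) by (intro integral_mono) auto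
   finally have 1: "(LINT a|rh1. ph1 a) - e <= (LINT a|rh1. ps (1, a))" .
   have "(LINT a|rh0. ps (0, a)) <= (LINT a|rh0. ph0 a + e)" using i T(5) by (intro integral_mono) auto
   also have "... = (LINT a|rh0. ph0 a) + e" using i P0.prob_space by simp
   finally have 2: "(LINT a|rh0. ps (0, a)) <= (LINT a|rh0. ph0 a) + e" .
   have "(LINT z|rh. pst z) + (LINT z|?L. psx z \<bullet> w z) = (LINT a|rh1. ps (1, a)) - (LINT a|rh0. ps (0, a))"
   using ce T(1) unfolding continuity_eq_def by blast
   thus ?thesis using le2 1 2 by linarith
  qed
  let ?F = "\<integral>z. f z * s z \<partial>?L" and ?S = "\<integral>z. s z \<partial>?L"
  have "((%e. (1 + e)*(?F + e*?S) + 2*e) \<longlongrightarrow> (1 + 0)*(?F + 0*?S) + 2*0) (at_right 0)"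
   by (intro tendsto_intros)
  moreover have "\<forall>\<^sub>F e in at_right 0. ?J <= (1 + e)*(?F + e*?S) + 2*e"
   using J by (intro eventually_at_right_less[THEN eventually_mono])
  ultimately have "?J <= (1 + 0)*(?F + 0*?S) + 2*0" by (rule tendsto_lowerbound) simp
  thus "?J <= (LINT z|density ?L (%z. ennreal (s z)). f z)" by (simp add: Fe)
 qed
 thus ?thesis by (rule that[OF sm s0 sI act])
qed

section \<open>Coding families of points by one real number\<close>

text \<open>A periodic function that is constantly one or zero on the ranges that encode a binary digit, so that it reads
off digits continuously.\<close>
definition bitwave :: "real => real" where "bitwave x = max 0 (min 1 (1/2 - cos (pi*x)))"

text \<open>A coordinate of a continuous map of the unit interval onto a countable power of the unit interval, after
Schoenberg: the digits of \<open>t\<close> are distributed over the coordinates by the pairing function and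
read off by the wave.\<close>
definition coord :: "nat => real => real" where
 "coord j t = (\<Sum>k. (1/2)^(Suc k)*bitwave (3^(prod_encode (j, k))*t))"

lemma bitwave_bounds: "0 <= bitwave x" "bitwave x <= 1" by (auto simp: bitwave_def)

lemma continuous_coord: "cont (coord j)"
proof -
 have "uniform_limit UNIV (%n t. \<Sum>k<n. (1/2)^(Suc k)*bitwave (3^(prod_encode (j, k))*t)) (%t. \<Sum>k. (1/2)^(Suc k)*bitwave (3^(prod_encode (j, k))*t)) sequentially"
 proof (rule Weierstrass_m_test)
  show "norm ((1/2)^(Suc k)*bitwave (3^(prod_encode (j, k))*t)) <= (1/2)^(Suc k)" for k t
   using bitwave_bounds[of "3^(prod_encode (j, k))*t"] by (simp add: abs_mult mult_left_le)
  show "summable (%k. (1/2 :: real)^(Suc k))" by (simp add: summable_geometric)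
 qed
 thus ?thesis unfolding coord_def[abs_def]
  by (rule uniform_limit_theorem[rotated]) (auto simp: bitwave_def intro!: always_eventually continuous_intros)
qed

lemma bitwave_periodic: "bitwave (2*real n + x) = bitwave x"
proof -
 have "cos (pi*(2*real n + x)) = cos (pi*x)"
  using cos_int_2pin[of "int n"] sin_int_2pin[of "int n"] by (simp add: distrib_left cos_add mult_ac)
 thus ?thesis by (simp add: bitwave_def)
qed

lemma bitwave_digit:
 assumes "0 <= x" "x <= 1/3" shows "bitwave (2/3 * of_bool b + x) = of_bool b"
proof (cases b)
 case False
 have "cos (pi/3) <= cos (pi*x)" using assms by (intro cos_monotone_0_pi_le) (auto simp: field_simps)
 thus ?thesis using False by (simp add: bitwave_def cos_60)
next
 case True
 have "pi*(1/3 - x) <= pi*(1/3)" using assms by (intro mult_left_mono) auto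
 hence "cos (pi/3) <= cos (pi*(1/3 - x))" using assms by (intro cos_monotone_0_pi_le) auto
 moreover have "cos (pi*(2/3 + x)) = - cos (pi*(1/3 - x))"
 proof -
  have "pi*(2/3 + x) = pi - pi*(1/3 - x)" by (simp add: algebra_simps)
  thus ?thesis by (simp only: cos_pi_minus)
 qed
 ultimately show ?thesis using True by (simp add: bitwave_def cos_60)
qed

lemma binary_digits:
 assumes "0 <= y" "y < (1::real)"
 shows "(%k. (1/2)^(Suc k) * of_bool (odd \<lfloor>2^(Suc k)*y\<rfloor>)) sums y"
proof -
 have part: "(\<Sum>k<n. (1/2::real)^(Suc k) * of_bool (odd \<lfloor>2^(Suc k)*y\<rfloor>)) = of_int \<lfloor>2^n*y\<rfloor>/2^n" for n
 proof (induction n)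
  case 0 thus ?case using assms by (simp add: floor_eq_iff)
 next
  case (Suc n)
  define m where "m = \<lfloor>2^(Suc n)*y\<rfloor>"
  have "\<lfloor>(2^(Suc n)*y)/of_int 2\<rfloor> = m div 2" unfolding m_def by (rule floor_divide_real_eq_div) simp
  hence h: "\<lfloor>2^n*y\<rfloor> = m div 2" by simp
  have "m = 2*(m div 2) + of_bool (odd m)" by (cases "even m") auto
  hence "real_of_int m = 2*real_of_int (m div 2) + of_bool (odd m)" by (metis of_int_add of_int_mult of_int_numeral of_int_of_bool)
  thus ?case unfolding sum.lessThan_Suc Suc h m_def[symmetric] by (simp add: field_simps)
 qed
 have "(%n. of_int \<lfloor>2^n*y\<rfloor>/2^n) ~> y"
 proof (rule real_tendsto_sandwich[where f = "%n. y - (1/2)^n" and h = "%_. y"])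
  have "(%n. y - (1/2)^n) ~> y - 0" by (intro tendsto_intros LIMSEQ_power_zero) auto
  thus "(%n. y - (1/2)^n) ~> y" by simp
  have "y - (1/2)^n <= of_int \<lfloor>2^n*y\<rfloor>/2^n" for n
  proof -
   have "2^n*y - 1 <= of_int \<lfloor>2^n*y\<rfloor>" by linarith
   hence "(2^n*y - 1)/2^n <= of_int \<lfloor>2^n*y\<rfloor>/2^n" by (intro divide_right_mono) auto
   thus ?thesis by (simp add: diff_divide_distrib power_one_over)
  qed
  thus "\<forall>\<^sub>F n in sequentially. y - (1/2)^n <= of_int \<lfloor>2^n*y\<rfloor>/2^n" by simp
  have "of_int \<lfloor>2^n*y\<rfloor>/2^n <= y" for n
   using of_int_floor_le[of "2^n*y"] by (simp add: divide_le_eq mult.commute)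
  thus "\<forall>\<^sub>F n in sequentially. of_int \<lfloor>2^n*y\<rfloor>/2^n <= y" by simp
 qed simp
 thus ?thesis unfolding sums_def part .
qed

lemma coord_onto:
 assumes y: "!!j. 0 <= y j" "!!j. y j < (1::real)"
 obtains t where "0 <= t" "t <= 1" "!!j. coord j t = y j"
proof -
 define b where "b m = (case prod_decode m of (j, k) => odd \<lfloor>2^(Suc k)*y j\<rfloor>)" for m
 let ?c = "%m. 2/3 * of_bool (b m)*(1/3)^m :: real"
 have geo: "(%m. 2/3*(1/3)^m) sums (1::real)"
  using sums_mult[OF geometric_sums[of "1/3 :: real"], of "2/3"] by simp
 have le: "2/3 * of_bool B*(1/3)^m <= 2/3*(1/3 :: real)^m" for B m by simp
 have summ: "summable (%m. 2/3 * of_bool (B m)*(1/3 :: real)^m)" for B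
  by (rule summable_comparison_test[OF _ sums_summable[OF geo]]) (use le in auto)
 have bd: "0 <= (\<Sum>m. 2/3 * of_bool (B m)*(1/3 :: real)^m)" "(\<Sum>m. 2/3 * of_bool (B m)*(1/3 :: real)^m) <= 1" for B
  using suminf_le[OF le summ sums_summable[OF geo]] sums_unique[OF geo] suminf_nonneg[OF summ] by auto
 define t where "t = (\<Sum>m. ?c m)"
 have digit: "bitwave (3^m*t) = of_bool (b m)" for m
 proof -
  define R where "R = (\<Sum>i. 2/3 * of_bool (b (i + Suc m))*(1/3 :: real)^i)"
  define N where "N = (\<Sum>i<m. of_bool (b i)*3^(m - Suc i) :: nat)"
  have "t = (\<Sum>i. ?c (i + Suc m)) + (\<Sum>i<Suc m. ?c i)"
   unfolding t_def by (rule suminf_split_initial_segment[OF summ])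
  also have "(\<Sum>i. ?c (i + Suc m)) = (1/3)^(Suc m)*R"
   unfolding R_def using suminf_mult[OF summ[of "%i. b (i + Suc m)"], of "(1/3)^(Suc m)"] by (simp add: power_add mult_ac)
  finally have "3^m*t = 3^m*(1/3)^(Suc m)*R + (\<Sum>i<m. 3^m*?c i) + 3^m*?c m"
   by (simp add: distrib_left sum_distrib_left)
  also have "3^m*(1/3)^(Suc m)*R = R/3" by (simp add: power_one_over)
  also have "3^m*?c m = 2/3 * of_bool (b m)" by (simp add: power_one_over)
  also have "(\<Sum>i<m. 3^m*?c i) = 2*real N"
  proof -
   have cc: "3^m*?c i = 2*(of_bool (b i)*3^(m - Suc i))" if "i < m" for i
   proof -
   have "(3::real)^m = 3^(m - Suc i)*3^(Suc i)" using that by (subst power_add[symmetric]) simp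
   thus ?thesis by (simp add: power_one_over)
   qed
   thus ?thesis
   unfolding N_def of_nat_sum of_nat_mult of_nat_of_bool of_nat_power of_nat_numeral sum_distrib_left by (intro sum.cong) auto
  qed
  finally have "3^m*t = 2*real N + (2/3 * of_bool (b m) + R/3)" by simp
  thus ?thesis using bitwave_digit[of "R/3" "b m"] bd[of "%i. b (i + Suc m)"] by (simp add: bitwave_periodic R_def)
 qed
 show ?thesis
 proof (rule that[of t])
  show "0 <= t" "t <= 1" unfolding t_def by (rule bd)+
  show "coord j t = y j" for j
   unfolding coord_def digit b_def using sums_unique[OF binary_digits[OF y]] by simp
 qed
qed

text \<open>Every family of points indexed by the rationals is coded by one number, continuously in the decoding
direction. Laws of such families become laws on a compact interval.\<close>
lemma torus_family_code:
 obtains D :: "rat => real => 'n::finite torus" where "!!r. cont (D r)"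
  "!!x :: rat => 'n torus. EX u:{0..1}. \<forall>r. D r u = x r"
proof -
 obtain sec :: "'n torus => real ^ 'n" where sec: "!!a. sec a : fund_cube" "!!a. torus_proj (sec a) = a"
  by (rule measurable_torus_section, rule that)
 define D :: "rat => real => 'n torus" where
  "D r u = torus_proj (\<chi> i. 2*coord (to_nat (r, i)) u - 1)" for r u
 show ?thesis
 proof (rule that[of D])
  show "cont (D r)" for r
   unfolding D_def[abs_def]
   by (intro continuous_on_compose2[OF continuous_on_torus_proj[of UNIV]] continuous_on_vec_lambda continuous_intros continuous_coord) auto
  fix x :: "rat => 'n torus"
  define y where "y j = (case from_nat j :: rat \<times> 'n of (r, i) => (sec (x r) $ i + 1)/2)" for j
  have b: "- 1/2 <= sec a $ i" "sec a $ i <= 1/2" for a i using sec(1)[of a] by (auto simp: fund_cube_def mem_box_cart)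
  have yb: "0 <= y j" "y j < 1" for j
   using b[of "x (fst (from_nat j :: rat \<times> 'n))" "snd (from_nat j :: rat \<times> 'n)"] by (auto simp: y_def case_prod_beta)
  obtain u where u: "0 <= u" "u <= 1" "!!j. coord j u = y j" by (rule coord_onto[of y, OF yb]) (rule that)
  have "(\<chi> i. 2*coord (to_nat (r, i)) u - 1) = sec (x r)" for r by (simp add: u(3) y_def vec_eq_iff field_simps)
  hence "\<forall>r. D r u = x r" by (simp add: D_def sec(2))
  thus "EX u:{0..1}. \<forall>r. D r u = x r" using u by auto
 qed
qed

lemma countable_sup_dense:
 fixes S :: "'a::metric_space set"
 assumes S: "compact S"
 obtains F :: "nat => 'a => real" where "!!i. cont (F i)"
  "!!f e. continuous_on S f ==> 0 < e ==> \<exists>i. ALL x:S. \<bar>F i x - f x\<bar> <= e"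
proof -
 have "\<exists>C. finite C & C <= S & S <= (\<Union>z\<in>C. ball z (1/real (Suc n)))" for n
  using compactE_image[OF S, of S "%z. ball z (1/real (Suc n))"] by (metis UN_I centre_in_ball of_nat_0_less_iff open_ball subsetI zero_less_Suc zero_less_divide_1_iff)
 then obtain C where C: "!!n. finite (C n)" "!!n. C n <= S" "!!n. S <= (\<Union>z\<in>C n. ball z (1/real (Suc n)))" by metis
 define E where "E = (\<Union>n. C n)"
 have "countable E" unfolding E_def using C(1) by (auto intro: uncountable_infinite countable_finite)
 define G :: "('a \<times> rat) list => nat => 'a => real" where
  "G l L x = (if l = [] then 0 else Min ((%(z, a). of_rat a + real L*dist x z) ` set l))" for l L x
 have Gc: "cont (G l L)" for l L
 proof (induction l)
  case (Cons za l)
  thus ?case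
  proof (cases "l = []")
   case False
   hence "G (za # l) L = (%x. min (of_rat (snd za) + real L*dist x (fst za)) (G l L x))"
   by (auto simp: G_def fun_eq_iff case_prod_beta)
   thus ?thesis using Cons by (auto intro!: continuous_intros)
  qed (auto simp: G_def[abs_def] case_prod_beta intro!: continuous_intros)
 qed (simp add: G_def[abs_def])
 let ?Fs = "(%(l, L). G l L) ` ({l. set l <= E \<times> UNIV} \<times> UNIV)"
 have "countable ?Fs" using \<open>countable E\<close>
  by (intro countable_image countable_SIGMA) (auto simp: lists_eq_set[symmetric] intro!: countable_lists)
 moreover have "?Fs ~= {}" by (auto intro!: exI[of _ "[]"])
 ultimately have ran: "range (from_nat_into ?Fs) = ?Fs" by (metis range_from_nat_into)
 show ?thesis
 proof (rule that[of "from_nat_into ?Fs"])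
  show "cont (from_nat_into ?Fs i)" for i
   using ran Gc by (metis (mono_tags, lifting) case_prod_beta imageE rangeI)
  fix f :: "'a => real" and e :: real assume f: "continuous_on S f" and e: "0 < e"
  obtain M where M: "!!x. x : S ==> \<bar>f x\<bar> <= M"
   using compact_imp_bounded[OF compact_continuous_image[OF f S]] unfolding bounded_iff by auto
  have "uniformly_continuous_on S f" by (rule compact_uniformly_continuous[OF f S])
  then obtain d where d: "0 < d" "!!x y. x : S ==> y : S ==> dist x y < d ==> \<bar>f x - f y\<bar> < e/3"
   using e unfolding uniformly_continuous_on_def dist_real_def by (metis dist_commute divide_pos_pos zero_less_numeral)
  obtain L :: nat where L: "2*M/d <= real L" using real_arch_simple by blast
  define r where "r = min d (e/3/(real L + 1))"
  have "0 < r" using d e by (simp add: r_def)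
  then obtain n where n: "1/real (Suc n) < r" using nat_approx_posE by blast
  have "\<exists>q. f z < of_rat q & of_rat q < f z + e/3" for z using of_rat_dense[of "f z" "f z + e/3"] e by auto
  then obtain q where q: "!!z. f z < of_rat (q z)" "!!z. of_rat (q z) < f z + e/3" by metis
  obtain zs where zs: "set zs = C n" using finite_list[OF C(1)] by blast
  define l where "l = map (%z. (z, q z)) zs"
  have "G l L : ?Fs" using zs by (intro image_eqI[of _ _ "(l, L)"]) (auto simp: l_def E_def)
  hence "G l L : range (from_nat_into ?Fs)" unfolding ran .
  then obtain i where i: "G l L = from_nat_into ?Fs i" by (rule rangeE)
  have "\<bar>G l L x - f x\<bar> <= e" if x: "x : S" for x
  proof -
   obtain z where z: "z : C n" "dist x z < 1/real (Suc n)" using C(3)[of n] x by (auto simp: dist_commute)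
   have ne: "l ~= []" using z zs by (auto simp: l_def)
   have zS: "z : S" using z C by blast
   have img: "G l L x = Min ((%z. of_rat (q z) + real L*dist x z) ` C n)"
   using ne zs by (simp add: G_def l_def image_image)
   have "real L*dist x z <= (real L + 1)*r" using z n by (intro mult_mono) auto
   also have "... <= (real L + 1)*(e/3/(real L + 1))" by (intro mult_left_mono) (auto simp: r_def)
   also have "... = e/3"
   proof -
   have "real L + 1 ~= 0" by linarith
   thus ?thesis by (metis nonzero_mult_div_cancel_left times_divide_eq_right)
   qed
   finally have "real L*dist x z <= e/3" .
   moreover have "dist x z < d" using z n by (simp add: r_def)
   ultimately have "of_rat (q z) + real L*dist x z <= f x + e"
   using q(2)[of z] d(2)[OF x zS] by linarith
   moreover have "G l L x <= of_rat (q z) + real L*dist x z" unfolding img using C(1) z by (intro Min_le) auto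
   moreover have "f x - e <= G l L x"
   unfolding img
   proof (subst Min_ge_iff)
   show "ALL a:(%z. of_rat (q z) + real L*dist x z) ` C n. f x - e <= a"
   proof clarify
   fix z assume z: "z : C n"
   hence zS: "z : S" using C by blast
   show "f x - e <= of_rat (q z) + real L*dist x z"
   proof (cases "dist x z < d")
   case True
   have "0 <= real L*dist x z" by simp
   thus ?thesis using d(2)[OF x zS True] q(1)[of z] e by linarith
   next
   case False
   have "2*M = 2*M/d*d" using d by simp
   also have "... <= real L*dist x z"
   using False L d M[OF x] by (intro mult_mono) auto
   finally show ?thesis using q(1)[of z] M[OF x] M[OF zS] e by linarith
   qed
   qed
   qed (use C z in auto)
   ultimately show ?thesis by linarith
  qed
  thus "\<exists>i. ALL x:S. \<bar>from_nat_into ?Fs i x - f x\<bar> <= e" unfolding i by blast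
 qed
qed

section \<open>Discrete laws on curves and their limits\<close>

lemma cost_mono:
 fixes f g :: "real \<times> 'n::finite torus => real"
 assumes "c : controls" "continuous_on cyl f" "continuous_on cyl g" "!!z. z : cyl ==> f z <= g z" "0 <= p"
 shows "cost p f c 1 <= cost p g c 1"
 unfolding cost_def using assms by (intro integral_le cost_integrand mult_right_mono) (auto simp: cyl_def)

lemma cost_cmult: "cost p (%z. a*f z) c 1 = a*cost p f c 1"
 unfolding cost_def mult.assoc by simp

lemma cost_add:
 fixes f g :: "real \<times> 'n::finite torus => real"
 assumes "c : controls" "continuous_on cyl f" "continuous_on cyl g" "0 <= p"
 shows "cost p (%z. f z + g z) c 1 = cost p f c 1 + cost p g c 1"
 unfolding cost_def distrib_right
 using assms by (intro Henstock_Kurzweil_Integration.integral_add cost_integrand) auto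

lemma cost_sum:
 fixes f :: "'i => real \<times> 'n::finite torus => real"
 assumes "finite I" "c : controls" "!!i. i : I ==> continuous_on cyl (f i)" "0 <= p"
 shows "cost p (%z. \<Sum>i\<in>I. a i*f i z) c 1 = (\<Sum>i\<in>I. a i*cost p (f i) c 1)"
 using assms(1,3)
proof (induction I rule: finite_induct)
 case (insert i I)
 hence "cost p (%z. a i*f i z + (\<Sum>i\<in>I. a i*f i z)) c 1 = cost p (%z. a i*f i z) c 1 + cost p (%z. \<Sum>i\<in>I. a i*f i z) c 1"
  using assms by (intro cost_add) (auto intro!: continuous_intros)
 thus ?case using insert by (simp add: cost_cmult)
qed (simp add: cost_def)

lemma torus_bounded_fn:
 fixes a :: "'n::finite torus => real"
 assumes "cont a" obtains B where "!!x. \<bar>a x\<bar> <= B" "0 <= B"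
proof -
 obtain B where B: "!!x. \<bar>a x\<bar> <= B"
  using compact_imp_bounded[OF compact_continuous_image[OF assms compact_UNIV_torus]] unfolding bounded_iff by auto
 hence "0 <= B" using abs_ge_zero order_trans by blast
 thus ?thesis using B that by blast
qed

text \<open>The minimax inequality for the functionals given by the weighted energies and boundary potentials along
trajectories; its dual hypothesis is the dual inequality.\<close>
lemma discrete_superposition:
 fixes f :: "nat => real \<times> 'n::finite torus => real" and a b :: "nat => 'n torus => real"
 assumes p: "1 < p" and P: "prob_space rh0" "sets rh0 = sets borel" "prob_space rh1" "sets rh1 = sets borel"
  and sg: "is_finite_cyl_measure sg" "dual_ineq p rh0 rh1 sg"
  and f: "!!i. continuous_on cyl (f i)" "!!i z. 0 <= f i z"
  and a: "!!i. cont (a i)" and b: "!!i. cont (b i)"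
  and z0: "f 0 = (%_. 1)" "a 0 = (%_. 0)" "b 0 = (%_. 0)" and ep: "0 < ep"
 obtains S c where "weights controls S c"
  "!!i. i <= n ==> (\<Sum>ga\<in>S. c ga*(cost p (f i) ga 1 + a i (torus_proj (fst ga)) + b i (torus_proj (pos ga 1))))
   <= (LINT z|sg. f i z) + (LINT x|rh0. a i x) + (LINT x|rh1. b i x) + ep"
proof -
 interpret P0: prob_space rh0 by fact
 interpret P1: prob_space rh1 by fact
 have ia: "integrable rh0 (a i)" "integrable rh1 (b i)" "integrable sg (f i)" for i
  using P a b f sg P0.finite_measure_axioms P1.finite_measure_axioms
  by (auto intro!: continuous_torus_integrable finite_cyl_integrable)
 define \<Phi> where "\<Phi> i ga = cost p (f i) ga 1 + a i (torus_proj (fst ga)) + b i (torus_proj (pos ga 1))" for i and ga :: "(real ^ 'n) \<times> (real => real ^ 'n)"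
 define z where "z i = (LINT z|sg. f i z) + (LINT x|rh0. a i x) + (LINT x|rh1. b i x)" for i
 have \<Phi>0: "\<Phi> 0 ga = cost p (%_. 1) ga 1" for ga by (simp add: \<Phi>_def z0)
 have cn: "0 <= cost p g ga 1" if "ga : controls" "continuous_on cyl g" "!!z. 0 <= g z" for g and ga :: "(real ^ 'n) \<times> (real => real ^ 'n)"
  using cost_nonneg[of ga g 1 p] that p by simp
 have "\<exists>B. 0 <= B & (ALL ga:controls. - B <= \<Phi> i ga & \<Phi> i ga <= B*(1 + \<Phi> 0 ga))" for i
 proof -
  obtain A where A: "!!x. \<bar>a i x\<bar> <= A" "0 <= A" by (rule torus_bounded_fn[OF a[of i]], rule that)
  obtain A' where A': "!!x. \<bar>b i x\<bar> <= A'" "0 <= A'" by (rule torus_bounded_fn[OF b[of i]], rule that)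
  obtain F where F: "!!z. z : cyl ==> norm (f i z) <= F" by (rule cont_cyl_bounded[OF f(1)[of i]], rule that)
  have ab: "\<bar>a i x\<bar> + \<bar>b i y\<bar> <= A + A'" for x y using A(1)[of x] A'(1)[of y] by linarith
  have "- (A + A' + \<bar>F\<bar>) <= \<Phi> i ga & \<Phi> i ga <= (A + A' + \<bar>F\<bar>)*(1 + \<Phi> 0 ga)" if ga: "ga : controls" for ga
  proof -
   have "0 <= cost p (f i) ga 1" "0 <= cost p (%_. 1) ga 1" using f by (auto intro!: cn ga)
   moreover have "cost p (f i) ga 1 <= cost p (%z. \<bar>F\<bar>*1) ga 1"
   using F f p by (intro cost_mono ga) (auto intro: order_trans[OF _ abs_ge_self])
   hence "cost p (f i) ga 1 <= \<bar>F\<bar>*cost p (%_. 1) ga 1" unfolding cost_cmult .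
   moreover have "0 <= (A + A')*cost p (%_. 1) ga 1" using calculation A A' by simp
   ultimately show ?thesis using ab[of "torus_proj (fst ga)" "torus_proj (pos ga 1)"]
   unfolding \<Phi>0 \<Phi>_def[of i] by (simp add: algebra_simps abs_le_iff) linarith
  qed
  thus ?thesis using A(2) A'(2) by (intro exI[of _ "A + A' + \<bar>F\<bar>"]) auto
 qed
 then obtain Bs where Bs: "!!i. 0 <= Bs i" "!!i ga. ga : controls ==> - Bs i <= \<Phi> i ga & \<Phi> i ga <= Bs i*(1 + \<Phi> 0 ga)" by metis
 define B where "B = (\<Sum>i\<le>n. Bs i)"
 have BB: "Bs i <= B" if "i : {..n}" for i unfolding B_def using that Bs(1) by (intro member_le_sum) auto
 have p0: "0 <= \<Phi> 0 ga" if "ga : controls" for ga unfolding \<Phi>0 by (rule cn[OF that]) auto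
 show ?thesis
 proof (rule finite_minimax[of "{..n}" 0 controls B \<Phi> z ep])
  show "finite {..n}" "0 : {..n}" by auto
  show "(controls :: ((real ^ 'n) \<times> (real => real ^ 'n)) set) ~= {}"
   by (auto simp: controls_def intro!: exI[of _ "%_. 0"])
  show "- B <= \<Phi> i ga" if "i : {..n}" "ga : controls" for i ga using BB[OF that(1)] Bs(2)[OF that(2), of i] by linarith
  show "\<Phi> i ga <= B*(1 + \<Phi> 0 ga)" if "i : {..n}" "ga : controls" for i ga
  proof -
   have "Bs i*(1 + \<Phi> 0 ga) <= B*(1 + \<Phi> 0 ga)" using BB[OF that(1)] p0[OF that(2)] by (intro mult_right_mono) auto
   thus ?thesis using Bs(2)[OF that(2), of i] by linarith
  qed
  show "0 <= \<Phi> 0 ga" if "ga : controls" for ga by (rule p0[OF that])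
  fix s :: "nat => real" and e :: real assume s: "!!i. i : {..n} ==> 0 <= s i" and e: "0 < e"
  define fs as bs where "fs = (%z. \<Sum>i\<le>n. s i*f i z)" and "as = (%x. \<Sum>i\<le>n. s i*a i x)" and "bs = (%x. \<Sum>i\<le>n. s i*b i x)"
  have comb: "(\<Sum>i\<le>n. s i*\<Phi> i ga) = cost p fs ga 1 + as (torus_proj (fst ga)) + bs (torus_proj (pos ga 1))" if "ga : controls" for ga
   unfolding fs_def as_def bs_def \<Phi>_def using p f that by (subst cost_sum) (auto simp: distrib_left sum.distrib)
  have zs: "(\<Sum>i\<le>n. s i*z i) = (LINT z|sg. fs z) + (LINT x|rh0. as x) + (LINT x|rh1. bs x)"
   unfolding fs_def as_def bs_def z_def using ia by (simp add: distrib_left sum.distrib)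
  have c: "continuous_on cyl fs" "cont as" "cont bs" "!!z. 0 <= fs z"
   unfolding fs_def as_def bs_def using f a b s by (auto intro!: continuous_intros sum_nonneg)
  let ?M = "\<Sum>i\<le>n. s i*z i"
  show "\<exists>ga\<in>controls. (\<Sum>i\<le>n. s i*\<Phi> i ga) <= ?M + e"
  proof (rule ccontr)
   assume "\<not> ?thesis"
   hence no: "?M + e - bs (torus_proj (pos ga 1)) <= as (torus_proj (fst ga)) + cost p fs ga 1" if "ga : controls" for ga
   using comb[OF that] that by (force simp: not_le)
   have "cont (%x. ?M + e - bs x)" using c by (intro continuous_intros) auto
   hence "(LINT x|rh1. ?M + e - bs x) - (LINT x|rh0. as x) <= (LINT z|sg. fs z)"
   using sg(2)[unfolded dual_ineq_def, rule_format, of fs as "%x. ?M + e - bs x"] c no by auto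
   moreover have "integrable rh1 bs" unfolding bs_def using ia by auto
   hence "(LINT x|rh1. ?M + e - bs x) = ?M + e - (LINT x|rh1. bs x)" using P1.prob_space by simp
   ultimately show False using e zs by linarith
  qed
 qed (use ep that in \<open>auto simp: \<Phi>_def z_def\<close>)
qed

text \<open>Countably many test functions are dense in the supremum norm; the law with index \<open>n\<close> takes care
of the first \<open>n\<close> constraints.\<close>
lemma superposition_sequence:
 fixes rh0 rh1 :: "'n::finite torus measure"
 assumes p: "1 < p" and P: "prob_space rh0" "sets rh0 = sets borel" "prob_space rh1" "sets rh1 = sets borel"
  and sg: "!!n. is_finite_cyl_measure (sg n)" "!!n. dual_ineq p rh0 rh1 (sg n)" and C: "!!n. measure (sg n) cyl <= C"
 obtains S c where "!!n::nat. weights controls (S n) (c n)"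
  "!!f a b e. continuous_on cyl f ==> ALL z:cyl. 0 <= f z ==> cont a ==> cont b ==> 0 < e ==>
   \<forall>\<^sub>F n in sequentially. (\<Sum>ga\<in>S n. c n ga*(cost p f ga 1 + a (torus_proj (fst ga)) + b (torus_proj (pos ga 1))))
   <= (LINT z|sg n. f z) + (LINT x|rh0. a x) + (LINT x|rh1. b x) + e"
proof -
 interpret P0: prob_space rh0 by fact
 interpret P1: prob_space rh1 by fact
 obtain F :: "nat => real \<times> 'n torus => real" where F: "!!i. cont (F i)"
  "!!f e. continuous_on cyl f ==> 0 < e ==> \<exists>i. ALL x:cyl. \<bar>F i x - f x\<bar> <= e"
  by (rule countable_sup_dense[OF compact_cyl], rule that)
 obtain G :: "nat => 'n torus => real" where G: "!!i. cont (G i)"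
  "!!f e. cont f ==> 0 < e ==> \<exists>i. ALL x:UNIV. \<bar>G i x - f x\<bar> <= e"
  by (rule countable_sup_dense[OF compact_UNIV_torus], rule that)
 define dec3 where "dec3 i = (from_nat i :: nat \<times> nat \<times> nat)" for i
 define fs where "fs i = (case i of 0 => (%_. 1) | Suc j => (%z. max 0 (F (fst (dec3 j)) z)))" for i
 define as where "as i = (case i of 0 => (%_. 0) | Suc j => G (fst (snd (dec3 j))))" for i
 define bs where "bs i = (case i of 0 => (%_. 0) | Suc j => G (snd (snd (dec3 j))))" for i
 have cs: "continuous_on cyl (fs i)" "0 <= fs i z" "cont (as i)" "cont (bs i)" for i z
  using F(1) G(1) by (auto simp: fs_def as_def bs_def split: nat.splits intro!: continuous_intros intro: continuous_on_subset)
 let ?T = "%f a b ga. cost p f ga 1 + a (torus_proj (fst ga)) + b (torus_proj (pos ga 1))"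
 let ?Z = "%n f a b. (LINT z|sg n. f z) + (LINT x|rh0. a x) + (LINT x|rh1. b x)"
 have z0: "fs 0 = (%_. 1)" "as 0 = (%_. 0)" "bs 0 = (%_. 0)" by (auto simp: fs_def as_def bs_def)
 define Q where "Q n Sc \<longleftrightarrow> weights controls (fst Sc) (snd Sc) & (\<forall>i\<le>n. (\<Sum>ga\<in>fst Sc. snd Sc ga*?T (fs i) (as i) (bs i) ga) <= ?Z n (fs i) (as i) (bs i) + 1/real (Suc n))" for n Sc
 have "\<exists>Sc. Q n Sc" for n
 proof -
  have "0 < 1/real (Suc n)" by simp
  then obtain S c where "weights controls S c" "!!i. i <= n ==> (\<Sum>ga\<in>S. c ga*?T (fs i) (as i) (bs i) ga) <= ?Z n (fs i) (as i) (bs i) + 1/real (Suc n)"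
   by (rule discrete_superposition[where f = fs and a = as and b = bs and n = n, OF p P sg(1)[of n] sg(2)[of n] cs z0]) (rule that)
  hence "Q n (S, c)" unfolding Q_def by simp
  thus ?thesis ..
 qed
 then obtain SC where SC: "!!n. Q n (SC n)" by metis
 define S c where "S n = fst (SC n)" and "c n = snd (SC n)" for n
 have Sc: "weights controls (S n) (c n)"
  "i <= n ==> (\<Sum>ga\<in>S n. c n ga*?T (fs i) (as i) (bs i) ga) <= ?Z n (fs i) (as i) (bs i) + 1/real (Suc n)" for n i
  using SC[of n] unfolding Q_def S_def c_def by blast+
 have W: "S n <= controls" "0 <= c n ga" "sum (c n) (S n) = 1" "finite (S n)" for n ga using Sc(1)[of n] unfolding weights_def by blast+
 have one: "(\<Sum>ga\<in>S n. c n ga*cost p (%_. 1) ga 1) <= C + 1" for n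
 proof -
  interpret s: finite_measure "sg n" using sg(1)[of n] by (simp add: is_finite_cyl_measure_def)
  have "space (sg n) = cyl" using sg(1)[of n] sets_eq_imp_space_eq[of "sg n" cyl_borel] by (simp add: is_finite_cyl_measure_def space_cyl_borel)
  hence "(\<Sum>ga\<in>S n. c n ga*cost p (%_. 1) ga 1) <= measure (sg n) cyl + 1/real (Suc n)"
   using Sc(2)[of 0 n] by (simp add: z0 del: of_nat_Suc)
  moreover have "1/real (Suc n) <= 1" by simp
  ultimately show ?thesis using C[of n] by linarith
 qed
 have C0: "0 <= C" using C[of 0] measure_nonneg order_trans by blast
 show ?thesis
 proof (rule that[of S c, OF Sc(1)])
  fix f :: "real \<times> 'n torus => real" and a b :: "'n torus => real" and e :: real
  assume f': "continuous_on cyl f" "ALL z:cyl. 0 <= f z" and a: "cont a" and b: "cont b" and e: "0 < e"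
  have f: "continuous_on cyl f" "!!z. z : cyl ==> 0 <= f z" using f' by auto
  define de where "de = e/(2*C + 6)"
  have "de*(2*C + 6) = e" using C0 by (simp add: de_def)
  hence d: "de*(C + 1) + de*C + 5*de = e" "0 < de" using e C0 by (simp add: algebra_simps, simp add: de_def)
  obtain i where i: "!!x. x : cyl ==> \<bar>F i x - f x\<bar> <= de" using F(2)[OF f(1) d(2)] by blast
  obtain j where j: "!!x. \<bar>G j x - a x\<bar> <= de" using G(2)[OF a d(2)] by blast
  obtain k where k: "!!x. \<bar>G k x - b x\<bar> <= de" using G(2)[OF b d(2)] by blast
  define m where "m = Suc (to_nat (i, j, k))"
  have m: "fs m = (%z. max 0 (F i z))" "as m = G j" "bs m = G k" by (auto simp: m_def fs_def as_def bs_def dec3_def)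
  have fm: "fs m z <= f z + de" "f z <= fs m z + de" if "z : cyl" for z using i[OF that] f(2)[OF that] d(2) by (auto simp: m)
  obtain N where N: "1/real (Suc N) < de" using nat_approx_posE[OF d(2)] by blast
  show "\<forall>\<^sub>F n in sequentially. (\<Sum>ga\<in>S n. c n ga*?T f a b ga) <= ?Z n f a b + e"
   using eventually_ge_at_top[of "max m N"]
  proof eventually_elim
   case (elim n)
   interpret s: finite_measure "sg n" using sg(1)[of n] by (simp add: is_finite_cyl_measure_def)
   have spn: "space (sg n) = cyl" using sg(1)[of n] sets_eq_imp_space_eq[of "sg n" cyl_borel] by (simp add: is_finite_cyl_measure_def space_cyl_borel)
   have "?T f a b ga <= ?T (fs m) (as m) (bs m) ga + (de*cost p (%_. 1) ga 1 + 2*de)" if ga: "ga : S n" for ga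
   proof -
   have gaC: "ga : controls" using ga W by blast
   have "cost p f ga 1 <= cost p (%z. fs m z + de*1) ga 1"
   using fm cs f p by (intro cost_mono gaC) (auto intro!: continuous_intros)
   also have "... = cost p (fs m) ga 1 + de*cost p (%_. 1) ga 1"
   using cs p by (subst cost_add[OF gaC]) (auto simp only: cost_cmult intro!: continuous_intros)
   finally show ?thesis using j[of "torus_proj (fst ga)"] k[of "torus_proj (pos ga 1)"] unfolding m by linarith
   qed
   hence "(\<Sum>ga\<in>S n. c n ga*?T f a b ga) <= (\<Sum>ga\<in>S n. c n ga*(?T (fs m) (as m) (bs m) ga + (de*cost p (%_. 1) ga 1 + 2*de)))"
   using W by (intro sum_mono mult_left_mono) auto
   also have "... = (\<Sum>ga\<in>S n. c n ga*?T (fs m) (as m) (bs m) ga) + (de*(\<Sum>ga\<in>S n. c n ga*cost p (%_. 1) ga 1) + 2*de * sum (c n) (S n))"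
   unfolding distrib_left[of "c n _" "?T (fs m) (as m) (bs m) _"] sum.distrib
   by (simp add: distrib_left sum.distrib sum_distrib_left mult_ac)
   also have "... <= (?Z n (fs m) (as m) (bs m) + 1/real (Suc n)) + (de*(C + 1) + 2*de)"
   proof -
   have "de*(\<Sum>ga\<in>S n. c n ga*cost p (%_. 1) ga 1) <= de*(C + 1)" using one[of n] d by (intro mult_left_mono) auto
   thus ?thesis using Sc(2)[of m n] elim W(3)[of n] by auto
   qed
   also have "?Z n (fs m) (as m) (bs m) <= ?Z n f a b + (de*C + 2*de)"
   proof -
   have "(LINT z|sg n. fs m z) <= (LINT z|sg n. f z + de)"
   using fm spn by (intro integral_mono_AE AE_I2) (auto intro!: finite_cyl_integrable[OF sg(1)] cs f continuous_intros)
   also have "... = (LINT z|sg n. f z) + de*measure (sg n) cyl" using finite_cyl_integrable[OF sg(1) f(1)] spn by simp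
   also have "... <= (LINT z|sg n. f z) + de*C" using C[of n] d by simp
   finally have 1: "(LINT z|sg n. fs m z) <= (LINT z|sg n. f z) + de*C" .
   have gen: "(LINT x|M. g x) <= (LINT x|M. h x) + de" if M: "prob_space M" "sets M = sets borel" and gh: "cont g" "cont h" "!!x. \<bar>g x - h x\<bar> <= de"
   for g h :: "'n torus => real" and M
   proof -
   interpret M: prob_space M by fact
   have i: "integrable M g" "integrable M h" using M gh by (auto intro!: continuous_torus_integrable M.finite_measure_axioms)
   have "(LINT x|M. g x) <= (LINT x|M. h x + de)" using gh(3) i by (intro integral_mono) (auto simp: abs_le_iff algebra_simps)
   thus ?thesis using i M.prob_space by simp
   qed
   show ?thesis using 1 gen[OF P(1,2) cs(3)[of m] a] gen[OF P(3,4) cs(4)[of m] b] j k unfolding m by simp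
   qed
   finally have "(\<Sum>ga\<in>S n. c n ga*?T f a b ga) <= ?Z n f a b + (de*(C + 1) + de*C + 4*de) + 1/real (Suc n)" by (simp add: algebra_simps)
   moreover have "1/real (Suc n) <= 1/real (Suc N)" using elim by (simp add: frac_le)
   ultimately show ?case using N d by linarith
  qed
 qed
qed

text \<open>Helly's selection theorem; tightness is automatic since all codes lie in the unit interval.\<close>
lemma discrete_law_limit:
 fixes code :: "nat => 'g => real"
 assumes W: "!!n::nat. weights \<Gamma> (S n) (c n)" and code: "!!n ga. code n ga : {0..1}"
 obtains s \<mu> where "strict_mono (s :: nat => nat)" "prob_space \<mu>" "sets \<mu> = sets borel"
  "!!g B. cont g ==> \<forall>x. \<bar>g x\<bar> <= B ==> (%k. \<Sum>ga\<in>S (s k). c (s k) ga*g (code (s k) ga)) ~> (LINT x|\<mu>. g x)"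
proof -
 define \<nu> where "\<nu> n = distr (point_measure (S n) (%ga. ennreal (c n ga))) borel (code n)" for n
 have S: "finite (S n)" "0 <= c n ga" "sum (c n) (S n) = 1" for n ga using W[of n] by (auto simp: weights_def)
 have pm: "prob_space (point_measure (S n) (%ga. ennreal (c n ga)))" for n
  using S[of n] by (intro prob_spaceI) (simp add: emeasure_point_measure_finite space_point_measure)
 have rd: "real_distribution (\<nu> n)" for n
  unfolding \<nu>_def by (intro real_distribution.intro prob_space.prob_space_distr pm real_distribution_axioms.intro) (auto simp: space_point_measure)
 have I: "integral\<^sup>L (\<nu> n) g = (\<Sum>ga\<in>S n. c n ga*g (code n ga))" if "cont g" for g :: "real => real" and n
  using S[of n] borel_measurable_continuous_onI[OF that] unfolding \<nu>_def
  by (subst integral_distr) (auto simp: lebesgue_integral_point_measure_finite)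
 have "tight \<nu>"
  unfolding tight_def
 proof (intro conjI allI impI rd, rule exI[of _ "-1"], rule exI[of _ 1], intro conjI allI)
  fix e :: real and n assume "0 < e"
  have "measure (\<nu> n) {-1<..1} = measure (point_measure (S n) (%ga. ennreal (c n ga))) (S n)"
  proof -
   have "code n -` {-1<..1} = UNIV"
   proof -
   have "- 1 < code n ga & code n ga <= 1" for ga using code[of n ga] by auto
   thus ?thesis by auto
   qed
   thus ?thesis unfolding \<nu>_def by (subst measure_distr) (auto simp: space_point_measure)
  qed
  also have "... = 1" using prob_space.prob_space[OF pm[of n]] by (simp add: space_point_measure)
  finally show "1 - e < measure (\<nu> n) {-1<..1}" using \<open>0 < e\<close> by simp
 qed auto
 then obtain s \<mu> where s: "strict_mono s" "real_distribution \<mu>" "weak_conv_m (\<nu> \<circ> id \<circ> s) \<mu>"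
  using tight_imp_convergent_subsubsequence[of \<nu> id] by (auto simp: strict_mono_id)
 interpret \<mu>: real_distribution \<mu> by fact
 have lim: "(%k. \<Sum>ga\<in>S (s k). c (s k) ga*g (code (s k) ga)) ~> (LINT x|\<mu>. g x)"
  if g: "cont g" "\<forall>x. \<bar>g x\<bar> <= B" for g :: "real => real" and B
 proof -
  have rds: "real_distribution ((\<nu> \<circ> id \<circ> s) n)" for n using rd by simp
  have "(%n. integral\<^sup>L ((\<nu> \<circ> id \<circ> s) n) g) ~> integral\<^sup>L \<mu> g"
   by (rule weak_conv_imp_integral_bdd_continuous_conv[OF rds s(2,3), where B = B]) (use g in \<open>auto simp: continuous_on_eq_continuous_at\<close>)
  thus ?thesis by (simp add: I[OF g(1)])
 qed
 show ?thesis by (rule that[OF s(1) \<mu>.prob_space_axioms _ lim]) auto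
qed

section \<open>Reconstruction of curves from dyadic values\<close>

lemma E_dy_mono:
 fixes ga :: "real => 'b::metric_space"
 assumes p: "1 < p" shows "E_dy p k ga <= E_dy p (Suc k) ga"
proof -
 let ?x = "%i. 2^(Suc k)*dist (ga (real i/2^(Suc k))) (ga (real (Suc i)/2^(Suc k)))"
 have "(2^k*increment ga k i) powr p/2^k <= ?x (i*2) powr p/2^(Suc k) + ?x (Suc (i*2)) powr p/2^(Suc k)" for i
 proof -
  let ?a = "?x (i*2)" and ?b = "?x (Suc (i*2))"
  have e: "real i/2^k = real (i*2)/2^(Suc k)" "real (Suc i)/2^k = real (Suc (Suc (i*2)))/2^(Suc k)" by (auto simp: field_simps)
  have "2^k*increment ga k i <= (?a + ?b)/2"
   using dist_triangle[of "ga (real (i*2)/2^(Suc k))" "ga (real (Suc (Suc (i*2)))/2^(Suc k))" "ga (real (Suc (i*2))/2^(Suc k))"]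
   unfolding e by (simp add: distrib_left[symmetric])
  hence "(2^k*increment ga k i) powr p <= ((?a + ?b)/2) powr p"
   using p by (intro powr_mono2) auto
  also have "... <= (?a powr p + ?b powr p)/2"
  proof -
   let ?c = "(?a + ?b)/2"
   have c0: "0 <= ?c" by simp
   have 1: "?c powr p + p*?c powr (p - 2)*(?c*(v - ?c)) <= \<bar>v\<bar> powr p" for v
   using powr_tangent[OF p, of ?c v] c0 by (simp add: abs_of_nonneg)
   have 2: "p*?c powr (p - 2)*(?c*(?a - ?c)) + p*?c powr (p - 2)*(?c*(?b - ?c)) = 0"
   by (simp add: distrib_left[symmetric])
   have "2*?c powr p <= \<bar>?a\<bar> powr p + \<bar>?b\<bar> powr p" using 1[of ?a] 1[of ?b] 2 by linarith
   thus ?thesis by simp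
  qed
  finally have "(2^k*increment ga k i) powr p/2^k <= (?a powr p + ?b powr p)/2/2^k"
   by (rule divide_right_mono) simp
  thus ?thesis by (simp add: add_divide_distrib)
 qed
 hence "E_dy p k ga <= (\<Sum>i<2^k. ?x (i*2) powr p/2^(Suc k) + ?x (Suc (i*2)) powr p/2^(Suc k))"
  unfolding E_dy_def by (intro sum_mono)
 also have "... = (\<Sum>i<2^k. \<Sum>j\<in>{i*2..<i*2 + 2}. ?x j powr p/2^(Suc k))"
 proof (rule sum.cong[OF refl])
  fix i :: nat have "{i*2..<i*2 + 2} = {i*2, Suc (i*2)}" by auto
  thus "?x (i*2) powr p/2^(Suc k) + ?x (Suc (i*2)) powr p/2^(Suc k) = (\<Sum>j\<in>{i*2..<i*2 + 2}. ?x j powr p/2^(Suc k))" by simp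
 qed
 also have "... = E_dy p (Suc k) ga" unfolding E_dy_def by (subst sum.nat_group) (simp add: mult.commute)
 finally show ?thesis .
qed

text \<open>The number \<open>u\<close> codes the candidate values \<open>Y u t\<close> of a curve. Where the dyadic
energies are bounded these values extend from the dyadic times to a continuous curve.\<close>
locale random_path =
 fixes Y :: "real => real => 'n::finite torus" and p :: real
 assumes Yc: "!!t. cont (%u. Y u t)" and p1: "1 < p"
begin

definition good :: "real => real set" where "good M = {u. \<forall>k. E_dy p k (Y u) <= M}"

lemma continuous_E: "cont (%u. E_dy p k (Y u))"
 unfolding E_dy_def using p1 by (intro continuous_intros continuous_on_powr' Yc) auto

lemma closed_good: "closed (good M)"
 unfolding good_def by (intro closed_Collect_all closed_Collect_le continuous_E continuous_on_const)

lemma good_equicontinuous: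
 assumes e: "0 < e"
 obtains d where "0 < d" "!!u k i j. u : good M ==> i <= 2^k ==> j <= 2^k ==> \<bar>real i/2^k - real j/2^k\<bar> < d ==>
  dist (Y u (real i/2^k)) (Y u (real j/2^k)) < e"
proof -
 define L where "L = (2*(\<bar>M\<bar> + 1)/e) powr (1/(p - 1))"
 have X: "L powr (p - 1) = 2*(\<bar>M\<bar> + 1)/e" using p1 e by (simp add: L_def powr_powr)
 have "e/2*(2*(\<bar>M\<bar> + 1)/e) = \<bar>M\<bar> + 1" "0 < 2*(\<bar>M\<bar> + 1)/e" using e by simp_all
 hence L: "\<bar>M\<bar>/L powr (p - 1) < e/2" unfolding X by (simp only: pos_divide_less_eq)
 have "2*(\<bar>M\<bar> + 1)/e ~= 0" using e by simp
 hence L0: "0 < L" unfolding L_def by (simp only: powr_gt_zero not_False_eq_True)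
 have main: "dist (Y u (real i/2^k)) (Y u (real j/2^k)) < e"
  if u: "u : good M" and ij: "i <= j" "j <= 2^k" "real j/2^k - real i/2^k < e/(2*L)" for u i j k
 proof -
  have M: "E_dy p k (Y u) <= M" for k using u by (simp add: good_def)
  have "dist (Y u (real i/2^k)) (Y u (real j/2^k)) <= (\<Sum>l\<in>{i..<j}. dist (Y u (real l/2^k)) (Y u (real (Suc l)/2^k)))"
   using dist_le_sum_steps[OF ij(1), of "%l. Y u (real l/2^k)"] .
  also have "... <= L*(real (card {i..<j})/2^k) + M/L powr (p - 1)"
   using ij by (intro dyadic_ac_continuity_aux[OF p1 M L0]) auto
  also have "M/L powr (p - 1) <= \<bar>M\<bar>/L powr (p - 1)" by (intro divide_right_mono) auto
  also have "L*(real (card {i..<j})/2^k) = L*(real j/2^k - real i/2^k)" using ij by (simp add: diff_divide_distrib of_nat_diff)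
  also have "... <= L*(e/(2*L))" using ij L0 by (intro mult_left_mono) auto
  also have "... = e/2" using L0 by simp
  finally show ?thesis using L by linarith
 qed
 show ?thesis
 proof (rule that[of "e/(2*L)"])
  fix u k and i j :: nat assume a: "u : good M" "i <= 2^k" "j <= 2^k" "\<bar>real i/2^k - real j/2^k\<bar> < e/(2*L)"
  show "dist (Y u (real i/2^k)) (Y u (real j/2^k)) < e"
   using main[OF a(1), of i j k] main[OF a(1), of j i k] a(2-4) by (cases "i <= j") (auto simp: dist_commute)
 qed (use e L0 in simp)
qed

definition fits :: "real => (real => 'n torus) => bool" where
 "fits u ga \<longleftrightarrow> ga : curves & (\<forall>k i. i <= 2^k --> ga (real i/2^k) = Y u (real i/2^k))"

text \<open>The constant curve is a default on the set of codes of unbounded energy, which is null in the application.\<close>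
definition path :: "real => real => 'n torus" where
 "path u = (if \<exists>M. u : good M then SOME ga. fits u ga else restrict (%_. torus_proj 0) {0..1})"

lemma dyadic_dense:
 assumes "t : {0..1::real}"
 shows "(%k. real (cell k t)/2^k) ~> t" "cell k t <= 2^k" "\<bar>real (cell k t)/2^k - t\<bar> <= 1/2^k"
proof -
 show "(%k. real (cell k t)/2^k) ~> t" using assms by (intro dyadic_floor_tendsto) auto
 have "2^k*t <= (2::real)^k" using assms by (simp add: mult_left_le)
 hence "of_int \<lfloor>2^k*t\<rfloor> <= (2::real)^k" using of_int_floor_le[of "2^k*t"] by linarith
 hence "\<lfloor>2^k*t\<rfloor> <= 2^k" by (metis of_int_le_iff of_int_numeral of_int_power)
 thus "cell k t <= 2^k" by (simp add: nat_le_iff)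
 have "0 <= 2^k*t" using assms by simp
 hence "\<bar>real (cell k t) - 2^k*t\<bar> <= 1" by linarith
 hence "\<bar>real (cell k t) - 2^k*t\<bar>/2^k <= 1/2^k" by (intro divide_right_mono) auto
 moreover have "real (cell k t)/2^k - t = (real (cell k t) - 2^k*t)/2^k" by (simp add: diff_divide_distrib)
 ultimately show "\<bar>real (cell k t)/2^k - t\<bar> <= 1/2^k" by (simp add: abs_divide)
qed

lemma fits_exists:
 assumes u: "u : good M" shows "\<exists>ga. fits u ga"
proof -
 define X where "X = {real i/2^k |i k. i <= 2^k}"
 have "uniformly_continuous_on X (Y u)"
  unfolding uniformly_continuous_on_def
 proof (intro allI impI)
  fix e :: real assume e: "0 < e"
  obtain d where d: "0 < d" "!!u k i j. u : good M ==> i <= 2^k ==> j <= 2^k ==> \<bar>real i/2^k - real j/2^k\<bar> < d ==>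
   dist (Y u (real i/2^k)) (Y u (real j/2^k)) < e" by (rule good_equicontinuous[OF e, of M], rule that)
  have "dist (Y u y) (Y u x) < e" if x: "x : X" and y: "y : X" and "dist y x < d" for x y
  proof -
   obtain i k where i: "x = real i/2^k" "i <= 2^k" using x by (auto simp: X_def)
   obtain j l where j: "y = real j/2^l" "j <= 2^l" using y by (auto simp: X_def)
   have "i*2^l <= 2^k*2^l" "j*2^k <= 2^l*2^k" using i j by (auto intro: mult_right_mono)
   hence "i*2^l <= 2^(k + l)" "j*2^k <= 2^(k + l)" by (simp_all add: power_add mult.commute)
   moreover have "x = real (i*2^l)/2^(k + l)" "y = real (j*2^k)/2^(k + l)" using i j by (simp_all add: power_add)
   ultimately show ?thesis using d(2)[OF u, of "j*2^k" "k + l" "i*2^l"] that(3) by (simp add: dist_real_def)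
  qed
  thus "\<exists>d>0. ALL x:X. ALL x':X. dist x' x < d --> dist (Y u x') (Y u x) < e" using d(1) by blast
 qed
 then obtain g where g: "uniformly_continuous_on (closure X) g" "!!x. x : X ==> Y u x = g x"
  using uniformly_continuous_on_extension_on_closure by metis
 have "{0..1} <= closure X"
 proof
  fix t :: real assume t: "t : {0..1}"
  show "t : closure X" unfolding closure_sequential
  proof (intro exI[of _ "%k. real (cell k t)/2^k"] conjI allI dyadic_dense(1)[OF t])
   show "real (cell k t)/2^k : X" for k using dyadic_dense(2)[OF t, of k] unfolding X_def by blast
  qed
 qed
 hence "continuous_on {0..1} g" using g(1) uniformly_continuous_imp_continuous continuous_on_subset by blast
 hence "restrict g {0..1} : curves" unfolding curves_iff by (auto elim!: continuous_on_eq)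
 moreover have "restrict g {0..1} (real i/2^k) = Y u (real i/2^k)" if "i <= 2^k" for i k
 proof -
  have "real i/2^k : X" using that unfolding X_def by blast
  thus ?thesis using g(2) dyadic_le_1[OF that] by simp
 qed
 ultimately show ?thesis unfolding fits_def by blast
qed

lemma path_fits: "u : good M ==> fits u (path u)"
proof -
 assume u: "u : good M"
 hence "path u = (SOME ga. fits u ga)" unfolding path_def by (intro if_P) blast
 thus ?thesis using someI_ex[OF fits_exists[OF u]] by simp
qed

lemma path_in_curves: "path u : curves"
proof (cases "\<exists>M. u : good M")
 case True thus ?thesis using path_fits by (auto simp: fits_def)
next
 case False
 hence "path u = restrict (%_. torus_proj 0) {0..1}" unfolding path_def by (rule if_not_P)
 moreover have "continuous_on {0..1} (restrict (%_. torus_proj 0 :: 'n torus) {0..1::real})"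
  by (rule continuous_on_eq[OF continuous_on_const]) auto
 ultimately show ?thesis by (simp add: curves_iff)
qed

lemma E_path: "u : good M ==> E_dy p k (path u) = E_dy p k (Y u)"
 unfolding E_dy_def using path_fits[of u M] by (intro sum.cong refl) (auto simp: fits_def Suc_leI less_imp_le simp del: of_nat_Suc)

text \<open>A common energy bound makes the paths equicontinuous, so closeness at finitely many dyadic times is closeness
everywhere. This yields measurability of the path in its code.\<close>
lemma path_continuous:
 assumes u: "u : good M" and e: "0 < e"
 shows "\<exists>d>0. ALL u':good M. dist u' u < d --> (ALL t:{0..1}. dist (path u t) (path u' t) <= e)"
proof -
 have "0 < e/3" using e by simp
 obtain d where d: "0 < d" "!!u k i j. u : good M ==> i <= 2^k ==> j <= 2^k ==> \<bar>real i/2^k - real j/2^k\<bar> < d ==>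
   dist (Y u (real i/2^k)) (Y u (real j/2^k)) < e/3" by (rule good_equicontinuous[OF \<open>0 < e/3\<close>, of M], rule that)
 obtain k where k: "(1/2)^k < d" using real_arch_pow_inv[OF d(1), of "1/2"] by auto
 have near: "dist (path w t) (Y w (real (cell k t)/2^k)) <= e/3" if w: "w : good M" and t: "t : {0..1}" for w t
 proof -
  have F: "fits w (path w)" by (rule path_fits[OF w])
  have c: "continuous_on {0..1} (path w)" using path_in_curves by (simp add: curves_iff)
  have "(%m. dist (path w (real (cell m t)/2^m)) (Y w (real (cell k t)/2^k))) ~> dist (path w t) (Y w (real (cell k t)/2^k))"
  proof (intro tendsto_dist tendsto_const continuous_on_tendsto_compose[OF c dyadic_dense(1)[OF t] t] always_eventually allI)
   show "real (cell m t)/2^m : {0..1}" for m using dyadic_le_1[OF dyadic_dense(2)[OF t]] by simp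
  qed
  moreover have "\<forall>\<^sub>F m in sequentially. dist (path w (real (cell m t)/2^m)) (Y w (real (cell k t)/2^k)) <= e/3"
  proof -
   have "(%m. \<bar>real (cell m t)/2^m - real (cell k t)/2^k\<bar>) ~> \<bar>t - real (cell k t)/2^k\<bar>"
   by (intro tendsto_intros dyadic_dense(1)[OF t])
   moreover have "\<bar>t - real (cell k t)/2^k\<bar> < d" using dyadic_dense(3)[OF t, of k] k by (simp add: power_one_over abs_minus_commute)
   ultimately have "\<forall>\<^sub>F m in sequentially. \<bar>real (cell m t)/2^m - real (cell k t)/2^k\<bar> < d" by (rule order_tendstoD)
   thus ?thesis using eventually_ge_at_top[of k]
   proof eventually_elim
   case (elim m)
   let ?i = "cell m t" and ?j = "cell k t"
   have e1: "real ?j/2^k = real (?j*2^(m - k))/2^m"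
   proof -
   have "(2::real)^m = 2^k*2^(m - k)" using elim(2) by (simp add: power_add[symmetric])
   thus ?thesis by simp
   qed
   have "?j*2^(m - k) <= 2^k*2^(m - k)" using dyadic_dense(2)[OF t, of k] by (intro mult_right_mono) auto
   also have "... = 2^m" using elim(2) by (simp add: power_add[symmetric])
   finally have "dist (Y w (real ?i/2^m)) (Y w (real (?j*2^(m - k))/2^m)) < e/3"
   using elim(1) dyadic_dense(2)[OF t, of m] unfolding e1 by (intro d(2)[OF w])
   thus ?case using F dyadic_dense(2)[OF t, of m] unfolding e1 fits_def by simp
   qed
  qed
  ultimately show ?thesis by (rule tendsto_upperbound) simp
 qed
 have "\<exists>d>0. \<forall>u'. dist u' u < d --> dist (Y u (real i/2^k)) (Y u' (real i/2^k)) < e/3" for i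
  using Yc[of "real i/2^k"] e unfolding continuous_on_iff by (metis UNIV_I \<open>0 < e/3\<close> dist_commute)
 then obtain ds where ds: "!!i::nat. 0 < ds i" "!!i u'. dist u' u < ds i ==> dist (Y u (real i/2^k)) (Y u' (real i/2^k)) < e/3" by metis
 define d' where "d' = Min (ds ` {..2^k})"
 have d': "0 < d'" "d' <= ds i" if "i <= 2^k" for i using ds(1) that by (auto simp: d'_def Min_gr_iff)
 have "dist (path u t) (path u' t) <= e" if "u' : good M" "dist u' u < d'" "t : {0..1}" for u' t
 proof -
  let ?s = "real (cell k t)/2^k"
  have "dist (Y u ?s) (Y u' ?s) < e/3" using d'(2)[OF dyadic_dense(2)[OF that(3), of k]] that(2) by (intro ds(2)) simp
  thus ?thesis using near[OF u that(3)] near[OF that(1,3)]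
   dist_triangle[of "path u t" "path u' t" "Y u ?s"] dist_triangle[of "Y u ?s" "path u' t" "Y u' ?s"] by (simp add: dist_commute)
 qed
 thus ?thesis using d'(1)[of 0] by auto
qed

lemma path_measurable: "path : measurable borel curves_borel"
 unfolding curves_borel_def
proof (rule measurable_measure_of)
 show "{U. openin (mtopology_of (curve_metric :: (real => 'n torus) metric)) U} <= Pow curves" by (auto simp: openin_curves_iff)
 show "path : space borel \<rightarrow> curves" using path_in_curves by auto
 fix U assume "U : {U. openin (mtopology_of (curve_metric :: (real => 'n torus) metric)) U}"
 hence U: "!!ga. ga : U ==> \<exists>r>0. ALL de:curves. mdist curve_metric ga de < r --> de : U" by (auto simp: openin_curves_iff)
 have "good M Int path -` U : sets borel" for M
 proof -
  have "openin (top_of_set (good M)) (good M Int path -` U)"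
   unfolding openin_euclidean_subtopology_iff
  proof (intro conjI ballI)
   fix u assume u: "u : good M Int path -` U"
   then obtain r where r: "0 < r" "!!de. de : curves ==> mdist curve_metric (path u) de < r ==> de : U" using U[of "path u"] by auto
   obtain d where d: "d > 0" "!!u'. u' : good M ==> dist u' u < d ==> ALL t:{0..1}. dist (path u t) (path u' t) <= r/2"
   using path_continuous[of u M "r/2"] u r(1) by auto
   have "path u' : U" if "u' : good M" "dist u' u < d" for u'
   proof (rule r(2)[OF path_in_curves])
   have "mdist curve_metric (path u) (path u') <= r/2" using d(2)[OF that] by (rule iffD2[OF curve_mdist_le[OF path_in_curves path_in_curves]])
   thus "mdist curve_metric (path u) (path u') < r" using r(1) by linarith
   qed
   thus "\<exists>e>0. ALL x':good M. dist x' u < e --> x' : good M Int path -` U" using d(1) by auto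
  qed auto
  then obtain T where "open T" "good M Int path -` U = good M Int T" unfolding openin_open by auto
  thus ?thesis using closed_good[of M] by (simp add: borel_closed borel_open sets.Int)
 qed
 hence "(\<Union>m::nat. good (real m) Int path -` U) : sets borel" by blast
 moreover define Gs where "Gs = (\<Union>m::nat. good (real m))"
 ultimately have 1: "Gs Int path -` U : sets borel" by simp
 have G: "(\<exists>M. u : good M) \<longleftrightarrow> (\<exists>m::nat. u : good (real m))" for u
 proof
  assume "\<exists>M. u : good M"
  then obtain M where M: "u : good M" by blast
  obtain m :: nat where "M <= real m" using real_arch_simple by blast
  thus "\<exists>m::nat. u : good (real m)" using M by (auto simp: good_def intro: order_trans)
 qed blast
 have 2: "- Gs : sets borel" unfolding Gs_def using closed_good by (intro borel_comp sets.countable_UN) (auto simp: borel_closed)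
 have c: "path u = restrict (%_. torus_proj 0) {0..1}" if "u ~: Gs" for u
  unfolding path_def using that G[of u] unfolding Gs_def by (intro if_not_P) auto
 have "path -` U = Gs Int path -` U \<union> (if restrict (%_. torus_proj 0) {0..1} : U then - Gs else {})"
 proof (rule set_eqI)
  fix u show "u : path -` U \<longleftrightarrow> u : Gs Int path -` U \<union> (if restrict (%_. torus_proj 0) {0..1} : U then - Gs else {})"
   using c[of u] by (cases "u : Gs") (auto simp del: restrict_apply)
 qed
 moreover have "Gs Int path -` U \<union> (if restrict (%_. torus_proj 0) {0..1} : U then - Gs else {}) : sets borel" using 1 2 by auto
 ultimately show "path -` U Int space borel : sets borel" by simp
qed

end

text \<open>A weighted dyadic energy. The truncation keeps it bounded, so that it is a legitimate test function for weak
convergence, and disappears as \<open>k\<close> grows.\<close>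
definition A_dy :: "real => (real \<times> 'n::finite torus => real) => nat => (real => 'n torus) => real" where
 "A_dy p f k ga = (\<Sum>i<2^k. f (real i/2^k, ga (real i/2^k)) *
  min ((2^k) powr (p/2)) ((2^k*increment ga k i) powr p)/2^k)"

lemma A_dy_le_cost:
 fixes f :: "real \<times> 'n::finite torus => real"
 assumes c: "c : controls" and p: "1 < p" and f: "continuous_on cyl f" "!!z. z : cyl ==> 0 <= f z" "!!z. z : cyl ==> f z <= B" and B: "0 <= B"
  and r: "0 < r" "!!z z'. z : cyl ==> z' : cyl ==> dist z z' < 2*r ==> \<bar>f z - f z'\<bar> < w" and w: "0 < w"
  and k: "1/2^k < r" and ga: "!!i. i <= 2^k ==> ga (real i/2^k) = torus_proj (pos c (real i/2^k))"
 shows "A_dy p (%z. max 0 (f z - w)) k ga <= cost p (%z. f z + B*r powr (- p)*(1/2^k) powr (p/2)) c 1"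
proof -
 define E where "E = B*r powr (- p)*(1/2^k) powr (p/2)"
 let ?F = "%s. (f (s, torus_proj (pos c s)) + E)*norm (snd c s) powr p"
 let ?V = "%s. norm (snd c s) powr p"
 have E0: "0 <= E" using B by (simp add: E_def)
 have fE: "continuous_on cyl (%z. f z + E)" using f by (intro continuous_intros)
 have Fi: "?F integrable_on {a..b}" if "0 <= a" "b <= 1" for a b
  using cost_integrand[OF c fE that, of p] p by simp
 have Vi: "?V integrable_on {a..b}" if "0 <= a" "b <= 1" for a b
  using cost_integrand[OF c continuous_on_const that, of p 1] p by simp
 have Vc: "(%x. a'*?V x) integrable_on {a..b}" if "0 <= a" "b <= 1" for a b a'
  using integrable_on_cmult_left[OF Vi[OF that], of a'] by simp
 have step: "max 0 (f (s, torus_proj (pos c s)) - w)*min ((2^k) powr (p/2)) ((2^k*dist (torus_proj (pos c s)) (torus_proj (pos c t))) powr p)/2^k <= integral {s..t} ?F"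
  if st: "0 <= s" "t <= 1" "t = s + 1/2^k" for s t
 proof -
  have lt: "s < t" using st by simp
  have ts: "t - s = 1/2^k" using st by simp
  have si: "snd c absolutely_integrable_on {s..t}" by (rule controls_integrable(1)[OF c])
  define l where "l = integral {s..t} (%x. norm (snd c x))"
  have ni: "(%x. norm (snd c x)) integrable_on {a..b}" for a b using controls_integrable(1)[OF c] absolutely_integrable_on_def by blast
  have moved: "norm (pos c x - pos c s) <= l" if "s <= x" "x <= t" for x
  proof -
   have h: "(snd c has_integral (pos c x - pos c s)) {s..x}" using pos_diff[OF c] st that by auto
   have "norm (pos c x - pos c s) = norm (integral {s..x} (snd c))" using h by (simp add: integral_unique)
   also have "... <= integral {s..x} (%x. norm (snd c x))"
   by (rule integral_norm_bound_integral[OF controls_integrable(2)[OF c] ni]) simp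
   also have "... <= l" unfolding l_def using that by (intro integral_subset_le ni) auto
   finally show ?thesis .
  qed
  let ?d = "2^k*dist (torus_proj (pos c s)) (torus_proj (pos c t))"
  let ?m = "min ((2^k) powr (p/2)) (?d powr p)"
  show ?thesis
  proof (cases "l < r")
   case True
   have fle: "max 0 (f (s, torus_proj (pos c s)) - w) <= f (x, torus_proj (pos c x)) + E" if x: "x : {s..t}" for x
   proof -
   have "dist (torus_proj (pos c s)) (torus_proj (pos c x)) < r"
   using dist_torus_le[of "pos c s" "pos c x"] moved[of x] x True by (simp add: dist_norm norm_minus_commute)
   moreover have "\<bar>s - x\<bar> < r" using x ts k by simp
   ultimately have "dist (s, torus_proj (pos c s)) (x, torus_proj (pos c x)) < 2*r"
   using sqrt_sum_squares_le_sum_abs[of "dist s x" "dist (torus_proj (pos c s)) (torus_proj (pos c x))"]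
   by (simp add: dist_Pair_Pair dist_real_def)
   moreover have "(s, torus_proj (pos c s)) : cyl" "(x, torus_proj (pos c x)) : cyl" using x st lt by (auto simp: cyl_def)
   ultimately show ?thesis using r(2)[of "(s, torus_proj (pos c s))" "(x, torus_proj (pos c x))"] f(2)[of "(x, torus_proj (pos c x))"] E0 by auto
   qed
   have "?d powr p <= (norm (pos c t - pos c s)/(t - s)) powr p"
   using p dist_torus_le[of "pos c s" "pos c t"] by (intro powr_mono2) (auto simp: ts dist_norm norm_minus_commute mult.commute)
   hence "?m/2^k <= (norm (pos c t - pos c s)/(t - s)) powr p*(t - s)" by (simp add: ts divide_right_mono min.coboundedI2)
   also have "... <= integral {s..t} ?V"
   using st lt by (intro jensen_interval[OF pos_diff[OF c] p] Vi) auto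
   finally have "max 0 (f (s, torus_proj (pos c s)) - w)*(?m/2^k) <= max 0 (f (s, torus_proj (pos c s)) - w)*integral {s..t} ?V"
   by (intro mult_left_mono) auto
   also have "... = integral {s..t} (%x. max 0 (f (s, torus_proj (pos c s)) - w)*?V x)" by simp
   also have "... <= integral {s..t} ?F"
   using st lt fle by (intro integral_le Fi Vc mult_right_mono) auto
   finally show ?thesis by simp
  next
   case False
   have "((%x. norm (snd c x)) has_integral l) {s..t}" unfolding l_def using ni by (simp add: integrable_integral)
   hence J: "(\<bar>l\<bar>/(t - s)) powr p*(t - s) <= integral {s..t} ?V"
   using jensen_interval[where g = "%x. if x = t then l else 0" and v = "%x. norm (snd c x)" and s = s and t = t and p = p]
   p lt st Vi[of s t] by simp
   have "max 0 (f (s, torus_proj (pos c s)) - w) <= B" using f(3)[of "(s, torus_proj (pos c s))"] st lt w B by (auto simp: cyl_def)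
   hence "max 0 (f (s, torus_proj (pos c s)) - w)*(?m/2^k) <= B*((2^k) powr (p/2)/2^k)"
   using B by (intro mult_mono divide_right_mono) auto
   also have "... = E*((2^k*r) powr p*(1/2^k))"
   proof -
   have "((2::real)^k) powr (p/2) = (1/2^k) powr (p/2)*(2^k) powr p"
   by (simp add: powr_divide powr_add[symmetric] field_simps)
   thus ?thesis using r(1) by (simp add: E_def powr_mult powr_minus field_simps)
   qed
   also have "... <= E*((\<bar>l\<bar>/(t - s)) powr p*(t - s))"
   using False r(1) p E0 by (intro mult_left_mono) (auto simp: ts mult.commute intro!: divide_right_mono powr_mono2)
   also have "... <= E*integral {s..t} ?V" using J E0 by (rule mult_left_mono)
   also have "... = integral {s..t} (%x. E*?V x)" by simp
   also have "... <= integral {s..t} ?F"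
   proof (intro integral_le Fi Vc mult_right_mono)
   fix x assume "x : {s..t}"
   thus "E <= f (x, torus_proj (pos c x)) + E" using f(2)[of "(x, torus_proj (pos c x))"] st by (auto simp: cyl_def)
   qed (use st in auto)
   finally show ?thesis by simp
  qed
 qed
 have "(\<Sum>i<m. max 0 (f (real i/2^k, ga (real i/2^k)) - w) *
  min ((2^k) powr (p/2)) ((2^k*increment ga k i) powr p)/2^k) <= integral {0..real m/2^k} ?F"
  if "m <= 2^k" for m using that
 proof (induction m)
  case (Suc m)
  have st: "real (Suc m)/2^k = real m/2^k + 1/2^k" "real (Suc m)/2^k <= 1" using dyadic_le_1[OF Suc.prems] by (simp_all add: add_divide_distrib)
  have "integral {0..real m/2^k} ?F + integral {real m/2^k..real (Suc m)/2^k} ?F = integral {0..real (Suc m)/2^k} ?F"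
   using st by (intro Henstock_Kurzweil_Integration.integral_combine Fi) (auto simp del: of_nat_Suc)
  thus ?case using Suc step[of "real m/2^k" "real (Suc m)/2^k"] st ga[of m] ga[of "Suc m"] by (simp del: of_nat_Suc)
 qed simp
 from this[of "2^k"] show ?thesis unfolding A_dy_def cost_def E_def[symmetric] by simp
qed

section \<open>Superposition for the limit law\<close>

lemma A_dy_nonneg: "(!!z. 0 <= f z) ==> 0 <= A_dy p f k ga"
 unfolding A_dy_def by (intro sum_nonneg divide_nonneg_nonneg mult_nonneg_nonneg) auto

lemma cyl_slice:
 fixes f :: "real \<times> 'n::finite torus => 'b::topological_space"
 assumes "continuous_on cyl f" "t : {0..1}" "continuous_on A g"
 shows "continuous_on A (%u. f (t, g u))"
 using assms by (intro continuous_on_compose2[OF assms(1)] continuous_intros) (auto simp: cyl_def)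

lemma dyadic_energy_lsc:
 fixes ga :: "real => 'n::finite torus"
 assumes a: "abs_continuous_curve ga" "ga : curves" and p: "1 < p" and f: "continuous_on cyl f" "!!z. 0 <= f z"
 shows "(nn_integral (lebesgue_on {0..1}) (%s. ennreal (norm (velocity ga s) powr p*f (s, ga s)))) <= liminf (%k. ennreal (A_dy p f k ga))"
proof -
 have c: "continuous_on {0..1} ga" using a(2) by (simp add: curves_iff)
 obtain g where g: "is_lift ga g" using lift_exists[OF c] by (auto simp: is_lift_def)
 define F where "F k i = ennreal (f (real i/2^k, ga (real i/2^k)) *
  min ((2^k) powr (p/2)) ((2^k*increment ga k i) powr p))" for k i
 have A: "(nn_integral (lebesgue_on {0..1::real}) (%s. F k (cell k s))) = ennreal (A_dy p f k ga)" for k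
 proof -
  have "(nn_integral (lebesgue_on {0..1::real}) (%s. F k (cell k s))) = (\<Sum>i<2^k. F k i*ennreal (1/2^k))" by (rule nn_integral_dyadic_step)
  also have "... = (\<Sum>i<2^k. ennreal (f (real i/2^k, ga (real i/2^k)) *
  min ((2^k) powr (p/2)) ((2^k*increment ga k i) powr p)/2^k))"
   unfolding F_def using f(2) by (intro sum.cong refl) (subst ennreal_mult''[symmetric], auto)
  finally show ?thesis unfolding A_dy_def using f(2) by (subst (asm) sum_ennreal) (auto intro!: mult_nonneg_nonneg divide_nonneg_nonneg)
 qed
 have lim: "AE s in lebesgue_on {0..1}. (%k. F k (cell k s)) ~> ennreal (norm (velocity ga s) powr p*f (s, ga s))"
  using dq_tendsto_velocity[OF a(1) g] AE_space
 proof eventually_elim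
  case (elim s)
  hence s: "s : {0..1}" by (simp add: space_restrict_space)
  let ?x = "%k. real (cell k s)/2^k"
  have x: "?x ~> s" "!!k. ?x k : {0..1}" using random_path.dyadic_dense[of "%_ _. torus_proj 0" 2 s] s dyadic_le_1
   by (auto simp: random_path_def)
  have "(%k. ga (?x k)) ~> ga s" using x s by (intro continuous_on_tendsto_compose[OF c]) auto
  hence "(%k. (?x k, ga (?x k))) ~> (s, ga s)" using x by (intro tendsto_Pair)
  hence ft: "(%k. f (?x k, ga (?x k))) ~> f (s, ga s)"
   using x(2) s by (intro continuous_on_tendsto_compose[OF f(1)]) (auto simp: cyl_def)
  have dt: "(%k. dq k ga s powr p) ~> norm (velocity ga s) powr p"
   using elim(1) p by (intro tendsto_powr2 tendsto_const) (auto simp: dq_def)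
  have "\<forall>\<^sub>F k in sequentially. dq k ga s powr p < norm (velocity ga s) powr p + 1" by (rule order_tendstoD(2)[OF dt]) simp
  moreover have "filterlim (%k::nat. ((2::real)^k) powr (p/2)) at_top sequentially" using p by real_asymp
  hence "\<forall>\<^sub>F k in sequentially. norm (velocity ga s) powr p + 1 <= (2^k) powr (p/2)" by (simp add: filterlim_at_top)
  ultimately have "\<forall>\<^sub>F k in sequentially. dq k ga s powr p = min ((2^k) powr (p/2)) (dq k ga s powr p)" by eventually_elim simp
  from Lim_transform_eventually[OF dt this]
  have "(%k. ennreal (f (?x k, ga (?x k))*min ((2^k) powr (p/2)) (dq k ga s powr p))) ~> ennreal (f (s, ga s)*norm (velocity ga s) powr p)"
   by (intro tendsto_ennrealI tendsto_mult ft)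
  thus ?case by (simp add: F_def dq_def mult.commute)
 qed
 have "(nn_integral (lebesgue_on {0..1}) (%s. ennreal (norm (velocity ga s) powr p*f (s, ga s)))) = (nn_integral (lebesgue_on {0..1::real}) (%s. liminf (%k. F k (cell k s))))"
 proof (rule nn_integral_cong_AE)
  show "AE s in lebesgue_on {0..1}. ennreal (norm (velocity ga s) powr p*f (s, ga s)) = liminf (%k. F k (cell k s))"
   using lim by eventually_elim (simp add: lim_imp_Liminf)
 qed
 also have "... <= liminf (%k. \<integral>\<^sup>+s. F k (cell k s) \<partial>lebesgue_on {0..1::real})" by (intro nn_integral_liminf measurable_dyadic_step)
 finally show ?thesis by (simp add: A)
qed

text \<open>The codes of the discrete laws converge weakly. Energies are bounded in mean, so almost every code in the
limit has bounded energy and defines a curve; boundary values pass to the limit since they are continuous in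
the code. The weighted energies are bounded below by weighted dyadic energies, which converge, and the limit
inferior over generations recovers the weighted energy of the limit law.\<close>
theorem limit_superposition:
 fixes rh0 rh1 :: "'n::finite torus measure"
 assumes a: "0 < al" "al < 1" and p: "p = 2/(2 - al)"
  and P: "prob_space rh0" "sets rh0 = sets borel" "prob_space rh1" "sets rh1 = sets borel"
  and sg: "!!n. is_finite_cyl_measure (sg n)" "!!n. dual_ineq p rh0 rh1 (sg n)" and C: "!!n::nat. measure (sg n) cyl <= C"
 obtains et where "Pi2_law et al p" "marg et 0 = rh0" "marg et 1 = rh1"
  "!!(f :: real \<times> 'n torus => real) be. continuous_on cyl f ==> ALL z:cyl. 0 <= f z ==>
   \<forall>e>0. \<forall>\<^sub>F n in sequentially. (LINT z|sg n. f z) <= be + e ==> (LINT z|sig p et. f z) <= be"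
proof -
 have p1: "1 < p" using a by (simp add: p field_simps)
 interpret P0: prob_space rh0 by fact
 interpret P1: prob_space rh1 by fact
 obtain D :: "rat => real => 'n torus" where D: "!!r. cont (D r)" "!!x. EX u:{0..1}. \<forall>r. D r u = x r"
  by (rule torus_family_code, rule that)
 obtain S c where W: "!!n::nat. weights controls (S n) (c n)"
  and lim: "!!f a b e. continuous_on cyl f ==> ALL z:cyl. 0 <= f z ==> cont a ==> cont b ==> 0 < e ==>
   \<forall>\<^sub>F n in sequentially. (\<Sum>ga\<in>S n. c n ga*(cost p f ga 1 + a (torus_proj (fst ga)) + b (torus_proj (pos ga 1))))
   <= (LINT z|sg n. f z) + (LINT x|rh0. a x) + (LINT x|rh1. b x) + e"
  by (rule superposition_sequence[OF p1 P sg C], rule that)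
 have Wc: "S n <= controls" "0 <= c n ga" for n ga using W[of n] unfolding weights_def by blast+
 define code where "code ga = (SOME u. u : {0..1} & (\<forall>r. D r u = torus_proj (pos ga (of_rat r))))" for ga :: "(real ^ 'n) \<times> (real => real ^ 'n)"
 have code: "code ga : {0..1} & (\<forall>r. D r (code ga) = torus_proj (pos ga (of_rat r)))" for ga
  unfolding code_def by (rule someI_ex) (use D(2)[of "%r. torus_proj (pos ga (of_rat r))"] in blast)
 obtain s \<mu> where s: "strict_mono (s :: nat => nat)" and pr\<mu>: "prob_space \<mu>" and s\<mu> [measurable_cong]: "sets \<mu> = sets borel"
  and conv: "!!g B. cont g ==> \<forall>x. \<bar>g x\<bar> <= B ==> (%k. \<Sum>ga\<in>S (s k). c (s k) ga*g (code ga)) ~> (LINT x|\<mu>. g x)"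
  by (rule discrete_law_limit[where code = "%_. code" and S = S and c = c and \<Gamma> = controls, OF W]) (use code in blast, rule that)
 interpret \<mu>: prob_space \<mu> by fact
 define Y where "Y u t = D (SOME r. of_rat r = t) u" for u t :: real
 interpret Y: random_path Y p by unfold_locales (simp_all add: Y_def D p1)
 have Yc: "Y (code ga) (real i/2^k) = torus_proj (pos ga (real i/2^k))" for ga i k
 proof -
  have "real i/2^k = of_rat (of_nat i/2^k)" by (simp add: of_rat_divide of_rat_power)
  hence "\<exists>r. of_rat r = real i/2^k" by metis
  hence "of_rat (SOME r. of_rat r = real i/2^k) = real i/2^k" by (rule someI_ex)
  thus ?thesis using code[of ga] by (simp add: Y_def)
 qed
 have C0: "0 <= C" using C[of 0] measure_nonneg order_trans by blast
 have gint: "integrable \<mu> g" if "cont g" "!!x. \<bar>g x\<bar> <= B" for g :: "real => real" and B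
  using that borel_measurable_continuous_onI[OF that(1)] by (intro \<mu>.integrable_const_bound[where B = B]) auto
 have H: "(LINT x|\<mu>. g x) <= be"
  if g: "cont g" "!!x. \<bar>g x\<bar> <= B" and f: "continuous_on cyl f" "!!z. z : cyl ==> 0 <= f z"
   and ab: "cont a'" "cont b'"
   and le: "!!ga. ga : controls ==> g (code ga) <= cost p f ga 1 + a' (torus_proj (fst ga)) + b' (torus_proj (pos ga 1))"
   and ev: "!!e. 0 < e ==> \<forall>\<^sub>F n in sequentially. (LINT z|sg n. f z) + (LINT x|rh0. a' x) + (LINT x|rh1. b' x) <= be + e"
  for g B f a' b' be
 proof (rule field_le_epsilon)
  fix e :: real assume "0 < e"
  hence e: "0 < e/2" by simp
  have fb: "ALL z:cyl. 0 <= f z" and gb: "\<forall>x. \<bar>g x\<bar> <= B" using f(2) g(2) by blast+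
  have "\<forall>\<^sub>F n in sequentially. (\<Sum>ga\<in>S n. c n ga*g (code ga)) <= be + e"
   using lim[OF f(1) fb ab e] ev[OF e]
  proof eventually_elim
   case (elim n)
   have "(\<Sum>ga\<in>S n. c n ga*g (code ga)) <= (\<Sum>ga\<in>S n. c n ga*(cost p f ga 1 + a' (torus_proj (fst ga)) + b' (torus_proj (pos ga 1))))"
   proof (intro sum_mono mult_left_mono Wc(2) le)
   fix ga assume "ga : S n" thus "ga : controls" using Wc(1) by blast
   qed
   thus ?case using elim by linarith
  qed
  hence "\<forall>\<^sub>F k in sequentially. (\<Sum>ga\<in>S (s k). c (s k) ga*g (code ga)) <= be + e" by (rule eventually_subseq[OF s])
  thus "(LINT x|\<mu>. g x) <= be + e" by (rule tendsto_upperbound[OF conv[OF g(1) gb]]) simp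
 qed
 define Bd where "Bd = diameter (UNIV :: 'n torus set)"
 have Bd: "dist x y <= Bd" for x y :: "'n torus"
  unfolding Bd_def using compact_imp_bounded[OF compact_UNIV_torus] by (intro diameter_bounded_bound) auto
 have E1: "(nn_integral \<mu> (%u. ennreal (E_dy p k (Y u)))) <= ennreal C" for k
 proof -
  have b: "\<bar>E_dy p k (Y u)\<bar> <= (\<Sum>i<(2::nat)^k. (2^k*Bd) powr p/2^k)" for u
  proof -
   have "E_dy p k (Y u) <= (\<Sum>i<(2::nat)^k. (2^k*Bd) powr p/2^k)"
   unfolding E_dy_def by (intro sum_mono divide_right_mono powr_mono2 mult_left_mono Bd) (use p1 in auto)
   thus ?thesis using E_dy_nonneg[of p k "Y u"] by linarith
  qed
  have "(LINT u|\<mu>. E_dy p k (Y u)) <= C"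
  proof (rule H[of _ _ "%_. 1" "%_. 0" "%_. 0", OF Y.continuous_E b ])
   fix ga :: "(real ^ 'n) \<times> (real => real ^ 'n)" assume ga: "ga : controls"
   have "(%r. norm (snd ga r) powr p) integrable_on {0..1}"
   using cost_integrand[OF ga continuous_on_const, of 0 1 p 1] p1 by simp
   hence "E_dy p k (%t. torus_proj (pos ga t)) <= integral {0..1} (%r. norm (snd ga r) powr p)"
   by (intro E_dy_le_integral[OF pos_ind_int[OF ga] p1]) auto
   moreover have "E_dy p k (Y (code ga)) = E_dy p k (%t. torus_proj (pos ga t))" unfolding E_dy_def Yc ..
   ultimately show "E_dy p k (Y (code ga)) <= cost p (%_. 1) ga 1 + 0 + 0" by (simp add: cost_def)
  next
   fix e :: real assume e: "0 < e"
   show "\<forall>\<^sub>F n in sequentially. (LINT z|sg n. 1) + (LINT x|rh0. 0) + (LINT x|rh1. 0) <= C + e"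
   proof (rule always_eventually, rule allI)
   fix n
   have "space (sg n) = cyl" using sg(1)[of n] sets_eq_imp_space_eq[of "sg n" cyl_borel] by (simp add: is_finite_cyl_measure_def space_cyl_borel)
   thus "(LINT z|sg n. 1) + (LINT x|rh0. 0) + (LINT x|rh1. 0) <= C + e" using C[of n] e by simp
   qed
  qed auto
  moreover have "(nn_integral \<mu> (%u. ennreal (E_dy p k (Y u)))) = ennreal (LINT u|\<mu>. E_dy p k (Y u))"
   by (intro nn_integral_eq_integral gint[OF Y.continuous_E b] AE_I2 E_dy_nonneg)
  ultimately show ?thesis by (simp add: ennreal_leI)
 qed
 define SE where "SE u = (SUP k. ennreal (E_dy p k (Y u)))" for u
 have Em [measurable]: "(%u. E_dy p k (Y u)) : bm borel" for k
  by (rule borel_measurable_continuous_onI[OF Y.continuous_E])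
 have SEi: "(nn_integral \<mu> (%u. SE u)) <= ennreal C"
  unfolding SE_def using E_dy_mono[OF p1] E1
  by (subst nn_integral_monotone_convergence_SUP) (auto simp: incseq_Suc_iff le_fun_def intro!: ennreal_leI SUP_least)
 have SEm: "SE : bm \<mu>" unfolding SE_def by measurable
 have "AE u in \<mu>. SE u ~= \<infinity>" using SEi SEm by (intro nn_integral_PInf_AE) (auto simp: top.not_eq_extremum intro: le_less_trans)
 hence good: "AE u in \<mu>. \<exists>M. u : Y.good M"
 proof eventually_elim
  case (elim u)
  then obtain M where M: "SE u = ennreal M" "0 <= M" by (cases "SE u") auto
  have "ennreal (E_dy p k (Y u)) <= ennreal M" for k unfolding M(1)[symmetric] SE_def by (rule SUP_upper) simp
  hence "u : Y.good M" using M(2) by (simp add: Y.good_def)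
  thus ?case ..
 qed
 note pm = Y.path_measurable
 have pm\<mu> [measurable]: "Y.path : measurable \<mu> curves_borel" using pm by (simp add: measurable_cong_sets[OF s\<mu> refl])
 define et where "et = distr \<mu> curves_borel Y.path"
 have cl: "curve_law et" unfolding curve_law_def curve_law_axioms_def et_def by (simp add: \<mu>.prob_space_distr[OF pm\<mu>])
 have en: "(nn_integral et (%ga. curve_energy al ga)) <= ennreal C"
 proof -
  have "(nn_integral et (%ga. curve_energy al ga)) = (nn_integral \<mu> (%u. curve_energy al (Y.path u)))"
   unfolding et_def by (rule nn_integral_distr[OF pm\<mu>]) (use curve_energy_measurable[OF a] in simp)
  also have "... = (nn_integral \<mu> (%u. SE u))"
   using good by (intro nn_integral_cong_AE, eventually_elim) (auto simp: curve_energy_eq[OF a Y.path_in_curves] p[symmetric] SE_def Y.E_path)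
  finally show ?thesis using SEi by simp
 qed
 interpret L: Pi2_law et al p
  using cl a p en by (auto simp: Pi2_law_def Pi2_law_axioms_def top.not_eq_extremum intro: le_less_trans)
 have marg: "distr et borel (%ga. ga (real i/2^0)) = rh"
  if i: "i <= 2^0" and rh: "prob_space rh" "sets rh = sets borel"
   and le: "!!ph :: 'n torus => real. cont ph ==> (LINT u|\<mu>. ph (Y u (real i/2^0))) <= (LINT x|rh. ph x)"
  for i and rh :: "'n torus measure"
 proof (rule finite_measure_eqI_continuous[where C = UNIV])
  have em: "(%ga. ga (real i/2^0)) : measurable et borel" by measurable
  show "finite_measure (distr et borel (%ga. ga (real i/2^0)))"
   using L.prob_space_distr[OF em] by (simp add: prob_space_def)
  show "finite_measure rh" using rh by (simp add: prob_space_def)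
  show "sets (distr et borel (%ga. ga (real i/2^0))) = sets (restrict_space borel UNIV)" "sets rh = sets (restrict_space borel UNIV)"
   using rh by simp_all
  fix ph :: "'n torus => real" assume ph: "cont ph"
  note [measurable] = borel_measurable_continuous_onI[OF ph]
  have "integral\<^sup>L (distr et borel (%ga. ga (real i/2^0))) ph = (LINT ga|et. ph (ga (real i/2^0)))" by (rule integral_distr) measurable
  also have "... = (LINT u|\<mu>. ph (Y.path u (real i/2^0)))"
   unfolding et_def by (rule integral_distr) measurable
  also have "... = (LINT u|\<mu>. ph (Y u (real i/2^0)))"
  proof (rule integral_cong_AE)
   show "AE u in \<mu>. ph (Y.path u (real i/2^0)) = ph (Y u (real i/2^0))"
   using good
   proof eventually_elim
   case (elim u)
   then obtain M where "u : Y.good M" ..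
   from Y.path_fits[OF this] have "Y.path u (real i/2^0) = Y u (real i/2^0)" unfolding Y.fits_def using i by blast
   thus ?case by simp
   qed
   show "(%u. ph (Y.path u (real i/2^0))) : bm \<mu>" by measurable
   show "(%u. ph (Y u (real i/2^0))) : bm \<mu>"
   using borel_measurable_continuous_onI[OF Y.Yc[of "real i/2^0"]] by measurable
  qed
  finally have eq: "integral\<^sup>L (distr et borel (%ga. ga (real i/2^0))) ph = (LINT u|\<mu>. ph (Y u (real i/2^0)))" .
  have "cont (%x. - ph x)" using ph by (intro continuous_intros)
  from le[OF this] le[OF ph] show "integral\<^sup>L (distr et borel (%ga. ga (real i/2^0))) ph = integral\<^sup>L rh ph"
   unfolding eq by simp
 qed
 have comp: "cont (%u. ph (Y u t))" if "cont ph" for ph :: "'n torus => real" and t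
  by (rule continuous_on_compose2[OF that Y.Yc]) auto
 have z: "cost p (%_. 0) ga 1 = 0" for ga :: "(real ^ 'n) \<times> (real => real ^ 'n)" by (simp add: cost_def)
 have m0: "marg et 0 = rh0"
 proof -
  have "(LINT u|\<mu>. ph (Y u (real 0/2^0))) <= (LINT x|rh0. ph x)" if ph: "cont ph" for ph :: "'n torus => real"
  proof -
   obtain B where B: "!!x. \<bar>ph x\<bar> <= B" by (rule torus_bounded_fn[OF ph], rule that)
   show ?thesis
   by (rule H[of _ _ "%_. 0" ph "%_. 0", OF comp[OF ph] B])
   (use ph in \<open>simp_all add: z Yc[of _ 0 0, simplified] pos_def\<close>)
  qed
  from marg[OF _ P(1,2) this] show ?thesis by simp
 qed
 have m1: "marg et 1 = rh1"
 proof -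
  have "(LINT u|\<mu>. ph (Y u (real 1/2^0))) <= (LINT x|rh1. ph x)" if ph: "cont ph" for ph :: "'n torus => real"
  proof -
   obtain B where B: "!!x. \<bar>ph x\<bar> <= B" by (rule torus_bounded_fn[OF ph], rule that)
   show ?thesis
   by (rule H[of _ _ "%_. 0" "%_. 0" ph, OF comp[OF ph] B])
   (use ph in \<open>simp_all add: z Yc[of _ 1 0, simplified]\<close>)
  qed
  from marg[OF _ P(3,4) this] show ?thesis by simp
 qed
 have fs: "is_finite_cyl_measure (sig p et)" using L.finite_sig by (simp add: is_finite_cyl_measure_def)
 have low: "(LINT z|sig p et. f z) <= be"
  if f': "continuous_on cyl f" "ALL z:cyl. 0 <= f z"
   and ev': "\<forall>e>0. \<forall>\<^sub>F n in sequentially. (LINT z|sg n. f z) <= be + e" for f :: "real \<times> 'n torus => real" and be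
 proof -
  have f: "continuous_on cyl f" "!!z. z : cyl ==> 0 <= f z"
   and ev: "!!e. 0 < e ==> \<forall>\<^sub>F n in sequentially. (LINT z|sg n. f z) <= be + e" using f' ev' by blast+
  obtain B where B: "!!z. z : cyl ==> norm (f z) <= B" by (rule cont_cyl_bounded[OF f(1)], rule that)
  have "norm (f (0, torus_proj 0)) <= B" by (rule B) (simp add: cyl_def)
  hence B0: "0 <= B" using norm_ge_zero order_trans by blast
  have sp: "space (sg n) = cyl" for n using sg(1)[of n] sets_eq_imp_space_eq[of "sg n" cyl_borel] by (simp add: is_finite_cyl_measure_def space_cyl_borel)
  have be0: "0 <= be"
  proof (rule field_le_epsilon)
   fix e :: real assume "0 < e"
   then obtain n where "(LINT z|sg n. f z) <= be + e" using eventually_happens'[OF sequentially_bot ev] by blast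
   moreover have "0 <= (LINT z|sg n. f z)" using f(2) sp by (intro Bochner_Integration.integral_nonneg_AE AE_I2) simp
   ultimately show "0 <= be + e" by linarith
  qed
  have key: "(nn_integral (sig p et) (%z. ennreal (max 0 (f z - w)))) <= ennreal be" if w: "0 < w" for w
  proof -
   let ?f = "%z. max 0 (f z - w)"
   have fc: "continuous_on cyl ?f" using f by (intro continuous_intros)
   note fm = cont_cyl_measurable[OF fc]
   obtain d where d: "0 < d" "!!z z'. z : cyl ==> z' : cyl ==> dist z z' < d ==> \<bar>f z - f z'\<bar> < w"
   by (rule continuous_on_cyl_uniform[OF f(1) w], rule that)
   define r where "r = d/2"
   define E where "E k = B*r powr (- p)*(1/2^k) powr (p/2)" for k :: nat
   have r: "0 < r" "2*r = d" using d(1) by (auto simp: r_def)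
   have E0: "0 <= E k" for k using B0 by (simp add: E_def)
   have dy: "real i/2^k : {0..1}" if "i < 2^k" for i k using dyadic_le_1[of i k] that by simp
   have Ac: "cont (%u. A_dy p ?f k (Y u))" for k
   unfolding A_dy_def
   by (intro continuous_intros continuous_on_powr' Y.Yc cyl_slice[OF fc] dy) (use p1 in auto)
   have Ab: "\<bar>A_dy p ?f k ga\<bar> <= (\<Sum>i<(2::nat)^k. B*(2^k) powr (p/2)/2^k)" for k ga
   proof -
   have "0 <= A_dy p ?f k ga" by (intro A_dy_nonneg) simp
   moreover have "A_dy p ?f k ga <= (\<Sum>i<(2::nat)^k. B*(2^k) powr (p/2)/2^k)"
   unfolding A_dy_def
   proof (intro sum_mono divide_right_mono mult_mono)
   fix i :: nat assume "i : {..<2^k}"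
   hence "f (real i/2^k, ga (real i/2^k)) <= B" using B[of "(real i/2^k, ga (real i/2^k))"] dy[of i k] by (auto simp: cyl_def)
   thus "max 0 (f (real i/2^k, ga (real i/2^k)) - w) <= B" using w B0 by simp
   qed (use B0 in auto)
   ultimately show ?thesis by simp
   qed
   have A1: "(LINT u|\<mu>. A_dy p ?f k (Y u)) <= be + E k*C" if k: "1/2^k < r" for k
   proof (rule H[of _ _ "%z. f z + E k" "%_. 0" "%_. 0", OF Ac Ab ])
   fix ga :: "(real ^ 'n) \<times> (real => real ^ 'n)" assume ga: "ga : controls"
   have "A_dy p ?f k (Y (code ga)) <= cost p (%z. f z + B*r powr (- p)*(1/2^k) powr (p/2)) ga 1"
   proof (rule A_dy_le_cost[OF ga p1 f _ B0 r(1) _ w k])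
   show "f z <= B" if "z : cyl" for z using B[OF that] by simp
   qed (use d r Yc in auto)
   thus "A_dy p ?f k (Y (code ga)) <= cost p (%z. f z + E k) ga 1 + 0 + 0" by (simp add: E_def)
   next
   fix e :: real assume e: "0 < e"
   show "\<forall>\<^sub>F n in sequentially. (LINT z|sg n. f z + E k) + (LINT x|rh0. 0) + (LINT x|rh1. 0) <= be + E k*C + e"
   using ev[OF e]
   proof eventually_elim
   case (elim n)
   interpret s: finite_measure "sg n" using sg(1)[of n] by (simp add: is_finite_cyl_measure_def)
   have "(LINT z|sg n. f z + E k) = (LINT z|sg n. f z) + E k*measure (sg n) cyl" using finite_cyl_integrable[OF sg(1) f(1), of n] sp by simp
   moreover have "E k*measure (sg n) cyl <= E k*C" using C E0 by (intro mult_left_mono)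
   ultimately show ?case using elim by simp
   qed
   qed (use f E0 in \<open>auto intro!: continuous_intros\<close>)
   have Am [measurable]: "(%ga. A_dy p ?f k ga) : bm curves_borel" for k
   proof -
   have "(%ga. ?f (real i/2^k, ga (real i/2^k))) : bm (curves_borel :: (real => 'n torus) measure)" if "i < 2^k" for i
   proof -
   have "(%x. ?f (real i/2^k, x)) : bm borel"
   by (intro borel_measurable_continuous_onI cyl_slice[OF fc dy[OF that]] continuous_on_id)
   from measurable_compose[OF eval_measurable this] show ?thesis .
   qed
   note this [measurable]
   show ?thesis unfolding A_dy_def
   proof (rule borel_measurable_sum)
   fix i :: nat assume "i : {..<2^k}"
   hence [measurable]: "i < 2^k" by simp
   show "(%ga. ?f (real i/2^k, ga (real i/2^k))*min ((2^k) powr (p/2)) ((2^k*increment ga k i) powr p)/2^k)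
   : bm (curves_borel :: (real => 'n torus) measure)"
   using \<open>i < 2^k\<close> by measurable
   qed
   qed
   have A2: "(nn_integral et (%ga. ennreal (A_dy p ?f k ga))) <= ennreal (be + E k*C)" if k: "1/2^k < r" for k
   proof -
   have "(nn_integral et (%ga. ennreal (A_dy p ?f k ga))) = (nn_integral \<mu> (%u. ennreal (A_dy p ?f k (Y.path u))))"
   unfolding et_def by (rule nn_integral_distr[OF pm\<mu>]) measurable
   also have "... = (nn_integral \<mu> (%u. ennreal (A_dy p ?f k (Y u))))"
   using good
   proof (intro nn_integral_cong_AE, eventually_elim)
   case (elim u)
   then obtain M where "u : Y.good M" by blast
   from Y.path_fits[OF this] have "i <= 2^k ==> Y.path u (real i/2^k) = Y u (real i/2^k)" for i unfolding Y.fits_def by blast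
   hence "A_dy p ?f k (Y.path u) = A_dy p ?f k (Y u)"
   unfolding A_dy_def by (intro sum.cong refl) (simp add: Suc_leI less_imp_le del: of_nat_Suc)
   thus ?case by simp
   qed
   also have "... = ennreal (LINT u|\<mu>. A_dy p ?f k (Y u))"
   by (intro nn_integral_eq_integral gint[OF Ac Ab] AE_I2 A_dy_nonneg) simp
   finally show ?thesis using A1[OF k] by (simp add: ennreal_leI)
   qed
   have "(nn_integral (sig p et) (%z. ennreal (?f z))) = (nn_integral L.M (%z. ennreal (pspeed p z)*ennreal (?f (L.Phi z))))"
   by (rule L.nn_integral_sig) (use fm in measurable)
   also have "... = (\<integral>\<^sup>+ga. \<integral>\<^sup>+s. ennreal (norm (velocity ga s) powr p)*ennreal (?f (s, ga s)) \<partial>I01 \<partial>et)"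
   proof -
   have [measurable]: "(%z. ?f (L.Phi z)) : bm L.M" by (rule measurable_compose[OF L.Phi_M fm])
   define G where "G z = ennreal (pspeed p z)*ennreal (?f (L.Phi z))" for z
   have "(\<integral>\<^sup>+ga. \<integral>\<^sup>+s. G (ga, s) \<partial>I01 \<partial>et) = (nn_integral L.M (%z. G z))"
   unfolding G_def by (rule L.I.nn_integral_fst) measurable
   thus ?thesis unfolding G_def fst_conv snd_conv ..
   qed
   also have "... <= (nn_integral et (%ga. liminf (%k. ennreal (A_dy p ?f k ga))))"
   using L.AE_W
   proof (intro nn_integral_mono_AE, eventually_elim)
   case (elim ga)
   hence ga: "ga : curves" "abs_continuous_curve ga" by (auto simp: W_curves_def)
   have [measurable]: "(%s. ?f (s, ga s)) : bm I01" by (rule measurable_compose[OF L.Phi_section[OF ga(1)] fm])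
   note [measurable] = L.vel_section[OF ga(1)]
   have "(nn_integral I01 (%s. ennreal (norm (velocity ga s) powr p)*ennreal (?f (s, ga s)))) = (nn_integral I01 (%s. ennreal (norm (velocity ga s) powr p*?f (s, ga s))))"
   by (simp add: ennreal_mult'')
   also have "... = (nn_integral (lebesgue_on {0..1}) (%s. ennreal (norm (velocity ga s) powr p*?f (s, ga s))))"
   by (intro nn_integral_I01[symmetric]) measurable
   also have "... <= liminf (%k. ennreal (A_dy p ?f k ga))" by (intro dyadic_energy_lsc[OF ga(2,1) p1 fc]) simp
   finally show ?case .
   qed
   also have "... <= liminf (%k. \<integral>\<^sup>+ga. ennreal (A_dy p ?f k ga) \<partial>et)" by (intro nn_integral_liminf) measurable
   also have "... <= liminf (%k. ennreal (be + E k*C))"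
   proof (rule Liminf_mono)
   obtain k0 where k0: "(1/2)^k0 < r" using real_arch_pow_inv[OF r(1), of "1/2"] by auto
   show "\<forall>\<^sub>F k in sequentially. (nn_integral et (%ga. ennreal (A_dy p ?f k ga))) <= ennreal (be + E k*C)"
   using eventually_ge_at_top[of k0]
   proof eventually_elim
   case (elim k)
   hence "(1/2 :: real)^k <= (1/2)^k0" by (intro power_decreasing) auto
   thus ?case using k0 by (intro A2) (simp add: power_one_over)
   qed
   qed
   also have "... = ennreal (be + B*r powr (- p)*0*C)"
   proof (rule lim_imp_Liminf[OF sequentially_bot], unfold E_def, intro tendsto_intros)
   show "(%k. ((1::real)/2^k) powr (p/2)) ~> 0" using p1 by real_asymp
   qed
   finally show ?thesis by simp
  qed
  have fi: "integrable (sig p et) f" by (rule finite_cyl_integrable[OF fs f(1)])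
  define m where "m = measure (sig p et) (space (sig p et))"
  have m0: "0 <= m" by (simp add: m_def)
  interpret sg: finite_measure "sig p et" by (rule L.finite_sig)
  show ?thesis
  proof (rule field_le_epsilon)
   fix e :: real assume e: "0 < e"
   define w where "w = e/(m + 1)"
   have w: "0 < w" "w*m <= e" using e m0 by (auto simp: w_def field_simps)
   have gi: "integrable (sig p et) (%z. max 0 (f z - w))" by (intro finite_cyl_integrable[OF fs] continuous_intros f)
   have "(LINT z|sig p et. f z) <= (LINT z|sig p et. max 0 (f z - w) + w)" using fi gi by (intro integral_mono) auto
   also have "... = (LINT z|sig p et. max 0 (f z - w)) + w*m" using gi by (simp add: m_def)
   also have "(LINT z|sig p et. max 0 (f z - w)) <= be"
   using key[OF w(1)] nn_integral_eq_integral[OF gi] be0 by (simp add: Bochner_Integration.integral_nonneg)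
   finally show "(LINT z|sig p et. f z) <= be + e" using w by simp
  qed
 qed
 have PL: "Pi2_law et al p" by unfold_locales
 show ?thesis
 proof (rule that)
  show "Pi2_law et al p" by (rule PL)
  show "marg et 0 = rh0" by (rule m0)
  show "marg et 1 = rh1" by (rule m1)
 qed (rule low)
qed

section \<open>Finite competitors for arbitrary marginals\<close>

lemma fund_cube_convex_comb:
 assumes "x : fund_cube" "y : fund_cube" "0 <= u" "u <= 1"
 shows "(1 - u) *\<^sub>R x + u *\<^sub>R y : fund_cube"
 using assms convexD_alt[OF convex_box(1), of x _ _ y u] unfolding fund_cube_def by blast

lemma null_scaled_slice:
 fixes g :: "'e::euclidean_space => ennreal"
 assumes "c ~= 0" and g: "g : bm borel" and z: "(nn_integral lborel (%u. g u)) = 0"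
 shows "(nn_integral lborel (%u. g (t + c *\<^sub>R u))) = 0"
proof -
 note [measurable] = g
 have "(nn_integral lborel (%u. g u)) = (nn_integral (density (distr lborel borel (%x. t + c *\<^sub>R x)) (%_. ennreal (\<bar>c\<bar>^DIM('e)))) (%u. g u))"
  using lborel_affine[OF assms(1), of t] by simp
 also have "... = ennreal (\<bar>c\<bar>^DIM('e))*(nn_integral lborel (%u. g (t + c *\<^sub>R u)))"
  by (subst nn_integral_density, measurable) (simp add: nn_integral_cmult nn_integral_distr)
 finally show ?thesis using z assms(1) by simp
qed

text \<open>Mass travels on a straight line to an intermediate point that is uniformly distributed in a cube and then to
its destination. At a fixed time the position is, given both ends, a nondegenerate affine image of the
intermediate point, so the positions do not charge null sets. The speeds are bounded, which gives the dual
inequality by averaging over trajectories.\<close>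
theorem spread_out_dual_feasible:
 fixes rh0 rh1 :: "'n::finite torus measure"
 assumes p: "1 < p" and P: "prob_space rh0" "sets rh0 = sets borel" "prob_space rh1" "sets rh1 = sets borel"
 obtains sg where "is_finite_cyl_measure sg" "absolutely_continuous cyl_leb sg" "dual_ineq p rh0 rh1 sg"
proof -
 obtain sec :: "'n torus => real ^ 'n" where sec: "sec : bm borel" "!!a. sec a : fund_cube" "!!a. torus_proj (sec a) = a"
  by (rule measurable_torus_section, rule that)
 let ?Q = "fund_cube :: (real ^ 'n) set"
 define U where "U = restrict_space lborel ?Q"
 have spU: "space U = ?Q" by (simp add: U_def space_restrict_space)
 have Qb: "?Q : sets borel" by (simp add: fund_cube_def)
 interpret P0: prob_space rh0 by fact
 interpret P1: prob_space rh1 by fact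
 interpret U: prob_space U
 proof
  have "emeasure lborel ?Q = 1"
   unfolding fund_cube_def by (subst emeasure_lborel_cbox) (auto simp: Basis_vec_def inner_axis intro!: prod.neutral)
  thus "emeasure U (space U) = 1" using Qb unfolding U_def by (simp add: emeasure_restrict_space space_restrict_space)
 qed
 interpret I: prob_space I01 by (rule finite_I01)
 interpret A: pair_prob_space rh0 rh1 ..
 let ?A = "rh0 \<Otimes>\<^sub>M rh1"
 interpret \<Omega>: pair_prob_space ?A U ..
 let ?\<Omega> = "?A \<Otimes>\<^sub>M U"
 interpret B: pair_prob_space ?\<Omega> I01 ..
 interpret UI: pair_prob_space U I01 ..
 let ?B = "?\<Omega> \<Otimes>\<^sub>M I01"
 note s [measurable_cong] = P(2,4)
 have id_U [measurable]: "(%z. z) : measurable U borel" unfolding U_def by (intro measurable_restrict_space1) simp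
 have id_I [measurable]: "(%z. z) : measurable I01 borel" by (intro measurable_restrict_space1) simp
 note [measurable] = sec(1)
 define cf where "cf s = (if s <= 1/2 then 2 * s else 2 - 2 * s)" for s :: real
 define pt where "pt x y z s = (1 - cf s) *\<^sub>R (if s <= 1/2 then x else y) + cf s *\<^sub>R z" for x y z :: "real ^ 'n" and s
 have cf: "0 <= cf s" "cf s <= 1" "s ~= 0 ==> s ~= 1 ==> cf s ~= 0" if "s : {0..1}" for s using that by (auto simp: cf_def)
 have pt_Q: "pt x y z s : ?Q" if "x : ?Q" "y : ?Q" "z : ?Q" "s : {0..1}" for x y z s
  unfolding pt_def using that cf by (intro fund_cube_convex_comb) auto
 obtain R where R: "!!x y. x : ?Q ==> y : ?Q ==> norm (x - y) <= R"
  using compact_imp_bounded[OF compact_fund_cube] diameter_bounded_bound[of ?Q] by (metis dist_norm)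
 define K where "K = (2*R) powr p"
 have R0: "0 <= R" using R[OF sec(2)[of undefined] sec(2)[of undefined]] by simp
 have K0: "0 <= K" by (simp add: K_def)
 define T where "T w = (snd w, torus_proj (pt (sec (fst (fst (fst w)))) (sec (snd (fst (fst w)))) (snd (fst w)) (snd w)))"
  for w :: "(('n torus \<times> 'n torus) \<times> (real ^ 'n)) \<times> real"
 have cfm [measurable]: "cf : bm borel" unfolding cf_def[abs_def] by measurable
 have mfst [measurable]: "(%w. fst (fst (fst w))) : measurable ?B borel" "(%w. snd (fst (fst w))) : measurable ?B borel"
  "(%w. snd (fst w)) : measurable ?B borel" "snd : measurable ?B borel"
  using measurable_compose[OF _ id_U] measurable_compose[OF _ id_I] by measurable
 have pm [measurable]: "(%w. pt (sec (fst (fst (fst w)))) (sec (snd (fst (fst w)))) (snd (fst w)) (snd w)) : bm ?B"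
  unfolding pt_def by measurable
 have tp [measurable]: "torus_proj : bm (borel :: (real ^ 'n) measure)"
  by (rule borel_measurable_continuous_onI[OF continuous_on_torus_proj])
 have spB: "fst (fst (fst w)) : UNIV & snd (fst w) : ?Q & snd w : {0..1}" if "w : space ?B" for w
  using that by (auto simp: space_pair_measure spU space_I01)
 have Tm [measurable]: "T : measurable ?B cyl_borel"
  unfolding cyl_borel_def
 proof (rule measurable_restrict_space2)
  show "T : space ?B \<rightarrow> cyl" using spB by (auto simp: T_def cyl_def)
  show "T : measurable ?B borel" unfolding T_def[abs_def] borel_prod[symmetric] by measurable
 qed
 define sg where "sg = distr (density ?B (%_. ennreal K)) cyl_borel T"
 have nn: "(nn_integral sg (%x. g x)) = ennreal K*(nn_integral ?B (%w. g (T w)))" if [measurable]: "g : bm cyl_borel" for g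
  unfolding sg_def by (subst nn_integral_distr, simp, simp, subst nn_integral_density) (simp_all add: nn_integral_cmult)
 have sets: "sets sg = sets cyl_borel" by (simp add: sg_def)
 have fin: "is_finite_cyl_measure sg"
  unfolding is_finite_cyl_measure_def
 proof (intro conjI sets finite_measureI)
  have "emeasure sg (space sg) = ennreal K*1"
   using nn[of "%_. 1"] B.emeasure_space_1 by simp
  thus "emeasure sg (space sg) ~= \<infinity>" by simp
 qed
 have ac: "absolutely_continuous cyl_leb sg"
  unfolding absolutely_continuous_def
 proof
  fix N assume N: "N : null_sets (cyl_leb :: (real \<times> 'n torus) measure)"
  hence Ns [measurable]: "N : sets cyl_borel" by (auto simp: null_sets_def)
  define g where "g s u = (indicator ?Q u*indicator {0..1} s*indicator N (s, torus_proj u) :: ennreal)" for s :: real and u :: "real ^ 'n"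
  have Nb: "N : sets borel" using Ns unfolding cyl_borel_def by (subst (asm) sets_restrict_space_iff) (auto simp: cyl_def intro!: borel_closed closed_Times)
  have gm [measurable]: "(%w. g (fst w) (snd w)) : bm (lborel \<Otimes>\<^sub>M lborel)"
  proof -
   have "(%w. (fst w, torus_proj (snd w))) : measurable (borel \<Otimes>\<^sub>M borel) (borel :: (real \<times> 'n torus) measure)" unfolding borel_prod[symmetric, where 'b = "'n torus"] by measurable
   hence "(%w. indicator N (fst w, torus_proj (snd w)) :: ennreal) : bm (borel \<Otimes>\<^sub>M borel)"
   using Nb by measurable
   thus ?thesis unfolding g_def using Qb by measurable
  qed
  have "0 = emeasure cyl_leb N" using N by (simp add: null_sets_def)
  also have "... = (nn_integral cyl_leb (%x. indicator N x))" using Ns by simp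
  also have "... = (nn_integral (restrict_space lborel ({0..1} \<times> ?Q)) (%w. indicator N (case w of (t, x) => (t, torus_proj x))))"
   unfolding cyl_leb_def using measurable_cyl_proj by (subst nn_integral_distr) auto
  also have "... = (nn_integral lborel (%w. g (fst w) (snd w)))"
   using Qb by (subst nn_integral_restrict_space) (auto simp: g_def indicator_def case_prod_beta intro!: nn_integral_cong borel_Times)
  also have "... = (\<integral>\<^sup>+s. \<integral>\<^sup>+u. g s u \<partial>lborel \<partial>lborel)"
   unfolding lborel_prod[symmetric] using lborel.nn_integral_fst[OF gm] by simp
  finally have "AE s in lborel. (nn_integral lborel (%u. g s u)) = 0"
   using lborel.borel_measurable_nn_integral[of "%s u. g s u" lborel] gm by (subst (asm) eq_commute, subst (asm) nn_integral_0_iff_AE) (auto simp: case_prod_beta)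
  moreover have "AE s in (lborel :: real measure). s ~= 0 & s ~= 1" using AE_lborel_singleton[of "0::real"] AE_lborel_singleton[of "1::real"] by eventually_elim auto
  ultimately have "AE s in lborel. s : {0..1} --> (nn_integral lborel (%u. g s u)) = 0 & cf s ~= 0"
   by eventually_elim (use cf(3) in auto)
  hence slices: "AE s in I01. (nn_integral lborel (%u. g s u)) = 0 & cf s ~= 0" by (subst AE_restrict_space_iff) auto
  have gs: "g s : bm borel" for s using measurable_compose[OF measurable_Pair1'[of s lborel lborel] gm] by simp
  have inner: "(\<integral>\<^sup>+z. \<integral>\<^sup>+s. indicator N (T ((ab, z), s)) \<partial>I01 \<partial>U) = 0" if ab: "ab : space ?A" for ab
  proof -
   have m: "(%w. indicator N (T ((ab, fst w), snd w)) :: ennreal) : bm (U \<Otimes>\<^sub>M I01)"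
   proof -
   have "(%w. ((ab, fst w), snd w)) : measurable (U \<Otimes>\<^sub>M I01) ?B" using ab by measurable
   from measurable_compose[OF this Tm] show ?thesis by measurable
   qed
   have "(\<integral>\<^sup>+z. \<integral>\<^sup>+s. indicator N (T ((ab, z), s)) \<partial>I01 \<partial>U) = (\<integral>\<^sup>+s. \<integral>\<^sup>+z. indicator N (T ((ab, z), s)) \<partial>U \<partial>I01)"
   using UI.Fubini'[of "%z s. indicator N (T ((ab, z), s))"] m by (simp add: case_prod_beta')
   also have "... = (nn_integral I01 (%s. 0))"
   proof (rule nn_integral_cong_AE)
   show "AE s in I01. (nn_integral U (%z. indicator N (T ((ab, z), s)))) = 0"
   using slices AE_space
   proof eventually_elim
   case (elim s)
   hence s: "s : {0..1}" by (simp add: space_I01)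
   let ?t = "(1 - cf s) *\<^sub>R (if s <= 1/2 then sec (fst ab) else sec (snd ab))"
   have "(nn_integral U (%z. indicator N (T ((ab, z), s)))) = (nn_integral lborel (%z. indicator N (T ((ab, z), s))*indicator ?Q z))"
   unfolding U_def using Qb by (subst nn_integral_restrict_space) auto
   also have "... <= (nn_integral lborel (%z. g s (?t + cf s *\<^sub>R z)))"
   proof (rule nn_integral_mono)
   fix z show "indicator N (T ((ab, z), s))*indicator ?Q z <= g s (?t + cf s *\<^sub>R z)"
   using pt_Q[OF sec(2) sec(2), of z s "fst ab" "snd ab"] s unfolding pt_def by (auto simp: T_def g_def pt_def indicator_def)
   qed
   also have "... = 0" using elim(1) by (intro null_scaled_slice gs) auto
   finally show ?case by simp
   qed
   qed
   finally show ?thesis by simp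
  qed
  have "emeasure sg N = (nn_integral sg (%x. indicator N x))" using Ns sets by simp
  also have "... = ennreal K*(nn_integral ?B (%w. indicator N (T w)))" by (rule nn) measurable
  also have "(nn_integral ?B (%w. indicator N (T w))) = (\<integral>\<^sup>+om. \<integral>\<^sup>+s. indicator N (T (om, s)) \<partial>I01 \<partial>?\<Omega>)"
   by (rule I.nn_integral_fst[symmetric]) measurable
  also have "... = (\<integral>\<^sup>+ab. \<integral>\<^sup>+z. \<integral>\<^sup>+s. indicator N (T ((ab, z), s)) \<partial>I01 \<partial>U \<partial>?A)"
   by (rule U.nn_integral_fst[symmetric]) measurable
  also have "... = (nn_integral ?A (%ab. 0))" by (intro nn_integral_cong inner)
  finally show "N : null_sets sg" using Ns sets by (simp add: null_sets_def)
 qed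
 have "dual_ineq p rh0 rh1 sg"
  unfolding dual_ineq_def
 proof (intro allI impI, elim conjE)
  fix f :: "real \<times> 'n torus => real" and ph0 ph1 :: "'n torus => real"
  assume f: "continuous_on cyl f" "ALL z:cyl. 0 <= f z" and ph: "cont ph0" "cont ph1"
   and D: "ALL c:controls. ph1 (torus_proj (pos c 1)) <= ph0 (torus_proj (fst c)) + cost p f c 1"
  note [measurable] = cont_cyl_measurable[OF f(1)] borel_measurable_continuous_onI[OF ph(1)] borel_measurable_continuous_onI[OF ph(2)]
  obtain F where F: "!!z. z : cyl ==> norm (f z) <= F" by (rule cont_cyl_bounded[OF f(1)], rule that)
  obtain F0 where F0: "!!x. \<bar>ph0 x\<bar> <= F0" by (rule torus_bounded_fn[OF ph(1)], rule that)
  obtain F1 where F1: "!!x. \<bar>ph1 x\<bar> <= F1" by (rule torus_bounded_fn[OF ph(2)], rule that)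
  have Tc: "T w : cyl" if "w : space ?B" for w using measurable_space[OF Tm that] by (simp add: space_cyl_borel)
  have int: "integrable ?B (%w. f (T w))"
  proof (rule B.integrable_const_bound[where B = F])
   show "AE w in ?B. norm (f (T w)) <= F" by (intro AE_I2 F Tc)
   show "(%w. f (T w)) : bm ?B" by measurable
  qed
  have leg: "ph1 (snd (fst om)) - ph0 (fst (fst om)) <= K*(LINT s|I01. f (T (om, s)))" if om: "om : space ?\<Omega>" for om
  proof -
   define x y z where "x = sec (fst (fst om))" and "y = sec (snd (fst om))" and "z = snd om"
   have Q: "x : ?Q" "y : ?Q" "z : ?Q" using om sec by (auto simp: x_def y_def z_def space_pair_measure spU)
   define v where "v s = (if s <= 1/2 then 2 *\<^sub>R (z - x) else 2 *\<^sub>R (y - z))" for s :: real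
   have vb: "norm (v s) <= 2*R" for s using R[OF Q(3,1)] R[OF Q(2,3)] by (simp add: v_def)
   have "bounded (range v)" using vb by (auto simp: bounded_iff)
   moreover have "v : bm borel" unfolding v_def[abs_def] by measurable
   ultimately have c: "(x, v) : controls" by (simp add: controls_def)
   have pos1: "pos (x, v) s = pt x y z s" if s: "s : {0..1/2}" for s
   proof -
   have "((%_. 2 *\<^sub>R (z - x)) has_integral s *\<^sub>R (2 *\<^sub>R (z - x))) {0..s}" using has_integral_const_real[of "2 *\<^sub>R (z - x)" 0 s] s by simp
   hence "(v has_integral s *\<^sub>R (2 *\<^sub>R (z - x))) {0..s}"
   by (rule has_integral_eq[rotated]) (use s in \<open>auto simp: v_def\<close>)
   thus ?thesis using s unfolding pos_def by (simp add: integral_unique pt_def cf_def algebra_simps)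
   qed
   have pos2: "pos (x, v) s = pt x y z s" if s: "1/2 < s" "s <= 1" for s
   proof -
   have "((%_. 2 *\<^sub>R (y - z)) has_integral (s - 1/2) *\<^sub>R (2 *\<^sub>R (y - z))) {1/2..s}" using has_integral_const_real[of "2 *\<^sub>R (y - z)" "1/2" s] s by simp
   hence "(v has_integral (s - 1/2) *\<^sub>R (2 *\<^sub>R (y - z))) {1/2..s}"
   by (rule has_integral_spike[OF negligible_sing[of "1/2"], rotated]) (auto simp: v_def)
   moreover have "(v has_integral (pos (x, v) s - pos (x, v) (1/2))) {1/2..s}" using pos_diff[OF c, of "1/2" s] s by simp
   ultimately have "pos (x, v) s - pos (x, v) (1/2) = (s - 1/2) *\<^sub>R (2 *\<^sub>R (y - z))" by (rule has_integral_unique[rotated])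
   hence E: "pos (x, v) s = z + (s - 1/2) *\<^sub>R (2 *\<^sub>R (y - z))" using pos1[of "1/2"] by (simp add: pt_def cf_def diff_eq_eq add.commute)
   have "pos (x, v) s $ i = pt x y z s $ i" for i unfolding E using s by (simp add: pt_def cf_def algebra_simps)
   thus ?thesis by (simp add: vec_eq_iff)
   qed
   have pos: "pos (x, v) s = pt x y z s" if "s : {0..1}" for s using pos1[of s] pos2[of s] that by fastforce
   have Tom: "T (om, s) = (s, torus_proj (pt x y z s))" for s by (simp add: T_def x_def y_def z_def)
   have cont: "continuous_on {0..1} (%s. K*f (s, torus_proj (pos (x, v) s)))"
   proof (intro continuous_on_mult continuous_on_const continuous_on_compose2[OF f(1)])
   show "continuous_on {0..1} (%s. (s, torus_proj (pos (x, v) s)))"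
   by (intro continuous_on_Pair continuous_on_id continuous_on_compose2[OF continuous_on_torus_proj[of UNIV] continuous_pos[OF c]]) simp
   qed (auto simp: cyl_def)
   have "cost p f (x, v) 1 <= integral {0..1} (%s. K*f (s, torus_proj (pos (x, v) s)))"
   unfolding cost_def
   proof (rule integral_le)
   show "(%s. f (s, torus_proj (pos (x, v) s))*norm (snd (x, v) s) powr p) integrable_on {0..1}" using p by (intro cost_integrand[OF c f(1)]) auto
   show "(%s. K*f (s, torus_proj (pos (x, v) s))) integrable_on {0..1}" by (rule integrable_continuous_real[OF cont])
   fix s :: real assume "s : {0..1}"
   hence "0 <= f (s, torus_proj (pos (x, v) s))" using f(2) by (auto simp: cyl_def)
   moreover have "norm (v s) powr p <= K" unfolding K_def using vb p by (intro powr_mono2) auto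
   ultimately show "f (s, torus_proj (pos (x, v) s))*norm (snd (x, v) s) powr p <= K*f (s, torus_proj (pos (x, v) s))"
   by (simp add: mult.commute mult_right_mono)
   qed
   also have "... = (LINT s|lebesgue_on {0..1}. K*f (s, torus_proj (pos (x, v) s)))"
   by (rule lebesgue_integral_eq_integral[symmetric, OF continuous_imp_integrable_real[OF cont]]) simp
   also have "... = (LINT s|I01. K*f (s, torus_proj (pos (x, v) s)))"
   proof (rule integral_I01)
   have sI: "sets I01 = sets (restrict_space borel {0..1::real})" by (intro sets_restrict_space_cong) simp
   show "(%s. K*f (s, torus_proj (pos (x, v) s))) : bm I01"
   using borel_measurable_continuous_on_restrict[OF cont] by (simp only: measurable_cong_sets[OF sI refl])
   qed
   also have "... = (LINT s|I01. K*f (T (om, s)))"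
   by (intro Bochner_Integration.integral_cong refl) (simp add: Tom pos space_I01)
   finally have "cost p f (x, v) 1 <= K*(LINT s|I01. f (T (om, s)))" by simp
   moreover have "pt x y z 1 = y" by (simp add: pt_def cf_def)
   hence "ph1 (torus_proj y) <= ph0 (torus_proj x) + cost p f (x, v) 1" using bspec[OF D c] pos[of 1] by simp
   ultimately show ?thesis by (simp add: x_def y_def sec(3))
  qed
  have i0: "integrable ?\<Omega> (%om. ph0 (fst (fst om)))"
   by (rule \<Omega>.integrable_const_bound[where B = F0]) (use F0 in auto)
  have i1: "integrable ?\<Omega> (%om. ph1 (snd (fst om)))"
   by (rule \<Omega>.integrable_const_bound[where B = F1]) (use F1 in auto)
  have i1A: "integrable ?A (%ab. ph1 (snd ab))"
   by (rule A.integrable_const_bound[where B = F1]) (use F1 in auto)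
  have \<Omega>A: "(LINT om|?\<Omega>. g (fst om)) = (LINT ab|?A. g ab)" if [measurable]: "g : bm ?A" for g :: "'n torus \<times> 'n torus => real"
  proof -
   have "(LINT om|?\<Omega>. g (fst om)) = integral\<^sup>L (distr ?\<Omega> ?A fst) g" by (rule integral_distr[symmetric]) measurable
   thus ?thesis by (simp only: U.distr_pair_fst)
  qed
  have "ph0 : bm rh0" using borel_measurable_continuous_onI[OF ph(1)] by (simp only: measurable_cong_sets[OF P(2) refl])
  hence "(LINT ab|?A. ph0 (fst ab)) = integral\<^sup>L (distr ?A rh0 fst) ph0" by (rule integral_distr[symmetric, OF measurable_fst])
  hence e0: "(LINT a|rh0. ph0 a) = (LINT om|?\<Omega>. ph0 (fst (fst om)))" using \<Omega>A[of "%ab. ph0 (fst ab)"] by (simp only: P1.distr_pair_fst) simp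
  have "(LINT ab|?A. ph1 (snd ab)) = (LINT b|rh1. ph1 b)" using A.integral_fst'[OF i1A] by (simp add: P0.prob_space)
  hence e1: "(LINT b|rh1. ph1 b) = (LINT om|?\<Omega>. ph1 (snd (fst om)))" using \<Omega>A[of "%ab. ph1 (snd ab)"] by simp
  have "(LINT b|rh1. ph1 b) - (LINT a|rh0. ph0 a) = (LINT om|?\<Omega>. ph1 (snd (fst om)) - ph0 (fst (fst om)))"
   unfolding e0 e1 using i0 i1 by simp
  also have "... <= (\<integral>om. K*(LINT s|I01. f (T (om, s))) \<partial>?\<Omega>)"
   using i0 i1 B.integrable_fst'[OF int] leg by (intro integral_mono) auto
  also have "... = K*(LINT w|?B. f (T w))" using B.integral_fst'[OF int] by simp
  also have "... = (LINT z|sg. f z)"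
   unfolding sg_def using K0 by (subst integral_distr, simp, simp, subst integral_density) (auto simp: )
  finally show "(LINT b|rh1. ph1 b) - (LINT a|rh0. ph0 a) <= (LINT z|sg. f z)" .
 qed
 thus ?thesis by (rule that[OF fin ac])
qed

section \<open>Equality and attainment\<close>

text \<open>A minimizing sequence of admissible pairs gives measures with the dual inequality and converging actions. The
limit law inherits the bound of its speed measure against test functions, and Young's inequality in the form
of the density bound converts it into the cost.\<close>
lemma attained_if_finite:
 fixes rh0 rh1 :: "'n::finite torus measure"
 assumes a: "0 < al" "al < 1"
  and P: "prob_space rh0" "sets rh0 = sets borel" "prob_space rh1" "sets rh1 = sets borel"
  and fin: "(W_dist al rh0 rh1)\<^sup>2 < \<infinity>"
 shows "\<exists>et\<in>Pi2_ac_between al rh0 rh1. K_cost al rh0 rh1 et <= (W_dist al rh0 rh1)\<^sup>2"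
proof -
 let ?L = "cyl_leb :: (real \<times> 'n torus) measure"
 interpret L: prob_space ?L by (rule prob_space_cyl_leb)
 define p q q' where "p = 2/(2 - al)" and "q = 2 - al" and "q' = q/(q - 1)"
 have q: "1 < q" "1 < q'" "1/q + 1/q' = 1" using a by (auto simp: q_def q'_def field_simps)
 obtain A where A: "(W_dist al rh0 rh1)\<^sup>2 = ennreal A" "0 <= A" using fin by (cases "(W_dist al rh0 rh1)\<^sup>2") auto
 have inf: "(INF (rh, w)\<in>admissible rh0 rh1. action al rh w) = ennreal A" using A(1) W_dist_power2 by metis
 have "\<exists>s. s : bm ?L & (\<forall>z. 0 <= s z) & integrable ?L s &
   (nn_integral ?L (%z. ennreal (s z powr q))) <= ennreal (A + 1/real (Suc n)) & dual_ineq p rh0 rh1 (density ?L (%z. ennreal (s z)))" for n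
 proof -
  have "A < A + 1/real (Suc n)" by simp
  hence "(INF (rh, w)\<in>admissible rh0 rh1. action al rh w) < ennreal (A + 1/real (Suc n))"
   unfolding inf using A(2) by (intro ennreal_lessI add_nonneg_pos) simp_all
  then obtain rh w where adm: "(rh, w) : admissible rh0 rh1" and less: "action al rh w < ennreal (A + 1/real (Suc n))"
   unfolding INF_less_iff by auto
  have fin': "action al rh w < \<infinity>" using less by (rule less_trans) simp
  obtain s where "s : bm ?L" "!!z. 0 <= s z" "integrable ?L s"
   "(nn_integral ?L (%z. ennreal (s z powr (2 - al)))) = action al rh w" "dual_ineq p rh0 rh1 (density ?L (%z. ennreal (s z)))"
   by (rule admissible_dual_ineq[OF a p_def P adm fin'], rule that)
  thus ?thesis using less by (intro exI[of _ s]) (auto simp: q_def)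
 qed
 then obtain s where s: "!!n. s n : bm ?L" "!!n z. 0 <= s n z" "!!n. integrable ?L (s n)"
   "!!n. (nn_integral ?L (%z. ennreal (s n z powr q))) <= ennreal (A + 1/real (Suc n))" "!!n. dual_ineq p rh0 rh1 (density ?L (%z. ennreal (s n z)))"
  by metis
 define sg where "sg n = density ?L (%z. ennreal (s n z))" for n
 have finsg: "is_finite_cyl_measure (sg n)" for n
  unfolding is_finite_cyl_measure_def sg_def
 proof (intro conjI finite_measureI)
  have "emeasure (density ?L (%z. ennreal (s n z))) (space (density ?L (%z. ennreal (s n z)))) = (nn_integral ?L (%z. ennreal (s n z)))"
   using s(1)[of n] by (subst emeasure_density) (use sets.top[of cyl_borel] in \<open>auto intro!: nn_integral_cong simp: indicator_def space_cyl_borel\<close>)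
  thus "emeasure (density ?L (%z. ennreal (s n z))) (space (density ?L (%z. ennreal (s n z)))) ~= \<infinity>"
   using nn_integral_eq_integral[OF s(3)[of n]] s(2) by simp
 qed simp
 have cm: "f : bm ?L" if "continuous_on cyl f" for f :: "real \<times> 'n torus => real"
  using cont_cyl_measurable[OF that] by (simp add: measurable_cong_sets[OF sets_cyl_leb refl])
 have cint: "integrable ?L f" if "continuous_on cyl f" for f :: "real \<times> 'n torus => real"
  using that by (intro finite_cyl_integrable) (auto simp: is_finite_cyl_measure_def L.finite_measure_axioms)
 have powc: "continuous_on cyl (%z. f z powr q')" if "continuous_on cyl f" "ALL z:cyl. 0 <= f z" for f :: "real \<times> 'n torus => real"
  using that q by (intro continuous_on_powr') auto
 have young: "(LINT z|sg n. f z) <= (A + 1/real (Suc n))/q + (LINT z|?L. f z powr q')/q'"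
  if f: "continuous_on cyl f" "ALL z:cyl. 0 <= f z" for f n
 proof -
  note [measurable] = cm[OF f(1)] s(1)[of n]
  have iq: "integrable ?L (%z. s n z powr q)"
   using s(4)[of n] by (intro integrableI_nonneg) (auto intro: le_less_trans)
  have "ennreal (LINT z|?L. s n z powr q) <= ennreal (A + 1/real (Suc n))" using s(4)[of n] nn_integral_eq_integral[OF iq] by simp
  moreover have "0 <= A + 1/real (Suc n)" using A(2) by simp
  ultimately have sq: "(LINT z|?L. s n z powr q) <= A + 1/real (Suc n)" by (simp only: ennreal_le_iff)
  have "(LINT z|sg n. f z) = (LINT z|?L. s n z*f z)"
   unfolding sg_def using s(2) by (subst integral_density) auto
  also have "... <= (LINT z|?L. s n z powr q/q + f z powr q'/q')"
  proof (rule integral_mono_AE)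
   obtain B where B: "!!z. z : cyl ==> norm (f z) <= B" by (rule cont_cyl_bounded[OF f(1)], rule that)
   show "integrable ?L (%z. s n z*f z)"
   proof (rule Bochner_Integration.integrable_bound[OF integrable_mult_left[OF s(3)[of n], of B]])
   show "AE z in ?L. norm (s n z*f z) <= norm (s n z*B)"
   proof (rule AE_I2)
   fix z :: "real \<times> 'n torus" assume "z : space ?L"
   hence "norm (f z) <= B" by (intro B) simp
   hence "s n z*norm (f z) <= s n z*norm B" using s(2)[of n z] by (intro mult_left_mono) auto
   thus "norm (s n z*f z) <= norm (s n z*B)" using s(2)[of n z] by (simp add: abs_mult)
   qed
   qed measurable
   show "integrable ?L (%z. s n z powr q/q + f z powr q'/q')" using iq cint[OF powc[OF f]] by simp
   show "AE z in ?L. s n z*f z <= s n z powr q/q + f z powr q'/q'"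
   using f(2) by (intro AE_I2 Youngs_inequality q s(2)) auto
  qed
  also have "... = (LINT z|?L. s n z powr q)/q + (LINT z|?L. f z powr q')/q'" using iq cint[OF powc[OF f]] by simp
  also have "(LINT z|?L. s n z powr q)/q <= (A + 1/real (Suc n))/q" using sq q by (intro divide_right_mono) auto
  finally show ?thesis by simp
 qed
 have C: "measure (sg n) cyl <= (A + 1)/q + 1/q'" for n
 proof -
  interpret s: finite_measure "sg n" using finsg[of n] by (simp add: is_finite_cyl_measure_def)
  have "space (sg n) = cyl" by (simp add: sg_def)
  hence "measure (sg n) cyl <= (A + 1/real (Suc n))/q + 1/q'"
   using young[of "%_. 1" n] L.prob_space by (simp del: of_nat_Suc)
  also have "(A + 1/real (Suc n))/q <= (A + 1)/q" using q by (intro divide_right_mono) auto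
  finally show ?thesis by simp
 qed
 have dq: "dual_ineq p rh0 rh1 (sg n)" for n unfolding sg_def by (rule s(5))
 obtain et where et: "Pi2_law et al p" "marg et 0 = rh0" "marg et 1 = rh1"
  and low: "!!(f :: real \<times> 'n torus => real) be. continuous_on cyl f ==> ALL z:cyl. 0 <= f z ==>
   \<forall>e>0. \<forall>\<^sub>F n in sequentially. (LINT z|sg n. f z) <= be + e ==> (LINT z|sig p et. f z) <= be"
  by (rule limit_superposition[OF a p_def P finsg dq C], rule that)
 interpret E: Pi2_law et al p by fact
 have bound: "(LINT z|sig p et. f z) <= A/q + (LINT z|?L. f z powr (q/(q - 1)))/(q/(q - 1))"
  if f: "cont f" "!!z. 0 <= f z" for f :: "real \<times> 'n torus => real"
  unfolding q'_def[symmetric]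
 proof (rule low)
  have fc: "continuous_on cyl f" using f(1) continuous_on_subset by blast
  show "continuous_on cyl f" by fact
  show pos: "ALL z:cyl. 0 <= f z" using f(2) by simp
  show "\<forall>e>0. \<forall>\<^sub>F n in sequentially. (LINT z|sg n. f z) <= A/q + (LINT z|?L. f z powr q')/q' + e"
  proof (intro allI impI)
   fix e :: real assume e: "0 < e"
   obtain N where N: "1/real (Suc N) < e" using nat_approx_posE[OF e] by blast
   show "\<forall>\<^sub>F n in sequentially. (LINT z|sg n. f z) <= A/q + (LINT z|?L. f z powr q')/q' + e"
   using eventually_ge_at_top[of N]
   proof eventually_elim
   case (elim n)
   have "1/real (Suc n)/q <= 1/real (Suc n)/1" using q by (intro divide_left_mono) auto
   moreover have "1/real (Suc n) <= 1/real (Suc N)" using elim by (simp add: frac_le)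
   ultimately show ?case using young[OF fc pos, of n] N unfolding add_divide_distrib by linarith
   qed
  qed
 qed
 have sets: "sets (sig p et) = sets (restrict_space borel cyl)" "sets ?L = sets (restrict_space borel cyl)"
  by (simp_all add: cyl_borel_def)
 note db = density_bound[OF E.finite_sig sets(1) L.finite_measure_axioms sets(2) q(1) A(2) bound]
 have "et : Pi2 al" by (rule Pi2_law_iff[OF a, THEN iffD1, OF et(1)[unfolded p_def]])
 hence mem: "et : Pi2_ac_between al rh0 rh1"
  using db(1) et(2,3) by (simp add: Pi2_ac_between_def Pi2_ac_def E.sigma_meas_eq_sig)
 hence "K_cost al rh0 rh1 et <= (W_dist al rh0 rh1)\<^sup>2"
  using db(2) by (simp add: K_cost_def E.sigma_meas_eq_sig A(1) q_def)
 thus ?thesis using mem by blast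
qed

lemma competitor_exists:
 fixes rh0 rh1 :: "'n::finite torus measure"
 assumes a: "0 < al" "al < 1"
  and P: "prob_space rh0" "sets rh0 = sets borel" "prob_space rh1" "sets rh1 = sets borel"
 shows "Pi2_ac_between al rh0 rh1 ~= {}"
proof -
 define p where "p = 2/(2 - al)"
 have p1: "1 < p" using a by (simp add: p_def field_simps)
 obtain sg where sg: "is_finite_cyl_measure sg" "absolutely_continuous cyl_leb sg" "dual_ineq p rh0 rh1 sg"
  by (rule spread_out_dual_feasible[OF p1 P], rule that)
 interpret S: finite_measure sg using sg(1) by (simp add: is_finite_cyl_measure_def)
 obtain et where et: "Pi2_law et al p" "marg et 0 = rh0" "marg et 1 = rh1"
  and low: "!!(f :: real \<times> 'n torus => real) be. continuous_on cyl f ==> ALL z:cyl. 0 <= f z ==>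
   \<forall>e>0. \<forall>\<^sub>F n::nat in sequentially. (LINT z|sg. f z) <= be + e ==> (LINT z|sig p et. f z) <= be"
  by (rule limit_superposition[where sg = "%_. sg" and C = "measure sg cyl", OF a p_def P sg(1) sg(3) order_refl], rule that)
 interpret E: Pi2_law et al p by fact
 define m where "m = measure sg (space sg)"
 have bound: "(LINT z|sig p et. f z) <= m/2 + (LINT z|sg. f z powr (2/(2 - 1)))/(2/(2 - 1))"
  if f: "cont f" "!!z. 0 <= f z" for f :: "real \<times> 'n torus => real"
 proof -
  have fc: "continuous_on cyl f" using f(1) continuous_on_subset by blast
  have "continuous_on cyl (%z. f z powr 2)" by (intro continuous_on_powr' fc continuous_on_const) (use f in auto)
  note i = finite_cyl_integrable[OF sg(1) fc] finite_cyl_integrable[OF sg(1) this]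
  have "(LINT z|sig p et. f z) <= (LINT z|sg. f z)" using fc f by (intro low) auto
  also have "... <= (LINT z|sg. 1/2 + f z powr 2/2)"
  proof (rule integral_mono[OF i(1)])
   show "f z <= 1/2 + f z powr 2/2" for z
   using Youngs_inequality[of 2 2 1 "f z"] f(2) by simp
  qed (use i in simp)
  also have "... = m/2 + (LINT z|sg. f z powr 2)/2" using i by (simp add: m_def)
  finally show ?thesis by simp
 qed
 have sets: "sets (sig p et) = sets (restrict_space borel cyl)" "sets sg = sets (restrict_space borel cyl)"
  using sg(1) by (simp_all add: cyl_borel_def is_finite_cyl_measure_def)
 have m0: "0 <= m" by (simp add: m_def)
 have "absolutely_continuous sg (sig p et)"
  by (rule density_bound(1)[OF E.finite_sig sets(1) S.finite_measure_axioms sets(2) _ m0 bound]) auto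
 hence ac: "absolutely_continuous cyl_leb (sig p et)" using sg(2) by (auto simp: absolutely_continuous_def)
 have "et : Pi2 al" by (rule Pi2_law_iff[OF a, THEN iffD1, OF et(1)[unfolded p_def]])
 hence "et : Pi2_ac_between al rh0 rh1"
  using ac et(2,3) by (simp add: Pi2_ac_between_def Pi2_ac_def E.sigma_meas_eq_sig)
 thus ?thesis by blast
qed

theorem theorem4p2:
  fixes \<alpha> :: real and \<rho>0 \<rho>1 :: "'n::finite torus measure"
  assumes "0 < \<alpha>" and "\<alpha> < 1"
    and "prob_space \<rho>0" and "sets \<rho>0 = sets borel"
    and "prob_space \<rho>1" and "sets \<rho>1 = sets borel"
  shows "(INF \<eta>\<in>Pi2_ac_between \<alpha> \<rho>0 \<rho>1. K_cost \<alpha> \<rho>0 \<rho>1 \<eta>) = (W_dist \<alpha> \<rho>0 \<rho>1)\<^sup>2 \<and>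
    (\<exists>\<eta>'\<in>Pi2_ac_between \<alpha> \<rho>0 \<rho>1.
       K_cost \<alpha> \<rho>0 \<rho>1 \<eta>' = (INF \<eta>\<in>Pi2_ac_between \<alpha> \<rho>0 \<rho>1. K_cost \<alpha> \<rho>0 \<rho>1 \<eta>))"
proof -
  have "\<exists>\<eta>\<in>Pi2_ac_between \<alpha> \<rho>0 \<rho>1. K_cost \<alpha> \<rho>0 \<rho>1 \<eta> \<le> (W_dist \<alpha> \<rho>0 \<rho>1)\<^sup>2"
  proof (cases "(W_dist \<alpha> \<rho>0 \<rho>1)\<^sup>2 < \<infinity>")
    case True
    then show ?thesis by (rule attained_if_finite[OF assms])
  next
    case False
    then have "(W_dist \<alpha> \<rho>0 \<rho>1)\<^sup>2 = \<infinity>" using less_top by (metis infinity_ennreal_def)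
    then show ?thesis using competitor_exists[OF assms] by auto
  qed
  then obtain \<eta> where \<eta>: "\<eta> \<in> Pi2_ac_between \<alpha> \<rho>0 \<rho>1" "K_cost \<alpha> \<rho>0 \<rho>1 \<eta> \<le> (W_dist \<alpha> \<rho>0 \<rho>1)\<^sup>2" by blast
  have ge: "(W_dist \<alpha> \<rho>0 \<rho>1)\<^sup>2 \<le> K_cost \<alpha> \<rho>0 \<rho>1 \<eta>'" for \<eta>' by (rule W_dist_le_K_cost[OF assms(1,2)])
  have inf: "(INF \<eta>\<in>Pi2_ac_between \<alpha> \<rho>0 \<rho>1. K_cost \<alpha> \<rho>0 \<rho>1 \<eta>) = (W_dist \<alpha> \<rho>0 \<rho>1)\<^sup>2"
    using \<eta> ge by (intro antisym INF_lower2[of \<eta>] INF_greatest)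
  then show ?thesis using \<eta> ge[of \<eta>] by (auto intro!: bexI[of _ \<eta>])
qed

end
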